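(* Let the alphabet be $\{1,\dots,\sigma\}$ with $\sigma$ a constant, and work in the word RAM model with machine word size $w=\Theta(\log md)$. Let $\mathcal{D}$ be a dictionary of $d>2$ strings, each of length $m$, and let $k>0$ be an integer. There is a data structure for dictionary look-up with $k$ mismatches on $\mathcal{D}$ that occupies $\mathcal{O}(wmd + w d\log^k d)$ bits of space and answers a query for a string $P$ of length $m$, given in packed form, in $\mathcal{O}(m/w + \log^{k+1} d + occ)$ time, where $occ$ is the number of dictionary strings reported.
   Context: Dictionary look-up with $k$ mismatches: given a query string $P$ of length $m$, report all strings of $\mathcal{D}$ whose Hamming distance to $P$ is at most $k$. A string is given in packed form if each $w/\log\sigma$ consecutive letters are stored in one machine word, so a string of length $m$ occupies $\mathcal{O}(m/w)$ words. *)

theory Defs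
  imports Complex_Main
begin

subsection \<open>Strings and dictionaries\<close>

definition strings :: "nat \<Rightarrow> nat \<Rightarrow> nat list set" where
  "strings \<sigma> m = {s. length s = m \<and> set s \<subseteq> {1..\<sigma>}}"

text \<open>
  A dictionary is a set of strings; the list fixes the numbering by which its strings are reported.
\<close>
definition dictionary :: "nat \<Rightarrow> nat \<Rightarrow> nat list list \<Rightarrow> bool" where
  "dictionary \<sigma> m D \<longleftrightarrow> distinct D \<and> set D \<subseteq> strings \<sigma> m"

definition hamming :: "'a list \<Rightarrow> 'a list \<Rightarrow> nat" where
  "hamming s t = card {i. i < length s \<and> s ! i \<noteq> t ! i}"
  \<comment> \<open>only used for strings of equal length\<close>

definition occurrences :: "nat \<Rightarrow> nat list list \<Rightarrow> nat list \<Rightarrow> nat set" where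
  "occurrences k D P = {i. i < length D \<and> hamming (D ! i) P \<le> k}"

subsection \<open>Packed strings\<close>

definition letter_bits :: "nat \<Rightarrow> nat" where
  "letter_bits \<sigma> = nat \<lceil>log 2 (real \<sigma>)\<rceil>"

definition letters_per_word :: "nat \<Rightarrow> nat \<Rightarrow> nat" where
  "letters_per_word \<sigma> w = w div letter_bits \<sigma>"

text \<open>
  The letter \<open>c\<close> is stored as \<open>c - 1\<close> in a field of \<open>letter_bits \<sigma>\<close> bits; the first letter of a
  block occupies the least significant field, and unused fields are zero.
\<close>
definition pack_word :: "nat \<Rightarrow> nat list \<Rightarrow> nat" where
  "pack_word \<sigma> cs = horner_sum (\<lambda>c. c - 1) (2 ^ letter_bits \<sigma>) cs"

definition packed :: "nat \<Rightarrow> nat \<Rightarrow> nat list \<Rightarrow> nat list" where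
  "packed \<sigma> w P =
    (let n = letters_per_word \<sigma> w
     in map (\<lambda>j. pack_word \<sigma> (take n (drop (j * n) P)))
          [0..<nat \<lceil>real (length P) / real n\<rceil>])"

subsection \<open>Word RAM\<close>

text \<open>
  Words are natural numbers below \<open>2 ^ w\<close>, and every instruction takes unit time.
  A program is a finite list of instructions, so it uses finitely many registers.

  Addresses and reported numbers are given by a list of registers, read as the digits of a number
  in base \<open>2 ^ w\<close>, least significant first. The length of such a list is fixed by the program. A
  singleton is the usual one-word address; longer lists are needed because a word of
  \<open>\<Theta>(log n)\<close> bits with a small constant cannot hold a number polynomial in \<open>n\<close>, whereas a constant
  number of words can.
\<close>

type_synonym reg = nat

datatype binop = Add | Sub | Mul | Div | Mod | And | Or | Xor | Shl | Shr | Less | Eq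

datatype segment =
    Static \<comment> \<open>the data structure, read-only\<close>
  | Query  \<comment> \<open>the query input, read-only\<close>
  | Work   \<comment> \<open>working memory of fixed size, zero at the start of a query\<close>

datatype instr =
    Const reg nat
  | Bin binop reg reg reg
  | Load segment reg "reg list"
  | Store "reg list" reg \<comment> \<open>to working memory\<close>
  | Jump_If_Zero reg nat
  | Report "reg list"
  | Halt

record config =
  pc :: nat
  regs :: "reg \<Rightarrow> nat"
  work :: "nat list"
  reported :: "nat list"

fun binop_val :: "nat \<Rightarrow> binop \<Rightarrow> nat \<Rightarrow> nat \<Rightarrow> nat" where
  "binop_val w Add x y = (x + y) mod 2 ^ w"
| "binop_val w Sub x y = (x + 2 ^ w - y) mod 2 ^ w"
| "binop_val w Mul x y = (x * y) mod 2 ^ w"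
| "binop_val w Div x y = x div y"
| "binop_val w Mod x y = x mod y"
| "binop_val w And x y = Bit_Operations.and x y"
| "binop_val w Or x y = Bit_Operations.or x y"
| "binop_val w Xor x y = Bit_Operations.xor x y"
| "binop_val w Shl x y = push_bit y x mod 2 ^ w"
| "binop_val w Shr x y = drop_bit y x"
| "binop_val w Less x y = of_bool (x < y) mod 2 ^ w"
| "binop_val w Eq x y = of_bool (x = y) mod 2 ^ w"

definition wide_val :: "nat \<Rightarrow> config \<Rightarrow> reg list \<Rightarrow> nat" where
  "wide_val w c rs = horner_sum (regs c) (2 ^ w) rs"

fun segment_content :: "nat list \<Rightarrow> nat list \<Rightarrow> config \<Rightarrow> segment \<Rightarrow> nat list" where
  "segment_content S Q c Static = S"
| "segment_content S Q c Query = Q"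
| "segment_content S Q c Work = work c"

definition set_reg :: "reg \<Rightarrow> nat \<Rightarrow> config \<Rightarrow> config" where
  "set_reg r v c = c\<lparr>pc := Suc (pc c), regs := (regs c)(r := v)\<rparr>"

text \<open>
  An access outside a segment leaves the configuration unchanged, so the machine then loops
  forever without halting. The same holds if control leaves the program.
\<close>
fun exec_instr :: "nat \<Rightarrow> nat list \<Rightarrow> nat list \<Rightarrow> instr \<Rightarrow> config \<Rightarrow> config" where
  "exec_instr w S Q (Const r v) c = set_reg r (v mod 2 ^ w) c"
| "exec_instr w S Q (Bin f r x y) c = set_reg r (binop_val w f (regs c x) (regs c y)) c"
| "exec_instr w S Q (Load seg r rs) c =
    (let M = segment_content S Q c seg; i = wide_val w c rs
     in if i < length M then set_reg r (M ! i) c else c)"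
| "exec_instr w S Q (Store rs r) c =
    (let i = wide_val w c rs
     in if i < length (work c)
        then c\<lparr>pc := Suc (pc c), work := (work c)[i := regs c r]\<rparr> else c)"
| "exec_instr w S Q (Jump_If_Zero r n) c =
    c\<lparr>pc := (if regs c r = 0 then n else Suc (pc c))\<rparr>"
| "exec_instr w S Q (Report rs) c =
    c\<lparr>pc := Suc (pc c), reported := reported c @ [wide_val w c rs]\<rparr>"
| "exec_instr w S Q Halt c = c"

definition step :: "nat \<Rightarrow> instr list \<Rightarrow> nat list \<Rightarrow> nat list \<Rightarrow> config \<Rightarrow> config" where
  "step w prog S Q c =
    (if pc c < length prog then exec_instr w S Q (prog ! pc c) c else c)"

definition halted :: "instr list \<Rightarrow> config \<Rightarrow> bool" where
  "halted prog c \<longleftrightarrow> pc c < length prog \<and> prog ! pc c = Halt"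

definition init_config :: "nat \<Rightarrow> config" where
  "init_config s = \<lparr>pc = 0, regs = (\<lambda>_. 0), work = replicate s 0, reported = []\<rparr>"

text \<open>
  With word size \<open>w\<close>, static memory \<open>S\<close>, \<open>s\<close> words of working memory and input \<open>Q\<close>, the program
  halts after at most \<open>t\<close> steps, having reported \<open>xs\<close>.
\<close>
definition reports_within ::
  "nat \<Rightarrow> instr list \<Rightarrow> nat list \<Rightarrow> nat \<Rightarrow> nat list \<Rightarrow> nat \<Rightarrow> nat list \<Rightarrow> bool" where
  "reports_within w prog S s Q t xs \<longleftrightarrow>
    (let c = (step w prog S Q ^^ t) (init_config s) in halted prog c \<and> reported c = xs)"

end

theory Submission
  imports Defs "HOL-Library.List_Lexorder"
begin

text \<open>
  Proof idea. The strings are kept in an error tree: a node tests a prefix of one of its strings, sends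
  the strings sharing the prefix one way, and the others another way, the latter also in a copy in which
  their first deviation from the prefix has been overwritten at the cost of one error. The prefix is
  chosen so that all parts shrink by a constant factor, so the height is \<open>h = O(log d)\<close>, and a string
  occurs in at most \<open>\<Sum>i\<le>k. h choose i\<close> places.

  A test asks for the first mismatch of the query with a dictionary string after a given position, in
  constant time. To this end the query is first cut greedily, word by word, into phrases, each followed
  by a word at which no dictionary string continues the phrase. More than \<open>k + 1\<close> phrases mean
  that there is no answer; otherwise a binary search tree over the suffixes of the dictionary finds each
  phrase in time \<open>O(log d)\<close> plus its length. Within a phrase the query is replaced by a dictionary
  string, and common prefixes of dictionary strings are read off a disjoint sparse table. As every
  dictionary string has a mismatch in every phrase, two phrases suffice.

  The query algorithm is written for a machine whose variables have a constant number of words each,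
  as one word need not hold an address.
\<close>

subsection \<open>Error trees\<close>

text \<open>The program and the constant \<open>C\<close> are fixed for given alphabet,
  \<open>a\<close> and \<open>b\<close>, so the parameters of the instance, even the number of
  errors, are read from a memory header, and all bounds must be uniform in \<open>k\<close>. Factors
  linear in \<open>k\<close> are absorbed by powers of \<open>log d\<close>, which is at least 3/2
  because \<open>d > 2\<close>.

  Wide variables offer only addition, xor, comparison and selection. This dictates the encodings:
  positions are scaled by the record length in advance, a stack entry stores the previous stack
  pointer, spent errors are counted upwards, and two ranks are related through a table indexed by
  their xor.

  A table indexed by whole words would be too large, since \<open>2 ^ w\<close> may be a high power
  of \<open>m d\<close>. The lowest set bit of a word is therefore looked up by a residue modulo
  some \<open>p\<close> of size \<open>O(w)\<close>.

  Phrases start and end at word boundaries. So only suffixes at word boundaries are sorted,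
  \<open>O(m / w + 1)\<close> per string, and a record of one word may occupy \<open>O(w)\<close>
  cells; it has room for a whole column of the sparse table.\<close>

text \<open>
  \<open>Node e i x0 v B U N\<close> tests the prefix of length \<open>v\<close> of a string that equals the string number \<open>i\<close>
  from position \<open>x0\<close> on. Strings with this prefix are in \<open>B\<close>, the others are in \<open>U\<close>, and in \<open>N\<close> with
  their first deviation overwritten, which costs \<open>e\<close>. All strings of a \<open>Leaf\<close> are equal.
  In \<open>qry fm T x k\<close> the query agrees with every prefix tested so far up to \<open>x\<close>, and \<open>k\<close> errors are left.
\<close>
datatype tree =
    Empty
  | Rep nat tree
  | Leaf nat nat nat tree
  | Node nat nat nat nat tree tree tree

text \<open>If the query follows the tested prefix, a string of \<open>U\<close> deviates from the
  prefix at a position where the query does not, which costs an error; its overwritten copy in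
  \<open>N\<close> stands for it and \<open>U\<close> is skipped. If the query leaves the prefix,
  all strings of \<open>B\<close> share this mismatch: it is paid once and the search resumes behind
  it. The lookup starts at \<open>max x x0\<close> because string \<open>i\<close> is the tested
  string only from \<open>x0\<close> on.\<close>

function (sequential) qry :: "(nat \<Rightarrow> nat \<Rightarrow> nat) \<Rightarrow> tree \<Rightarrow> nat \<Rightarrow> nat \<Rightarrow> nat list" where
  "qry fm Empty x k = []"
| "qry fm (Rep i T) x k = i # qry fm T x k"
| "qry fm (Leaf i x0 v B) x k =
    (if v \<le> fm i (max x x0) then qry fm B x k
     else if k = 0 then [] else qry fm (Leaf i x0 v B) (Suc (fm i (max x x0))) (k - 1))"
| "qry fm (Node e i x0 v B U N) x k =
    (if v \<le> fm i (max x x0) then qry fm B x k @ (if e \<le> k then qry fm N x (k - e) else [])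
     else qry fm U x k @ (if k = 0 then [] else qry fm B (Suc (fm i (max x x0))) (k - 1)))"
  by pat_completeness auto
termination by (relation "measures [\<lambda>(fm, T, x, k). size T, \<lambda>(fm, T, x, k). k]") auto

text \<open>The number of stack entries that an iterative version of \<open>qry\<close> removes, exhausted ones included.\<close>
function (sequential) pops :: "(nat \<Rightarrow> nat \<Rightarrow> nat) \<Rightarrow> tree \<Rightarrow> nat \<Rightarrow> nat \<Rightarrow> nat" where
  "pops fm Empty x k = 1"
| "pops fm (Rep i T) x k = Suc (pops fm T x k)"
| "pops fm (Leaf i x0 v B) x k =
    (if v \<le> fm i (max x x0) then pops fm B x k + 2
     else if k = 0 then 3 else pops fm (Leaf i x0 v B) (Suc (fm i (max x x0))) (k - 1) + 2)"
| "pops fm (Node e i x0 v B U N) x k =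
    (if v \<le> fm i (max x x0) then pops fm B x k + (if e \<le> k then pops fm N x (k - e) else 1) + 1
     else pops fm U x k + (if k = 0 then 1 else pops fm B (Suc (fm i (max x x0))) (k - 1)) + 1)"
  by pat_completeness auto
termination by (relation "measures [\<lambda>(fm, T, x, k). size T, \<lambda>(fm, T, x, k). k]") auto

declare qry.simps(3) [simp del] pops.simps(3) [simp del]

text \<open>A leaf calls itself after a mismatch, so its defining equations could be rewritten
  without end. Split by the number of errors left they are safe.\<close>

lemma Leaf_0 [simp]:
  "qry fm (Leaf i x0 v B) x 0 = (if v \<le> fm i (max x x0) then qry fm B x 0 else [])"
  "pops fm (Leaf i x0 v B) x 0 = (if v \<le> fm i (max x x0) then pops fm B x 0 + 2 else 3)"
  by (simp_all add: qry.simps(3) pops.simps(3))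

lemma Leaf_Suc [simp]:
  "qry fm (Leaf i x0 v B) x (Suc k) =
    (if v \<le> fm i (max x x0) then qry fm B x (Suc k) else qry fm (Leaf i x0 v B) (Suc (fm i (max x x0))) k)"
  "pops fm (Leaf i x0 v B) x (Suc k) =
    (if v \<le> fm i (max x x0) then pops fm B x (Suc k) + 2
     else pops fm (Leaf i x0 v B) (Suc (fm i (max x x0))) k + 2)"
  by (simp_all add: qry.simps(3) pops.simps(3))

fun tree_ok :: "nat \<Rightarrow> nat \<Rightarrow> tree \<Rightarrow> bool" where
  "tree_ok d M Empty \<longleftrightarrow> True"
| "tree_ok d M (Rep i T) \<longleftrightarrow> i < d \<and> tree_ok d M T"
| "tree_ok d M (Leaf i x0 v B) \<longleftrightarrow> i < d \<and> x0 \<le> M \<and> v \<le> M \<and> tree_ok d M B"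
| "tree_ok d M (Node e i x0 v B U N) \<longleftrightarrow>
    e \<le> 1 \<and> i < d \<and> x0 \<le> M \<and> v \<le> M \<and> tree_ok d M B \<and> tree_ok d M U \<and> tree_ok d M N"

fun nodes :: "tree \<Rightarrow> nat" where
  "nodes Empty = 0"
| "nodes (Rep i T) = Suc (nodes T)"
| "nodes (Leaf i x0 v B) = Suc (nodes B)"
| "nodes (Node e i x0 v B U N) = Suc (nodes B + nodes U + nodes N)"

definition reps :: "nat list \<Rightarrow> tree" where
  "reps ids = foldr Rep ids Empty"

lemma qry_reps [simp]: "qry fm (reps ids) x k = ids"
  by (induction ids) (auto simp: reps_def)

lemma pops_reps [simp]: "pops fm (reps ids) x k = Suc (length ids)"
  by (induction ids) (auto simp: reps_def)

lemma nodes_reps [simp]: "nodes (reps ids) = length ids"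
  by (induction ids) (auto simp: reps_def)

lemma tree_ok_reps: "set ids \<subseteq> {..<d} \<Longrightarrow> tree_ok d M (reps ids)"
  by (induction ids) (auto simp: reps_def)

text \<open>
  An item \<open>(i, f, x0)\<close> is the string number \<open>i\<close> after changes at positions below \<open>x0\<close>.
\<close>
type_synonym item = "nat \<times> (nat \<Rightarrow> nat) \<times> nat"

definition agree :: "(nat \<Rightarrow> nat) \<Rightarrow> nat \<Rightarrow> item \<Rightarrow> bool" where
  "agree f v = (\<lambda>(j, g, y). \<forall>p<v. g p = f p)"

definition modify :: "(nat \<Rightarrow> nat) \<Rightarrow> item \<Rightarrow> item" where
  "modify f = (\<lambda>(j, g, y). let p = (LEAST p. g p \<noteq> f p) in (j, g(p := f p), max y (Suc p)))"

text \<open>The number \<open>k\<close> of errors for which the tree is built drops only along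
  \<open>N\<close>, the height \<open>h\<close> along all branches. With \<open>k = 0\<close> no
  overwritten copies are kept. \<open>U\<close> is required to be nonempty and \<open>B\<close>
  contains the tested item itself, so both can pay for the node when sizes are added up.\<close>

inductive etree :: "nat \<Rightarrow> nat \<Rightarrow> nat \<Rightarrow> item list \<Rightarrow> tree \<Rightarrow> bool" for M where
  Empty: "etree M k h [] Empty"
| Leaf: "(i, f, x0) \<in> set X \<Longrightarrow> \<forall>z\<in>set X. agree f M z \<Longrightarrow> etree M k h X (Leaf i x0 M (reps (map fst X)))"
| Node0: "(i, f, x0) \<in> set X \<Longrightarrow> v \<le> M \<Longrightarrow> etree M 0 h (filter (agree f v) X) B \<Longrightarrow>
    etree M 0 h (filter (\<lambda>z. \<not> agree f v z) X) U \<Longrightarrow> filter (\<lambda>z. \<not> agree f v z) X \<noteq> [] \<Longrightarrow>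
    etree M 0 (Suc h) X (Node 1 i x0 v B U Empty)"
| NodeS: "(i, f, x0) \<in> set X \<Longrightarrow> v \<le> M \<Longrightarrow> etree M (Suc k) h (filter (agree f v) X) B \<Longrightarrow>
    etree M (Suc k) h (filter (\<lambda>z. \<not> agree f v z) X) U \<Longrightarrow> filter (\<lambda>z. \<not> agree f v z) X \<noteq> [] \<Longrightarrow>
    etree M k h (map (modify f) (filter (\<lambda>z. \<not> agree f v z) X)) N \<Longrightarrow>
    etree M (Suc k) (Suc h) X (Node 1 i x0 v B U N)"

section \<open>Size of an error tree and cost of a search in it\<close>

definition below_sum :: "nat \<Rightarrow> nat \<Rightarrow> nat" where
  "below_sum h k = (\<Sum>i\<le>k. h choose i)"

lemma below_sum_0 [simp]: "below_sum h 0 = 1"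
  by (simp add: below_sum_def)

lemma below_sum_0_left [simp]: "below_sum 0 k = 1"
proof -
  have "(\<Sum>i\<le>k. (0::nat) choose i) = (\<Sum>i\<in>{0::nat}. 0 choose i)"
    by (rule sum.mono_neutral_right) auto
  then show ?thesis by (simp add: below_sum_def)
qed

text \<open>Pascal's rule, summed. It mirrors one level of the tree: an item goes to one of
  \<open>B\<close> and \<open>U\<close> with the same number of errors, and at most one copy of it
  goes to \<open>N\<close> with one error less.\<close>

lemma below_sum_Suc: "below_sum (Suc h) (Suc k) = below_sum h (Suc k) + below_sum h k"
proof -
  have "below_sum (Suc h) (Suc k) = 1 + (\<Sum>i\<le>k. h choose Suc i) + (\<Sum>i\<le>k. h choose i)"
    unfolding below_sum_def by (subst sum.atMost_Suc_shift) (simp add: sum.distrib)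
  moreover have "below_sum h (Suc k) = 1 + (\<Sum>i\<le>k. h choose Suc i)"
    unfolding below_sum_def by (subst sum.atMost_Suc_shift) simp
  ultimately show ?thesis by (simp add: below_sum_def)
qed

lemma below_sum_pos: "1 \<le> below_sum h k"
proof -
  have "(h choose 0) \<le> below_sum h k" unfolding below_sum_def by (rule member_le_sum) auto
  then show ?thesis by simp
qed

lemma length_filter_agree: "length (filter (agree f v) X) + length (filter (\<lambda>z. \<not> agree f v z) X) = length X"
  by (rule sum_length_filter_compl)

text \<open>The summand 1 on the left lets the nonempty parts pay for their common root. The factor
  3 covers a leaf over a single item, with its node, its report and the summand.\<close>

lemma etree_nodes: "etree M k h X T \<Longrightarrow> X \<noteq> [] \<Longrightarrow> nodes T + 1 \<le> 3 * length X * below_sum h k"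
proof (induction rule: etree.induct)
  case (Leaf i f x0 X k h)
  have "1 \<le> length X" using Leaf(3) by (cases X) auto
  then have "nodes (Leaf i x0 M (reps (map fst X))) + 1 \<le> 3 * length X * 1" by simp
  also have "\<dots> \<le> 3 * length X * below_sum h k" by (intro mult_left_mono below_sum_pos) auto
  finally show ?case .
next
  case (Node0 i f x0 X v h B U)
  have "filter (agree f v) X \<noteq> []" using Node0(1) by (auto simp: agree_def filter_empty_conv intro!: bexI[of _ "(i, f, x0)"])
  then show ?case using Node0 length_filter_agree[of f v X] by simp
next
  case (NodeS i f x0 X v k h B U N)
  let ?b = "length (filter (agree f v) X)" and ?u = "length (filter (\<lambda>z. \<not> agree f v z) X)"
  let ?s = "below_sum h (Suc k)" and ?t = "below_sum h k"
  have "filter (agree f v) X \<noteq> []" using NodeS(1) by (auto simp: agree_def filter_empty_conv intro!: bexI[of _ "(i, f, x0)"])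
  then have "nodes B + 1 \<le> 3 * ?b * ?s" "nodes U + 1 \<le> 3 * ?u * ?s" "nodes N + 1 \<le> 3 * ?u * ?t"
    using NodeS by auto
  then have "nodes (Node 1 i x0 v B U N) + 1 \<le> 3 * ?b * ?s + 3 * ?u * ?s + 3 * ?u * ?t" by simp
  also have "\<dots> \<le> 3 * (?b + ?u) * (?s + ?t)" by (simp add: algebra_simps)
  finally show ?case unfolding below_sum_Suc length_filter_agree .
qed simp

lemma etree_ok: "etree M k h X T \<Longrightarrow> \<forall>(i, f, x0)\<in>set X. i < d \<and> x0 \<le> M \<Longrightarrow> tree_ok d M T"
proof (induction rule: etree.induct)
  case (Leaf i f x0 X k h)
  have "set (map fst X) \<subseteq> {..<d}" using Leaf.prems by fastforce
  moreover have "i < d" "x0 \<le> M" using Leaf.hyps(1) Leaf.prems by auto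
  ultimately show ?case by (simp add: tree_ok_reps)
next
  case (NodeS i f x0 X v k h B U N)
  have "Suc (LEAST p. g p \<noteq> f p) \<le> M" if "\<not> (\<forall>p<v. g p = f p)" for g :: "nat \<Rightarrow> nat"
  proof -
    from that obtain p where p: "p < v" "g p \<noteq> f p" by auto
    then show ?thesis using Least_le[of "\<lambda>p. g p \<noteq> f p" p] NodeS(2) by simp
  qed
  then have "\<forall>(i, f, x0)\<in>set (map (modify f) (filter (\<lambda>z. \<not> agree f v z) X)). i < d \<and> x0 \<le> M"
    using NodeS.prems by (fastforce simp: modify_def agree_def Let_def)
  moreover have "\<forall>(i, f, x0)\<in>set (filter p X). i < d \<and> x0 \<le> M" for p using NodeS.prems by auto
  moreover have "i < d" "x0 \<le> M" using NodeS.hyps(1) NodeS.prems by auto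
  ultimately show ?case using NodeS.IH NodeS.hyps(2) by simp
next
  case (Node0 i f x0 X v h B U)
  have "\<forall>(i, f, x0)\<in>set (filter p X). i < d \<and> x0 \<le> M" for p using Node0.prems by auto
  moreover have "i < d" "x0 \<le> M" using Node0.hyps(1) Node0.prems by auto
  ultimately show ?case using Node0.IH Node0.hyps(2) by simp
qed auto

text \<open>The errors \<open>k\<close> of the search are independent of those for which the tree
  was built. Whether the query follows or leaves the tested prefix, one part is searched with
  \<open>k\<close> errors and one with at most \<open>k - 1\<close>, which is Pascal's rule again.
  Because of the factor \<open>k + 1\<close> the bound exceeds the two recursive ones by
  \<open>3 * below_sum h k\<close>, and this surplus pays for the entry that is removed.\<close>

lemma etree_pops:
  "etree M k0 h X T \<Longrightarrow> pops fm T x k \<le> 3 * (k + 1) * below_sum h (k + 1) + length (qry fm T x k)"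
proof (induction arbitrary: x k rule: etree.induct)
  case (Empty k h)
  have "1 \<le> 3 * (k + 1) * 1" for k :: nat by simp
  also have "3 * (k + 1) * 1 \<le> 3 * (k + 1) * below_sum h (k + 1)" for k by (intro mult_left_mono below_sum_pos) auto
  finally show ?case by simp
next
  case (Leaf i f x0 X k0 h)
  have "pops fm (Leaf i x0 M (reps (map fst X))) x k \<le> 3 * (k + 1) * 1 + length (qry fm (Leaf i x0 M (reps (map fst X))) x k)"
  proof (induction k arbitrary: x)
    case (Suc k)
    show ?case
    proof (cases "M \<le> fm i (max x x0)")
      case False
      then show ?thesis unfolding Leaf_Suc using Suc.IH[of "Suc (fm i (max x x0))"]
        by (simp only: if_False) simp
    qed simp
  qed simp
  also have "3 * (k + 1) * 1 \<le> 3 * (k + 1) * below_sum h (k + 1)" by (intro mult_left_mono below_sum_pos) auto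
  finally show ?case by simp
next
  case (Node0 i f x0 X v h B U)
  show ?case
  proof (cases k)
    case 0
    show ?thesis using Node0.IH[of x 0] below_sum_Suc[of h 0] 0 by auto
  next
    case (Suc k')
    have 1: "1 \<le> below_sum h (Suc k')" by (rule below_sum_pos)
    define a where "a = 3 * (k + 1) * below_sum h (k + 1)"
    define b where "b = 3 * (k' + 1) * below_sum h (k' + 1)"
    have B: "pops fm B x k \<le> a + length (qry fm B x k)"
      "\<And>y. pops fm B y k' \<le> b + length (qry fm B y k')" and U: "pops fm U x k \<le> a + length (qry fm U x k)"
      unfolding a_def b_def using Node0.IH(1,2) by auto
    have "pops fm (Node 1 i x0 v B U Empty) x k \<le> a + b + 1 + length (qry fm (Node 1 i x0 v B U Empty) x k)"
    proof (cases "v \<le> fm i (max x x0)")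
      case True
      have "1 \<le> b" unfolding b_def using below_sum_pos[of h "k' + 1"] by simp
      with True show ?thesis using B(1)  Suc by simp
    next
      case False
      then show ?thesis using B(2)[of "Suc (fm i (max x x0))"] U Suc by simp
    qed
    also have "a + b + 1 \<le> 3 * (k + 1) * below_sum (Suc h) (k + 1)"
      using 1 unfolding a_def b_def by (simp add: Suc below_sum_Suc algebra_simps)
    finally show ?thesis by simp
  qed
next
  case (NodeS i f x0 X v k0 h B U N)
  show ?case
  proof (cases k)
    case 0
    show ?thesis using NodeS.IH(1,2)[of x 0] below_sum_Suc[of h 0] 0 by auto
  next
    case (Suc k')
    have 1: "1 \<le> below_sum h (Suc k')" by (rule below_sum_pos)
    define a where "a = 3 * (k + 1) * below_sum h (k + 1)"
    define b where "b = 3 * (k' + 1) * below_sum h (k' + 1)"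
    have B: "pops fm B x k \<le> a + length (qry fm B x k)"
      "\<And>y. pops fm B y k' \<le> b + length (qry fm B y k')" and U: "pops fm U x k \<le> a + length (qry fm U x k)"
      unfolding a_def b_def using NodeS.IH(1,2) by auto
    have N: "pops fm N x k' \<le> b + length (qry fm N x k')"
      unfolding b_def using NodeS.IH(3) by auto
    have "pops fm (Node 1 i x0 v B U N) x k \<le> a + b + 1 + length (qry fm (Node 1 i x0 v B U N) x k)"
    proof (cases "v \<le> fm i (max x x0)")
      case True
      have "1 \<le> b" unfolding b_def using below_sum_pos[of h "k' + 1"] by simp
      with True show ?thesis using B(1) N Suc by simp
    next
      case False
      then show ?thesis using B(2)[of "Suc (fm i (max x x0))"] U Suc by simp
    qed
    also have "a + b + 1 \<le> 3 * (k + 1) * below_sum (Suc h) (k + 1)"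
      using 1 unfolding a_def b_def by (simp add: Suc below_sum_Suc algebra_simps)
    finally show ?thesis by simp
  qed
qed

text \<open>The fallback when an error tree would be too large. A test with \<open>v = 0\<close>
  always succeeds, and \<open>e = 0\<close> makes the step along \<open>N\<close> free, so the nodes
  form a list whose leaves are all searched with the full number of errors.\<close>

definition scan :: "nat \<Rightarrow> nat list \<Rightarrow> tree" where
  "scan M is = foldr (\<lambda>i T. Node 0 i 0 0 (Leaf i 0 M (reps [i])) Empty T) is Empty"

lemma scan_ok:
  "set is \<subseteq> {..<d} \<Longrightarrow> tree_ok d M (scan M is) \<and> nodes (scan M is) = 3 * length is"
  by (induction "is") (auto simp: scan_def reps_def)

section \<open>Existence of error trees of logarithmic height\<close>

lemma sum_length_filter:
  fixes n :: nat
  assumes "\<And>z. z \<in> set xs \<Longrightarrow> g z < n"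
  shows "(\<Sum>a<n. length (filter (\<lambda>z. g z = a) xs)) = length xs"
  using assms
proof (induction xs)
  case (Cons x xs)
  have "(\<Sum>a<n. length (filter (\<lambda>z. g z = a) (x # xs))) =
      (\<Sum>a<n. (if a = g x then 1 else 0) + length (filter (\<lambda>z. g z = a) xs))"
    by (rule sum.cong) auto
  also have "\<dots> = (\<Sum>a<n. if a = g x then 1 else 0) + length xs" using Cons by (simp add: sum.distrib)
  also have "(\<Sum>a<n. if a = g x then 1 else 0) = (1 :: nat)" 
    using Cons.prems[of x] sum.delta[of "{..<n}" "g x" "\<lambda>_. 1 :: nat"] by simp
  finally show ?case by simp
qed simp

text \<open>
  Follow the prefixes shared by more than half of the strings as far as possible and extend the last
  one by its most frequent letter.
\<close>
lemma balanced_prefix: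
  fixes X :: "item list"
  assumes "X \<noteq> []" "\<not> (\<exists>(i, f, x0)\<in>set X. \<forall>z\<in>set X. agree f M z)" "0 < t"
    "\<forall>(i, f, x0)\<in>set X. \<forall>p<M. f p < t"
  obtains i f x0 v where "(i, f, x0) \<in> set X" "v \<le> M" "filter (\<lambda>z. \<not> agree f v z) X \<noteq> []"
    "2 * t * length (filter (\<lambda>z. \<not> agree f v z) X) \<le> (2 * t - 1) * length X"
    "2 * length (filter (agree f v) X) \<le> length X \<or> (\<forall>z\<in>set (filter (agree f v) X). agree f M z)"
proof -
  define n where "n = length X"
  define S where "S = (\<lambda>v. \<exists>(i, f, x0)\<in>set X. n < 2 * length (filter (agree f v) X))"
  have n: "0 < n" using assms(1) by (simp add: n_def)
  have len: "length (filter (agree f v) X) + length (filter (\<lambda>z. \<not> agree f v z) X) = n" for f v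
    unfolding n_def by (rule length_filter_agree)
  have "filter (agree f 0) X = X" for f by (simp add: agree_def filter_id_conv)
  moreover obtain i f x0 where "(i, f, x0) \<in> set X" using assms(1) by (metis list.set_intros(1) neq_Nil_conv surj_pair)
  ultimately have "S 0" unfolding S_def using n by (auto simp: n_def intro!: bexI[of _ "(i, f, x0)"])
  then have ex: "\<exists>v. v \<le> M \<and> S v" by blast
  define v where "v = (GREATEST v. v \<le> M \<and> S v)"
  have v: "v \<le> M" "S v" using GreatestI_ex_nat[OF ex, of M] unfolding v_def by auto
  have vmax: "v' \<le> v" if "v' \<le> M" "S v'" for v'
    using Greatest_le_nat[of "\<lambda>v. v \<le> M \<and> S v" v' M] that unfolding v_def by auto
  obtain i f x0 where f: "(i, f, x0) \<in> set X" "n < 2 * length (filter (agree f v) X)" using v(2) unfolding S_def by auto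
  show thesis
  proof (cases "v = M")
    case True
    have "filter (\<lambda>z. \<not> agree f v z) X \<noteq> []"
      using assms(2) f(1) True unfolding filter_empty_conv by auto
    moreover have "2 * t * length (filter (\<lambda>z. \<not> agree f v z) X) \<le> (2 * t - 1) * n"
    proof -
      have "2 * length (filter (\<lambda>z. \<not> agree f v z) X) \<le> n" using f(2) len[of f v] by linarith
      then have "t * (2 * length (filter (\<lambda>z. \<not> agree f v z) X)) \<le> t * n" by (rule mult_le_mono2)
      also have "\<dots> \<le> (2 * t - 1) * n" using assms(3) by (intro mult_le_mono1) auto
      finally show ?thesis by (simp add: algebra_simps)
    qed
    ultimately show thesis using that[OF f(1) v(1)] True unfolding n_def by auto
  next
    case False
    define L where "L = filter (agree f v) X"
    define g where "g = (\<lambda>z :: item. fst (snd z) v)"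
    have gt: "g z < t" if "z \<in> set L" for z
      using that assms(4) v(1) False unfolding L_def g_def by fastforce
    have "\<exists>a<t. length L \<le> t * length (filter (\<lambda>z. g z = a) L)"
    proof (rule ccontr)
      assume "\<not> ?thesis"
      then have "t * length (filter (\<lambda>z. g z = a) L) < length L" if "a < t" for a using that by (auto simp: not_le)
      then have "(\<Sum>a<t. t * length (filter (\<lambda>z. g z = a) L)) < (\<Sum>a<t. length L)"
        using assms(3) by (intro sum_strict_mono) auto
      then show False using sum_length_filter[of L g t, OF gt] by (simp add: sum_distrib_left [symmetric])
    qed
    then obtain a where a: "a < t" "length L \<le> t * length (filter (\<lambda>z. g z = a) L)" by blast
    define A where "A = filter (\<lambda>z. g z = a) L"
    have La: "n < 2 * t * length A" using f(2) a(2) unfolding L_def[symmetric] A_def[symmetric] by simp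
    then have "A \<noteq> []" by auto
    then obtain z where z: "z \<in> set A" by (cases A) auto
    obtain j g' y where zz: "z = (j, g', y)" by (cases z)
    have z1: "(j, g', y) \<in> set X" "agree f v (j, g', y)" "g' v = a" using z unfolding zz A_def L_def g_def by auto
    have "agree g' (Suc v) z' \<longleftrightarrow> agree f v z' \<and> g z' = a" for z'
      using z1(2,3) unfolding agree_def g_def by (cases z') (auto simp: less_Suc_eq)
    then have A: "filter (agree g' (Suc v)) X = A" unfolding A_def L_def filter_filter by (intro filter_cong) auto
    \<comment> \<open>Maximality of \<open>v\<close> bounds the inner part by one half. The choice
      of \<open>a\<close> makes it larger than a \<open>1 / (2 t)\<close> fraction, which bounds the
      outer part.\<close>
    have "\<not> S (Suc v)" using vmax[of "Suc v"] v(1) False by auto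
    then have half: "2 * length A \<le> n" using z1(1) A unfolding S_def by force
    have out: "length A + length (filter (\<lambda>z. \<not> agree g' (Suc v) z) X) = n" using len[of g' "Suc v"] A by simp
    show thesis
    proof (rule that[OF z1(1), of "Suc v"])
      show "Suc v \<le> M" using v(1) False by simp
      show "filter (\<lambda>z. \<not> agree g' (Suc v) z) X \<noteq> []" using out half n by auto
      have "2 * t * length A + 2 * t * length (filter (\<lambda>z. \<not> agree g' (Suc v) z) X) = 2 * t * n"
        using out by (metis distrib_left)
      then show "2 * t * length (filter (\<lambda>z. \<not> agree g' (Suc v) z) X) \<le> (2 * t - 1) * length X"
        using La unfolding n_def[symmetric] by (simp add: diff_mult_distrib)
      show "2 * length (filter (agree g' (Suc v)) X) \<le> length X \<or> (\<forall>z\<in>set (filter (agree g' (Suc v)) X). agree g' M z)"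
        using half A unfolding n_def by simp
    qed
  qed
qed

text \<open>The last hypothesis is a potential. A part that is not yet a leaf contains at most the
  fraction \<open>1 - 1 / (2 t)\<close> of the items, so the potential survives the loss of one
  level, and at \<open>h = 0\<close> it leaves no item. The only part that may be larger is a
  \<open>B\<close> whose items are all equal, and this one becomes a leaf at any height.\<close>

lemma etree_exists:
  assumes "0 < t" "\<forall>(i, f, x0)\<in>set X. \<forall>p<M. f p < t" "real (length X) * ((2 * real t - 1) / (2 * real t)) ^ h < 1"
  shows "\<exists>T. etree M k h X T"
  using assms(2,3)
proof (induction h arbitrary: k X)
  case 0
  then show ?case using etree.Empty by auto
next
  case (Suc h)
  let ?r = "(2 * real t - 1) / (2 * real t)"
  have r: "1 / 2 \<le> ?r" using assms(1) by (simp add: field_simps)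
  consider "X = []" | i f x0 where "(i, f, x0) \<in> set X" "\<forall>z\<in>set X. agree f M z"
    | "X \<noteq> []" "\<not> (\<exists>(i, f, x0)\<in>set X. \<forall>z\<in>set X. agree f M z)" by blast
  then show ?case
  proof cases
    case 1
    then show ?thesis using etree.Empty by auto
  next
    case 2
    then show ?thesis using etree.Leaf by blast
  next
    case 3
    obtain i f x0 v where f: "(i, f, x0) \<in> set X" "v \<le> M" "filter (\<lambda>z. \<not> agree f v z) X \<noteq> []"
      "2 * t * length (filter (\<lambda>z. \<not> agree f v z) X) \<le> (2 * t - 1) * length X"
      "2 * length (filter (agree f v) X) \<le> length X \<or> (\<forall>z\<in>set (filter (agree f v) X). agree f M z)"
      by (rule balanced_prefix[OF 3 assms(1) Suc.prems(1)])
    let ?b = "filter (agree f v) X" and ?u = "filter (\<lambda>z. \<not> agree f v z) X"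
    have small: "real (length Y) * ?r ^ h < 1" if "real (length Y) \<le> ?r * real (length X)" for Y :: "item list"
    proof -
      have "real (length Y) * ?r ^ h \<le> ?r * real (length X) * ?r ^ h"
        using that r by (intro mult_right_mono zero_le_power) linarith+
      also have "\<dots> = real (length X) * ?r ^ Suc h" by simp
      finally show ?thesis using Suc.prems(2) by linarith
    qed
    have "real (2 * t * length ?u) \<le> real ((2 * t - 1) * length X)" using f(4) by (rule of_nat_mono)
    then have u: "real (length ?u) \<le> ?r * real (length X)" using assms(1) by (simp add: field_simps of_nat_diff)
    have U: "\<exists>T. etree M k h ?u T" for k
      using Suc.IH[OF _ small[OF u]] Suc.prems(1) by auto
    have B: "\<exists>T. etree M k h ?b T" for k
    proof (cases "\<forall>z\<in>set ?b. agree f M z")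
      case True
      have "(i, f, x0) \<in> set ?b" using f(1) by (simp add: agree_def)
      then show ?thesis using True etree.Leaf by blast
    next
      case False
      then have "real (length ?b) \<le> 1 / 2 * real (length X)" using f(5) by linarith
      also have "\<dots> \<le> ?r * real (length X)" using r by (intro mult_right_mono) auto
      finally show ?thesis using Suc.IH[OF _ small] Suc.prems(1) by auto
    qed
    have N: "\<exists>T. etree M k h (map (modify f) ?u) T" for k
    proof (rule Suc.IH)
      show "real (length (map (modify f) ?u)) * ?r ^ h < 1" using small[OF u] by simp
      have lt: "f (LEAST p. g p \<noteq> f p) < t" if "\<not> (\<forall>p<v. g p = f p)" for g :: "nat \<Rightarrow> nat"
      proof -
        from that obtain p where p: "p < v" "g p \<noteq> f p" by auto
        then have "(LEAST p. g p \<noteq> f p) < M" using Least_le[of "\<lambda>p. g p \<noteq> f p" p] f(2) by simp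
        then show ?thesis using f(1) Suc.prems(1) by blast
      qed
      show "\<forall>(i, f, x0)\<in>set (map (modify f) ?u). \<forall>p<M. f p < t"
      proof
        fix z assume "z \<in> set (map (modify f) ?u)"
        then obtain j g y where z: "z = modify f (j, g, y)" "(j, g, y) \<in> set X" "\<not> (\<forall>p<v. g p = f p)"
          by (auto simp: agree_def)
        have "\<forall>p<M. g p < t" using z(2) Suc.prems(1) by blast
        then show "case z of (i, f, x0) \<Rightarrow> \<forall>p<M. f p < t" unfolding z(1) modify_def Let_def using lt[OF z(3)] by simp
      qed
    qed
    show ?thesis
    proof (cases k)
      case 0
      then show ?thesis using B[of 0] U[of 0] etree.Node0[OF f(1,2) _ _ f(3)] by blast
    next
      case (Suc k')
      then show ?thesis using B[of k] U[of k] N[of k'] etree.NodeS[OF f(1,2) _ _ f(3)] by blast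
    qed
  qed
qed

section \<open>Correctness of the search in an error tree\<close>

locale mism =
  fixes M :: nat and P :: "nat \<Rightarrow> nat" and D :: "nat \<Rightarrow> nat \<Rightarrow> nat" and d :: nat and fm :: "nat \<Rightarrow> nat \<Rightarrow> nat"
  assumes fm: "\<And>i y. i < d \<Longrightarrow> y \<le> M \<Longrightarrow> y \<le> fm i y \<and> fm i y \<le> M \<and> (\<forall>z. y \<le> z \<longrightarrow> z < fm i y \<longrightarrow> D i z = P z) \<and>
    (fm i y < M \<longrightarrow> D i (fm i y) \<noteq> P (fm i y))"
begin

definition cnt :: "(nat \<Rightarrow> nat) \<Rightarrow> nat \<Rightarrow> nat" where
  "cnt f x = card {y. x \<le> y \<and> y < M \<and> f y \<noteq> P y}"

lemma cnt_first:
  assumes "x \<le> l" "l < M" "f l \<noteq> P l" "\<And>y. x \<le> y \<Longrightarrow> y < l \<Longrightarrow> f y = P y"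
  shows "cnt f x = Suc (cnt f (Suc l))"
proof -
  have "{y. x \<le> y \<and> y < M \<and> f y \<noteq> P y} = insert l {y. Suc l \<le> y \<and> y < M \<and> f y \<noteq> P y}"
    using assms by (auto simp: Suc_le_eq) (metis linorder_neqE_nat)
  then show ?thesis by (simp add: cnt_def)
qed

lemma cnt_modify:
  assumes "x \<le> l" "l < M" "f l \<noteq> P l"
  shows "cnt f x = Suc (cnt (f(l := P l)) x)"
proof -
  have "{y. x \<le> y \<and> y < M \<and> f y \<noteq> P y} = insert l {y. x \<le> y \<and> y < M \<and> (f(l := P l)) y \<noteq> P y}"
    using assms by auto
  then show ?thesis by (simp add: cnt_def)
qed

definition static :: "item list \<Rightarrow> bool" where
  "static X \<longleftrightarrow> (\<forall>(i, f, x0)\<in>set X. i < d \<and> x0 \<le> M \<and> (\<forall>y<M. x0 \<le> y \<longrightarrow> f y = D i y)) \<and> distinct (map fst X)"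

text \<open>The search has accounted for the query below \<open>x\<close>. Changes made at or after
  \<open>x\<close> agree with the query, so a mismatch of a changed string is also one of the
  original string behind \<open>x0\<close>, where it can be looked up. All items coincide below
  \<open>x\<close>, so the first deviation between two of them lies at or after
  \<open>x\<close>.\<close>

definition inv :: "item list \<Rightarrow> nat \<Rightarrow> bool" where
  "inv X x \<longleftrightarrow> (\<forall>(i, f, x0)\<in>set X. \<forall>y<x0. x \<le> y \<longrightarrow> f y = P y) \<and>
    (\<forall>(i, f, x0)\<in>set X. \<forall>(j, g, y0)\<in>set X. \<forall>y<x. f y = g y)"

lemma item_fm:
  assumes "static X" "inv X x" "x \<le> M" "(i, f, x0) \<in> set X"
  defines "l \<equiv> fm i (max x x0)"
  shows "x \<le> l" "l \<le> M" "\<And>y. x \<le> y \<Longrightarrow> y < l \<Longrightarrow> f y = P y" "l < M \<Longrightarrow> f l \<noteq> P l"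
proof -
  have 0: "i < d" "max x x0 \<le> M" "\<And>y. y < M \<Longrightarrow> x0 \<le> y \<Longrightarrow> f y = D i y" "\<And>y. y < x0 \<Longrightarrow> x \<le> y \<Longrightarrow> f y = P y"
    using assms by (auto simp: static_def inv_def)
  note 1 = fm[OF 0(1,2), folded l_def]
  show 2: "x \<le> l" "l \<le> M" using 1 by auto
  show "f y = P y" if "x \<le> y" "y < l" for y
    using 1 0(3)[of y] 0(4)[of y] that 2 by (cases "y < x0") auto
  show "l < M \<Longrightarrow> f l \<noteq> P l" using 1 0(3) by simp
qed

lemma static_filter: "static X \<Longrightarrow> static (filter p X)"
  by (auto simp: static_def distinct_map_filter)

lemma inv_filter: "inv X x \<Longrightarrow> inv (filter p X) x"
  unfolding inv_def by fastforce

abbreviation answer :: "item list \<Rightarrow> nat \<Rightarrow> nat \<Rightarrow> nat set" where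
  "answer X x k \<equiv> {i. \<exists>f x0. (i, f, x0) \<in> set X \<and> cnt f x \<le> k}"

lemma answer_split: "answer X x k = answer (filter p X) x k \<union> answer (filter (\<lambda>z. \<not> p z) X) x k"
  by auto

lemma disjoint_filter:
  assumes "static X" "A \<subseteq> fst ` set (filter p X)" "B \<subseteq> fst ` set (filter (\<lambda>z. \<not> p z) X)"
  shows "A \<inter> B = {}"
proof -
  have "inj_on fst (set X)" using assms(1) by (auto simp: static_def distinct_map)
  then have "fst ` set (filter p X) \<inter> fst ` set (filter (\<lambda>z. \<not> p z) X) = {}"
    by (auto dest: inj_onD)
  then show ?thesis using assms by blast
qed

text \<open>The items of \<open>B\<close> coincide with \<open>f\<close> below \<open>v\<close>, in
  particular at \<open>l\<close>. So the query misses all of them at the same first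
  position.\<close>

lemma below_mismatch:
  assumes "static X" "inv X x" "x \<le> M" "(i, f, x0) \<in> set X" "v \<le> M" "fm i (max x x0) < v"
  defines "l \<equiv> fm i (max x x0)"
  shows "inv (filter (agree f v) X) (Suc l)"
    and "z \<in> set (filter (agree f v) X) \<Longrightarrow> cnt (fst (snd z)) x = Suc (cnt (fst (snd z)) (Suc l))"
proof -
  note l = item_fm[OF assms(1-4), folded l_def]
  have lv: "l < v" using assms(6) by (simp add: l_def)
  show "inv (filter (agree f v) X) (Suc l)"
    using assms(2) l lv unfolding inv_def agree_def by fastforce
  assume z: "z \<in> set (filter (agree f v) X)"
  obtain j g y0 where zz: "z = (j, g, y0)" by (cases z)
  have g: "g p = f p" if "p < v" for p using z that by (auto simp: zz agree_def)
  show "cnt (fst (snd z)) x = Suc (cnt (fst (snd z)) (Suc l))"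
    unfolding zz using l lv g assms(5) by (simp add: cnt_first)
qed

text \<open>The query agrees with \<open>f\<close> from \<open>x\<close> up to \<open>v\<close>.
  Hence the first deviation of an item from \<open>f\<close> is a mismatch with the query, and
  writing the letter of \<open>f\<close> there removes exactly this mismatch. Up to the deviation
  the item agrees with \<open>f\<close>, thus with the query, so the new start \<open>Suc p\<close>
  is compatible with \<open>inv\<close>.\<close>

lemma modify_out:
  assumes "static X" "inv X x" "x \<le> M" "(i, f, x0) \<in> set X" "v \<le> M" "v \<le> fm i (max x x0)"
  defines "Y \<equiv> filter (\<lambda>z. \<not> agree f v z) X"
  shows "static (map (modify f) Y)" "inv (map (modify f) Y) x"
    and "answer Y x k = (if k = 0 then {} else answer (map (modify f) Y) x (k - 1))"
proof -
  note l = item_fm[OF assms(1-4)]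
  have Y: "\<exists>p. modify f (j, g, y) = (j, g(p := P p), max y (Suc p)) \<and> x \<le> p \<and> p < v \<and> g p \<noteq> P p \<and> f p = P p \<and> (\<forall>q<p. g q = f q)"
    if "(j, g, y) \<in> set Y" for j g y
  proof -
    from that obtain p0 where p0: "p0 < v" "g p0 \<noteq> f p0" by (auto simp: Y_def agree_def)
    define p where "p = (LEAST p. g p \<noteq> f p)"
    have p1: "g p \<noteq> f p" unfolding p_def by (rule LeastI) (rule p0(2))
    have p2: "p \<le> p0" unfolding p_def by (rule Least_le) (rule p0(2))
    have p3: "g q = f q" if "q < p" for q using not_less_Least that unfolding p_def by blast
    note p = p1 p2 p3
    have "(j, g, y) \<in> set X" using that by (simp add: Y_def)
    then have "g q = f q" if "q < x" for q using that assms(2,4) unfolding inv_def by fast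
    then have xp: "x \<le> p" using p(1) by (metis not_le)
    have fp: "f p = P p" using l(3)[of p] xp p(2) p0(1) assms(6) by linarith
    have "modify f (j, g, y) = (j, g(p := P p), max y (Suc p))"
      unfolding modify_def fp[symmetric] by (simp add: p_def Let_def)
    then show ?thesis using p p0 xp fp by (intro exI[of _ p]) auto
  qed
  have fst: "fst (modify f z) = fst z" for z by (auto simp: modify_def Let_def split: prod.splits)
  have sY: "static Y" unfolding Y_def by (rule static_filter[OF assms(1)])
  have dis: "distinct (map fst (map (modify f) Y))" using sY by (simp add: static_def comp_def fst)
  show "static (map (modify f) Y)" unfolding static_def
  proof (intro conjI dis ballI)
    fix z assume "z \<in> set (map (modify f) Y)"
    then obtain j g y where z: "z = modify f (j, g, y)" "(j, g, y) \<in> set Y" by auto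
    then show "case z of (i, f, x0) \<Rightarrow> i < d \<and> x0 \<le> M \<and> (\<forall>y<M. x0 \<le> y \<longrightarrow> f y = D i y)"
      using Y[OF z(2)] sY assms(5) by (auto simp: static_def)
  qed
  have iY: "inv Y x" unfolding Y_def by (rule inv_filter[OF assms(2)])
  show "inv (map (modify f) Y) x" unfolding inv_def
  proof (intro conjI ballI)
    fix z assume "z \<in> set (map (modify f) Y)"
    then obtain j g y where z: "z = modify f (j, g, y)" "(j, g, y) \<in> set Y" by auto
    obtain p where p: "modify f (j, g, y) = (j, g(p := P p), max y (Suc p))" "x \<le> p" "p < v" "\<forall>q<p. g q = f q"
      using Y[OF z(2)] by auto
    have "g q = P q" if "x \<le> q" "q < p" for q
      using that p l(3)[of q] assms(6) by auto
    moreover have "\<forall>q<y. x \<le> q \<longrightarrow> g q = P q" using iY z(2) by (auto simp: inv_def)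
    ultimately show "case z of (i, f, x0) \<Rightarrow> \<forall>y<x0. x \<le> y \<longrightarrow> f y = P y"
      unfolding z(1) p(1) by (auto simp: less_Suc_eq less_max_iff_disj)
    show "case z of (i, f', x0) \<Rightarrow> \<forall>(j, g, y0)\<in>set (map (modify f) Y). \<forall>y<x. f' y = g y"
      unfolding z(1) p(1) prod.case
    proof (intro ballI)
      fix z' assume "z' \<in> set (map (modify f) Y)"
      then obtain j' g' y' where z': "z' = modify f (j', g', y')" "(j', g', y') \<in> set Y" by auto
      obtain p' where p': "modify f (j', g', y') = (j', g'(p' := P p'), max y' (Suc p'))" "x \<le> p'"
        using Y[OF z'(2)] by auto
      have "\<forall>q<x. g q = g' q" using iY z(2) z'(2) by (fastforce simp: inv_def)
      then show "case z' of (j, g'', y0) \<Rightarrow> \<forall>y<x. (g(p := P p)) y = g'' y"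
        unfolding z'(1) p'(1) using p(2) p'(2) by auto
    qed
  qed
  have c: "\<exists>g' y'. modify f (j, g, y) = (j, g', y') \<and> cnt g x = Suc (cnt g' x)" if "(j, g, y) \<in> set Y" for j g y
    using Y[OF that] cnt_modify[of x _ g] assms(5) by fastforce
  show "answer Y x k = (if k = 0 then {} else answer (map (modify f) Y) x (k - 1))"
  proof (cases k)
    case 0
    then show ?thesis using c by fastforce
  next
    case (Suc k')
    have "answer Y x k \<subseteq> answer (map (modify f) Y) x k'"
    proof
      fix j assume "j \<in> answer Y x k"
      then obtain g y where g: "(j, g, y) \<in> set Y" "cnt g x \<le> Suc k'" using Suc by auto
      from c[OF g(1)] g show "j \<in> answer (map (modify f) Y) x k'" by (force simp: image_iff)
    qed
    moreover have "answer (map (modify f) Y) x k' \<subseteq> answer Y x k"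
    proof
      fix j assume "j \<in> answer (map (modify f) Y) x k'"
      then obtain g' y' z where g: "z \<in> set Y" "(j, g', y') = modify f z" "cnt g' x \<le> k'" by auto
      obtain j' g y where z: "z = (j', g, y)" by (cases z)
      obtain g'' y'' where "modify f (j', g, y) = (j', g'', y'')" "cnt g x = Suc (cnt g'' x)"
        using c[of j' g y] g(1) z by auto
      then have "(j, g, y) \<in> set Y" "cnt g x \<le> Suc k'" using g z by auto
      then show "j \<in> answer Y x k" unfolding Suc by blast
    qed
    ultimately show ?thesis using Suc by auto
  qed
qed

lemma answer_fst: "answer X x k \<subseteq> fst ` set X"
  by force

text \<open>A tree without stored copies was built for no errors, so \<open>k \<le> k0\<close> keeps
  the search from needing a missing \<open>N\<close>. The two branches report disjoint numbers,
  since each number occurs in one item only and overwriting keeps it.\<close>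

lemma qry_correct:
  assumes "etree M k0 h X T" "static X" "inv X x" "x \<le> M" "k \<le> k0"
  shows "distinct (qry fm T x k) \<and> set (qry fm T x k) = answer X x k"
  using assms
proof (induction arbitrary: x k rule: etree.induct)
  case (Empty k h)
  then show ?case by simp
next
  case (Leaf i f x0 X k0 h)
  show ?case using Leaf.prems(2,3)
  proof (induction k arbitrary: x)
    case (0 x)
    note l = item_fm[OF Leaf.prems(1) 0 Leaf.hyps(1)]
    have c: "cnt g x = 0 \<longleftrightarrow> M \<le> fm i (max x x0)" if "(j, g, y) \<in> set X" for j g y
    proof -
      have g: "\<forall>p<M. g p = f p" using Leaf.hyps(2) that by (auto simp: agree_def)
      show ?thesis
      proof (cases "M \<le> fm i (max x x0)")
        case True
        then have "{y. x \<le> y \<and> y < M \<and> g y \<noteq> P y} = {}" using l(3) g by auto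
        then show ?thesis using True unfolding cnt_def by simp
      next
        case False
        then show ?thesis using cnt_first[of x "fm i (max x x0)" g] l g by auto
      qed
    qed
    have "answer X x 0 = (if M \<le> fm i (max x x0) then fst ` set X else {})" using c by force
    then show ?case using Leaf.prems(1) by (simp add: static_def)
  next
    case (Suc k x)
    note l = item_fm[OF Leaf.prems(1) Suc.prems Leaf.hyps(1)]
    show ?case
    proof (cases "M \<le> fm i (max x x0)")
      case True
      have "cnt g x = 0" if "(j, g, y) \<in> set X" for j g y
      proof -
        have "\<forall>p<M. g p = f p" using Leaf.hyps(2) that by (auto simp: agree_def)
        then have "{y. x \<le> y \<and> y < M \<and> g y \<noteq> P y} = {}" using l(3) True by auto
        then show ?thesis unfolding cnt_def by simp
      qed
      then have "answer X x (Suc k) = fst ` set X" by force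
      then show ?thesis using True Leaf.prems(1) by (simp add: static_def)
    next
      case False
      have X: "filter (agree f M) X = X" using Leaf.hyps(2) by (auto simp: filter_id_conv)
      note b = below_mismatch[OF Leaf.prems(1) Suc.prems Leaf.hyps(1) order.refl, unfolded X]
      have "answer X x (Suc k) = answer X (Suc (fm i (max x x0))) k"
        using b(2) False by force
      then show ?thesis using Suc.IH[OF b(1)] False l by simp
    qed
  qed
next
  case (Node0 i f x0 X v h B U)
  then have k: "k = 0" by simp
  let ?Y = "filter (\<lambda>z. \<not> agree f v z) X"
  show ?case
  proof (cases "v \<le> fm i (max x x0)")
    case True
    have "answer ?Y x 0 = {}" using modify_out(3)[OF Node0.prems(1-3) Node0.hyps(1,2) True, of 0] by simp
    then have "answer X x 0 = answer (filter (agree f v) X) x 0" using answer_split[of X x 0 "agree f v"] by blast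
    then show ?thesis
      using Node0.IH(1)[OF static_filter[OF Node0.prems(1)] inv_filter[OF Node0.prems(2)] Node0.prems(3), of 0] True k
      by simp
  next
    case False
    have "answer (filter (agree f v) X) x 0 = {}"
      using below_mismatch(2)[OF Node0.prems(1-3) Node0.hyps(1,2)] False by force
    then have "answer X x 0 = answer (filter (\<lambda>z. \<not> agree f v z) X) x 0" using answer_split[of X x 0 "agree f v"] by blast
    then show ?thesis
      using Node0.IH(2)[OF static_filter[OF Node0.prems(1)] inv_filter[OF Node0.prems(2)] Node0.prems(3), of 0] False k
      by simp
  qed
next
  case (NodeS i f x0 X v k0 h B U N)
  let ?Y = "filter (\<lambda>z. \<not> agree f v z) X"
  let ?l = "fm i (max x x0)"
  note IB = NodeS.IH(1)[OF static_filter[OF NodeS.prems(1)]]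
  note IU = NodeS.IH(2)[OF static_filter[OF NodeS.prems(1)] inv_filter[OF NodeS.prems(2)] NodeS.prems(3,4)]
  show ?case
  proof (cases "v \<le> ?l")
    case True
    note m = modify_out[OF NodeS.prems(1-3) NodeS.hyps(1,2) True]
    note B = IB[OF inv_filter[OF NodeS.prems(2)] NodeS.prems(3,4)]
    show ?thesis
    proof (cases k)
      case 0
      then have "answer ?Y x k = {}" using m(3)[of k] by simp
      then have "answer X x k = answer (filter (agree f v) X) x k" using answer_split[of X x k "agree f v"] by blast
      then show ?thesis using True B 0 by simp
    next
      case (Suc k')
      note N = NodeS.IH(3)[OF m(1,2) NodeS.prems(3), of k']
      have N': "distinct (qry fm N x k')" "set (qry fm N x k') = answer ?Y x k"
        using N NodeS.prems(4) m(3)[of k] Suc by auto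
      have "set (qry fm B x k) \<inter> set (qry fm N x k') = {}"
        unfolding conjunct2[OF B] N'(2) by (rule disjoint_filter[OF NodeS.prems(1) answer_fst answer_fst])
      moreover have "qry fm (Node 1 i x0 v B U N) x k = qry fm B x k @ qry fm N x k'" using True Suc by simp
      moreover have "answer X x k = set (qry fm B x k) \<union> set (qry fm N x k')"
        unfolding conjunct2[OF B] N'(2) by (rule answer_split)
      ultimately show ?thesis using B N'(1) by simp
    qed
  next
    case False
    note b = below_mismatch[OF NodeS.prems(1-3) NodeS.hyps(1,2)]
    have l: "Suc ?l \<le> M" using False NodeS.hyps(2) by simp
    show ?thesis
    proof (cases k)
      case 0
      have "answer (filter (agree f v) X) x 0 = {}" using b(2) False by force
      then have "answer X x 0 = answer ?Y x 0" using answer_split[of X x 0 "agree f v"] by blast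
      then show ?thesis using False IU 0 by simp
    next
      case (Suc k')
      have "answer (filter (agree f v) X) x k = answer (filter (agree f v) X) (Suc ?l) k'"
        using b(2) False Suc by force
      then have B: "distinct (qry fm B (Suc ?l) k')" "set (qry fm B (Suc ?l) k') = answer (filter (agree f v) X) x k"
        using IB[OF b(1) l, of k'] False NodeS.prems(4) Suc by auto
      have "set (qry fm B (Suc ?l) k') \<inter> set (qry fm U x k) = {}"
        unfolding conjunct2[OF IU] B(2) by (rule disjoint_filter[OF NodeS.prems(1) answer_fst answer_fst])
      moreover have "qry fm (Node 1 i x0 v B U N) x k = qry fm U x k @ qry fm B (Suc ?l) k'" using False Suc by simp
      moreover have "answer X x k = set (qry fm B (Suc ?l) k') \<union> set (qry fm U x k)"
        unfolding conjunct2[OF IU] B(2) by (rule answer_split)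
      ultimately show ?thesis using B(1) IU by auto
    qed
  qed
qed

definition items :: "nat list \<Rightarrow> item list" where
  "items = map (\<lambda>i. (i, D i, 0))"

lemma qry_etree:
  assumes "etree M k h (items [0..<d]) T"
  shows "distinct (qry fm T 0 k) \<and> set (qry fm T 0 k) = {i. i < d \<and> cnt (D i) 0 \<le> k}"
proof -
  have "static (items [0..<d])" "inv (items [0..<d]) 0"
    by (auto simp: static_def inv_def items_def comp_def)
  moreover have "answer (items [0..<d]) 0 k = {i. i < d \<and> cnt (D i) 0 \<le> k}" by (force simp: items_def)
  ultimately show ?thesis using qry_correct[OF assms] by simp
qed

lemma scan_leaf:
  assumes "i < d"
  shows "qry fm (Leaf i 0 M (reps [i])) 0 k = (if cnt (D i) 0 \<le> k then [i] else [])"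
proof -
  have "etree M k 0 [(i, D i, 0)] (Leaf i 0 M (reps (map fst [(i, D i, 0 :: nat)])))"
    by (rule etree.Leaf[of i "D i" 0]) (auto simp: agree_def)
  moreover have "static [(i, D i, 0)]" "inv [(i, D i, 0)] 0" using assms by (auto simp: static_def inv_def)
  ultimately have a: "distinct (qry fm (Leaf i 0 M (reps [i])) 0 k)"
    "set (qry fm (Leaf i 0 M (reps [i])) 0 k) = {j. j = i \<and> cnt (D i) 0 \<le> k}"
    using qry_correct[of k 0 "[(i, D i, 0)]" "Leaf i 0 M (reps [i])" 0 k] by auto
  show ?thesis
  proof (cases "cnt (D i) 0 \<le> k")
    case True
    then have "set (qry fm (Leaf i 0 M (reps [i])) 0 k) = {i}" using a(2) by auto
    then show ?thesis using True a(1) by (metis distinct_length_2_or_more distinct_singleton empty_iff insert_iff list.set_cases list.set_intros(1,2) neq_Nil_conv set_ConsD)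
  next
    case False
    then have "set (qry fm (Leaf i 0 M (reps [i])) 0 k) = {}" using a(2) by auto
    then show ?thesis using False by (simp del: qry.simps)
  qed
qed

lemma qry_scan:
  "set is \<subseteq> {..<d} \<Longrightarrow> qry fm (scan M is) 0 k = filter (\<lambda>i. cnt (D i) 0 \<le> k) is"
  using scan_leaf by (induction "is") (auto simp: scan_def simp del: qry.simps(3))

lemma pops_scan:
  "set is \<subseteq> {..<d} \<Longrightarrow> pops fm (scan M is) 0 k \<le> length is * (3 * k + 4) + length (qry fm (scan M is) 0 k) + 1"
proof (induction "is")
  case (Cons i "is")
  have "etree M k 0 [(i, D i, 0)] (Leaf i 0 M (reps (map fst [(i, D i, 0 :: nat)])))"
    by (rule etree.Leaf[of i "D i" 0]) (auto simp: agree_def)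
  from etree_pops[OF this, of fm 0 k]
  have "pops fm (Leaf i 0 M (reps [i])) 0 k \<le> 3 * (k + 1) + length (qry fm (Leaf i 0 M (reps [i])) 0 k)"
    by (simp del: pops.simps qry.simps)
  then show ?case using Cons by (auto simp: scan_def simp del: pops.simps(3) qry.simps(3))
qed (simp add: scan_def)

end

subsection \<open>A machine with wide variables\<close>

definition digit :: "nat \<Rightarrow> nat \<Rightarrow> nat \<Rightarrow> nat" where
  "digit w x t = x div 2 ^ (w * t) mod 2 ^ w"

definition slot :: "nat \<Rightarrow> nat \<Rightarrow> nat \<Rightarrow> reg" where
  "slot K v t = v * K + t"

definition slots :: "nat \<Rightarrow> nat \<Rightarrow> reg list" where
  "slots K v = map (slot K v) [0..<K]"

lemma slot_eq_iff [simp]: "s < K \<Longrightarrow> t < K \<Longrightarrow> slot K u s = slot K v t \<longleftrightarrow> u = v \<and> s = t"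
proof -
  assume a: "s < K" "t < K"
  have "u = v" if "u * K + s = v * K + t"
  proof -
    have "(u * K + s) div K = (v * K + t) div K" using that by simp
    then show ?thesis using a by simp
  qed
  then show ?thesis unfolding slot_def by auto
qed

lemma digit_less [simp]: "digit w x t < 2 ^ w"
  by (simp add: digit_def)

lemma digit_zero [simp]: "digit w 0 t = 0"
  by (simp add: digit_def)

lemma digit_of_less: "x < 2 ^ w \<Longrightarrow> digit w x t = (if t = 0 then x else 0)"
proof -
  assume a: "x < 2 ^ w"
  have "x div 2 ^ (w * t) = 0" if "t > 0"
  proof -
    have "(2::nat) ^ w \<le> 2 ^ (w * t)" using that by (intro power_increasing) auto
    then show ?thesis using a by (intro div_less) linarith
  qed
  then show ?thesis using a by (auto simp: digit_def)
qed

lemma mod_power_Suc: "x mod 2 ^ (w * Suc t) = x mod 2 ^ (w * t) + 2 ^ (w * t) * digit w x t" for x :: nat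
proof -
  have "(2::nat) ^ (w * Suc t) = 2 ^ (w * t) * 2 ^ w" by (simp add: power_add [symmetric] add.commute)
  then show ?thesis by (simp add: mod_mult2_eq digit_def)
qed

lemma horner_cong: "(\<And>x. x \<in> set xs \<Longrightarrow> f x = g x) \<Longrightarrow> horner_sum f a xs = horner_sum g a xs"
  by (induction xs) auto

lemma horner_map: "horner_sum f a (map g xs) = horner_sum (\<lambda>x. f (g x)) a xs"
  by (induction xs) auto

lemma horner_digit: "horner_sum (digit w x) (2 ^ w) [0..<K] = x mod 2 ^ (w * K)"
proof (induction K)
  case (Suc K)
  have "horner_sum (digit w x) (2 ^ w) [0..<Suc K] = x mod 2 ^ (w * K) + 2 ^ (w * K) * digit w x K"
    by (simp add: horner_sum_append Suc power_mult [symmetric])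
  then show ?case by (simp only: mod_power_Suc)
qed simp

section \<open>The virtual machine and its translation\<close>

text \<open>
  A variable of the virtual machine is a number below \<open>2 ^ (w * K)\<close>, held in \<open>K\<close> registers.
\<close>

datatype vop =
    VZero nat
  | VOne nat
  | VCopy nat nat
  | VAdd nat nat nat
  | VXor nat nat nat
  | VLess nat nat nat
  | VSelect nat nat nat nat
  | VBin binop nat nat nat
  | VLoad nat nat
  | VLoadW nat nat
  | VStoreW nat nat
  | VQuery nat nat
  | VReport nat

type_synonym vstate = "(nat \<Rightarrow> nat) \<times> nat list \<times> nat list"

datatype cmd =
    Ops "vop list"
  | Seq cmd cmd (infixr ";;" 60)
  | If nat cmd cmd
  | While nat cmd

text \<open>A cell of static or working memory is as wide as a variable and occupies
  \<open>K\<close> words. The query \<open>QW\<close> is given by the problem, so its cells are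
  single words.\<close>

locale vm =
  fixes w K :: nat and SC :: "nat list" and QW :: "nat list"
  assumes w_pos: "0 < w" and K_pos: "0 < K"
begin

abbreviation "B \<equiv> (2::nat) ^ w"
abbreviation "BIG \<equiv> (2::nat) ^ (w * K)"

text \<open>\<open>None\<close> stands for a state that the translated code would not reproduce: an
  overflow, a selector that is not a bit, a wide operand of a one-word instruction, an access
  outside a segment. Programs are shown to avoid it, so \<open>run\<close> is a statement of total
  correctness.\<close>

fun vstep :: "vop \<Rightarrow> vstate \<Rightarrow> vstate option" where
  "vstep (VZero u) (v, W, R) = Some (v(u := 0), W, R)"
| "vstep (VOne u) (v, W, R) = Some (v(u := 1), W, R)"
| "vstep (VCopy u a) (v, W, R) = Some (v(u := v a), W, R)"
| "vstep (VAdd u a b) (v, W, R) = (if v a + v b < BIG then Some (v(u := v a + v b), W, R) else None)"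
| "vstep (VXor u a b) (v, W, R) = Some (v(u := Bit_Operations.xor (v a) (v b)), W, R)"
| "vstep (VLess u a b) (v, W, R) = Some (v(u := of_bool (v a < v b)), W, R)"
| "vstep (VSelect u f a b) (v, W, R) =
    (if v f \<le> 1 then Some (v(u := if v f = 1 then v a else v b), W, R) else None)"
| "vstep (VBin f u a b) (v, W, R) =
    (if v a < B \<and> v b < B then Some (v(u := binop_val w f (v a) (v b)), W, R) else None)"
| "vstep (VLoad u a) (v, W, R) =
    (if v a < length SC then Some (v(u := SC ! v a), W, R) else None)"
| "vstep (VLoadW u a) (v, W, R) =
    (if v a < length W then Some (v(u := W ! v a), W, R) else None)"
| "vstep (VStoreW a u) (v, W, R) =
    (if v a < length W then Some (v, W[v a := v u], R) else None)"
| "vstep (VQuery u a) (v, W, R) =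
    (if v a < length QW then Some (v(u := QW ! v a), W, R) else None)"
| "vstep (VReport a) (v, W, R) = Some (v, W, R @ [v a])"

fun vsteps :: "vop list \<Rightarrow> vstate \<Rightarrow> vstate option" where
  "vsteps [] s = Some s"
| "vsteps (x # xs) s = (case vstep x s of None \<Rightarrow> None | Some s' \<Rightarrow> vsteps xs s')"

text \<open>The clock counts virtual operations. A condition has to be below \<open>B\<close>
  because the translated jump inspects the lowest digit only.\<close>

inductive run :: "cmd \<Rightarrow> vstate \<Rightarrow> nat \<Rightarrow> vstate \<Rightarrow> bool" where
  run_Ops: "vsteps xs s = Some s' \<Longrightarrow> run (Ops xs) s (length xs) s'"
| run_Seq: "run a s t s' \<Longrightarrow> run b s' t' s'' \<Longrightarrow> run (a ;; b) s (t + t') s''"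
| run_IfT: "0 < fst s v \<Longrightarrow> fst s v < B \<Longrightarrow> run a s t s' \<Longrightarrow> run (If v a b) s (Suc t) s'"
| run_IfF: "fst s v = 0 \<Longrightarrow> run b s t s' \<Longrightarrow> run (If v a b) s (Suc t) s'"
| run_WhileT: "0 < fst s v \<Longrightarrow> fst s v < B \<Longrightarrow> run a s t s' \<Longrightarrow> run (While v a) s' t' s'' \<Longrightarrow>
    run (While v a) s (Suc (t + t')) s''"
| run_WhileF: "fst s v = 0 \<Longrightarrow> run (While v a) s 1 s"

text \<open>The register blocks 0 to 6 are scratch space: block 0 holds an address, block 1 the
  number one, and blocks 2 to 6 one auxiliary register each. Variables of the virtual machine are
  therefore shifted by 7.\<close>

abbreviation "cy \<equiv> slot K 2 0"
abbreviation "r1 \<equiv> slot K 3 0"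
abbreviation "r2 \<equiv> slot K 4 0"
abbreviation "r3 \<equiv> slot K 5 0"
abbreviation "fl \<equiv> slot K 6 0"

definition add_body :: "nat \<Rightarrow> nat \<Rightarrow> nat \<Rightarrow> nat \<Rightarrow> instr list" where
  "add_body u a b t = [Bin Add r1 (slot K a t) (slot K b t), Bin Less r2 r1 (slot K a t), Bin Add (slot K u t) r1 cy,
      Bin Less r3 (slot K u t) r1, Bin Or cy r2 r3]"

definition less_body :: "nat \<Rightarrow> nat \<Rightarrow> nat \<Rightarrow> instr list" where
  "less_body a b t = [Bin Less r1 (slot K a t) (slot K b t), Bin Eq r2 (slot K a t) (slot K b t), Bin And r2 r2 cy,
      Bin Or cy r1 r2]"

text \<open>The selection \<open>b + (a - b) * f\<close> without a branch. It is taken modulo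
  \<open>B\<close> in each digit separately, so no borrow passes between digits.\<close>

definition sel_body :: "nat \<Rightarrow> nat \<Rightarrow> nat \<Rightarrow> nat \<Rightarrow> instr list" where
  "sel_body u a b t = [Bin Sub r1 (slot K a t) (slot K b t), Bin Mul r1 r1 fl, Bin Add (slot K u t) (slot K b t) r1]"

definition wzero :: "nat \<Rightarrow> instr list" where
  "wzero u = map (\<lambda>t. Const (slot K u t) 0) [0..<K]"

definition wset :: "nat \<Rightarrow> instr list \<Rightarrow> instr list" where
  "wset u is = is @ map (\<lambda>t. Const (slot K u t) 0) [1..<K]"

definition wcopy :: "nat \<Rightarrow> nat \<Rightarrow> instr list" where
  "wcopy u a = map (\<lambda>t. Bin Or (slot K u t) (slot K a t) (slot K a t)) [0..<K]"

definition wxor :: "nat \<Rightarrow> nat \<Rightarrow> nat \<Rightarrow> instr list" where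
  "wxor u a b = map (\<lambda>t. Bin Xor (slot K u t) (slot K a t) (slot K b t)) [0..<K]"

definition wadd :: "nat \<Rightarrow> nat \<Rightarrow> nat \<Rightarrow> instr list" where
  "wadd u a b = Const cy 0 # concat (map (add_body u a b) [0..<K])"

definition wless :: "nat \<Rightarrow> nat \<Rightarrow> nat \<Rightarrow> instr list" where
  "wless u a b = wset u ((Const cy 0 # concat (map (less_body a b) [0..<K])) @ [Bin Or (slot K u 0) cy cy])"

definition wselect :: "nat \<Rightarrow> nat \<Rightarrow> nat \<Rightarrow> nat \<Rightarrow> instr list" where
  "wselect u f a b = Bin Or fl (slot K f 0) (slot K f 0) # concat (map (sel_body u a b) [0..<K])"

text \<open>A wide cell starts at \<open>K\<close> times its number. As \<open>K\<close> is a
  constant of the program, repeated addition replaces a wide multiplication.\<close>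

definition waddr :: "nat \<Rightarrow> instr list" where
  "waddr a = wset 1 [Const (slot K 1 0) 1] @ wzero 0 @ concat (replicate K (wadd 0 0 a))"

definition wload :: "segment \<Rightarrow> nat \<Rightarrow> nat \<Rightarrow> instr list" where
  "wload sg u a = waddr a @ concat (map (\<lambda>t. Load sg (slot K u t) (slots K 0) # wadd 0 0 1) [0..<K])"

definition wstore :: "nat \<Rightarrow> nat \<Rightarrow> instr list" where
  "wstore a u = waddr a @ concat (map (\<lambda>t. Store (slots K 0) (slot K u t) # wadd 0 0 1) [0..<K])"

fun opcode :: "vop \<Rightarrow> instr list" where
  "opcode (VZero u) = wzero (u + 7)"
| "opcode (VOne u) = wset (u + 7) [Const (slot K (u + 7) 0) 1]"
| "opcode (VCopy u a) = wcopy (u + 7) (a + 7)"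
| "opcode (VAdd u a b) = wadd (u + 7) (a + 7) (b + 7)"
| "opcode (VXor u a b) = wxor (u + 7) (a + 7) (b + 7)"
| "opcode (VLess u a b) = wless (u + 7) (a + 7) (b + 7)"
| "opcode (VSelect u f a b) = wselect (u + 7) (f + 7) (a + 7) (b + 7)"
| "opcode (VBin f u a b) = wset (u + 7) [Bin f (slot K (u + 7) 0) (slot K (a + 7) 0) (slot K (b + 7) 0)]"
| "opcode (VLoad u a) = wload Static (u + 7) (a + 7)"
| "opcode (VLoadW u a) = wload Work (u + 7) (a + 7)"
| "opcode (VStoreW a u) = wstore (a + 7) (u + 7)"
| "opcode (VQuery u a) = wset (u + 7) [Load Query (slot K (u + 7) 0) (slots K (a + 7))]"
| "opcode (VReport a) = [Report (slots K (a + 7))]"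

section \<open>Correctness of the arithmetic on wide variables\<close>

fun rrun :: "instr list \<Rightarrow> (reg \<Rightarrow> nat) \<Rightarrow> (reg \<Rightarrow> nat)" where
  "rrun [] g = g"
| "rrun (Const r v # is) g = rrun is (g(r := v mod B))"
| "rrun (Bin f r x y # is) g = rrun is (g(r := binop_val w f (g x) (g y)))"
| "rrun (_ # is) g = g"

definition regonly :: "instr list \<Rightarrow> bool" where
  "regonly is \<longleftrightarrow> (\<forall>i\<in>set is. (\<exists>r v. i = Const r v) \<or> (\<exists>f r x y. i = Bin f r x y))"

lemma regonly_simps [simp]:
  "regonly []"
  "regonly (Const r v # is) = regonly is"
  "regonly (Bin f r x y # is) = regonly is"
  "regonly (xs @ ys) = (regonly xs \<and> regonly ys)"
  "regonly (concat xss) = (\<forall>xs\<in>set xss. regonly xs)"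
  "regonly (map (\<lambda>t. Const (rf t) v) ts)"
  "regonly (map (\<lambda>t. Bin f (rf t) (xf t) (yf t)) ts)"
  by (auto simp: regonly_def)

lemma rrun_append: "regonly xs \<Longrightarrow> rrun (xs @ ys) g = rrun ys (rrun xs g)"
proof (induction xs arbitrary: g)
  case (Cons i xs)
  then show ?case by (cases i) (auto simp: regonly_def)
qed simp

lemma rrun_loop:
  assumes "regonly [i]" "\<And>t. regonly (body t)"
  shows "rrun (i # concat (map body [0..<Suc v])) g = rrun (body v) (rrun (i # concat (map body [0..<v])) g)"
proof -
  have "regonly (i # concat (map body [0..<v]))" using assms by (auto simp: regonly_def)
  from rrun_append[OF this, of "body v" g] show ?thesis by simp
qed

definition holds :: "(reg \<Rightarrow> nat) \<Rightarrow> nat \<Rightarrow> nat \<Rightarrow> bool" where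
  "holds g v x \<longleftrightarrow> x < BIG \<and> (\<forall>t<K. g (slot K v t) = digit w x t)"

definition keeps :: "nat set \<Rightarrow> (reg \<Rightarrow> nat) \<Rightarrow> (reg \<Rightarrow> nat) \<Rightarrow> bool" where
  "keeps U g g' \<longleftrightarrow> (\<forall>v t. v \<notin> U \<longrightarrow> t < K \<longrightarrow> g' (slot K v t) = g (slot K v t))"

lemma keeps_holds: "keeps U g g' \<Longrightarrow> v \<notin> U \<Longrightarrow> holds g v x \<Longrightarrow> holds g' v x"
  by (simp add: keeps_def holds_def)

lemma keeps_trans: "keeps U g g' \<Longrightarrow> keeps U g' g'' \<Longrightarrow> keeps U g g''"
  by (simp add: keeps_def)

lemma keeps_mono: "keeps U g g' \<Longrightarrow> U \<subseteq> V \<Longrightarrow> keeps V g g'"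
  by (auto simp: keeps_def)

lemma B_le_BIG: "B \<le> BIG"
  using K_pos by (intro power_increasing) auto

lemma one_less_B: "1 < B"
  using w_pos by (metis one_less_numeral_iff one_less_power semiring_norm(76))

lemma Suc_0_less_B [simp]: "Suc 0 < B" and Suc_0_le_K [simp]: "Suc 0 \<le> K" and w_gt [simp]: "0 < w" and K_gt [simp]: "0 < K"
  using one_less_B w_pos K_pos by simp_all

lemma holds_bound: "holds g v x \<Longrightarrow> x < BIG"
  by (simp add: holds_def)

lemma holds_small:
  assumes "x < B" "g (slot K v 0) = x" "\<And>t. 0 < t \<Longrightarrow> t < K \<Longrightarrow> g (slot K v t) = 0"
  shows "holds g v x"
  using assms less_le_trans[OF assms(1) B_le_BIG] by (auto simp: holds_def digit_of_less)

lemma holds_low: "holds g v x \<Longrightarrow> x < B \<Longrightarrow> g (slot K v 0) = x"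
  using K_pos by (simp add: holds_def digit_of_less)

lemma wzero_upper:
  assumes "a \<le> b" "b \<le> K"
  shows "rrun (map (\<lambda>t. Const (slot K u t) 0) [a..<b]) g =
    (\<lambda>r. if \<exists>t. a \<le> t \<and> t < b \<and> r = slot K u t then 0 else g r)"
  using assms
proof (induction "b" rule: dec_induct)
  case base
  have "\<not> (\<exists>t\<ge>a. t < a \<and> r = slot K u t)" for r by auto
  then show ?case by (simp only: upt_rec[of a a] less_irrefl if_False list.map rrun.simps)
next
  case (step b)
  then show ?case by (auto simp: rrun_append fun_eq_iff less_Suc_eq)
qed

lemma wzero: "holds (rrun (wzero u) g) u 0 \<and> keeps {u} g (rrun (wzero u) g)"
  unfolding wzero_def holds_def keeps_def by (simp add: wzero_upper) auto

lemma wset: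
  assumes "regonly is" "x < B" "rrun is g (slot K u 0) = x" "keeps U g (rrun is g)" "u \<in> U"
  shows "holds (rrun (wset u is) g) u x \<and> keeps U g (rrun (wset u is) g)"
proof -
  have K1: "1 \<le> K" using K_pos by simp
  let ?g = "rrun is g"
  have e: "rrun (wset u is) g = (\<lambda>r. if \<exists>t. 1 \<le> t \<and> t < K \<and> r = slot K u t then 0 else ?g r)"
    unfolding wset_def rrun_append[OF assms(1)] using wzero_upper[of 1 K] K1 by simp
  have "holds (rrun (wset u is) g) u x"
    by (rule holds_small[OF assms(2)]) (use assms(3) K_pos in \<open>auto simp: e\<close>)
  moreover have "keeps U g (rrun (wset u is) g)"
    using assms(4,5) unfolding keeps_def e by auto
  ultimately show ?thesis by simp
qed

lemma wdigits:
  assumes "v + 1 \<le> K + 1"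
  shows "rrun (map (\<lambda>t. Bin f (slot K u t) (slot K a t) (slot K b t)) [0..<v]) g =
    (\<lambda>r. if \<exists>t<v. r = slot K u t then binop_val w f (g (slot K a (r - u * K))) (g (slot K b (r - u * K))) else g r)"
  using assms
proof (induction v)
  case (Suc v)
  have 1: "\<not> (\<exists>t<v. slot K a v = slot K u t)" "\<not> (\<exists>t<v. slot K b v = slot K u t)"
    using Suc.prems by auto
  have "slot K u v - u * K = v" by (simp add: slot_def)
  then show ?case using Suc 1 by (auto simp: rrun_append fun_eq_iff less_Suc_eq)
qed simp

lemma wcopy:
  assumes "holds g a x"
  shows "holds (rrun (wcopy u a) g) u x \<and> keeps {u} g (rrun (wcopy u a) g)"
proof -
  have [simp]: "slot K u t - u * K = t" for t by (simp add: slot_def)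
  show ?thesis using assms unfolding wcopy_def holds_def keeps_def by (auto simp: wdigits)
qed

lemma digit_bits: "digit w x t = take_bit w (drop_bit (w * t) x)"
  by (simp add: digit_def take_bit_eq_mod drop_bit_eq_div)

lemma wxor:
  assumes "holds g a x" "holds g b y"
  shows "holds (rrun (wxor u a b) g) u (Bit_Operations.xor x y) \<and> keeps {u} g (rrun (wxor u a b) g)"
proof -
  have [simp]: "slot K u t - u * K = t" for t by (simp add: slot_def)
  have "Bit_Operations.xor x y < BIG"
    using assms by (metis holds_bound take_bit_nat_eq_self_iff take_bit_xor)
  then show ?thesis using assms unfolding wxor_def holds_def keeps_def
    by (auto simp: wdigits digit_bits)
qed

lemma mod_add3: "(p + q + c) mod m = (p mod m + q mod m + c) mod m" for p q c m :: nat
  by (metis mod_add_eq mod_add_left_eq)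

lemma digit_add:
  assumes "c = (x mod 2 ^ (w * t) + y mod 2 ^ (w * t)) div 2 ^ (w * t)"
  shows "digit w (x + y) t = (digit w x t + digit w y t + c) mod B"
    and "(x mod 2 ^ (w * Suc t) + y mod 2 ^ (w * Suc t)) div 2 ^ (w * Suc t) =
         (digit w x t + digit w y t + c) div B"
proof -
  let ?p = "2 ^ (w * t) :: nat"
  have "(x + y) div ?p = x div ?p + y div ?p + (x mod ?p + y mod ?p) div ?p"
    by (rule div_add1_eq)
  then have h: "(x + y) div ?p = x div ?p + y div ?p + c" by (simp only: assms)
  show "digit w (x + y) t = (digit w x t + digit w y t + c) mod B"
    unfolding digit_def h by (rule mod_add3)
  let ?q = "2 ^ (w * Suc t) :: nat"
  have q: "?q = ?p * B" by (simp add: power_add [symmetric] add.commute)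
  have "x mod ?q + y mod ?q = (x mod ?p + y mod ?p) + ?p * (digit w x t + digit w y t)"
    by (simp only: mod_power_Suc) (simp add: algebra_simps)
  then have "(x mod ?q + y mod ?q) div ?p = digit w x t + digit w y t + c"
    using assms by simp
  then show "(x mod ?q + y mod ?q) div ?q = (digit w x t + digit w y t + c) div B"
    by (simp only: q div_mult2_eq)
qed

text \<open>An addition modulo \<open>B\<close> has overflowed iff the result is smaller than an
  operand. At most one of the two additions overflows: if the first does, its result is at most
  \<open>B - 2\<close>, which leaves room for the carry.\<close>

lemma carry_step:
  fixes p q c :: nat
  assumes "p < B" "q < B" "c \<le> 1"
  defines "s \<equiv> (p + q) mod B"
  shows "(s + c) mod B = (p + q + c) mod B"
    and "Bit_Operations.or (of_bool (s < p)) (of_bool ((s + c) mod B < s)) = (p + q + c) div B"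
proof -
  show "(s + c) mod B = (p + q + c) mod B" by (simp add: s_def mod_simps)
  have B1: "1 < B" by (rule one_less_B)
  show "Bit_Operations.or (of_bool (s < p)) (of_bool ((s + c) mod B < s)) = (p + q + c) div B"
  proof (cases "p + q < B")
    case True
    then have s: "s = p + q" by (simp add: s_def)
    show ?thesis
    proof (cases "p + q + c < B")
      case True then show ?thesis using s by simp
    next
      case False
      then have "p + q + c = B" using True assms(3) by simp
      moreover from this True have "c = 1" using assms(3) by linarith
      moreover from this True B1 have "0 < p \<or> 0 < q" using \<open>p + q + c = B\<close> by linarith
      ultimately show ?thesis using s B1 by auto
    qed
  next
    case False
    then have s: "s = p + q - B" using assms
      by (simp add: s_def le_mod_geq)
    have "(p + q + c) div B = 1" using False assms by (intro div_nat_eqI) auto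
    moreover have "s < p" using s assms False by linarith
    moreover have "(s + c) mod B = s + c" using s assms False by (intro mod_less) linarith
    ultimately show ?thesis by simp
  qed
qed

text \<open>The last conjunct includes the digits of \<open>u\<close> that have not been reached.
  Thus the target may be one of the operands: their digit is read before the same digit of
  \<open>u\<close> is written.\<close>

lemma wadd_inv:
  assumes "holds g a x" "holds g b y" "a \<notin> {2..6}" "b \<notin> {2..6}" "u \<notin> {2..6}" "v \<le> K"
  shows "let g' = rrun (Const cy 0 # concat (map (add_body u a b) [0..<v])) g in
     g' cy = (x mod 2 ^ (w * v) + y mod 2 ^ (w * v)) div 2 ^ (w * v) \<and>
     (\<forall>t<v. g' (slot K u t) = digit w (x + y) t) \<and>
     (\<forall>z t. t < K \<longrightarrow> z \<notin> {2..6} \<longrightarrow> (z \<noteq> u \<or> v \<le> t) \<longrightarrow> g' (slot K z t) = g (slot K z t))"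
  using assms(6)
proof (induction v)
  case 0
  then show ?case using K_pos by auto
next
  case (Suc v)
  define g1 where "g1 = rrun (Const cy 0 # concat (map (add_body u a b) [0..<v])) g"
  define c where "c = g1 cy"
  have IH: "c = (x mod 2 ^ (w * v) + y mod 2 ^ (w * v)) div 2 ^ (w * v)"
     "\<And>t. t < v \<Longrightarrow> g1 (slot K u t) = digit w (x + y) t"
     "\<And>z t. t < K \<Longrightarrow> z \<notin> {2..6} \<Longrightarrow> z \<noteq> u \<or> v \<le> t \<Longrightarrow> g1 (slot K z t) = g (slot K z t)"
    using Suc unfolding g1_def c_def Let_def by auto
  have "x mod 2 ^ (w * v) + y mod 2 ^ (w * v) < 2 * 2 ^ (w * v)"
    by (simp add: add_strict_mono mult_2)
  then have "c < 2" unfolding IH(1) by (rule less_mult_imp_div_less)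
  then have c1: "c \<le> 1" by simp
  have vK: "v < K" using Suc by simp
  have ga: "g1 (slot K a v) = digit w x v" "g1 (slot K b v) = digit w y v"
    using IH(3)[of v a] IH(3)[of v b] assms vK by (auto simp: holds_def)
  note cs = carry_step[OF digit_less digit_less c1, of x v y v]
  have [simp]: "of_bool z mod B = (of_bool z :: nat)" for z using w_pos by (cases z) auto
  have n1: "slot K a v = slot K n 0 \<longleftrightarrow> False" "slot K b v = slot K n 0 \<longleftrightarrow> False"
    "slot K u v = slot K n 0 \<longleftrightarrow> False" "slot K n 0 = slot K u v \<longleftrightarrow> False" if "n \<in> {2..6}" for n
    using that K_pos vK assms(3-5) by auto
  note n1 = n1[of 2, simplified] n1[of 3, simplified] n1[of 4, simplified] n1[of 5, simplified]
  have n2: "slot K n 0 = slot K n' 0 \<longleftrightarrow> n = n'" for n n' using K_pos by simp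
  have n2: "(cy = r1) = False" "(cy = r2) = False" "(cy = r3) = False" "(r1 = cy) = False" "(r1 = r2) = False"
    "(r1 = r3) = False" "(r2 = cy) = False" "(r2 = r1) = False" "(r2 = r3) = False" by (simp_all add: n2)
  have ob: "of_bool z mod B = (of_bool z :: nat)" for z using w_pos by (cases z) auto
  have e: "rrun (Const cy 0 # concat (map (add_body u a b) [0..<Suc v])) g = rrun (add_body u a b v) g1"
    unfolding g1_def by (rule rrun_loop) (auto simp: regonly_def add_body_def)
  define g2 where "g2 = rrun (add_body u a b v) g1"
  let ?s = "(digit w x v + digit w y v) mod B"
  have g2: "g2 = g1(r1 := ?s, r2 := of_bool (?s < digit w x v), slot K u v := (?s + c) mod B,
      r3 := of_bool ((?s + c) mod B < ?s), cy := Bit_Operations.or (of_bool (?s < digit w x v)) (of_bool ((?s + c) mod B < ?s)))"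
    unfolding g2_def add_body_def
    by (simp only: rrun.simps binop_val.simps fun_upd_apply n1 n2 ga ob c_def if_False if_True refl)
  have "g2 cy = (x mod 2 ^ (w * Suc v) + y mod 2 ^ (w * Suc v)) div 2 ^ (w * Suc v)"
    unfolding g2 fun_upd_same by (rule trans[OF cs(2) digit_add(2)[OF IH(1), symmetric]])
  moreover have "\<forall>t<Suc v. g2 (slot K u t) = digit w (x + y) t"
  proof (intro allI impI)
    fix t assume t: "t < Suc v"
    show "g2 (slot K u t) = digit w (x + y) t"
    proof (cases "t = v")
      case True
      show ?thesis unfolding True
        using trans[OF cs(1) digit_add(1)[OF IH(1), symmetric]] by (simp only: g2 fun_upd_apply n1 refl if_True if_False)
    next
      case False
      then have "slot K u t \<noteq> slot K u v" "slot K u t \<noteq> slot K n 0" if "n \<in> {2..6}" for n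
        using t vK K_pos assms(5) that by auto
      from this[of 2] this[of 3] this[of 4] this[of 5]
      have "g2 (slot K u t) = g1 (slot K u t)" by (simp only: g2 fun_upd_apply) simp
      then show ?thesis using IH(2) t False by simp
    qed
  qed
  moreover have "\<forall>z t. t < K \<longrightarrow> z \<notin> {2..6} \<longrightarrow> (z \<noteq> u \<or> Suc v \<le> t) \<longrightarrow> g2 (slot K z t) = g (slot K z t)"
    using IH(3) vK K_pos by (auto simp: g2)
  ultimately show ?case unfolding Let_def e g2_def by (intro conjI)
qed

lemma wadd:
  assumes "holds g a x" "holds g b y" "a \<notin> {2..6}" "b \<notin> {2..6}" "u \<notin> {2..6}" "x + y < BIG"
  shows "holds (rrun (wadd u a b) g) u (x + y) \<and> keeps (insert u {2..6}) g (rrun (wadd u a b) g)"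
  using wadd_inv[OF assms(1-5) order.refl] assms(6)
  unfolding wadd_def[symmetric] Let_def holds_def keeps_def by auto

lemma less_digit:
  fixes x y :: nat
  shows "x mod 2 ^ (w * Suc t) < y mod 2 ^ (w * Suc t) \<longleftrightarrow>
    digit w x t < digit w y t \<or> digit w x t = digit w y t \<and> x mod 2 ^ (w * t) < y mod 2 ^ (w * t)"
proof -
  let ?p = "2 ^ (w * t) :: nat"
  have l: "x mod ?p < ?p" "y mod ?p < ?p" by auto
  consider "digit w x t < digit w y t" | "digit w x t = digit w y t" | "digit w y t < digit w x t" by linarith
  then show ?thesis
  proof cases
    case 1
    then have "?p * (digit w x t + 1) \<le> ?p * digit w y t" by (intro mult_left_mono) auto
    then have "?p + ?p * digit w x t \<le> ?p * digit w y t" by (simp add: algebra_simps)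
    then show ?thesis unfolding mod_power_Suc using l 1 by linarith
  next
    case 3
    then have "?p * (digit w y t + 1) \<le> ?p * digit w x t" by (intro mult_left_mono) auto
    then have "?p + ?p * digit w y t \<le> ?p * digit w x t" by (simp add: algebra_simps)
    then show ?thesis unfolding mod_power_Suc using l 3 by linarith
  next
    case 2
    then show ?thesis unfolding mod_power_Suc by simp
  qed
qed

text \<open>Digits are visited from the least significant one, so a later digit overrides the
  verdict in \<open>cy\<close> unless it is equal in both numbers.\<close>

lemma wless_inv:
  assumes "holds g a x" "holds g b y" "a \<notin> {2..6}" "b \<notin> {2..6}" "v \<le> K"
  shows "let g' = rrun (Const cy 0 # concat (map (less_body a b) [0..<v])) g in
     g' cy = of_bool (x mod 2 ^ (w * v) < y mod 2 ^ (w * v)) \<and> keeps {2..6} g g'"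
  using assms(5)
proof (induction v)
  case 0
  then show ?case using K_pos by (auto simp: keeps_def)
next
  case (Suc v)
  define g1 where "g1 = rrun (Const cy 0 # concat (map (less_body a b) [0..<v])) g"
  have IH: "g1 cy = of_bool (x mod 2 ^ (w * v) < y mod 2 ^ (w * v))" "keeps {2..6} g g1"
    using Suc unfolding g1_def Let_def by auto
  have vK: "v < K" using Suc by simp
  have ga: "g1 (slot K a v) = digit w x v" "g1 (slot K b v) = digit w y v"
    using IH(2) assms vK by (auto simp: holds_def keeps_def)
  have [simp]: "of_bool z mod B = (of_bool z :: nat)" for z using w_pos by (cases z) auto
  have e: "rrun (Const cy 0 # concat (map (less_body a b) [0..<Suc v])) g = rrun (less_body a b v) g1"
    unfolding g1_def by (rule rrun_loop) (auto simp: regonly_def less_body_def)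
  have ne: "slot K q v \<noteq> slot K n 0" if "n \<in> {2..6}" "q \<notin> {2..6}" for q n
    using that K_pos vK by auto
  have [simp]: "slot K q v = cy \<longleftrightarrow> False" "slot K q v = r1 \<longleftrightarrow> False" "slot K q v = r2 \<longleftrightarrow> False"
    "slot K q v = r3 \<longleftrightarrow> False" if "q \<notin> {2..6}" for q
    using ne[of 2 q] ne[of 3 q] ne[of 4 q] ne[of 5 q] that by auto
  have g2: "rrun (less_body a b v) g1 = g1(r1 := of_bool (digit w x v < digit w y v),
      r2 := Bit_Operations.and (of_bool (digit w x v = digit w y v)) (g1 cy),
      cy := Bit_Operations.or (of_bool (digit w x v < digit w y v)) (Bit_Operations.and (of_bool (digit w x v = digit w y v)) (g1 cy)))"
    unfolding less_body_def using vK assms(3,4) ga K_pos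
    by (simp del: slot_eq_iff atLeastAtMost_iff) simp
  have "rrun (less_body a b v) g1 cy = of_bool (x mod 2 ^ (w * Suc v) < y mod 2 ^ (w * Suc v))"
    unfolding less_digit using IH(1) by (auto simp: g2)
  moreover have "keeps {2..6} g (rrun (less_body a b v) g1)"
    using IH(2) vK K_pos by (auto simp: keeps_def g2)
  ultimately show ?case unfolding Let_def e by (intro conjI)
qed

lemma wless:
  assumes "holds g a x" "holds g b y" "a \<notin> {2..6}" "b \<notin> {2..6}"
  shows "holds (rrun (wless u a b) g) u (of_bool (x < y)) \<and> keeps (insert u {2..6}) g (rrun (wless u a b) g)"
proof -
  define cs where "cs = Const cy 0 # concat (map (less_body a b) [0..<K])"
  have 1: "rrun cs g cy = of_bool (x < y)" "keeps {2..6} g (rrun cs g)"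
    using wless_inv[OF assms order.refl] holds_bound[OF assms(1)] holds_bound[OF assms(2)]
    unfolding cs_def[symmetric] Let_def by auto
  have ro: "regonly cs" by (auto simp: cs_def less_body_def)
  have 2: "rrun (cs @ [Bin Or (slot K u 0) cy cy]) g = (rrun cs g)(slot K u 0 := of_bool (x < y))"
    using 1 by (simp add: rrun_append[OF ro])
  show ?thesis unfolding wless_def cs_def[symmetric]
    by (rule wset) (use ro 1 w_pos K_pos in \<open>auto simp: 2 keeps_def\<close>)
qed

lemma wselect_inv:
  assumes "holds g f z" "z \<le> 1" "holds g a x" "holds g b y" "a \<notin> {2..6}" "b \<notin> {2..6}" "u \<notin> {2..6}" "v \<le> K"
  shows "let g' = rrun (Bin Or fl (slot K f 0) (slot K f 0) # concat (map (sel_body u a b) [0..<v])) g in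
     g' fl = z \<and> (\<forall>t<v. g' (slot K u t) = digit w (if z = 1 then x else y) t) \<and>
     (\<forall>q t. t < K \<longrightarrow> q \<notin> {2..6} \<longrightarrow> (q \<noteq> u \<or> v \<le> t) \<longrightarrow> g' (slot K q t) = g (slot K q t))"
  using assms(8)
proof (induction v)
  case 0
  have "z < B" using assms(2) one_less_B by linarith
  then have "g (slot K f 0) = z" using holds_low[OF assms(1)] by simp
  then show ?case using K_pos by auto
next
  case (Suc v)
  define g1 where "g1 = rrun (Bin Or fl (slot K f 0) (slot K f 0) # concat (map (sel_body u a b) [0..<v])) g"
  have IH: "g1 fl = z" "\<And>t. t<v \<Longrightarrow> g1 (slot K u t) = digit w (if z = 1 then x else y) t" 
     "\<And>q t. t < K \<Longrightarrow> q \<notin> {2..6} \<Longrightarrow> q \<noteq> u \<or> v \<le> t \<Longrightarrow> g1 (slot K q t) = g (slot K q t)"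
    using Suc unfolding g1_def Let_def by auto
  have vK: "v < K" using Suc by simp
  have ga: "g1 (slot K a v) = digit w x v" "g1 (slot K b v) = digit w y v"
    using IH(3)[of v a] IH(3)[of v b] assms vK by (auto simp: holds_def)
  have e: "rrun (Bin Or fl (slot K f 0) (slot K f 0) # concat (map (sel_body u a b) [0..<Suc v])) g = rrun (sel_body u a b v) g1"
    unfolding g1_def by (rule rrun_loop) (auto simp: regonly_def sel_body_def)
  have ne: "slot K q v \<noteq> slot K n 0" if "n \<in> {2..6}" "q \<notin> {2..6}" for q n
    using that K_pos vK by auto
  have [simp]: "slot K q v = r1 \<longleftrightarrow> False" "slot K q v = fl \<longleftrightarrow> False" if "q \<notin> {2..6}" for q
    using ne[of 3 q] ne[of 6 q] that by auto
  define s where "s = (digit w x v + B - digit w y v) mod B * z mod B"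
  have g2: "rrun (sel_body u a b v) g1 = g1(r1 := s, slot K u v := (digit w y v + s) mod B)"
    unfolding sel_body_def s_def using vK assms(5-7) ga IH(1) K_pos by (simp del: slot_eq_iff atLeastAtMost_iff) simp
  have s: "(digit w y v + s) mod B = digit w (if z = 1 then x else y) v"
  proof (cases "z = 1")
    case True
    have "digit w y v < B" "digit w x v < B" by simp_all
    then have "digit w y v + (digit w x v + B - digit w y v) = digit w x v + B" by linarith
    then have "(digit w y v + (digit w x v + B - digit w y v)) mod B = digit w x v" by simp
    moreover have "s = (digit w x v + B - digit w y v) mod B" using True by (simp add: s_def)
    ultimately show ?thesis using True by (simp only: mod_add_right_eq if_True refl)
  next
    case False
    then have "z = 0" using assms(2) by simp
    then show ?thesis by (simp add: s_def)
  qed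
  have "rrun (sel_body u a b v) g1 fl = z" using IH(1) vK K_pos assms(7) by (auto simp: g2)
  moreover have "\<forall>t<Suc v. rrun (sel_body u a b v) g1 (slot K u t) = digit w (if z = 1 then x else y) t"
    using s IH(2) vK K_pos assms(7) by (auto simp: g2 less_Suc_eq)
  moreover have "\<forall>q t. t < K \<longrightarrow> q \<notin> {2..6} \<longrightarrow> (q \<noteq> u \<or> Suc v \<le> t) \<longrightarrow> rrun (sel_body u a b v) g1 (slot K q t) = g (slot K q t)"
    using IH(3) vK K_pos by (auto simp: g2)
  ultimately show ?case unfolding Let_def e by (intro conjI)
qed

lemma wselect:
  assumes "holds g f z" "z \<le> 1" "holds g a x" "holds g b y" "a \<notin> {2..6}" "b \<notin> {2..6}" "u \<notin> {2..6}"
  shows "holds (rrun (wselect u f a b) g) u (if z = 1 then x else y) \<and>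
    keeps (insert u {2..6}) g (rrun (wselect u f a b) g)"
  using wselect_inv[OF assms order.refl] holds_bound[OF assms(3)] holds_bound[OF assms(4)]
  unfolding wselect_def[symmetric] Let_def holds_def keeps_def by auto

lemma waddr:
  assumes "holds g a x" "7 \<le> a" "K * x < BIG"
  shows "holds (rrun (waddr a) g) 0 (K * x) \<and> holds (rrun (waddr a) g) 1 1 \<and> keeps {0..6} g (rrun (waddr a) g)"
proof -
  define g0 where "g0 = rrun (wset 1 [Const (slot K 1 0) 1]) g"
  have 0: "holds g0 1 1 \<and> keeps {1} g g0" unfolding g0_def
    by (rule wset) (use w_pos K_pos in \<open>auto simp: keeps_def\<close>)
  define g1 where "g1 = rrun (wzero 0) g0"
  have 1: "holds g1 0 0" "keeps {0} g0 g1" using wzero by (auto simp: g1_def)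
  have 2: "holds g1 1 1" "keeps {0..6} g g1"
    using 0 1 keeps_holds[of "{0}" g0 g1 1 1]
      keeps_trans[OF keeps_mono[of "{1}" g g0 "{0..6}"] keeps_mono[of "{0}" g0 g1 "{0..6}"]] by auto
  have ro: "regonly (wadd 0 0 a)" by (auto simp: wadd_def add_body_def)
  have 3: "n \<le> K \<Longrightarrow> holds (rrun (concat (replicate n (wadd 0 0 a))) g1) 0 (n * x) \<and>
      holds (rrun (concat (replicate n (wadd 0 0 a))) g1) 1 1 \<and>
      keeps {0..6} g (rrun (concat (replicate n (wadd 0 0 a))) g1)" for n
  proof (induction n)
    case 0
    then show ?case using 1 2 by simp
  next
    case (Suc n)
    define g2 where "g2 = rrun (concat (replicate n (wadd 0 0 a))) g1"
    have ro2: "regonly (concat (replicate n (wadd 0 0 a)))" using ro by auto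
    have IH: "holds g2 0 (n * x)" "holds g2 1 1" "keeps {0..6} g g2" using Suc by (auto simp: g2_def)
    have ha: "holds g2 a x" using keeps_holds[OF IH(3) _ assms(1)] assms(2) by simp
    have lt: "n * x + x < BIG"
    proof -
      have "Suc n * x \<le> K * x" using Suc.prems by (intro mult_le_mono) auto
      then show ?thesis using assms(3) by simp
    qed
    have e: "rrun (concat (replicate (Suc n) (wadd 0 0 a))) g1 = rrun (wadd 0 0 a) g2"
      unfolding replicate_Suc replicate_append_same[symmetric] g2_def by (simp add: rrun_append[OF ro2])
    have A: "holds (rrun (wadd 0 0 a) g2) 0 (n * x + x)" "keeps (insert 0 {2..6}) g2 (rrun (wadd 0 0 a) g2)"
      using wadd[OF IH(1) ha, of 0] lt assms(2) by auto
    have "holds (rrun (wadd 0 0 a) g2) 1 1" using keeps_holds[OF A(2) _ IH(2)] by simp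
    moreover have "keeps {0..6} g (rrun (wadd 0 0 a) g2)"
      using keeps_trans[OF IH(3) keeps_mono[OF A(2)]] by auto
    ultimately show ?case unfolding e using A(1) by (simp add: add.commute)
  qed
  have "regonly (wset 1 [Const (slot K 1 0) 1])" "regonly (wzero 0)"
    by (auto simp: wset_def wzero_def regonly_def)
  then have "rrun (waddr a) g = rrun (concat (replicate K (wadd 0 0 a))) g1"
    unfolding waddr_def g1_def g0_def by (simp only: rrun_append)
  then show ?thesis using 3[of K] by simp
qed


section \<open>Simulation of the virtual machine on the word RAM\<close>

fun sl :: "nat list \<Rightarrow> nat list \<Rightarrow> instr list \<Rightarrow> config \<Rightarrow> config \<Rightarrow> bool" where
  "sl S Q [] c c' \<longleftrightarrow> c' = c"
| "sl S Q (i # is) c c' \<longleftrightarrow> pc (exec_instr w S Q i c) = Suc (pc c) \<and> sl S Q is (exec_instr w S Q i c) c'"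

lemma sl_append: "sl S Q (xs @ ys) c c' \<longleftrightarrow> (\<exists>c1. sl S Q xs c c1 \<and> sl S Q ys c1 c')"
  by (induction xs arbitrary: c) auto

definition code_at :: "instr list \<Rightarrow> nat \<Rightarrow> instr list \<Rightarrow> bool" where
  "code_at prog p is \<longleftrightarrow> p + length is \<le> length prog \<and> (\<forall>i<length is. prog ! (p + i) = is ! i)"

lemma code_at_append [simp]:
  "code_at prog p (xs @ ys) \<longleftrightarrow> code_at prog p xs \<and> code_at prog (p + length xs) ys"
proof
  assume a: "code_at prog p (xs @ ys)"
  then have "\<And>i. i < length xs \<Longrightarrow> prog ! (p + i) = xs ! i"
    unfolding code_at_def by (metis length_append nth_append trans_less_add1)
  moreover have "\<And>i. i < length ys \<Longrightarrow> prog ! (p + length xs + i) = ys ! i"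
    using a unfolding code_at_def by (metis add.assoc length_append nat_add_left_cancel_less nth_append_length_plus)
  ultimately show "code_at prog p xs \<and> code_at prog (p + length xs) ys"
    using a by (auto simp: code_at_def)
next
  assume a: "code_at prog p xs \<and> code_at prog (p + length xs) ys"
  have "prog ! (p + i) = (xs @ ys) ! i" if "i < length (xs @ ys)" for i
  proof (cases "i < length xs")
    case False
    then have "i - length xs < length ys" "p + i = p + length xs + (i - length xs)" using that by auto
    then show ?thesis using a False unfolding code_at_def nth_append by metis
  qed (use a in \<open>auto simp: code_at_def nth_append\<close>)
  then show "code_at prog p (xs @ ys)" using a by (auto simp: code_at_def)
qed

lemma code_at_Cons: "code_at prog p (x # xs) \<longleftrightarrow> p < length prog \<and> prog ! p = x \<and> code_at prog (Suc p) xs"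
  using code_at_append[of prog p "[x]" xs] by (auto simp: code_at_def simp del: code_at_append)

lemma funpow_add_apply: "(f ^^ (m + n)) x = (f ^^ n) ((f ^^ m) x)"
  by (metis add.commute comp_apply funpow_add)

text \<open>In a straight line every instruction advances the program counter by one. This excludes
  faulting accesses, which leave the configuration unchanged.\<close>

lemma sl_steps:
  assumes "sl S Q is c c'" "code_at prog (pc c) is"
  shows "(step w prog S Q ^^ length is) c = c' \<and> pc c' = pc c + length is"
  using assms
proof (induction "is" arbitrary: c)
  case (Cons i "is")
  have st: "step w prog S Q c = exec_instr w S Q i c"
    using Cons.prems by (simp add: code_at_Cons step_def)
  have "(step w prog S Q ^^ length is) (exec_instr w S Q i c) = c' \<and> pc c' = Suc (pc c) + length is"
    using Cons.IH[of "exec_instr w S Q i c"] Cons.prems by (simp add: code_at_Cons)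
  then show ?case by (simp add: funpow_swap1 st)
qed simp

lemma sl_regonly: "regonly is \<Longrightarrow> sl S Q is c (c\<lparr>pc := pc c + length is, regs := rrun is (regs c)\<rparr>)"
proof (induction "is" arbitrary: c)
  case (Cons i xs)
  then show ?case using Cons.IH[of "exec_instr w S Q i c"]
    by (cases i) (auto simp: regonly_def set_reg_def fun_upd_def)
qed simp

definition seg_rep :: "nat list \<Rightarrow> nat list \<Rightarrow> bool" where
  "seg_rep xs ms \<longleftrightarrow> length ms = K * length xs \<and>
     (\<forall>i<length xs. xs ! i < BIG \<and> (\<forall>t<K. ms ! (K * i + t) = digit w (xs ! i) t))"

definition rel :: "vstate \<Rightarrow> config \<Rightarrow> bool" where
  "rel s c \<longleftrightarrow> (case s of (v, W, R) \<Rightarrow>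
     (\<forall>u. holds (regs c) (u + 7) (v u)) \<and> seg_rep W (work c) \<and> reported c = R \<and>
     K * length W < BIG)"

lemma wide_val_holds: "holds (regs c) v x \<Longrightarrow> wide_val w c (slots K v) = x"
proof -
  assume h: "holds (regs c) v x"
  have "wide_val w c (slots K v) = horner_sum (digit w x) B [0..<K]"
    unfolding wide_val_def slots_def horner_map
    by (rule horner_cong) (use h in \<open>simp add: holds_def\<close>)
  then show ?thesis using holds_bound[OF h] by (simp add: horner_digit)
qed

lemma seg_index: "t < K \<Longrightarrow> i < n \<Longrightarrow> K * i + t < K * n"
proof -
  assume "t < K" "i < n"
  then have "K * i + t < K * Suc i" by simp
  also have "\<dots> \<le> K * n" using \<open>i < n\<close> by (intro mult_le_mono) auto
  finally show ?thesis .
qed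

lemma wadd_sl:
  assumes "holds (regs c) a x" "holds (regs c) b y" "a \<notin> {2..6}" "b \<notin> {2..6}" "u \<notin> {2..6}" "x + y < BIG"
  obtains g where "sl S Q (wadd u a b) c (c\<lparr>pc := pc c + length (wadd u a b), regs := g\<rparr>)"
    "holds g u (x + y)" "keeps (insert u {2..6}) (regs c) g"
  using that[OF sl_regonly] wadd[OF assms] by (auto simp: wadd_def add_body_def)

lemma wload_sl:
  assumes "holds (regs c) a x" "7 \<le> a" "7 \<le> u" "x < length xs" "seg_rep xs (segment_content S Q c sg)"
    "K * length xs < BIG"
  shows "\<exists>c'. sl S Q (wload sg u a) c c' \<and> holds (regs c') u (xs ! x) \<and> keeps (insert u {0..6}) (regs c) (regs c') \<and>
     work c' = work c \<and> reported c' = reported c"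
proof -
  let ?M = "segment_content S Q c sg"
  have b: "K * x + t < BIG" if "t \<le> K" for t
  proof -
    have "K * x + t \<le> K * Suc x" using that by simp
    also have "\<dots> \<le> K * length xs" using assms(4) by (intro mult_le_mono) auto
    finally show ?thesis using assms(6) by linarith
  qed
  have ro: "regonly (waddr a)"
    by (auto simp: waddr_def wset_def wzero_def wadd_def add_body_def)
  define c1 where "c1 = c\<lparr>pc := pc c + length (waddr a), regs := rrun (waddr a) (regs c)\<rparr>"
  have 1: "sl S Q (waddr a) c c1" unfolding c1_def by (rule sl_regonly[OF ro])
  have 2: "holds (regs c1) 0 (K * x)" "holds (regs c1) 1 1" "keeps {0..6} (regs c) (regs c1)"
    using waddr[OF assms(1,2)] b[of 0] by (auto simp: c1_def)
  have "n \<le> K \<Longrightarrow> \<exists>c'. sl S Q (concat (map (\<lambda>t. Load sg (slot K u t) (slots K 0) # wadd 0 0 1) [0..<n])) c1 c' \<and>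
     holds (regs c') 0 (K * x + n) \<and> holds (regs c') 1 1 \<and> keeps (insert u {0..6}) (regs c) (regs c') \<and>
     (\<forall>t<n. regs c' (slot K u t) = digit w (xs ! x) t) \<and>
     work c' = work c \<and> reported c' = reported c" for n
  proof (induction n)
    case 0
    then show ?case using 2 by (auto simp: c1_def keeps_def)
  next
    case (Suc n)
    then obtain c' where IH: "sl S Q (concat (map (\<lambda>t. Load sg (slot K u t) (slots K 0) # wadd 0 0 1) [0..<n])) c1 c'"
     "holds (regs c') 0 (K * x + n)" "holds (regs c') 1 1" "keeps (insert u {0..6}) (regs c) (regs c')"
     "\<And>t. t < n \<Longrightarrow> regs c' (slot K u t) = digit w (xs ! x) t"
     "work c' = work c" "reported c' = reported c" by (auto simp: Suc_le_eq)
    have nK: "n < K" using Suc.prems by simp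
    have M: "segment_content S Q c' sg = ?M" using IH(6) by (cases sg) auto
    have "K * x + n < length ?M" using assms(4,5) nK seg_index by (auto simp: seg_rep_def)
    moreover have "?M ! (K * x + n) = digit w (xs ! x) n" using assms(4,5) nK by (auto simp: seg_rep_def)
    ultimately have ld: "exec_instr w S Q (Load sg (slot K u n) (slots K 0)) c' = set_reg (slot K u n) (digit w (xs ! x) n) c'"
      by (simp add: wide_val_holds[OF IH(2)] M)
    define c2 where "c2 = set_reg (slot K u n) (digit w (xs ! x) n) c'"
    have k2: "keeps {u} (regs c') (regs c2)" using nK by (auto simp: c2_def set_reg_def keeps_def)
    have h2: "holds (regs c2) 0 (K * x + n)" "holds (regs c2) 1 1"
      using keeps_holds[OF k2] IH(2,3) assms(3) by auto
    obtain g where g: "sl S Q (wadd 0 0 1) c2 (c2\<lparr>pc := pc c2 + length (wadd 0 0 1), regs := g\<rparr>)"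
      "holds g 0 (K * x + n + 1)" "keeps (insert 0 {2..6}) (regs c2) g"
      using wadd_sl[OF h2, of 0 S Q] b[of "Suc n"] nK by auto
    have "sl S Q (concat (map (\<lambda>t. Load sg (slot K u t) (slots K 0) # wadd 0 0 1) [0..<Suc n])) c1
       (c2\<lparr>pc := pc c2 + length (wadd 0 0 1), regs := g\<rparr>)"
      using IH(1) ld g(1) by (auto simp: sl_append c2_def set_reg_def)
    moreover have "holds g 1 1" using keeps_holds[OF g(3) _ h2(2)] by simp
    moreover have "keeps (insert u {0..6}) (regs c) g"
      by (rule keeps_trans[OF IH(4)], rule keeps_trans[OF keeps_mono[OF k2] keeps_mono[OF g(3)]]) auto
    moreover have "g (slot K u t) = digit w (xs ! x) t" if "t < Suc n" for t
    proof -
      have "g (slot K u t) = regs c2 (slot K u t)"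
        using g(3) assms(3) that nK unfolding keeps_def by auto
      then show ?thesis using IH(5) that nK by (auto simp: c2_def set_reg_def less_Suc_eq)
    qed
    ultimately show ?case using g(2) IH(6,7) by (intro exI[of _ "c2\<lparr>pc := pc c2 + length (wadd 0 0 1), regs := g\<rparr>"])
        (auto simp: c2_def set_reg_def)
  qed
  from this[OF order.refl] show ?thesis
    using 1 assms(4,5) unfolding wload_def sl_append holds_def seg_rep_def by blast
qed

lemma wstore_sl:
  assumes "holds (regs c) a x" "holds (regs c) u y" "7 \<le> a" "7 \<le> u" "x < length W" "seg_rep W (work c)"
    "K * length W < BIG"
  shows "\<exists>c'. sl S Q (wstore a u) c c' \<and> keeps {0..6} (regs c) (regs c') \<and>
     seg_rep (W[x := y]) (work c') \<and> reported c' = reported c"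
proof -
  have b: "K * x + t < BIG" if "t \<le> K" for t
  proof -
    have "K * x + t \<le> K * Suc x" using that by simp
    also have "\<dots> \<le> K * length W" using assms(5) by (intro mult_le_mono) auto
    finally show ?thesis using assms(7) by linarith
  qed
  have ro: "regonly (waddr a)"
    by (auto simp: waddr_def wset_def wzero_def wadd_def add_body_def)
  define c1 where "c1 = c\<lparr>pc := pc c + length (waddr a), regs := rrun (waddr a) (regs c)\<rparr>"
  have 1: "sl S Q (waddr a) c c1" unfolding c1_def by (rule sl_regonly[OF ro])
  have 2: "holds (regs c1) 0 (K * x)" "holds (regs c1) 1 1" "keeps {0..6} (regs c) (regs c1)"
    using waddr[OF assms(1,3)] b[of 0] by (auto simp: c1_def)
  have lw: "length (work c) = K * length W" using assms(6) by (simp add: seg_rep_def)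
  have "n \<le> K \<Longrightarrow> \<exists>c'. sl S Q (concat (map (\<lambda>t. Store (slots K 0) (slot K u t) # wadd 0 0 1) [0..<n])) c1 c' \<and>
     holds (regs c') 0 (K * x + n) \<and> holds (regs c') 1 1 \<and> keeps {0..6} (regs c) (regs c') \<and>
     length (work c') = length (work c) \<and>
     (\<forall>t<n. work c' ! (K * x + t) = digit w y t) \<and>
     (\<forall>i. i < length (work c) \<longrightarrow> (i < K * x \<or> K * x + n \<le> i) \<longrightarrow> work c' ! i = work c ! i) \<and> reported c' = reported c" for n
  proof (induction n)
    case 0
    then show ?case using 2 by (auto simp: c1_def keeps_def)
  next
    case (Suc n)
    then obtain c' where IH: "sl S Q (concat (map (\<lambda>t. Store (slots K 0) (slot K u t) # wadd 0 0 1) [0..<n])) c1 c'"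
     "holds (regs c') 0 (K * x + n)" "holds (regs c') 1 1" "keeps {0..6} (regs c) (regs c')"
     "length (work c') = length (work c)"
     "\<And>t. t < n \<Longrightarrow> work c' ! (K * x + t) = digit w y t"
     "\<And>i. i < length (work c) \<Longrightarrow> (i < K * x \<or> K * x + n \<le> i) \<Longrightarrow> work c' ! i = work c ! i"
     "reported c' = reported c" by (auto simp: Suc_le_eq)
    have nK: "n < K" using Suc.prems by simp
    have lt: "K * x + n < length (work c)" using lw nK assms(5) seg_index by auto
    have hu: "holds (regs c') u y" using keeps_holds[OF IH(4) _ assms(2)] assms(4) by simp
    define c2 where "c2 = c'\<lparr>pc := Suc (pc c'), work := (work c')[K * x + n := digit w y n]\<rparr>"
    have st: "exec_instr w S Q (Store (slots K 0) (slot K u n)) c' = c2"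
      using lt hu nK by (simp add: wide_val_holds[OF IH(2)] IH(5) c2_def holds_def)
    have r2: "regs c2 = regs c'" by (simp add: c2_def)
    obtain g where g: "sl S Q (wadd 0 0 1) c2 (c2\<lparr>pc := pc c2 + length (wadd 0 0 1), regs := g\<rparr>)"
      "holds g 0 (K * x + n + 1)" "keeps (insert 0 {2..6}) (regs c2) g"
      using wadd_sl[of c2 0 "K * x + n" 1 1 0 S Q] IH(2,3) r2 b[of "Suc n"] nK by auto
    have "sl S Q (concat (map (\<lambda>t. Store (slots K 0) (slot K u t) # wadd 0 0 1) [0..<Suc n])) c1
       (c2\<lparr>pc := pc c2 + length (wadd 0 0 1), regs := g\<rparr>)"
      using IH(1) st g(1) by (auto simp: sl_append c2_def simp del: exec_instr.simps)
    moreover have "holds g 1 1" using keeps_holds[OF g(3), of 1 1] IH(3) r2 by simp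
    moreover have "keeps {0..6} (regs c) g"
      using keeps_trans[OF IH(4)] keeps_mono[OF g(3), of "{0..6}"] r2 by auto
    ultimately show ?case using g(2) IH(5-8) lt
      by (intro exI[of _ "c2\<lparr>pc := pc c2 + length (wadd 0 0 1), regs := g\<rparr>"])
        (auto simp: c2_def less_Suc_eq nth_list_update)
  qed
  from this[OF order.refl] obtain c' where c': "sl S Q (concat (map (\<lambda>t. Store (slots K 0) (slot K u t) # wadd 0 0 1) [0..<K])) c1 c'"
     "keeps {0..6} (regs c) (regs c')" "length (work c') = length (work c)"
     "\<And>t. t < K \<Longrightarrow> work c' ! (K * x + t) = digit w y t"
     "\<And>i. i < length (work c) \<Longrightarrow> (i < K * x \<or> K * x + K \<le> i) \<Longrightarrow> work c' ! i = work c ! i"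
     "reported c' = reported c" by blast
  have "work c' ! (K * i + t) = digit w (W[x := y] ! i) t" if "i < length W" "t < K" for i t
  proof (cases "i = x")
    case True
    then show ?thesis using c'(4) that assms(5) by simp
  next
    case False
    then have "K * i + t < K * x \<or> K * x + K \<le> K * i + t"
    proof (cases "i < x")
      case True then show ?thesis using seg_index[OF that(2)] by simp
    next
      case False
      then have "K * Suc x \<le> K * i" using \<open>i \<noteq> x\<close> by (intro mult_le_mono) auto
      then show ?thesis by simp
    qed
    then show ?thesis using c'(5) lw seg_index[OF that(2,1)] assms(6) that False by (simp add: seg_rep_def)
  qed
  then have "seg_rep (W[x := y]) (work c')" using assms(5,6) c'(3) holds_bound[OF assms(2)]
    by (auto simp: seg_rep_def nth_list_update)
  then show ?thesis using 1 c'(1,2,6) unfolding wstore_def sl_append by blast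
qed

lemma rel_keeps:
  assumes "rel (v, W, R) c" "keeps (insert (u + 7) {0..6}) (regs c) (regs c')" "holds (regs c') (u + 7) x"
    "work c' = work c" "reported c' = reported c"
  shows "rel (v(u := x), W, R) c'"
  using assms keeps_holds[OF assms(2)] by (auto simp: rel_def)

lemma rel_regs:
  assumes "rel (v, W, R) c" "regonly is"
    "holds (rrun is (regs c)) (u + 7) x \<and> keeps V (regs c) (rrun is (regs c))" "V \<subseteq> insert (u + 7) {0..6}"
  shows "\<exists>c'. sl S Q is c c' \<and> rel (v(u := x), W, R) c'"
  using sl_regonly[OF assms(2), of S Q c] rel_keeps[OF assms(1) keeps_mono[OF _ assms(4)]] assms(3)
  by fastforce

lemma regonly_codes [simp]: "regonly (wzero u)" "regonly (wcopy u a)" "regonly (wxor u a b)" "regonly (wadd u a b)"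
  "regonly (wless u a b)" "regonly (wselect u f a b)" "regonly is \<Longrightarrow> regonly (wset u is)"
  by (auto simp: wzero_def wcopy_def wxor_def wadd_def wless_def wselect_def wset_def add_body_def less_body_def sel_body_def)

lemma binop_val_less: "x < B \<Longrightarrow> y < B \<Longrightarrow> binop_val w f x y < B"
proof (cases f)
  case Div
  assume "x < B" then show ?thesis using Div by (simp add: le_less_trans[OF div_le_dividend])
next
  case Mod
  assume "x < B" then show ?thesis using Mod by (simp add: le_less_trans[OF mod_less_eq_dividend])
next
  case Shr
  assume "x < B" then show ?thesis using Shr by (simp add: drop_bit_eq_div le_less_trans[OF div_le_dividend])
next
  case And
  assume "x < B" "y < B" then show ?thesis using And by (metis binop_val.simps(6) take_bit_and take_bit_nat_eq_self_iff)
next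
  case Or
  assume "x < B" "y < B" then show ?thesis using Or by (metis binop_val.simps(7) take_bit_or take_bit_nat_eq_self_iff)
next
  case Xor
  assume "x < B" "y < B" then show ?thesis using Xor by (metis binop_val.simps(8) take_bit_xor take_bit_nat_eq_self_iff)
qed auto

lemma vstep_sim:
  assumes "vstep x s = Some s'" "rel s c" "seg_rep SC S" "K * length SC < BIG" "\<forall>q\<in>set QW. q < B"
  shows "\<exists>c'. sl S QW (opcode x) c c' \<and> rel s' c'"
proof -
  obtain v W R where s: "s = (v, W, R)" by (cases s)
  note r = assms(2)[unfolded s]
  have h: "holds (regs c) (u + 7) (v u)" for u using r by (simp add: rel_def)
  have ni: "u + 7 \<notin> {2..6}" for u :: nat by simp
  have sub: "{2..6} \<subseteq> insert (z :: nat) {0..6}" for z by auto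
  show ?thesis
  proof (cases x)
    case (VZero u)
    then show ?thesis using rel_regs[OF r _ wzero] assms(1) s by auto
  next
    case (VOne u)
    have "holds (rrun (wset (u + 7) [Const (slot K (u + 7) 0) 1]) (regs c)) (u + 7) 1 \<and>
      keeps {u + 7} (regs c) (rrun (wset (u + 7) [Const (slot K (u + 7) 0) 1]) (regs c))"
      by (rule wset) (auto simp: keeps_def)
    from rel_regs[OF r _ this] show ?thesis using VOne assms(1) s by auto
  next
    case (VCopy u a)
    then show ?thesis using rel_regs[OF r _ wcopy[OF h]] assms(1) s by auto
  next
    case (VAdd u a b)
    then have lt: "v a + v b < BIG" using assms(1) s by (auto split: if_splits)
    show ?thesis using rel_regs[OF r _ wadd[OF h h ni ni ni lt]] VAdd lt assms(1) s sub by auto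
  next
    case (VXor u a b)
    then show ?thesis using rel_regs[OF r _ wxor[OF h h]] assms(1) s by auto
  next
    case (VLess u a b)
    then have s': "s' = (v(u := of_bool (v a < v b)), W, R)" using assms(1) s by simp
    show ?thesis unfolding s' VLess opcode.simps
      by (rule rel_regs[OF r _ wless[OF h[of a] h[of b] ni ni, of "u + 7"]]) (use sub in auto)
  next
    case (VSelect u f a b)
    then have lt: "v f \<le> 1" using assms(1) s by (auto split: if_splits)
    have s': "s' = (v(u := if v f = 1 then v a else v b), W, R)" using VSelect lt assms(1) s by simp
    show ?thesis unfolding s' VSelect opcode.simps
      by (rule rel_regs[OF r _ wselect[OF h[of f] lt h[of a] h[of b] ni ni ni, of u]]) (use sub in auto)
  next
    case (VBin f u a b)
    then have lt: "v a < B" "v b < B" using assms(1) s by (auto split: if_splits)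
    have "holds (rrun (wset (u + 7) [Bin f (slot K (u + 7) 0) (slot K (a + 7) 0) (slot K (b + 7) 0)]) (regs c)) (u + 7) (binop_val w f (v a) (v b)) \<and>
      keeps {u + 7} (regs c) (rrun (wset (u + 7) [Bin f (slot K (u + 7) 0) (slot K (a + 7) 0) (slot K (b + 7) 0)]) (regs c))"
      by (rule wset) (auto simp: keeps_def holds_low[OF h] lt intro!: binop_val_less)
    from rel_regs[OF r _ this] show ?thesis using VBin assms(1) s lt by auto
  next
    case (VLoad u a)
    then have lt: "v a < length SC" using assms(1) s by (auto split: if_splits)
    obtain c' where c': "sl S QW (wload Static (u + 7) (a + 7)) c c'" "holds (regs c') (u + 7) (SC ! v a)"
      "keeps (insert (u + 7) {0..6}) (regs c) (regs c')" "work c' = work c" "reported c' = reported c"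
      using wload_sl[where S = S and Q = QW and sg = Static and u = "u + 7", OF h[of a] _ _ lt] assms(3,4) by auto
    from rel_keeps[OF r c'(3,2,4,5)] show ?thesis using c'(1) VLoad lt assms(1) s by auto
  next
    case (VLoadW u a)
    then have lt: "v a < length W" using assms(1) s by (auto split: if_splits)
    obtain c' where c': "sl S QW (wload Work (u + 7) (a + 7)) c c'" "holds (regs c') (u + 7) (W ! v a)"
      "keeps (insert (u + 7) {0..6}) (regs c) (regs c')" "work c' = work c" "reported c' = reported c"
      using wload_sl[where S = S and Q = QW and sg = Work and u = "u + 7", OF h[of a] _ _ lt] r by (auto simp: rel_def)
    from rel_keeps[OF r c'(3,2,4,5)] show ?thesis using c'(1) VLoadW lt assms(1) s by auto
  next
    case (VStoreW a u)
    then have lt: "v a < length W" using assms(1) s by (auto split: if_splits)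
    obtain c' where c': "sl S QW (wstore (a + 7) (u + 7)) c c'" "keeps {0..6} (regs c) (regs c')"
     "seg_rep (W[v a := v u]) (work c')" "reported c' = reported c"
      using wstore_sl[where S = S and Q = QW, OF h[of a] h[of u] _ _ lt] r by (auto simp: rel_def)
    have "rel (v, W[v a := v u], R) c'" using r c' keeps_holds[OF c'(2)] by (auto simp: rel_def)
    then show ?thesis using c'(1) VStoreW lt assms(1) s by auto
  next
    case (VQuery u a)
    then have lt: "v a < length QW" using assms(1) s by (auto split: if_splits)
    let ?x = "QW ! v a"
    have xB: "?x < B" using assms(5) lt by simp
    let ?c1 = "set_reg (slot K (u + 7) 0) ?x c"
    have 1: "exec_instr w S QW (Load Query (slot K (u + 7) 0) (slots K (a + 7))) c = ?c1"
      using lt by (simp add: wide_val_holds[OF h])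
    let ?is = "map (\<lambda>t. Const (slot K (u + 7) t) 0) [1..<K]"
    let ?c2 = "?c1\<lparr>pc := pc ?c1 + length ?is, regs := rrun ?is (regs ?c1)\<rparr>"
    have 2: "sl S QW ?is ?c1 ?c2" by (rule sl_regonly) simp
    have e: "regs ?c2 = (\<lambda>r. if \<exists>t\<ge>1. t < K \<and> r = slot K (u + 7) t then 0 else regs ?c1 r)"
      using wzero_upper[of 1 K "u + 7" "regs ?c1"] by simp
    have hu: "holds (regs ?c2) (u + 7) ?x"
      unfolding e by (rule holds_small[OF xB]) (auto simp: set_reg_def)
    have ku: "keeps (insert (u + 7) {0..6}) (regs c) (regs ?c2)"
      unfolding e by (auto simp: keeps_def set_reg_def)
    have "rel (v(u := ?x), W, R) ?c2"
      by (rule rel_keeps[OF r ku hu]) (auto simp: set_reg_def)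
    moreover have "sl S QW (opcode x) c ?c2"
      using 1 2 VQuery by (simp add: wset_def set_reg_def del: exec_instr.simps)
    ultimately show ?thesis using VQuery lt assms(1) s by auto
  next
    case (VReport a)
    then show ?thesis using r assms(1) s by (auto simp: rel_def wide_val_holds[OF h])
  qed
qed

lemma vsteps_sim:
  assumes "vsteps xs s = Some s'" "rel s c" "seg_rep SC S" "K * length SC < BIG" "\<forall>q\<in>set QW. q < B"
  shows "\<exists>c'. sl S QW (concat (map opcode xs)) c c' \<and> rel s' c'"
  using assms(1,2)
proof (induction xs arbitrary: s c)
  case Nil
  then show ?case by auto
next
  case (Cons x xs)
  then obtain s1 where s1: "vstep x s = Some s1" "vsteps xs s1 = Some s'" by (auto split: option.splits)
  obtain c1 where c1: "sl S QW (opcode x) c c1" "rel s1 c1" using vstep_sim[OF s1(1) Cons.prems(2) assms(3-5)] by blast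
  show ?case using Cons.IH[OF s1(2) c1(2)] c1(1) by (auto simp: sl_append)
qed

text \<open>Quadratic in \<open>K\<close>: an access multiplies the cell number by \<open>K\<close>
  and then advances a wide address \<open>K\<close> times, each time by an addition over
  \<open>K\<close> digits.\<close>

definition opmax :: nat where
  "opmax = 40 * Suc K * Suc K"

lemma length_opcode: "length (opcode x) \<le> opmax"
proof -
  have l: "length (concat (map f [0..<n])) = n * q" if "\<And>t. length (f t) = q" for f :: "nat \<Rightarrow> instr list" and n q
    using that by (induction n) auto
  have l2: "length (concat (replicate n xs)) = n * length xs" for n and xs :: "instr list" by (induction n) auto
  have a: "length (wadd u a b) = 5 * K + 1" for u a b
    unfolding wadd_def using l[of "add_body u a b" 5] by (simp add: add_body_def)
  have b: "length (wless u a b) \<le> 5 * K + 2" for u a b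
    unfolding wless_def wset_def using l[of "less_body a b" 4] by (simp add: less_body_def)
  have s: "length (wselect u f a b) = 3 * K + 1" for u f a b
    unfolding wselect_def using l[of "sel_body u a b" 3] by (simp add: sel_body_def)
  have d: "length (waddr u) \<le> 2 * K + 1 + K * (5 * K + 1)" for u
    unfolding waddr_def by (simp add: l2 a wset_def wzero_def)
  have e: "length (wload sg u v) \<le> 2 * K + 1 + K * (5 * K + 1) + K * (5 * K + 2)" for sg u v
    unfolding wload_def using d[of v] l[of "\<lambda>t. Load sg (slot K u t) (slots K 0) # wadd 0 0 1" "5 * K + 2" K]
    by (simp add: a)
  have f: "length (wstore v u) \<le> 2 * K + 1 + K * (5 * K + 1) + K * (5 * K + 2)" for u v
    unfolding wstore_def using d[of v] l[of "\<lambda>t. Store (slots K 0) (slot K u t) # wadd 0 0 1" "5 * K + 2" K]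
    by (simp add: a)
  have z: "opmax = 40 + 80 * K + 40 * (K * K)" by (simp add: opmax_def algebra_simps)
  show ?thesis
  proof (cases x)
    case (VLoad u a) then show ?thesis using e[of Static "u + 7" "a + 7"] unfolding z by (simp add: algebra_simps)
  next
    case (VLoadW u a) then show ?thesis using e[of Work "u + 7" "a + 7"] unfolding z by (simp add: algebra_simps)
  next
    case (VStoreW a u) then show ?thesis using f[of "a + 7" "u + 7"] unfolding z by (simp add: algebra_simps)
  next
    case (VLess u a b') then show ?thesis using b[of "u + 7" "a + 7" "b' + 7"] unfolding z by simp
  qed (auto simp: z a s wzero_def wset_def wcopy_def wxor_def)
qed

text \<open>Jump targets are absolute, hence the start address \<open>p\<close>. An unconditional
  jump is a test of a register that has just been set to zero.\<close>

fun comp :: "cmd \<Rightarrow> nat \<Rightarrow> instr list" where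
  "comp (Ops xs) p = concat (map opcode xs)"
| "comp (a ;; b) p = comp a p @ comp b (p + length (comp a p))"
| "comp (If v a b) p =
    (let ca = comp a (Suc p); q = Suc p + length ca + 2; cb = comp b q
     in [Jump_If_Zero (slot K (v + 7) 0) q] @ ca @ [Const r1 0, Jump_If_Zero r1 (q + length cb)] @ cb)"
| "comp (While v a) p =
    (let ca = comp a (Suc p)
     in [Jump_If_Zero (slot K (v + 7) 0) (Suc p + length ca + 2)] @ ca @ [Const r1 0, Jump_If_Zero r1 p])"

lemma rel_r1: "rel s c \<Longrightarrow> rel s (c\<lparr>pc := p, regs := (regs c)(r1 := z)\<rparr>)"
  by (cases s) (auto simp: rel_def holds_def)

lemma rel_pc: "rel s c \<Longrightarrow> rel s (c\<lparr>pc := p\<rparr>)"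
  by (cases s) (auto simp: rel_def)

lemma rel_low: "rel s c \<Longrightarrow> fst s v < B \<Longrightarrow> regs c (slot K (v + 7) 0) = fst s v"
  by (cases s) (auto simp: rel_def intro: holds_low)

lemma opmax_ge: "40 \<le> opmax"
  by (simp add: opmax_def)

text \<open>A branch or an iteration adds at most three instructions to those of its body.
  \<open>opmax\<close> is at least 40, so the one tick that \<open>run\<close> charges for it covers
  them.\<close>

lemma run_sim:
  assumes "run a s t s'" "rel s c" "code_at prog (pc c) (comp a (pc c))"
    "seg_rep SC S" "K * length SC < BIG" "\<forall>q\<in>set QW. q < B"
  shows "\<exists>T\<le>opmax * t. \<exists>c'. (step w prog S QW ^^ T) c = c' \<and> rel s' c' \<and> pc c' = pc c + length (comp a (pc c))"
  using assms(1-3)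
proof (induction arbitrary: c rule: run.induct)
  case (run_Ops xs s s')
  obtain c' where c': "sl S QW (concat (map opcode xs)) c c'" "rel s' c'"
    using vsteps_sim[OF run_Ops(1,2) assms(4-6)] by blast
  have "length (concat (map opcode xs)) \<le> opmax * length xs"
    using length_opcode by (induction xs) (auto intro: add_mono)
  then show ?case using sl_steps[OF c'(1), of prog] c'(2) run_Ops(3) by auto
next
  case (run_Seq a s t s' b t' s'')
  let ?ca = "comp a (pc c)"
  from run_Seq obtain T c' where 1: "T \<le> opmax * t" "(step w prog S QW ^^ T) c = c'" "rel s' c'" "pc c' = pc c + length ?ca"
    by fastforce
  from run_Seq.IH(2)[OF 1(3)] run_Seq.prems(2) 1(4) obtain T' c'' where
    2: "T' \<le> opmax * t'" "(step w prog S QW ^^ T') c' = c''" "rel s'' c''" "pc c'' = pc c' + length (comp b (pc c'))"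
    by auto
  have "(step w prog S QW ^^ (T + T')) c = c''" using 1(2) 2(2) by (simp add: funpow_add_apply)
  moreover have "T + T' \<le> opmax * (t + t')" using 1(1) 2(1) by (simp add: algebra_simps)
  ultimately show ?case using 2(3,4) 1(4) by auto
next
  case (run_IfT s v a t s' b)
  let ?ca = "comp a (Suc (pc c))"
  let ?q = "Suc (pc c) + length ?ca + 2"
  let ?cb = "comp b ?q"
  have code: "code_at prog (pc c) ([Jump_If_Zero (slot K (v + 7) 0) ?q] @ ?ca @ [Const r1 0, Jump_If_Zero r1 (?q + length ?cb)] @ ?cb)"
    using run_IfT.prems(2) by (simp add: Let_def)
  have s1: "step w prog S QW c = c\<lparr>pc := Suc (pc c)\<rparr>"
    using code rel_low[OF run_IfT.prems(1) run_IfT.hyps(2)] run_IfT.hyps(1) by (simp add: step_def code_at_Cons)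
  obtain T c' where 1: "T \<le> opmax * t" "(step w prog S QW ^^ T) (c\<lparr>pc := Suc (pc c)\<rparr>) = c'" "rel s' c'" "pc c' = Suc (pc c) + length ?ca"
    using run_IfT.IH[OF rel_pc[OF run_IfT.prems(1)], of "Suc (pc c)"] code by (auto simp: code_at_Cons)
  let ?c2 = "c'\<lparr>pc := ?q + length ?cb, regs := (regs c')(r1 := 0)\<rparr>"
  have s2: "(step w prog S QW ^^ 2) c' = ?c2"
    using code 1(4) by (simp add: step_def code_at_Cons numeral_2_eq_2 set_reg_def)
  have "(step w prog S QW ^^ (1 + T + 2)) c = ?c2"
    using s1 1(2) s2 by (simp only: funpow_add_apply) simp
  moreover have "1 + T + 2 \<le> opmax * Suc t" using 1(1) opmax_ge by simp
  moreover have "rel s' ?c2" using rel_r1[OF 1(3)] .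
  ultimately show ?case by (intro exI[of _ "1 + T + 2"] conjI exI[of _ ?c2]) (auto simp: Let_def)
next
  case (run_IfF s v b t s' a)
  let ?ca = "comp a (Suc (pc c))"
  let ?q = "Suc (pc c) + length ?ca + 2"
  let ?cb = "comp b ?q"
  have code: "code_at prog (pc c) ([Jump_If_Zero (slot K (v + 7) 0) ?q] @ ?ca @ [Const r1 0, Jump_If_Zero r1 (?q + length ?cb)] @ ?cb)"
    using run_IfF.prems(2) by (simp add: Let_def)
  have s1: "step w prog S QW c = c\<lparr>pc := ?q\<rparr>"
    using code rel_low[OF run_IfF.prems(1), of v] run_IfF.hyps(1) by (simp add: step_def code_at_Cons)
  obtain T c' where 1: "T \<le> opmax * t" "(step w prog S QW ^^ T) (c\<lparr>pc := ?q\<rparr>) = c'" "rel s' c'" "pc c' = ?q + length ?cb"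
    using run_IfF.IH[OF rel_pc[OF run_IfF.prems(1)], of ?q] code by (auto simp: code_at_Cons)
  have "(step w prog S QW ^^ (1 + T)) c = c'"
    using s1 1(2) by (simp only: funpow_add_apply) simp
  moreover have "1 + T \<le> opmax * Suc t" using 1(1) opmax_ge by simp
  ultimately show ?case using 1(3,4) by (intro exI[of _ "1 + T"] conjI exI[of _ c']) (auto simp: Let_def)
next
  case (run_WhileT s v a t s' t' s'')
  let ?ca = "comp a (Suc (pc c))"
  let ?q = "Suc (pc c) + length ?ca + 2"
  have code: "code_at prog (pc c) ([Jump_If_Zero (slot K (v + 7) 0) ?q] @ ?ca @ [Const r1 0, Jump_If_Zero r1 (pc c)])"
    using run_WhileT.prems(2) by (simp add: Let_def)
  have s1: "step w prog S QW c = c\<lparr>pc := Suc (pc c)\<rparr>"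
    using code rel_low[OF run_WhileT.prems(1) run_WhileT.hyps(2)] run_WhileT.hyps(1) by (simp add: step_def code_at_Cons)
  obtain T c' where 1: "T \<le> opmax * t" "(step w prog S QW ^^ T) (c\<lparr>pc := Suc (pc c)\<rparr>) = c'" "rel s' c'" "pc c' = Suc (pc c) + length ?ca"
    using run_WhileT.IH(1)[OF rel_pc[OF run_WhileT.prems(1)], of "Suc (pc c)"] code by (auto simp: code_at_Cons)
  let ?c2 = "c'\<lparr>pc := pc c, regs := (regs c')(r1 := 0)\<rparr>"
  have s2: "(step w prog S QW ^^ 2) c' = ?c2"
    using code 1(4) by (simp add: step_def code_at_Cons numeral_2_eq_2 set_reg_def)
  obtain T' c'' where 3: "T' \<le> opmax * t'" "(step w prog S QW ^^ T') ?c2 = c''" "rel s'' c''"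
     "pc c'' = pc c + length (comp (While v a) (pc c))"
    using run_WhileT.IH(2)[OF rel_r1[where p = "pc c" and z = 0, OF 1(3)]] run_WhileT.prems(2) by auto
  have "(step w prog S QW ^^ (1 + T + 2 + T')) c = c''"
    using s1 1(2) s2 3(2) by (simp only: funpow_add_apply) simp
  moreover have "1 + T + 2 + T' \<le> opmax * Suc (t + t')" using 1(1) 3(1) opmax_ge by (simp add: algebra_simps)
  ultimately show ?case using 3(3,4) by blast
next
  case (run_WhileF s v a)
  let ?ca = "comp a (Suc (pc c))"
  let ?q = "Suc (pc c) + length ?ca + 2"
  have code: "code_at prog (pc c) ([Jump_If_Zero (slot K (v + 7) 0) ?q] @ ?ca @ [Const r1 0, Jump_If_Zero r1 (pc c)])"
    using run_WhileF.prems(2) by (simp add: Let_def)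
  have s1: "step w prog S QW c = c\<lparr>pc := ?q\<rparr>"
    using code rel_low[OF run_WhileF.prems(1), of v] run_WhileF.hyps(1) by (simp add: step_def code_at_Cons)
  show ?case
    using s1 rel_pc[OF run_WhileF.prems(1), of ?q] opmax_ge
    by (intro exI[of _ 1] conjI exI[of _ "c\<lparr>pc := ?q\<rparr>"]) (auto simp: Let_def)
qed

theorem run_reports:
  assumes "run a (\<lambda>_. 0, replicate n 0, []) t (v, W, xs)" "\<forall>x\<in>set SC. x < BIG"
    "K * length SC < BIG" "K * n < BIG" "\<forall>q\<in>set QW. q < B"
  shows "\<exists>T\<le>opmax * t. reports_within w (comp a 0 @ [Halt])
    (map (\<lambda>i. digit w (SC ! (i div K)) (i mod K)) [0..<K * length SC]) (K * n) QW T xs"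
proof -
  let ?S = "map (\<lambda>i. digit w (SC ! (i div K)) (i mod K)) [0..<K * length SC]"
  let ?c = "init_config (K * n)"
  have S: "seg_rep SC ?S" using assms(2) seg_index by (auto simp: seg_rep_def)
  have r: "rel (\<lambda>_. 0, replicate n 0, []) ?c"
    using assms(4) seg_index by (auto simp: rel_def holds_def init_config_def seg_rep_def)
  have p: "pc ?c = 0" by (simp add: init_config_def)
  have "code_at (comp a 0 @ [Halt]) (pc ?c) (comp a (pc ?c))"
    by (auto simp: code_at_def nth_append p)
  from run_sim[OF assms(1) r this S assms(3,5)] obtain T c' where
    c': "T \<le> opmax * t" "(step w (comp a 0 @ [Halt]) ?S QW ^^ T) ?c = c'" "rel (v, W, xs) c'" "pc c' = length (comp a 0)"
    by (auto simp: p)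
  then show ?thesis
    by (intro exI[of _ T]) (auto simp: reports_within_def Let_def halted_def rel_def)
qed

end

subsection \<open>Letters in words\<close>

text \<open>Subtracting one flips the lowest set bit and the zeros below it and nothing else. The
  induction removes trailing zeros by halving.\<close>

lemma low_bit:
  fixes x :: nat
  assumes "x \<noteq> 0"
  obtains i where "bit x i" "\<forall>k<i. \<not> bit x k" "Bit_Operations.xor x (x - 1) = 2 * 2 ^ i - 1"
proof -
  have "\<exists>i. bit x i \<and> (\<forall>k<i. \<not> bit x k) \<and> Bit_Operations.xor x (x - 1) = 2 * 2 ^ i - 1"
    using assms
  proof (induction x rule: less_induct)
    case (less x)
    show ?case
    proof (cases "odd x")
      case True
      then obtain y where y: "x = 2 * y + 1" by (elim oddE)
      have "Bit_Operations.xor x (x - 1) = of_bool (odd x \<noteq> odd (x - 1)) + 2 * Bit_Operations.xor (x div 2) ((x - 1) div 2)"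
        by (rule xor_rec)
      then have "Bit_Operations.xor x (x - 1) = 1" by (simp add: y)
      then show ?thesis using True by (intro exI[of _ 0]) (simp add: bit_0)
    next
      case False
      then obtain y where y: "x = 2 * y" by auto
      then have "y < x" "y \<noteq> 0" using less.prems by auto
      then obtain i where i: "bit y i" "\<forall>k<i. \<not> bit y k" "Bit_Operations.xor y (y - 1) = 2 * 2 ^ i - 1"
        using less.IH by blast
      have d: "(x - 1) div 2 = y - 1" "odd (x - 1)" "even x" using y \<open>y \<noteq> 0\<close> by (cases y; simp)+
      have "Bit_Operations.xor x (x - 1) = of_bool (odd x \<noteq> odd (x - 1)) + 2 * Bit_Operations.xor (x div 2) ((x - 1) div 2)"
        by (rule xor_rec)
      then have "Bit_Operations.xor x (x - 1) = 1 + 2 * (2 * 2 ^ i - 1)" using d y i(3) by simp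
      also have "\<dots> = 2 * 2 ^ Suc i - 1"
      proof -
        have "(1::nat) \<le> 2 ^ i" by simp
        then show ?thesis unfolding power_Suc by arith
      qed
      finally have e: "Bit_Operations.xor x (x - 1) = 2 * 2 ^ Suc i - 1" .
      have b: "bit x (Suc k) = bit y k" for k using y by (simp add: bit_Suc)
      have "\<not> bit x k" if "k < Suc i" for k
        using that i(2) b d(3) by (cases k) (auto simp: bit_0)
      then show ?thesis using e i(1) b by blast
    qed
  qed
  then show thesis using that by blast
qed

definition fld :: "nat \<Rightarrow> nat \<Rightarrow> nat \<Rightarrow> nat" where
  "fld lb a c = take_bit lb (drop_bit (lb * c) a)"

lemma bit_fld: "bit (fld lb a c) k \<longleftrightarrow> k < lb \<and> bit a (lb * c + k)"
  by (simp add: fld_def bit_take_bit_iff bit_drop_bit_eq)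

lemma fld_less: "fld lb a c < 2 ^ lb"
  by (simp add: fld_def)

lemma bit_less_exp: "a < 2 ^ m \<Longrightarrow> bit a k \<Longrightarrow> k < m" for a :: nat
  by (metis bit_take_bit_iff take_bit_nat_eq_self_iff)

text \<open>After the shift by whole fields, the lowest set bit of the xor lies in the first field
  from \<open>c\<close> on in which the words differ, and \<open>i div lb\<close> counts the fields
  before it.\<close>

lemma fld_first:
  assumes "bit x i" "\<forall>k<i. \<not> bit x k" "x = drop_bit (c * lb) (Bit_Operations.xor a b)" "0 < lb"
    "a < 2 ^ (n * lb)" "b < 2 ^ (n * lb)"
  shows "c + i div lb < n" "fld lb a (c + i div lb) \<noteq> fld lb b (c + i div lb)"
    "\<And>c'. c \<le> c' \<Longrightarrow> c' < c + i div lb \<Longrightarrow> fld lb a c' = fld lb b c'"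
    "i < n * lb"
proof -
  have bx: "bit x k \<longleftrightarrow> bit a (c * lb + k) \<noteq> bit b (c * lb + k)" for k
    using assms(3) by (simp add: bit_drop_bit_eq bit_xor_iff)
  have pos: "c * lb + i = lb * (c + i div lb) + i mod lb" by (simp add: algebra_simps)
  have "bit a (c * lb + i) \<or> bit b (c * lb + i)" using bx[of i] assms(1) by auto
  then have lt: "c * lb + i < n * lb" using bit_less_exp[OF assms(5)] bit_less_exp[OF assms(6)] by blast
  then show "i < n * lb" by simp
  from lt have "lb * (c + i div lb) < lb * n" unfolding pos by (metis add_lessD1 mult.commute)
  then show "c + i div lb < n" by simp
  have "bit (fld lb a (c + i div lb)) (i mod lb) \<noteq> bit (fld lb b (c + i div lb)) (i mod lb)"
    using bx[of i] assms(1,4) unfolding bit_fld pos by simp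
  then show "fld lb a (c + i div lb) \<noteq> fld lb b (c + i div lb)" by auto
  show "fld lb a c' = fld lb b c'" if "c \<le> c'" "c' < c + i div lb" for c'
  proof (rule bit_eqI)
    fix k
    have "bit a (lb * c' + k) = bit b (lb * c' + k)" if k: "k < lb"
    proof -
      let ?k = "(c' - c) * lb + k"
      have "?k < (c' - c + 1) * lb" using k by simp
      also have "\<dots> \<le> i div lb * lb" using \<open>c' < c + i div lb\<close> \<open>c \<le> c'\<close> by (intro mult_le_mono1) linarith
      also have "\<dots> \<le> i" by simp
      finally have "\<not> bit x ?k" using assms(2) by blast
      moreover have "c * lb + ?k = lb * c' + k" using \<open>c \<le> c'\<close>
        by (metis (no_types, lifting) add.assoc add_mult_distrib le_add_diff_inverse mult.commute)
      ultimately show ?thesis using bx[of ?k] by simp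
    qed
    then show "bit (fld lb a c') k = bit (fld lb b c') k" by (auto simp: bit_fld)
  qed
qed

lemma fld_same:
  assumes "drop_bit (c * lb) (Bit_Operations.xor a b) = 0" "c \<le> c'"
  shows "fld lb a c' = fld lb b c'"
proof (rule bit_eqI)
  fix k
  have "bit a (lb * c' + k) = bit b (lb * c' + k)"
  proof -
    let ?k = "(c' - c) * lb + k"
    have "\<not> bit (drop_bit (c * lb) (Bit_Operations.xor a b)) ?k" using assms(1) by simp
    moreover have "c * lb + ?k = lb * c' + k" using assms(2)
      by (metis (no_types, lifting) add.assoc add_mult_distrib le_add_diff_inverse mult.commute)
    ultimately show ?thesis by (simp add: bit_drop_bit_eq bit_xor_iff)
  qed
  then show "bit (fld lb a c') k = bit (fld lb b c') k" by (auto simp: bit_fld)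
qed

text \<open>A table of words is read as one string, \<open>n\<close> letters to a word.\<close>
definition ltr :: "nat \<Rightarrow> nat \<Rightarrow> (nat \<Rightarrow> nat) \<Rightarrow> nat \<Rightarrow> nat" where
  "ltr lb n W y = fld lb (W (y div n)) (y mod n)"

lemma ltr_less: "ltr lb n W y < 2 ^ lb"
  by (simp add: ltr_def fld_less)

lemma ltr_at: "c < n \<Longrightarrow> ltr lb n W (q * n + c) = fld lb (W q) c"
  by (simp add: ltr_def)

subsection \<open>The query program\<close>

text \<open>
  A position is kept as \<open>q * rec\<close> for the word \<open>q\<close> and a bit offset in this word, so that rows of
  records of size \<open>rec\<close> are accessed without multiplication. Variables from 20 on are temporary.
\<close>
abbreviation (input) "xONE \<equiv> 0 :: nat"
abbreviation (input) "xZERO \<equiv> 13 :: nat"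
abbreviation (input) "xKMAX \<equiv> 2 :: nat"
abbreviation (input) "xREC \<equiv> 3 :: nat"
abbreviation (input) "xQHAT \<equiv> 4 :: nat"
abbreviation (input) "xMSB \<equiv> 5 :: nat"
abbreviation (input) "xPMOD \<equiv> 6 :: nat"
abbreviation (input) "xLOWT \<equiv> 7 :: nat"
abbreviation (input) "xLB \<equiv> 8 :: nat"
abbreviation (input) "xSBASE \<equiv> 9 :: nat"
abbreviation (input) "xROOT \<equiv> 10 :: nat"
abbreviation (input) "xANCH \<equiv> 11 :: nat"
abbreviation (input) "xFIVE \<equiv> 12 :: nat"

text \<open>Common prefix of two suffixes: the xor of their ranks is looked up to get a level of the
  sparse table, and the smaller of the two entries of this level, kept behind word and rank in the
  records, is the result, already scaled by the record length.\<close>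

definition lcp_ops :: "nat \<Rightarrow> nat \<Rightarrow> nat \<Rightarrow> vop list" where
  "lcp_ops a b x =
    [VAdd 60 a x, VAdd 60 60 xONE, VLoad 61 60, VAdd 62 b x, VAdd 62 62 xONE, VLoad 63 62,
     VXor 64 61 63, VAdd 64 64 xMSB, VLoad 64 64,
     VAdd 60 60 xONE, VAdd 60 60 64, VLoad 60 60, VAdd 62 62 xONE, VAdd 62 62 64, VLoad 62 62,
     VLess 64 60 62, VSelect 65 64 60 62]"

text \<open>One step from the current word to the first word that differs from the query or leaves the phrase.\<close>
definition iter :: cmd where
  "iter =
    Ops [VAdd 52 50 xONE, VLoadW 53 52, VAdd 52 52 xONE, VLoadW 54 52] ;;
    Ops (lcp_ops 53 30 50) ;;
    Ops [VLess 55 65 54, VSelect 50 55 65 54, VAdd 55 30 50, VLoad 55 55, VLoadW 56 50, VXor 55 55 56] ;;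
    Ops [VLess 57 xZERO 55, VSelect 56 57 xZERO xREC, VAdd 50 50 56, VSelect 51 57 xZERO xONE]"

text \<open>
  For the lowest bit \<open>i\<close> of \<open>y\<close>, \<open>y xor (y - 1) = 2 * 2 ^ i - 1\<close>, whose residue modulo \<open>pm\<close>
  determines \<open>i\<close>.
\<close>
definition firstmis :: cmd where
  "firstmis =
    Ops [VAdd 41 30 31, VLoad 41 41, VLoadW 42 31, VXor 41 41 42, VBin Shr 41 41 32, VCopy 50 31, VCopy 40 32] ;;
    If 41 (Ops [])
      (Ops [VAdd 50 50 xREC, VZero 40] ;; iter ;; If 51 iter (Ops []) ;;
       Ops [VAdd 41 30 50, VLoad 41 41, VLoadW 42 50, VXor 41 41 42]) ;;
    Ops [VBin Sub 42 41 xONE, VXor 41 41 42, VBin Mod 41 41 xPMOD, VAdd 41 41 xLOWT, VLoad 41 41, VAdd 40 40 41]"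

context vm
begin

text \<open>A total correctness triple with time budget \<open>t\<close>.\<close>

definition runs :: "cmd \<Rightarrow> vstate \<Rightarrow> nat \<Rightarrow> (vstate \<Rightarrow> bool) \<Rightarrow> bool" where
  "runs c s t Q \<longleftrightarrow> (\<exists>t' s'. t' \<le> t \<and> run c s t' s' \<and> Q s')"

lemma runs_Ops: "vsteps xs s = Some s' \<Longrightarrow> Q s' \<Longrightarrow> length xs \<le> t \<Longrightarrow> runs (Ops xs) s t Q"
  unfolding runs_def using run_Ops by blast

lemma runs_Seq:
  assumes "runs a s t1 (\<lambda>s'. runs b s' t2 Q)" "t1 + t2 \<le> t"
  shows "runs (a ;; b) s t Q"
proof -
  obtain u1 u2 s1 s2 where "u1 \<le> t1" "run a s u1 s1" "u2 \<le> t2" "run b s1 u2 s2" "Q s2"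
    using assms(1) unfolding runs_def by blast
  then show ?thesis unfolding runs_def using run_Seq[of a s u1 s1 b u2 s2] assms(2)
    by (intro exI[of _ "u1 + u2"] exI[of _ s2]) auto
qed

lemma runs_IfT:
  assumes "0 < fst s v" "fst s v < B" "runs a s t Q" "Suc t \<le> t'"
  shows "runs (If v a b) s t' Q"
proof -
  obtain u s1 where "u \<le> t" "run a s u s1" "Q s1" using assms(3) unfolding runs_def by blast
  then show ?thesis unfolding runs_def using run_IfT[OF assms(1,2)] assms(4)
    by (intro exI[of _ "Suc u"] exI[of _ s1]) auto
qed

lemma runs_IfF:
  assumes "fst s v = 0" "runs b s t Q" "Suc t \<le> t'"
  shows "runs (If v a b) s t' Q"
proof -
  obtain u s1 where "u \<le> t" "run b s u s1" "Q s1" using assms(2) unfolding runs_def by blast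
  then show ?thesis unfolding runs_def using run_IfF[OF assms(1)] assms(3)
    by (intro exI[of _ "Suc u"] exI[of _ s1]) auto
qed

lemma runs_WhileT:
  assumes "0 < fst s v" "fst s v < B" "runs a s t1 (\<lambda>s'. runs (While v a) s' t2 Q)" "Suc (t1 + t2) \<le> t"
  shows "runs (While v a) s t Q"
proof -
  obtain u1 u2 s1 s2 where u: "u1 \<le> t1" "run a s u1 s1" "u2 \<le> t2" "run (While v a) s1 u2 s2" "Q s2"
    using assms(3) unfolding runs_def by blast
  show ?thesis unfolding runs_def using run_WhileT[OF assms(1,2) u(2,4)] assms(4) u(1,3,5)
    by (intro exI[of _ "Suc (u1 + u2)"] exI[of _ s2]) auto
qed

lemma runs_WhileF: "fst s v = 0 \<Longrightarrow> Q s \<Longrightarrow> 1 \<le> t \<Longrightarrow> runs (While v a) s t Q"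
  unfolding runs_def using run_WhileF by blast

lemma runs_mono:
  assumes "runs c s t Q" "t \<le> t'" "\<And>s'. Q s' \<Longrightarrow> Q' s'"
  shows "runs c s t' Q'"
proof -
  obtain u s1 where "u \<le> t" "run c s u s1" "Q s1" using assms(1) unfolding runs_def by blast
  then show ?thesis unfolding runs_def using assms(2,3) by (intro exI[of _ u] exI[of _ s1]) auto
qed

end

text \<open>
  The record of string \<open>j\<close> at word \<open>q\<close> starts at \<open>row j + q * rec\<close> and consists of the word, the rank of
  the suffix starting there, and one column of the sparse table. The additional word number \<open>Qn\<close>, where
  query and dictionary differ, is a sentinel.
\<close>
locale layout = vm +
  fixes d Qn n lb rec msb pm lowt kmax Wn :: nat and row :: "nat \<Rightarrow> nat" and dw :: "nat \<Rightarrow> nat \<Rightarrow> nat"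
    and pw :: "nat \<Rightarrow> nat" and rk :: "nat \<Rightarrow> nat \<Rightarrow> nat" and lc :: "nat \<Rightarrow> nat \<Rightarrow> nat \<Rightarrow> nat"
  assumes SC_small: "length SC < BIG" and W_small: "Wn < BIG"
    and Wn: "Suc Qn * rec \<le> Wn"
    and d_pos: "0 < d" and n_pos: "0 < n" and lb_pos: "0 < lb" and n_lb: "n * lb \<le> w" and rec: "n * lb < rec" "2 < rec"
    and QW: "length QW = Qn" "\<And>q. q < Qn \<Longrightarrow> QW ! q = pw q"
    and pw_last: "pw Qn = 1" and dw_last: "\<And>j. j < d \<Longrightarrow> dw j Qn = 0"
    and pw_less: "\<And>q. q \<le> Qn \<Longrightarrow> pw q < 2 ^ (n * lb)"
    and dw_less: "\<And>j q. j < d \<Longrightarrow> q \<le> Qn \<Longrightarrow> dw j q < 2 ^ (n * lb)"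
    and row_pos: "\<And>j. j < d \<Longrightarrow> 0 < row j"
    and SC_dw: "\<And>j q. j < d \<Longrightarrow> q \<le> Qn \<Longrightarrow> row j + q * rec + 1 < length SC \<and> SC ! (row j + q * rec) = dw j q \<and>
      SC ! (row j + q * rec + 1) = rk j q"
    and SC_lc: "\<And>i j q. i < d \<Longrightarrow> j < d \<Longrightarrow> q \<le> Qn \<Longrightarrow>
      (\<exists>h. Bit_Operations.xor (rk i q) (rk j q) + msb < length SC \<and> SC ! (Bit_Operations.xor (rk i q) (rk j q) + msb) = h \<and>
        row i + q * rec + 2 + h < length SC \<and> row j + q * rec + 2 + h < length SC \<and>
        min (SC ! (row i + q * rec + 2 + h)) (SC ! (row j + q * rec + 2 + h)) = lc i j q * rec)"
    and lc: "\<And>i j q. i < d \<Longrightarrow> j < d \<Longrightarrow> q \<le> Qn \<Longrightarrow>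
      q \<le> lc i j q \<and> (\<forall>r. q \<le> r \<longrightarrow> r < lc i j q \<longrightarrow> dw i r = dw j r) \<and>
      (lc i j q \<le> Qn \<longrightarrow> dw i (lc i j q) \<noteq> dw j (lc i j q))"
    and pm: "0 < pm" "pm < B"
    and SC_low: "\<And>i. i < w \<Longrightarrow> (2 * 2 ^ i - 1) mod pm + lowt < length SC \<and> SC ! ((2 * 2 ^ i - 1) mod pm + lowt) = i div lb * lb"
begin

definition env :: "(nat \<Rightarrow> nat) \<Rightarrow> bool" where
  "env v \<longleftrightarrow> v xONE = 1 \<and> v xZERO = 0 \<and> v xKMAX = kmax \<and> v xREC = rec \<and> v xQHAT = Qn * rec \<and> v xMSB = msb \<and>
    v xPMOD = pm \<and> v xLOWT = lowt \<and> v xLB = lb \<and> v xSBASE = Suc Qn * rec \<and> v xFIVE = 5"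

lemma env_frame: "env v \<Longrightarrow> (\<And>u. u < 20 \<Longrightarrow> v' u = v u) \<Longrightarrow> env v'"
  by (simp add: env_def)

lemma envD:
  assumes "env v"
  shows "v xONE = 1" "v xZERO = 0" "v xKMAX = kmax" "v xREC = rec" "v xQHAT = Qn * rec" "v xMSB = msb"
    "v xPMOD = pm" "v xLOWT = lowt" "v xLB = lb" "v xSBASE = Suc Qn * rec" "v xFIVE = 5"
  using assms by (auto simp: env_def)

lemma lcp_ops:
  assumes "env v" "i < d" "j < d" "q \<le> Qn" "v a = row i" "v b = row j" "v x = q * rec" "a < 60" "b < 60" "x < 60"
  shows "\<exists>v'. vsteps (lcp_ops a b x) (v, W, R) = Some (v', W, R) \<and> v' 65 = lc i j q * rec \<and> (\<forall>u<60. v' u = v u)"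
proof -
  obtain h where h: "Bit_Operations.xor (rk i q) (rk j q) + msb < length SC" "SC ! (Bit_Operations.xor (rk i q) (rk j q) + msb) = h"
     "row i + q * rec + 2 + h < length SC" "row j + q * rec + 2 + h < length SC"
     "min (SC ! (row i + q * rec + 2 + h)) (SC ! (row j + q * rec + 2 + h)) = lc i j q * rec"
    using SC_lc[OF assms(2-4)] by blast
  note s = SC_dw[OF assms(2,4)] SC_dw[OF assms(3,4)]
  have lt: "row i + q * rec < BIG" "Suc (row i + q * rec) < BIG" "row j + q * rec < BIG" "Suc (row j + q * rec) < BIG"
    "Suc (Suc (row i + q * rec)) < BIG" "Suc (Suc (row j + q * rec)) < BIG"
    "Suc (Suc (row i + q * rec + h)) < BIG" "Suc (Suc (row j + q * rec + h)) < BIG"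
    "Bit_Operations.xor (rk i q) (rk j q) + msb < BIG"
    using s h(1-4) SC_small by linarith+
  have sc: "SC ! Suc (row i + q * rec) = rk i q" "SC ! Suc (row j + q * rec) = rk j q"
    "Suc (row i + q * rec) < length SC" "Suc (row j + q * rec) < length SC"
    "Suc (Suc (row i + q * rec + h)) < length SC" "Suc (Suc (row j + q * rec + h)) < length SC"
    using s h by auto
  show ?thesis
    unfolding lcp_ops_def using assms(5-10) envD(1,6)[OF assms(1)]
    by (simp add: sc lt h(1,2) h(5)[symmetric] min_def)
qed


lemma runs_Ops_Seq:
  "vsteps xs s = Some s' \<Longrightarrow> runs b s' t2 Q \<Longrightarrow> length xs + t2 \<le> t \<Longrightarrow> runs (Ops xs ;; b) s t Q"
  by (rule runs_Seq[of _ _ "length xs"]) (auto intro: runs_Ops)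

abbreviation "pl \<equiv> ltr lb n pw"
abbreviation "dl j \<equiv> ltr lb n (dw j)"

section \<open>First mismatches of the query with a dictionary string\<close>

definition fm :: "nat \<Rightarrow> nat \<Rightarrow> nat" where
  "fm j y = (LEAST z. y \<le> z \<and> dl j z \<noteq> pl z)"

lemma fmI: "y \<le> z \<Longrightarrow> dl j z \<noteq> pl z \<Longrightarrow> (\<And>u. y \<le> u \<Longrightarrow> u < z \<Longrightarrow> dl j u = pl u) \<Longrightarrow> fm j y = z"
  unfolding fm_def by (rule Least_equality) (auto simp: not_less[symmetric])

text \<open>The sentinel words 1 and 0 differ in their lowest bit, hence in their first letter. So a
  search for a mismatch ends at position \<open>Qn * n\<close> at the latest.\<close>

lemma dl_end: "j < d \<Longrightarrow> dl j (Qn * n) \<noteq> pl (Qn * n)"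
  using ltr_at[of 0 n lb _ Qn] n_pos lb_pos pw_last dw_last
  by (auto simp: fld_def take_bit_eq_mod mod_eq_0_iff_dvd)

lemma fm_props:
  assumes "j < d" "y \<le> Qn * n"
  shows "y \<le> fm j y" "fm j y \<le> Qn * n" "dl j (fm j y) \<noteq> pl (fm j y)" "\<And>u. y \<le> u \<Longrightarrow> u < fm j y \<Longrightarrow> dl j u = pl u"
proof -
  have ex: "y \<le> Qn * n \<and> dl j (Qn * n) \<noteq> pl (Qn * n)" using assms dl_end by simp
  show "y \<le> fm j y" "dl j (fm j y) \<noteq> pl (fm j y)"
    using LeastI[of "\<lambda>z. y \<le> z \<and> dl j z \<noteq> pl z", OF ex] unfolding fm_def by auto
  show "fm j y \<le> Qn * n" unfolding fm_def
    by (rule Least_le[of "\<lambda>z. y \<le> z \<and> dl j z \<noteq> pl z", OF ex])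
  show "dl j u = pl u" if "y \<le> u" "u < fm j y" for u
    using not_less_Least[of u "\<lambda>z. y \<le> z \<and> dl j z \<noteq> pl z"] that unfolding fm_def by blast
qed

text \<open>A record of working memory holds the query word, the row of a dictionary string that
  agrees with the query up to the end of the current phrase, and this end. Records are as long as
  those of the dictionary, so that one scaled number addresses both.\<close>

definition W_ok :: "nat list \<Rightarrow> (nat \<Rightarrow> nat) \<Rightarrow> (nat \<Rightarrow> nat) \<Rightarrow> bool" where
  "W_ok W Jt Et \<longleftrightarrow> length W = Wn \<and> (\<forall>q\<le>Qn. W ! (q * rec) = pw q \<and> W ! (q * rec + 1) = row (Jt q) \<and>
    W ! (q * rec + 2) = Et q * rec \<and> Jt q < d \<and> q \<le> Et q \<and> Et q \<le> Qn \<and> (\<forall>r. q \<le> r \<longrightarrow> r < Et q \<longrightarrow> pw r = dw (Jt q) r))"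

text \<open>Every dictionary string has a mismatch in every phrase.\<close>
definition maximal :: "(nat \<Rightarrow> nat) \<Rightarrow> bool" where
  "maximal Et \<longleftrightarrow> (\<forall>q\<le>Qn. Et q < Qn \<longrightarrow> (\<forall>j<d. \<exists>r. Et q < r \<and> r \<le> Et (Suc (Et q)) \<and> pw r \<noteq> dw j r))"

lemma index_less: "q \<le> Qn \<Longrightarrow> c < rec \<Longrightarrow> q * rec + c < Wn"
proof -
  assume "q \<le> Qn" "c < rec"
  then have "q * rec + c < Suc q * rec" by simp
  also have "\<dots> \<le> Suc Qn * rec" using \<open>q \<le> Qn\<close> by (intro mult_le_mono1) simp
  finally show ?thesis using Wn by simp
qed

lemma pw_B: "q \<le> Qn \<Longrightarrow> pw q < B" and dw_B: "j < d \<Longrightarrow> q \<le> Qn \<Longrightarrow> dw j q < B"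
  using pw_less dw_less power_increasing[OF n_lb, of "2 :: nat"] by (fastforce intro: less_le_trans)+

lemma xor_eq_0 [simp]: "Bit_Operations.xor a b = 0 \<longleftrightarrow> a = b" for a b :: nat
  by (metis bit.xor_self xor.assoc xor.left_neutral xor_self_eq)

text \<open>Let \<open>y\<close> be the smaller of the common prefix of the strings
  \<open>Jt q\<close> and \<open>j\<close> and the phrase end. Up to the phrase end the query is
  string \<open>Jt q\<close>, so if \<open>y\<close> lies before it, the two strings and therefore
  query and string \<open>j\<close> differ at \<open>y\<close>. At the phrase end nothing is known
  about string \<open>j\<close>, and the words are compared directly; if they are equal, the next
  phrase begins behind them.\<close>

lemma iter:
  assumes "env v" "W_ok W Jt Et" "j < d" "q \<le> Qn" "v 30 = row j" "v 50 = q * rec"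
  shows "runs iter (v, W, R) 31 (\<lambda>(v', W', R'). W' = W \<and> R' = R \<and> (\<forall>u<50. v' u = v u) \<and>
    ((\<exists>f. q \<le> f \<and> f \<le> Et q \<and> pw f \<noteq> dw j f \<and> (\<forall>r. q \<le> r \<longrightarrow> r < f \<longrightarrow> pw r = dw j r) \<and> v' 50 = f * rec \<and> v' 51 = 0) \<or>
     (\<forall>r. q \<le> r \<longrightarrow> r \<le> Et q \<longrightarrow> pw r = dw j r) \<and> v' 50 = Suc (Et q) * rec \<and> v' 51 = 1))"
proof -
  note e = envD[OF assms(1)]
  have w: "length W = Wn" "W ! Suc (q * rec) = row (Jt q)" "W ! Suc (Suc (q * rec)) = Et q * rec" "Jt q < d"
    "q \<le> Et q" "Et q \<le> Qn" "\<And>r. q \<le> r \<Longrightarrow> r < Et q \<Longrightarrow> pw r = dw (Jt q) r"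
    using assms(2,4) by (auto simp: W_ok_def)
  have i: "Suc (q * rec) < Wn" "Suc (Suc (q * rec)) < Wn" using index_less[OF assms(4), of 1] index_less[OF assms(4), of 2] rec by auto
  have b: "q * rec < BIG" "Suc (q * rec) < BIG" "Suc (Suc (q * rec)) < BIG" using i W_small by linarith+
  define v1 where "v1 = v(52 := Suc (Suc (q * rec)), 53 := row (Jt q), 54 := Et q * rec)"
  have 1: "vsteps [VAdd 52 50 xONE, VLoadW 53 52, VAdd 52 52 xONE, VLoadW 54 52] (v, W, R) = Some (v1, W, R)"
    using assms(6) e(1) w i b by (simp add: v1_def fun_upd_twist)
  have env1: "env v1" by (rule env_frame[OF assms(1)]) (simp add: v1_def)
  have v1: "v1 53 = row (Jt q)" "v1 30 = v 30" "v1 50 = v 50" by (simp_all add: v1_def)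
  obtain v2 where 2: "vsteps (lcp_ops 53 30 50) (v1, W, R) = Some (v2, W, R)" "v2 65 = lc (Jt q) j q * rec" "\<forall>u<60. v2 u = v1 u"
    using lcp_ops[OF env1 w(4) assms(3,4), of 53 30 50 W R] assms(5,6) v1 by auto
  define y where "y = min (lc (Jt q) j q) (Et q)"
  have y: "y \<le> Qn" using w by (simp add: y_def)
  have c: "q \<le> lc (Jt q) j q" "\<And>r. q \<le> r \<Longrightarrow> r < lc (Jt q) j q \<Longrightarrow> dw (Jt q) r = dw j r"
     "lc (Jt q) j q \<le> Qn \<Longrightarrow> dw (Jt q) (lc (Jt q) j q) \<noteq> dw j (lc (Jt q) j q)"
    using lc[OF w(4) assms(3,4)] by auto
  have before: "pw r = dw j r" if "q \<le> r" "r < y" for r using that c(2) w(7) by (simp add: y_def)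
  have at: "pw y \<noteq> dw j y" if "y < Et q"
  proof -
    have "y = lc (Jt q) j q" using that by (simp add: y_def)
    then show ?thesis using c(1,3) w(7)[of y] that y by auto
  qed
  have qy: "q \<le> y" using c(1) w(5) by (simp add: y_def)
  have sel: "(if lc (Jt q) j q * rec < Et q * rec then lc (Jt q) j q * rec else Et q * rec) = y * rec"
    using rec by (auto simp: y_def min_def)
  have ry: "row j + y * rec < length SC" "SC ! (row j + y * rec) = dw j y" using SC_dw[OF assms(3) y] by auto
  have iy: "y * rec < Wn" "W ! (y * rec) = pw y"
    using index_less[OF y, of 0] rec assms(2) y by (auto simp: W_ok_def)
  have v2: "v2 u = v1 u" if "u < 60" for u using 2(3) that by simp
  have by': "row j + y * rec < BIG" using ry(1) SC_small by simp
  have yr: "y * rec + rec < BIG" 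
  proof -
    have "Suc y * rec \<le> Suc Qn * rec" using y by (intro mult_le_mono1) simp
    then have "y * rec + rec \<le> Suc Qn * rec" by (simp only: mult_Suc add.commute)
    then show ?thesis using Wn W_small by linarith
  qed
  define eq where "eq = (pw y = dw j y)"
  define v3 where "v3 = v2(55 := Bit_Operations.xor (dw j y) (pw y), 57 := of_bool (\<not> eq),
     56 := (if eq then rec else 0), 50 := (if eq then Suc y * rec else y * rec), 51 := of_bool eq)"
  define a1 where "a1 = lc (Jt q) j q * rec"
  define a2 where "a2 = Et q * rec"
  define a3 where "a3 = y * rec"
  have sel': "(if a1 < a2 then a1 else a2) = a3" using sel by (simp only: a1_def a2_def a3_def)
  have vv: "v2 65 = a1" "v2 54 = a2" "v2 30 = row j" "v2 0 = 1" "v2 13 = 0" "v2 3 = rec"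
    using 2(2) e assms(5) by (simp_all add: v2 a1_def a2_def v1_def)
  note ry' = ry[folded a3_def] and iy' = iy[folded a3_def] and yr' = yr[folded a3_def] and by'' = by'[folded a3_def]
  define v3a where "v3a = v2(55 := Bit_Operations.xor (dw j y) (pw y), 50 := a3, 56 := pw y)"
  have 3: "vsteps [VLess 55 65 54, VSelect 50 55 65 54, VAdd 55 30 50, VLoad 55 55, VLoadW 56 50, VXor 55 55 56] (v2, W, R)
     = Some (v3a, W, R)"
    using sel' ry' iy' w(1) by'' by (simp add: vv v3a_def fun_upd_twist split: if_splits)
  have va: "v3a 0 = 1" "v3a 13 = 0" "v3a 3 = rec" "v3a 50 = a3" "v3a 55 = Bit_Operations.xor (dw j y) (pw y)"
    by (simp_all add: v3a_def vv)
  have 4: "vsteps [VLess 57 xZERO 55, VSelect 56 57 xZERO xREC, VAdd 50 50 56, VSelect 51 57 xZERO xONE] (v3a, W, R)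
     = Some (v3, W, R)"
  proof (cases "pw y = dw j y")
    case True
    then show ?thesis using yr' va by (simp add: v3_def eq_def v3a_def fun_upd_twist a3_def add.commute)
  next
    case False
    moreover have "dw j y \<noteq> pw y" using False by simp
    ultimately show ?thesis using yr' va by (simp add: v3_def eq_def v3a_def fun_upd_twist a3_def)
  qed
  have "Q (v3, W, R)" if "Q = (\<lambda>(v', W', R'). W' = W \<and> R' = R \<and> (\<forall>u<50. v' u = v u) \<and>
    ((\<exists>f. q \<le> f \<and> f \<le> Et q \<and> pw f \<noteq> dw j f \<and> (\<forall>r. q \<le> r \<longrightarrow> r < f \<longrightarrow> pw r = dw j r) \<and> v' 50 = f * rec \<and> v' 51 = 0) \<or>
     (\<forall>r. q \<le> r \<longrightarrow> r \<le> Et q \<longrightarrow> pw r = dw j r) \<and> v' 50 = Suc (Et q) * rec \<and> v' 51 = 1))" for Q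
  proof -
    have fr: "\<forall>u<50. v3 u = v u" by (simp add: v3_def v2 v1_def)
    show ?thesis
    proof (cases eq)
      case True
      then have "\<not> y < Et q" using at by (auto simp: eq_def)
      then have "y = Et q" using y_def by linarith
      then have "\<forall>r. q \<le> r \<longrightarrow> r \<le> Et q \<longrightarrow> pw r = dw j r" using before True by (auto simp: eq_def le_less)
      then show ?thesis unfolding that using fr True \<open>y = Et q\<close> by (auto simp: v3_def)
    next
      case False
      then show ?thesis unfolding that using fr before qy
        by (auto simp: v3_def eq_def intro!: exI[of _ y]) (simp add: y_def)
    qed
  qed
  then show ?thesis unfolding iter_def
    by (intro runs_Ops_Seq[OF 1, of _ 27] runs_Ops_Seq[OF 2(1), of _ 10] runs_Ops_Seq[OF 3, of _ 4] runs_Ops[OF 4]) (auto simp: lcp_ops_def)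
qed

text \<open>The offset \<open>c = n\<close> is allowed: a search that resumes behind the last letter
  of a word does not carry into the next word. The shift then leaves zero, like for a word without
  further mismatch, and the search moves on. At the sentinel \<open>c = 0\<close> ensures that the
  xor is not shifted away.\<close>

lemma firstmis:
  assumes "env v" "W_ok W Jt Et" "maximal Et" "j < d" "q \<le> Qn" "c \<le> n" "q = Qn \<longrightarrow> c = 0"
    "v 30 = row j" "v 31 = q * rec" "v 32 = c * lb"
  shows "runs firstmis (v, W, R) 90 (\<lambda>(v', W', R'). W' = W \<and> R' = R \<and> (\<forall>u<40. v' u = v u) \<and>
    v' 50 = fm j (q * n + c) div n * rec \<and> v' 40 = fm j (q * n + c) mod n * lb)"
proof -
  note e = envD[OF assms(1)]
  have Wl: "length W = Wn" using assms(2) by (simp add: W_ok_def)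
  have row: "row j + q' * rec < length SC" "SC ! (row j + q' * rec) = dw j q'" "row j + q' * rec < BIG"
     "W ! (q' * rec) = pw q'" "q' * rec < Wn" "q' * rec < BIG" if "q' \<le> Qn" for q'
    using SC_dw[OF assms(4) that] SC_small index_less[OF that, of 0] rec assms(2) W_small that by (auto simp: W_ok_def)
  have xB: "Bit_Operations.xor (dw j q') (pw q') < B" if "q' \<le> Qn" for q'
    using binop_val_less[OF dw_B[OF assms(4) that] pw_B[OF that], of Xor] by simp
  have cB: "c * lb < B"
  proof -
    have "c * lb \<le> n * lb" using assms(6) by simp
    also have "\<dots> < B" using n_lb less_exp[of w] by linarith
    finally show ?thesis .
  qed
  define x where "x = drop_bit (c * lb) (Bit_Operations.xor (dw j q) (pw q))"
  have xB': "x < B" unfolding x_def drop_bit_eq_div by (rule le_less_trans[OF div_le_dividend xB[OF assms(5)]])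
  define v1 where "v1 = v(41 := x, 42 := pw q, 50 := q * rec, 40 := c * lb)"
  have 1: "vsteps [VAdd 41 30 31, VLoad 41 41, VLoadW 42 31, VXor 41 41 42, VBin Shr 41 41 32, VCopy 50 31, VCopy 40 32] (v, W, R)
      = Some (v1, W, R)"
    using assms(8-10) row[OF assms(5)] Wl xB[OF assms(5)] cB
    by (simp add: v1_def x_def fun_upd_twist)
  \<comment> \<open>The common outcome of all branches: a word with a nonzero shifted xor and no
    mismatch before it. The closing block only has to find the lowest bit.\<close>
  define P where "P = (\<lambda>s'. \<exists>v' q' c'. s' = (v', W, R) \<and> (\<forall>u<40. v' u = v u) \<and>
    (q' \<le> Qn \<and> q \<le> q' \<and> v' 50 = q' * rec \<and> v' 40 = c' * lb \<and> v' 41 \<noteq> 0 \<and>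
      v' 41 = drop_bit (c' * lb) (Bit_Operations.xor (dw j q') (pw q')) \<and> q * n + c \<le> q' * n + c' \<and>
      (\<forall>u. q * n + c \<le> u \<longrightarrow> u < q' * n + c' \<longrightarrow> dl j u = pl u)))"
  have mid: "runs (If 41 (Ops [])
      (Ops [VAdd 50 50 xREC, VZero 40] ;; iter ;; If 51 iter (Ops []) ;;
       Ops [VAdd 41 30 50, VLoad 41 41, VLoadW 42 50, VXor 41 41 42])) (v1, W, R) 72 P"
  proof (cases "x = 0")
    case False
    show ?thesis
    proof (rule runs_IfT)
      show "0 < fst (v1, W, R) 41" "fst (v1, W, R) 41 < B" using False xB' by (simp_all add: v1_def)
      have "P (v1, W, R)" unfolding P_def
        by (rule exI[of _ v1], rule exI[of _ q], rule exI[of _ c]) (use False assms(5) in \<open>auto simp: v1_def x_def\<close>)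
      then show "runs (Ops []) (v1, W, R) 0 P" by (intro runs_Ops) auto
    qed simp
  next
    case True
    have qQ: "q < Qn"
    proof (rule ccontr)
      assume "\<not> q < Qn"
      then have "q = Qn" "c = 0" using assms(5,7) by auto
      then show False using True assms(4) by (simp add: x_def pw_last dw_last)
    qed
    have in_word: "dl j u = pl u" if "q * n + c \<le> u" "u < Suc q * n" for u
    proof -
      have "u div n = q" using that n_pos by (intro div_nat_eqI) (auto simp: mult.commute[of n])
      then have "u = q * n + u mod n" by (metis div_mult_mod_eq)
      then have "c \<le> u mod n" using that by linarith
      then show ?thesis using fld_same[OF True[unfolded x_def]] \<open>u div n = q\<close> by (simp add: ltr_def)
    qed
    have words: "dl j u = pl u" if "q * n + c \<le> u" "u < f * n" "\<forall>r. Suc q \<le> r \<longrightarrow> r < f \<longrightarrow> pw r = dw j r" for u f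
    proof (cases "u < Suc q * n")
      case False
      then have "Suc q \<le> u div n" using n_pos by (metis div_le_mono nonzero_mult_div_cancel_right not_gr_zero not_le order_less_imp_le less_imp_neq)
      moreover have "u div n < f" using that(2) by (rule less_mult_imp_div_less)
      ultimately show ?thesis using that(3) by (simp add: ltr_def)
    qed (use in_word that in auto)
    define v2 where "v2 = v1(50 := Suc q * rec, 40 := 0)"
    have 2: "vsteps [VAdd 50 50 xREC, VZero 40] (v1, W, R) = Some (v2, W, R)"
      using e row[of "Suc q"] qQ by (simp add: v1_def v2_def add.commute)
    have env2: "env v2" by (rule env_frame[OF assms(1)]) (simp add: v2_def v1_def)
    have fr2: "v2 u = v u" if "u < 40" for u using that by (simp add: v2_def v1_def)
    have v40: "v2 40 = 0" by (simp add: v2_def)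
    have last: "runs (Ops [VAdd 41 30 50, VLoad 41 41, VLoadW 42 50, VXor 41 41 42]) (v', W, R) 4 P"
      if "\<forall>u<50. v' u = v2 u" "v' 50 = f * rec" "f \<le> Qn" "Suc q \<le> f" "pw f \<noteq> dw j f" "\<forall>r. Suc q \<le> r \<longrightarrow> r < f \<longrightarrow> pw r = dw j r" for v' f
    proof (rule runs_Ops)
      show "vsteps [VAdd 41 30 50, VLoad 41 41, VLoadW 42 50, VXor 41 41 42] (v', W, R) =
        Some (v'(41 := Bit_Operations.xor (dw j f) (pw f), 42 := pw f), W, R)"
        using that row[OF that(3)] Wl fr2[of 30] assms(8) by (simp add: fun_upd_twist)
      have le: "q * n + c \<le> f * n"
      proof -
        have "q * n + c \<le> Suc q * n" using assms(6) by simp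
        also have "\<dots> \<le> f * n" using that(4) by (intro mult_le_mono1)
        finally show ?thesis .
      qed
      have fr3: "\<forall>u<40. (v'(41 := Bit_Operations.xor (dw j f) (pw f), 42 := pw f)) u = v u" using that(1) fr2 by simp
      show "P (v'(41 := Bit_Operations.xor (dw j f) (pw f), 42 := pw f), W, R)"
        unfolding P_def
        by (rule exI[of _ "v'(41 := Bit_Operations.xor (dw j f) (pw f), 42 := pw f)"], rule exI[of _ f], rule exI[of _ 0])
          (use that v40 words[of _ f] le fr3 in auto)
    qed simp
    show ?thesis
    proof (rule runs_IfF)
      show "fst (v1, W, R) 41 = 0" using True by (simp add: v1_def)
      have it1: "runs iter (v2, W, R) 31 (\<lambda>(v', W', R'). W' = W \<and> R' = R \<and> (\<forall>u<50. v' u = v2 u) \<and>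
        ((\<exists>f. Suc q \<le> f \<and> f \<le> Et (Suc q) \<and> pw f \<noteq> dw j f \<and> (\<forall>r. Suc q \<le> r \<longrightarrow> r < f \<longrightarrow> pw r = dw j r) \<and> v' 50 = f * rec \<and> v' 51 = 0) \<or>
         (\<forall>r. Suc q \<le> r \<longrightarrow> r \<le> Et (Suc q) \<longrightarrow> pw r = dw j r) \<and> v' 50 = Suc (Et (Suc q)) * rec \<and> v' 51 = 1))"
        by (rule iter[OF env2 assms(2,4)]) (use qQ fr2 assms(8) in \<open>auto simp: v2_def\<close>)
      have EQ: "Et (Suc q) \<le> Qn" "Suc q \<le> Et (Suc q)" using assms(2) qQ unfolding W_ok_def by auto
      show "runs (Ops [VAdd 50 50 xREC, VZero 40] ;; iter ;; If 51 iter (Ops []) ;;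
         Ops [VAdd 41 30 50, VLoad 41 41, VLoadW 42 50, VXor 41 41 42]) (v1, W, R) 70 P"
      proof (rule runs_Ops_Seq[OF 2], rule runs_Seq[OF runs_mono[OF it1 order.refl]])
        fix s' assume s': "case s' of (v', W', R') \<Rightarrow> W' = W \<and> R' = R \<and> (\<forall>u<50. v' u = v2 u) \<and>
        ((\<exists>f. Suc q \<le> f \<and> f \<le> Et (Suc q) \<and> pw f \<noteq> dw j f \<and> (\<forall>r. Suc q \<le> r \<longrightarrow> r < f \<longrightarrow> pw r = dw j r) \<and> v' 50 = f * rec \<and> v' 51 = 0) \<or>
         (\<forall>r. Suc q \<le> r \<longrightarrow> r \<le> Et (Suc q) \<longrightarrow> pw r = dw j r) \<and> v' 50 = Suc (Et (Suc q)) * rec \<and> v' 51 = 1)"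
        obtain v' where v': "s' = (v', W, R)" "\<forall>u<50. v' u = v2 u" using s' by (cases s') auto
        consider f where "Suc q \<le> f" "f \<le> Et (Suc q)" "pw f \<noteq> dw j f" "\<forall>r. Suc q \<le> r \<longrightarrow> r < f \<longrightarrow> pw r = dw j r" "v' 50 = f * rec" "v' 51 = 0"
          | "\<forall>r. Suc q \<le> r \<longrightarrow> r \<le> Et (Suc q) \<longrightarrow> pw r = dw j r" "v' 50 = Suc (Et (Suc q)) * rec" "v' 51 = 1"
          using s' unfolding v'(1) by auto
        then show "runs (If 51 iter (Ops []) ;; Ops [VAdd 41 30 50, VLoad 41 41, VLoadW 42 50, VXor 41 41 42]) s' 37 P"
        proof cases
          case 1
          show ?thesis unfolding v'(1)
          proof (rule runs_Seq[of _ _ 1 _ 4], rule runs_IfF)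
            show "runs (Ops []) (v', W, R) 0 (\<lambda>s'. runs (Ops [VAdd 41 30 50, VLoad 41 41, VLoadW 42 50, VXor 41 41 42]) s' 4 P)"
              by (rule runs_Ops) (use last[where v' = v' and f = f] v'(2) 1 EQ in auto)
          qed (use 1 in auto)
        next
          case 2
          let ?E = "Et (Suc q)"
          have E: "?E < Qn"
          proof (rule ccontr)
            assume "\<not> ?E < Qn"
            then have "?E = Qn" using EQ by simp
            then show False using 2(1) qQ pw_last dw_last[OF assms(4)] by (metis EQ(2) order.refl zero_neq_one)
          qed
          have env': "env v'" by (rule env_frame[OF env2]) (use v'(2) in simp)
          have it2: "runs iter (v', W, R) 31 (\<lambda>(v'', W', R'). W' = W \<and> R' = R \<and> (\<forall>u<50. v'' u = v' u) \<and>
            ((\<exists>f. Suc ?E \<le> f \<and> f \<le> Et (Suc ?E) \<and> pw f \<noteq> dw j f \<and> (\<forall>r. Suc ?E \<le> r \<longrightarrow> r < f \<longrightarrow> pw r = dw j r) \<and> v'' 50 = f * rec \<and> v'' 51 = 0) \<or>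
             (\<forall>r. Suc ?E \<le> r \<longrightarrow> r \<le> Et (Suc ?E) \<longrightarrow> pw r = dw j r) \<and> v'' 50 = Suc (Et (Suc ?E)) * rec \<and> v'' 51 = 1))"
            by (rule iter[OF env' assms(2,4)]) (use E v'(2) fr2 assms(8) 2 in auto)
          \<comment> \<open>Word \<open>?E\<close> is where the first phrase ends, and the whole
            rest of that phrase agreed. By \<open>maximal\<close> the next phrase contains a
            mismatch with string \<open>j\<close>, so the second call of \<open>iter\<close> must
            succeed and its flag need not be tested.\<close>
          obtain r0 where r0: "?E < r0" "r0 \<le> Et (Suc ?E)" "pw r0 \<noteq> dw j r0"
            using assms(3,4) E qQ unfolding maximal_def by (metis Suc_leI)
          have EQ2: "Et (Suc ?E) \<le> Qn" using assms(2) E unfolding W_ok_def by auto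
          show ?thesis unfolding v'(1)
          proof (rule runs_Seq[of _ _ 32 _ 4], rule runs_IfT)
            show "runs iter (v', W, R) 31 (\<lambda>s''. runs (Ops [VAdd 41 30 50, VLoad 41 41, VLoadW 42 50, VXor 41 41 42]) s'' 4 P)"
            proof (rule runs_mono[OF it2 order.refl])
              fix s'' assume s'': "case s'' of (v'', W', R') \<Rightarrow> W' = W \<and> R' = R \<and> (\<forall>u<50. v'' u = v' u) \<and>
               ((\<exists>f. Suc ?E \<le> f \<and> f \<le> Et (Suc ?E) \<and> pw f \<noteq> dw j f \<and> (\<forall>r. Suc ?E \<le> r \<longrightarrow> r < f \<longrightarrow> pw r = dw j r) \<and> v'' 50 = f * rec \<and> v'' 51 = 0) \<or>
             (\<forall>r. Suc ?E \<le> r \<longrightarrow> r \<le> Et (Suc ?E) \<longrightarrow> pw r = dw j r) \<and> v'' 50 = Suc (Et (Suc ?E)) * rec \<and> v'' 51 = 1)"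
              obtain v'' where v'': "s'' = (v'', W, R)" "\<forall>u<50. v'' u = v' u" using s'' by (cases s'') auto
              obtain f where f: "Suc ?E \<le> f" "f \<le> Et (Suc ?E)" "pw f \<noteq> dw j f" "\<forall>r. Suc ?E \<le> r \<longrightarrow> r < f \<longrightarrow> pw r = dw j r" "v'' 50 = f * rec"
                using s'' r0 unfolding v''(1) by (auto simp: Suc_le_eq)
              show "runs (Ops [VAdd 41 30 50, VLoad 41 41, VLoadW 42 50, VXor 41 41 42]) s'' 4 P"
                unfolding v''(1)
              proof (rule last[where v' = v'' and f = f])
                show "\<forall>r. Suc q \<le> r \<longrightarrow> r < f \<longrightarrow> pw r = dw j r"
                  using 2(1) f(4) by (meson Suc_leI not_le)
              qed (use v'' v' f EQ EQ2 in auto)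
            qed
          qed (use 2 in auto)
        qed
      qed auto
    qed simp
  qed
  show ?thesis unfolding firstmis_def
  proof (rule runs_Ops_Seq[OF 1], rule runs_Seq[OF runs_mono[OF mid order.refl]])
    fix s' assume "P s'"
    then obtain v' q' c' where v': "s' = (v', W, R)" "\<forall>u<40. v' u = v u" "q' \<le> Qn" "q \<le> q'" "v' 50 = q' * rec"
      "v' 40 = c' * lb" "v' 41 \<noteq> 0" "v' 41 = drop_bit (c' * lb) (Bit_Operations.xor (dw j q') (pw q'))"
      "q * n + c \<le> q' * n + c'" "\<forall>u. q * n + c \<le> u \<longrightarrow> u < q' * n + c' \<longrightarrow> dl j u = pl u"
      unfolding P_def by blast
    define x where "x = v' 41"
    obtain i where i: "bit x i" "\<forall>k<i. \<not> bit x k" "Bit_Operations.xor x (x - 1) = 2 * 2 ^ i - 1"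
      using low_bit[of x] v'(7) unfolding x_def by blast
    note ff = fld_first[OF i(1,2) v'(8)[folded x_def] lb_pos dw_less[OF assms(4) v'(3)] pw_less[OF v'(3)]]
    have iw: "i < w" using ff(4) n_lb by simp
    note low = SC_low[OF iw]
    let ?c = "c' + i div lb"
    have fmv: "fm j (q * n + c) = q' * n + ?c"
    proof (rule fmI)
      show "q * n + c \<le> q' * n + ?c" using v'(9) by simp
      show "dl j (q' * n + ?c) \<noteq> pl (q' * n + ?c)" using ff(1,2) by (simp add: ltr_at)
      fix u assume u: "q * n + c \<le> u" "u < q' * n + ?c"
      show "dl j u = pl u"
      proof (cases "u < q' * n + c'")
        case False
        then obtain c2 where c2: "u = q' * n + c2" "c' \<le> c2" using le_Suc_ex[of "q' * n + c'" u] by (metis add.assoc le_add1 not_le)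
        then have "c2 < ?c" using u by simp
        then show ?thesis using ff(1) ff(3)[OF c2(2)] unfolding c2(1) by (simp add: ltr_at)
      qed (use v'(10) u in auto)
    qed
    have dm: "fm j (q * n + c) div n = q'" "fm j (q * n + c) mod n = ?c" unfolding fmv using ff(1) by auto
    have xB: "x < B" unfolding x_def v'(8) drop_bit_eq_div by (rule le_less_trans[OF div_le_dividend xB[OF v'(3)]])
    have x0: "0 < x" using v'(7) by (simp add: x_def)
    have sub: "(x + B - 1) mod B = x - 1"
    proof -
      have h: "x + B - 1 = x - 1 + B" using x0 by simp
      have "(x - 1 + B) mod B = (x - 1) mod B" by (rule mod_add_self2)
      also have "\<dots> = x - 1" by (rule mod_less) (use xB in linarith)
      finally show ?thesis unfolding h .
    qed
    have xm: "Bit_Operations.xor x (x - 1) < B"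
      using binop_val_less[of x "x - 1" Xor] xB by simp
    note ev = e(1,7,8) v'(2)
    have e': "v' 0 = 1" "v' 6 = pm" "v' 7 = lowt" using e v'(2) by auto
    have cs: "c' * lb + i div lb * lb = ?c * lb" by (simp add: algebra_simps)
    have "?c * lb < n * lb" using ff(1) lb_pos by simp
    then have cB: "?c * lb < BIG" using n_lb less_exp[of w] B_le_BIG by linarith
    have "vsteps [VBin Sub 42 41 xONE, VXor 41 41 42, VBin Mod 41 41 xPMOD, VAdd 41 41 xLOWT, VLoad 41 41, VAdd 40 40 41] (v', W, R) =
       Some (v'(42 := x - 1, 41 := i div lb * lb, 40 := ?c * lb), W, R)"
      using e' low SC_small v'(6) xB xm pm i(3) sub cB cs one_less_B
      by (simp add: x_def[symmetric] fun_upd_twist)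
    then show "runs (Ops [VBin Sub 42 41 xONE, VXor 41 41 42, VBin Mod 41 41 xPMOD, VAdd 41 41 xLOWT, VLoad 41 41, VAdd 40 40 41]) s' 6
       (\<lambda>(v', W', R'). W' = W \<and> R' = R \<and> (\<forall>u<40. v' u = v u) \<and>
         v' 50 = fm j (q * n + c) div n * rec \<and> v' 40 = fm j (q * n + c) mod n * lb)"
      unfolding v'(1) by (rule runs_Ops) (use v' dm in auto)
  qed auto
qed

end

subsection \<open>Parsing the query\<close>

datatype obj = Null | Rec "nat list" "obj list"

text \<open>Linked objects in memory, data cells before pointer cells. Address 0 is the null
  pointer, so every record lies at a positive address.\<close>

function (sequential) orep :: "nat list \<Rightarrow> nat \<Rightarrow> obj \<Rightarrow> bool" where
  "orep S p Null \<longleftrightarrow> p = 0"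
| "orep S p (Rec ds os) \<longleftrightarrow> 0 < p \<and> p + length ds + length os \<le> length S \<and>
    (\<forall>i<length ds. S ! (p + i) = ds ! i) \<and>
    (\<forall>i\<in>{..<length os}. orep S (S ! (p + length ds + i)) (os ! i))"
  by pat_completeness auto
termination
proof (relation "measure (\<lambda>(S, p, x). size x)", simp)
  fix S ds :: "nat list" and p i :: nat and os :: "obj list"
  assume "i \<in> {..<length os}"
  then have "os ! i \<in> set os" by simp
  then show "((S, S ! (p + length ds + i), os ! i), S, p, Rec ds os) \<in> measure (\<lambda>(S, p, x). size x)"
    by (simp add: size_list_estimation' less_Suc_eq_le)
qed

datatype bst = BE | BN nat bst bst

fun bset :: "bst \<Rightarrow> nat set" where
  "bset BE = {}"
| "bset (BN j l r) = insert j (bset l \<union> bset r)"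

fun bheight :: "bst \<Rightarrow> nat" where
  "bheight BE = 0"
| "bheight (BN j l r) = Suc (max (bheight l) (bheight r))"

fun bobj :: "(nat \<Rightarrow> nat) \<Rightarrow> bst \<Rightarrow> obj" where
  "bobj row BE = Null"
| "bobj row (BN j l r) = Rec [row j] [bobj row l, bobj row r]"

text \<open>A linked list with one search tree per word position. The parser follows it in step with
  its position and needs no index arithmetic.\<close>

fun aobj :: "(nat \<Rightarrow> nat) \<Rightarrow> bst list \<Rightarrow> obj" where
  "aobj row [] = Null"
| "aobj row (b # bs) = Rec [] [bobj row b, aobj row bs]"

text \<open>The lexicographic order of the word sequences from \<open>q\<close> to \<open>Q\<close>:
  at the first difference, if there is one, \<open>f\<close> is smaller.\<close>

definition lexle :: "nat \<Rightarrow> nat \<Rightarrow> (nat \<Rightarrow> nat) \<Rightarrow> (nat \<Rightarrow> nat) \<Rightarrow> bool" where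
  "lexle Q q f g \<longleftrightarrow> (\<forall>r. q \<le> r \<longrightarrow> r \<le> Q \<longrightarrow> (\<forall>s. q \<le> s \<longrightarrow> s < r \<longrightarrow> f s = g s) \<longrightarrow> f r \<le> g r)"

definition copy_query :: cmd where
  "copy_query =
    Ops [VZero 20, VZero 21, VLess 26 21 xQHAT] ;;
    While 26 (Ops [VQuery 34 20, VStoreW 21 34, VAdd 20 20 xONE, VAdd 21 21 xREC, VLess 26 21 xQHAT]) ;;
    Ops [VStoreW xQHAT xONE]"

definition compare_words :: "vop list" where
  "compare_words =
    [VAdd 34 28 31, VLoad 34 34, VLoadW 35 31, VXor 36 34 35, VLess 33 xZERO 36, VSelect 32 33 xZERO xONE]"

text \<open>Variable 28 is the string at the node, 29 the best string so far and 30 the end of its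
  agreement with the query. The common prefix of the two strings tells how far string 28 agrees with
  the query without reading words again; only beyond that are words compared. The differing word
  decides between the children.\<close>

definition search_step :: cmd where
  "search_step =
    Ops [VLoad 28 27] ;; Ops (lcp_ops 29 28 21) ;; Ops [VLess 33 65 30, VSelect 31 33 65 30] ;;
    Ops compare_words ;;
    While 32 (Ops [VAdd 31 31 xREC] ;; Ops compare_words) ;;
    Ops [VLess 33 31 30, VSelect 29 33 29 28, VSelect 30 33 30 31] ;;
    Ops [VLess 33 34 35, VAdd 36 27 xONE, VAdd 37 36 xONE, VSelect 36 33 37 36, VLoad 27 36, VLess 26 xZERO 27]"

definition fill :: cmd where
  "fill = While 26 (Ops [VAdd 34 21 xONE, VStoreW 34 29, VAdd 34 34 xONE, VStoreW 34 30, VAdd 21 21 xREC,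
     VAdd 22 22 xONE, VLoad 22 22, VLess 33 30 21, VSelect 26 33 xZERO xONE])"

text \<open>Variable 23 counts the phrases that end before the sentinel. The loop flag 24 is cleared
  at the sentinel or when the count exceeds the number of errors; in the latter case 25 is cleared
  too, as a sign of failure.\<close>

definition phrase :: cmd where
  "phrase =
    Ops [VLoad 27 22, VLoad 29 27, VCopy 30 21, VOne 26] ;;
    While 26 search_step ;;
    Ops [VOne 26] ;; fill ;;
    Ops [VLess 33 xQHAT 21, VSelect 24 33 xZERO xONE, VAdd 23 23 24, VLess 33 xKMAX 23, VSelect 24 33 xZERO 24,
      VSelect 25 33 xZERO 25]"

definition parse :: cmd where
  "parse = Ops [VCopy 22 xANCH, VZero 21, VZero 23, VOne 24, VOne 25] ;; While 24 phrase"

context vm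
begin

lemma runs_eq_Ops: "vsteps xs s = Some s' \<Longrightarrow> runs (Ops xs) s (length xs) (\<lambda>x. x = s')"
  by (rule runs_Ops) auto

lemma runs_eq_Seq: "runs a s t1 (\<lambda>x. x = s1) \<Longrightarrow> runs b s1 t2 Q \<Longrightarrow> t1 + t2 \<le> t \<Longrightarrow> runs (a ;; b) s t Q"
  by (rule runs_Seq[of a s t1]) (auto elim: runs_mono)

lemma runs_eq_While:
  assumes "0 < fst s v" "fst s v < B" "runs c s t1 (\<lambda>x. x = s1)" "runs (While v c) s1 t2 Q" "Suc (t1 + t2) \<le> t"
  shows "runs (While v c) s t Q"
  by (rule runs_WhileT[OF assms(1,2) runs_mono[OF assms(3) order.refl] assms(5)]) (simp add: assms(4))

end

context layout
begin

lemma rec_inj: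
  assumes "q * rec + c = r * rec + c'" "c < rec" "c' < rec"
  shows "q = r \<and> c = c'"
proof -
  have "(q * rec + c) div rec = (r * rec + c') div rec" using assms(1) by simp
  then have "q = r" using assms(2,3) by simp
  then show ?thesis using assms(1) by simp
qed

lemma rec_eq_Suc:
  assumes "c < rec"
  shows "Suc (r * rec) = q * rec + c \<longleftrightarrow> q = r \<and> c = 1" "Suc (Suc (r * rec)) = q * rec + c \<longleftrightarrow> q = r \<and> c = 2"
proof -
  have "1 < rec" using rec by simp
  show "Suc (r * rec) = q * rec + c \<longleftrightarrow> q = r \<and> c = 1"
  proof
    assume "Suc (r * rec) = q * rec + c"
    then have "q * rec + c = r * rec + 1" by simp
    from rec_inj[OF this assms \<open>1 < rec\<close>] show "q = r \<and> c = 1" .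
  qed simp
  show "Suc (Suc (r * rec)) = q * rec + c \<longleftrightarrow> q = r \<and> c = 2"
  proof
    assume "Suc (Suc (r * rec)) = q * rec + c"
    then have "q * rec + c = r * rec + 2" by simp
    from rec_inj[OF this assms rec(2)] show "q = r \<and> c = 2" .
  qed simp
qed

section \<open>Copying the query into working memory\<close>

definition W_pw :: "nat list \<Rightarrow> nat \<Rightarrow> bool" where
  "W_pw W m \<longleftrightarrow> length W = Wn \<and> (\<forall>q<m. W ! (q * rec) = pw q)"

lemma scaled_BIG: "q \<le> Suc Qn \<Longrightarrow> q * rec < BIG"
  using mult_le_mono1[of q "Suc Qn" rec] Wn W_small by linarith

lemma copy_loop:
  assumes "env v" "W_pw W i" "i \<le> Qn" "v 20 = i" "v 21 = i * rec" "v 26 = of_bool (i < Qn)"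
  shows "runs (While 26 (Ops [VQuery 34 20, VStoreW 21 34, VAdd 20 20 xONE, VAdd 21 21 xREC, VLess 26 21 xQHAT])) (v, W, R)
    (6 * (Qn - i) + 1) (\<lambda>(v', W', R'). R' = R \<and> (\<forall>u<20. v' u = v u) \<and> W_pw W' Qn)"
  using assms
proof (induction "Qn - i" arbitrary: i v W)
  case 0
  then show ?case by (intro runs_WhileF) (auto simp: W_pw_def)
next
  case (Suc m)
  have iQ: "i < Qn" using Suc by simp
  note e = envD[OF Suc.prems(1)]
  have ix: "i * rec < Wn" using index_less[of i 0] iQ rec by simp
  have lw: "length W = Wn" using Suc.prems(2) by (simp add: W_pw_def)
  have b: "Suc i < BIG" "i * rec + rec < BIG"
  proof -
    show "i * rec + rec < BIG" using scaled_BIG[of "Suc i"] iQ by (simp add: add.commute)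
    have "Suc i * 1 \<le> Suc i * rec" using rec by (intro mult_le_mono2) simp
    then show "Suc i < BIG" using scaled_BIG[of "Suc i"] iQ by simp
  qed
  let ?v = "v(34 := pw i, 20 := Suc i, 21 := Suc i * rec, 26 := of_bool (Suc i < Qn))"
  let ?W = "W[i * rec := pw i]"
  have cmp: "rec + i * rec < Qn * rec \<longleftrightarrow> Suc i < Qn" using mult_less_cancel2[of "Suc i" rec Qn] rec by simp
  have st: "vsteps [VQuery 34 20, VStoreW 21 34, VAdd 20 20 xONE, VAdd 21 21 xREC, VLess 26 21 xQHAT] (v, W, R) = Some (?v, ?W, R)"
    using Suc.prems(4,5) e QW iQ ix lw b rec by (simp add: fun_upd_twist add.commute cmp)
  have W': "W_pw ?W (Suc i)"
    using Suc.prems(2) ix rec_inj[of _ 0 i 0] rec by (auto simp: W_pw_def nth_list_update less_Suc_eq)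
  have "runs (While 26 (Ops [VQuery 34 20, VStoreW 21 34, VAdd 20 20 xONE, VAdd 21 21 xREC, VLess 26 21 xQHAT])) (?v, ?W, R)
    (6 * (Qn - Suc i) + 1) (\<lambda>(v', W', R'). R' = R \<and> (\<forall>u<20. v' u = ?v u) \<and> W_pw W' Qn)"
    by (rule Suc.hyps(1)) (use Suc.hyps(2) W' iQ env_frame[OF Suc.prems(1)] in auto)
  then have n: "runs (While 26 (Ops [VQuery 34 20, VStoreW 21 34, VAdd 20 20 xONE, VAdd 21 21 xREC, VLess 26 21 xQHAT])) (?v, ?W, R)
    (6 * (Qn - Suc i) + 1) (\<lambda>(v', W', R'). R' = R \<and> (\<forall>u<20. v' u = v u) \<and> W_pw W' Qn)"
    by (rule runs_mono) auto
  show ?case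
    by (rule runs_eq_While[OF _ _ runs_eq_Ops[OF st] n]) (use Suc.prems(6) iQ in auto)
qed

lemma copy_query:
  assumes "env v" "length W = Wn"
  shows "runs copy_query (v, W, R) (6 * Qn + 5) (\<lambda>(v', W', R'). R' = R \<and> (\<forall>u<20. v' u = v u) \<and> W_pw W' (Suc Qn))"
proof -
  note e = envD[OF assms(1)]
  let ?v = "v(20 := 0, 21 := 0, 26 := of_bool (0 < Qn))"
  have 1: "vsteps [VZero 20, VZero 21, VLess 26 21 xQHAT] (v, W, R) = Some (?v, W, R)"
    using e rec by (simp add: fun_upd_twist)
  have env': "env ?v" by (rule env_frame[OF assms(1)]) simp
  have l: "runs (While 26 (Ops [VQuery 34 20, VStoreW 21 34, VAdd 20 20 xONE, VAdd 21 21 xREC, VLess 26 21 xQHAT])) (?v, W, R)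
    (6 * Qn + 1) (\<lambda>(v', W', R'). R' = R \<and> (\<forall>u<20. v' u = ?v u) \<and> W_pw W' Qn)"
    using copy_loop[OF env', of W 0 R] assms(2) by (simp add: W_pw_def)
  show ?thesis unfolding copy_query_def
  proof (rule runs_Ops_Seq[OF 1], rule runs_Seq[OF runs_mono[OF l order.refl]])
    fix s' assume "case s' of (v', W', R') \<Rightarrow> R' = R \<and> (\<forall>u<20. v' u = ?v u) \<and> W_pw W' Qn"
    then obtain v' W' where s': "s' = (v', W', R)" "\<forall>u<20. v' u = v u" "W_pw W' Qn" by (cases s') auto
    have ix: "Qn * rec < length W'" using index_less[of Qn 0] rec s'(3) by (simp add: W_pw_def)
    have "v' 4 = Qn * rec" "v' 0 = 1" using s'(2) e by auto
    then have "vsteps [VStoreW xQHAT xONE] s' = Some (v', W'[Qn * rec := 1], R)" using ix s'(1) by simp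
    moreover have "W_pw (W'[Qn * rec := 1]) (Suc Qn)"
      using s'(3) ix rec_inj[of _ 0 Qn 0] rec pw_last by (auto simp: W_pw_def nth_list_update less_Suc_eq)
    ultimately show "runs (Ops [VStoreW xQHAT xONE]) s' 1 (\<lambda>(v', W', R'). R' = R \<and> (\<forall>u<20. v' u = v u) \<and> W_pw W' (Suc Qn))"
      by (intro runs_Ops) (use s'(2) in auto)
  qed auto
qed

section \<open>Finding a longest phrase in a search tree of suffixes\<close>

definition mis :: "nat \<Rightarrow> nat \<Rightarrow> nat" where
  "mis j q = (LEAST f. q \<le> f \<and> pw f \<noteq> dw j f)"

text \<open>The last word of the phrase that starts at \<open>q\<close>. Some string agrees with the
  query before it, while every string has a mismatch in the phrase, this word included.\<close>

definition me :: "nat \<Rightarrow> nat" where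
  "me q = Max ((\<lambda>j. mis j q) ` {..<d})"

lemma mis_props:
  assumes "j < d" "q \<le> Qn"
  shows "q \<le> mis j q" "mis j q \<le> Qn" "pw (mis j q) \<noteq> dw j (mis j q)" "\<And>r. q \<le> r \<Longrightarrow> r < mis j q \<Longrightarrow> pw r = dw j r"
proof -
  have ex: "q \<le> Qn \<and> pw Qn \<noteq> dw j Qn" using assms pw_last dw_last by simp
  show "q \<le> mis j q" "pw (mis j q) \<noteq> dw j (mis j q)"
    using LeastI[of "\<lambda>f. q \<le> f \<and> pw f \<noteq> dw j f", OF ex] unfolding mis_def by auto
  show "mis j q \<le> Qn" unfolding mis_def by (rule Least_le[of "\<lambda>f. q \<le> f \<and> pw f \<noteq> dw j f", OF ex])
  show "pw r = dw j r" if "q \<le> r" "r < mis j q" for r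
    using not_less_Least[of r "\<lambda>f. q \<le> f \<and> pw f \<noteq> dw j f"] that unfolding mis_def by blast
qed

lemma me_ge: "j < d \<Longrightarrow> mis j q \<le> me q"
  unfolding me_def by (rule Max_ge) auto

lemma me_le: "(\<And>j. j < d \<Longrightarrow> mis j q \<le> E) \<Longrightarrow> me q \<le> E"
  unfolding me_def using d_pos by (subst Max_le_iff) auto

lemma me_bound: "q \<le> Qn \<Longrightarrow> q \<le> me q \<and> me q \<le> Qn"
  using me_ge[OF d_pos, of q] mis_props[OF d_pos, of q] me_le[of q Qn] mis_props(2) by fastforce

abbreviation "wle \<equiv> lexle Qn"

fun bst_ok :: "nat \<Rightarrow> bst \<Rightarrow> bool" where
  "bst_ok q BE \<longleftrightarrow> True"
| "bst_ok q (BN j l r) \<longleftrightarrow> j < d \<and> (\<forall>i\<in>bset l. i < d \<and> wle q (dw i) (dw j)) \<and> (\<forall>i\<in>bset r. i < d \<and> wle q (dw j) (dw i)) \<and>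
    bst_ok q l \<and> bst_ok q r"

text \<open>If \<open>i \<le> j \<le> P\<close> or \<open>P \<le> j \<le> i\<close> in the lexicographic order, then \<open>j\<close> agrees with \<open>P\<close> at least as long as \<open>i\<close>.\<close>
lemma mis_mono:
  assumes "i < d" "j < d" "q \<le> Qn"
    "wle q (dw i) (dw j) \<and> dw j (mis j q) < pw (mis j q) \<or> wle q (dw j) (dw i) \<and> pw (mis j q) < dw j (mis j q)"
  shows "mis i q \<le> mis j q"
proof (rule ccontr)
  assume "\<not> mis i q \<le> mis j q"
  then have lt: "mis j q < mis i q" by simp
  note i = mis_props[OF assms(1,3)] and j = mis_props[OF assms(2,3)]
  have eq: "pw (mis j q) = dw i (mis j q)" using i(4)[OF j(1) lt] .
  have ag: "dw i s = dw j s" if "q \<le> s" "s < mis j q" for s using i(4)[of s] j(4)[of s] that lt by simp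
  from assms(4) show False
  proof
    assume a: "wle q (dw i) (dw j) \<and> dw j (mis j q) < pw (mis j q)"
    then have "dw i (mis j q) \<le> dw j (mis j q)" using j(1,2) ag unfolding lexle_def by blast
    then show False using a eq by simp
  next
    assume a: "wle q (dw j) (dw i) \<and> pw (mis j q) < dw j (mis j q)"
    then have "dw j (mis j q) \<le> dw i (mis j q)" using j(1,2) ag unfolding lexle_def by fastforce
    then show False using a eq by simp
  qed
qed

lemma compare_words:
  assumes "env v" "W_pw W (Suc Qn)" "j < d" "y \<le> Qn" "v 28 = row j" "v 31 = y * rec"
  shows "\<exists>v'. vsteps compare_words (v, W, R) = Some (v', W, R) \<and> (\<forall>u<32. v' u = v u) \<and>
    v' 32 = of_bool (pw y = dw j y) \<and> v' 34 = dw j y \<and> v' 35 = pw y"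
proof -
  note e = envD[OF assms(1)]
  have w: "y * rec < Wn" "W ! (y * rec) = pw y" "length W = Wn" using index_less[OF assms(4), of 0] rec assms(2,4) by (auto simp: W_pw_def)
  have s: "row j + y * rec < length SC" "SC ! (row j + y * rec) = dw j y" "row j + y * rec < BIG"
    using SC_dw[OF assms(3,4)] SC_small by auto
  show ?thesis
  proof (cases "dw j y = pw y")
    case True
    then show ?thesis using e w s assms(5,6) by (simp add: compare_words_def)
  next
    case False
    then show ?thesis using e w s assms(5,6) by (auto simp add: compare_words_def)
  qed
qed

lemma extend:
  assumes "env v" "W_pw W (Suc Qn)" "j < d" "q \<le> y" "y \<le> mis j q" "q \<le> Qn" "v 28 = row j" "v 31 = y * rec"
    "v 32 = of_bool (pw y = dw j y)" "v 34 = dw j y" "v 35 = pw y"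
  shows "runs (While 32 (Ops [VAdd 31 31 xREC] ;; Ops compare_words)) (v, W, R) (8 * (mis j q - y) + 1)
    (\<lambda>(v', W', R'). W' = W \<and> R' = R \<and> (\<forall>u<31. v' u = v u) \<and> v' 31 = mis j q * rec \<and>
      v' 34 = dw j (mis j q) \<and> v' 35 = pw (mis j q))"
  using assms
proof (induction "mis j q - y" arbitrary: y v)
  case 0
  then have "y = mis j q" by simp
  then show ?case using 0 mis_props(3)[OF 0(4,7)] by (intro runs_WhileF) auto
next
  case (Suc m)
  then have y: "y < mis j q" by simp
  note mp = mis_props[OF Suc.prems(3,6)]
  note e = envD[OF Suc.prems(1)]
  have b: "Suc y * rec < BIG" using scaled_BIG[of "Suc y"] y mp(2) by simp
  let ?v = "v(31 := Suc y * rec)"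
  have 1: "vsteps [VAdd 31 31 xREC] (v, W, R) = Some (?v, W, R)" using e Suc.prems(8) b by (simp add: add.commute)
  have env': "env ?v" by (rule env_frame[OF Suc.prems(1)]) simp
  obtain v' where 2: "vsteps compare_words (?v, W, R) = Some (v', W, R)" "\<forall>u<32. v' u = ?v u"
    "v' 32 = of_bool (pw (Suc y) = dw j (Suc y))" "v' 34 = dw j (Suc y)" "v' 35 = pw (Suc y)"
    using compare_words[OF env' Suc.prems(2,3), of "Suc y" R] y mp(2) Suc.prems(7) by auto
  have env2: "env v'" by (rule env_frame[OF env']) (use 2(2) in simp)
  have "runs (While 32 (Ops [VAdd 31 31 xREC] ;; Ops compare_words)) (v', W, R) (8 * (mis j q - Suc y) + 1)
    (\<lambda>(v'', W', R'). W' = W \<and> R' = R \<and> (\<forall>u<31. v'' u = v' u) \<and> v'' 31 = mis j q * rec \<and>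
      v'' 34 = dw j (mis j q) \<and> v'' 35 = pw (mis j q))"
    by (rule Suc.hyps(1)) (use Suc.hyps(2) Suc.prems y env2 2 in auto)
  then have 3: "runs (While 32 (Ops [VAdd 31 31 xREC] ;; Ops compare_words)) (v', W, R) (8 * (mis j q - Suc y) + 1)
    (\<lambda>(v'', W', R'). W' = W \<and> R' = R \<and> (\<forall>u<31. v'' u = v u) \<and> v'' 31 = mis j q * rec \<and>
      v'' 34 = dw j (mis j q) \<and> v'' 35 = pw (mis j q))"
    by (rule runs_mono) (use 2(2) in auto)
  have "pw y = dw j y" using mp(4) y Suc.prems(4) by blast
  then show ?case
    by (intro runs_eq_While[OF _ _ runs_eq_Seq[OF runs_eq_Ops[OF 1] runs_eq_Ops[OF 2(1)] order.refl] 3])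
      (use Suc.prems(9) y in \<open>auto simp: compare_words_def\<close>)
qed


lemma orep_bobj_0: "orep S p (bobj row t) \<Longrightarrow> 0 < p \<longleftrightarrow> t \<noteq> BE"
  by (cases t) auto

text \<open>If the string of the node leaves the best string before \<open>E\<close>, it leaves the
  query at the same word and one comparison suffices. Otherwise it agrees with the query up to
  \<open>E\<close> and words are compared from there. So the cost beyond a constant is charged to
  the growth of \<open>E\<close>.\<close>

lemma search_step:
  assumes "env v" "W_pw W (Suc Qn)" "orep SC (v 27) (bobj row (BN m l r))" "bst_ok q (BN m l r)"
    "q \<le> Qn" "v 21 = q * rec" "i < d" "v 29 = row i" "v 30 = E * rec" "q \<le> E" "E \<le> Qn"
    "\<And>s. q \<le> s \<Longrightarrow> s < E \<Longrightarrow> pw s = dw i s"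
  defines "t' \<equiv> (if dw m (mis m q) < pw (mis m q) then r else l)" and "E' \<equiv> max E (mis m q)"
  shows "runs search_step (v, W, R) (36 + 8 * (E' - E)) (\<lambda>(v', W', R'). W' = W \<and> R' = R \<and> (\<forall>u<26. v' u = v u) \<and>
    orep SC (v' 27) (bobj row t') \<and> v' 26 = of_bool (t' \<noteq> BE) \<and> v' 30 = E' * rec \<and>
    (\<exists>j<d. v' 29 = row j \<and> (\<forall>s. q \<le> s \<longrightarrow> s < E' \<longrightarrow> pw s = dw j s)))"
proof -
  note e = envD[OF assms(1)]
  have m: "m < d" using assms(4) by simp
  define p where "p = v 27"
  have o: "p + 3 \<le> length SC" "SC ! p = row m" "orep SC (SC ! Suc p) (bobj row l)" "orep SC (SC ! Suc (Suc p)) (bobj row r)"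
    using assms(3) by (auto simp: p_def numeral_3_eq_3 lessThan_Suc)
  note mp = mis_props[OF m assms(5)]
  define f where "f = mis m q"
  define v1 where "v1 = v(28 := row m)"
  have 1: "vsteps [VLoad 28 27] (v, W, R) = Some (v1, W, R)" using o by (simp add: p_def v1_def)
  have env1: "env v1" by (rule env_frame[OF assms(1)]) (simp add: v1_def)
  have vv1: "v1 29 = row i" "v1 28 = row m" "v1 21 = q * rec" using assms(6,8) by (simp_all add: v1_def)
  obtain v2 where 2: "vsteps (lcp_ops 29 28 21) (v1, W, R) = Some (v2, W, R)" "v2 65 = lc i m q * rec" "\<forall>u<60. v2 u = v1 u"
    using lcp_ops[OF env1 assms(7) m assms(5) vv1, of W R] by auto
  define y where "y = min (lc i m q) E"
  have c: "q \<le> lc i m q" "\<And>s. q \<le> s \<Longrightarrow> s < lc i m q \<Longrightarrow> dw i s = dw m s"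
     "lc i m q \<le> Qn \<Longrightarrow> dw i (lc i m q) \<noteq> dw m (lc i m q)"
    using lc[OF assms(7) m assms(5)] by auto
  have y: "q \<le> y" "y \<le> Qn" "y \<le> E" using c(1) assms(10,11) by (auto simp: y_def)
  have agy: "pw s = dw m s" if "q \<le> s" "s < y" for s using that c(2)[of s] assms(12)[of s] by (simp add: y_def)
  have yf: "y \<le> f" using agy mp(1,3) unfolding f_def by (metis not_le)
  have yE: "f = y" if "y < E"
  proof -
    have "y = lc i m q" using that by (simp add: y_def)
    then have "pw y \<noteq> dw m y" using c(3) y(2) assms(12)[of y] y(1) that by simp
    then show ?thesis using mp(4)[of y] y(1) yf unfolding f_def by (metis le_neq_implies_less)
  qed
  define a1 where "a1 = lc i m q * rec"
  define a2 where "a2 = E * rec"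
  have sel: "(if a1 < a2 then a1 else a2) = y * rec" unfolding a1_def a2_def using rec by (auto simp: y_def min_def)
  define v3 where "v3 = v2(33 := of_bool (a1 < a2), 31 := y * rec)"
  have vv2: "v2 65 = a1" "v2 30 = a2" using 2(2,3) assms(9) by (auto simp: a1_def a2_def v1_def)
  have 3: "vsteps [VLess 33 65 30, VSelect 31 33 65 30] (v2, W, R) = Some (v3, W, R)"
    using sel by (simp add: vv2 v3_def split: if_splits)
  have fr3: "v3 u = v1 u" if "u < 31" for u using 2(3) that by (simp add: v3_def)
  have env3: "env v3" by (rule env_frame[OF env1]) (simp add: fr3)
  have vv3: "v3 28 = row m" "v3 31 = y * rec" using fr3 by (simp_all add: v1_def, simp add: v3_def)
  obtain v4 where 4: "vsteps compare_words (v3, W, R) = Some (v4, W, R)" "\<forall>u<32. v4 u = v3 u"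
    "v4 32 = of_bool (pw y = dw m y)" "v4 34 = dw m y" "v4 35 = pw y"
    using compare_words[OF env3 assms(2) m y(2) vv3, of R] by blast
  have env4: "env v4" by (rule env_frame[OF env3]) (use 4(2) in simp)
  have vv4: "v4 28 = row m" "v4 31 = y * rec" using 4(2) fr3 by (auto simp: v1_def v3_def)
  note ext = extend[OF env4 assms(2) m y(1) yf[unfolded f_def] assms(5) vv4 4(3-5), of R, folded f_def]
  have fE: "(if f < E then E else f) = E'" by (auto simp: E'_def f_def max_def)
  have rest: "runs (Ops [VLess 33 31 30, VSelect 29 33 29 28, VSelect 30 33 30 31] ;;
      Ops [VLess 33 34 35, VAdd 36 27 xONE, VAdd 37 36 xONE, VSelect 36 33 37 36, VLoad 27 36, VLess 26 xZERO 27]) (v', W, R) 9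
     (\<lambda>(v', W', R'). W' = W \<and> R' = R \<and> (\<forall>u<26. v' u = v u) \<and>
    orep SC (v' 27) (bobj row t') \<and> v' 26 = of_bool (t' \<noteq> BE) \<and> v' 30 = E' * rec \<and>
    (\<exists>j<d. v' 29 = row j \<and> (\<forall>s. q \<le> s \<longrightarrow> s < E' \<longrightarrow> pw s = dw j s)))"
    if v': "\<forall>u<31. v' u = v4 u" "v' 31 = f * rec" "v' 34 = dw m f" "v' 35 = pw f" for v'
  proof -
    have fr: "v' u = v1 u" if "u < 31" for u using v'(1) 4(2) fr3 that by simp
    define b where "b = (f * rec < E * rec)"
    have b: "b \<longleftrightarrow> f < E" using rec by (simp add: b_def)
    define v5 where "v5 = v'(33 := of_bool b, 29 := if b then row i else row m, 30 := E' * rec)"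
    have s5: "v' 29 = row i" "v' 28 = row m" "v' 30 = E * rec" "v' 27 = p" "v' 0 = 1" "v' 13 = 0"
      using fr e assms(8,9) by (auto simp: v1_def p_def)
    have 5: "vsteps [VLess 33 31 30, VSelect 29 33 29 28, VSelect 30 33 30 31] (v', W, R) = Some (v5, W, R)"
    proof (cases b)
      case True
      then have "E' = E" using b fE by auto
      then show ?thesis using s5 v'(2) True by (simp add: v5_def b_def fun_upd_twist)
    next
      case False
      then have "E' = f" "\<not> f < E" using b fE by auto
      then show ?thesis using s5 v'(2) False by (simp add: v5_def b_def fun_upd_twist)
    qed
    define p' where "p' = (if dw m f < pw f then Suc (Suc p) else Suc p)"
    define v6 where "v6 = v5(33 := of_bool (dw m f < pw f), 37 := Suc (Suc p), 36 := p', 27 := SC ! p', 26 := of_bool (0 < SC ! p'))"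
    have s6: "v5 27 = p" "v5 0 = 1" "v5 13 = 0" "v5 34 = dw m f" "v5 35 = pw f" using s5 v' by (simp_all add: v5_def)
    have lp: "Suc (Suc p) < length SC" "Suc (Suc p) < BIG" "Suc p < BIG" "Suc p < length SC" using o(1) SC_small by auto
    have 6: "vsteps [VLess 33 34 35, VAdd 36 27 xONE, VAdd 37 36 xONE, VSelect 36 33 37 36, VLoad 27 36, VLess 26 xZERO 27] (v5, W, R) = Some (v6, W, R)"
      using s6 lp by (cases "dw m f < pw f") (simp_all add: v6_def p'_def fun_upd_twist)
    have orep': "orep SC (SC ! p') (bobj row t')" using o(3,4) by (simp add: p'_def t'_def f_def)
    have "\<exists>j<d. v6 29 = row j \<and> (\<forall>s. q \<le> s \<longrightarrow> s < E' \<longrightarrow> pw s = dw j s)"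
    proof (cases b)
      case True
      then show ?thesis using assms(7,12) fE b by (intro exI[of _ i]) (auto simp: v6_def v5_def)
    next
      case False
      then show ?thesis using m mp(4) fE b by (intro exI[of _ m]) (auto simp: v6_def v5_def f_def[symmetric])
    qed
    moreover have "\<forall>u<26. v6 u = v u" using fr by (simp add: v6_def v5_def v1_def)
    ultimately show ?thesis using orep' orep_bobj_0[OF orep']
      by (intro runs_Ops_Seq[OF 5 runs_Ops[OF 6], of _ 6]) (auto simp: v6_def v5_def)
  qed
  have time: "8 * (f - y) + 1 + 9 \<le> 10 + 8 * (E' - E)" using yE fE y(3) by (cases "y < E") (auto split: if_splits)
  show ?thesis unfolding search_step_def
  proof (rule runs_Ops_Seq[OF 1], rule runs_Ops_Seq[OF 2(1)], rule runs_Ops_Seq[OF 3], rule runs_Ops_Seq[OF 4(1)],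
      rule runs_Seq[OF runs_mono[OF ext order.refl] time])
    fix s' assume "case s' of (v', W', R') \<Rightarrow> W' = W \<and> R' = R \<and> (\<forall>u<31. v' u = v4 u) \<and> v' 31 = f * rec \<and> v' 34 = dw m f \<and> v' 35 = pw f"
    then obtain v' where "s' = (v', W, R)" "\<forall>u<31. v' u = v4 u" "v' 31 = f * rec" "v' 34 = dw m f" "v' 35 = pw f" by (cases s') auto
    then show "runs (Ops [VLess 33 31 30, VSelect 29 33 29 28, VSelect 30 33 30 31] ;;
      Ops [VLess 33 34 35, VAdd 36 27 xONE, VAdd 37 36 xONE, VSelect 36 33 37 36, VLoad 27 36, VLess 26 xZERO 27]) s' 9
     (\<lambda>(v', W', R'). W' = W \<and> R' = R \<and> (\<forall>u<26. v' u = v u) \<and>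
    orep SC (v' 27) (bobj row t') \<and> v' 26 = of_bool (t' \<noteq> BE) \<and> v' 30 = E' * rec \<and>
    (\<exists>j<d. v' 29 = row j \<and> (\<forall>s. q \<le> s \<longrightarrow> s < E' \<longrightarrow> pw s = dw j s)))" using rest by blast
  qed (auto simp: lcp_ops_def compare_words_def)
qed

text \<open>The last hypothesis says that no string outside the remaining subtree can beat
  \<open>E\<close>. It holds initially because the tree contains all strings, and
  \<open>mis_mono\<close> preserves it when a side is discarded. At an empty subtree it gives
  \<open>E = me q\<close>. The costs of extension telescope to \<open>me q - E\<close>.\<close>

lemma search:
  assumes "env v" "W_pw W (Suc Qn)" "orep SC (v 27) (bobj row t)" "bst_ok q t" "v 26 = of_bool (t \<noteq> BE)"
    "q \<le> Qn" "v 21 = q * rec" "i < d" "v 29 = row i" "v 30 = E * rec" "q \<le> E" "E \<le> me q"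
    "\<forall>s. q \<le> s \<longrightarrow> s < E \<longrightarrow> pw s = dw i s" "\<forall>j<d. j \<notin> bset t \<longrightarrow> mis j q \<le> E"
  shows "runs (While 26 search_step) (v, W, R) (37 * bheight t + 8 * (me q - E) + 1)
    (\<lambda>(v', W', R'). W' = W \<and> R' = R \<and> (\<forall>u<26. v' u = v u) \<and> v' 30 = me q * rec \<and>
    (\<exists>j<d. v' 29 = row j \<and> (\<forall>s. q \<le> s \<longrightarrow> s < me q \<longrightarrow> pw s = dw j s)))"
  using assms
proof (induction "bheight t" arbitrary: t v i E rule: less_induct)
  case less
  show ?case
  proof (cases t)
    case BE
    then have "me q \<le> E" using less.prems(14) me_le by simp
    then have "me q = E" using less.prems(12) by simp
    then show ?thesis using less.prems BE by (intro runs_WhileF) auto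
  next
    case (BN m l r)
    define t' where "t' = (if dw m (mis m q) < pw (mis m q) then r else l)"
    define E' where "E' = max E (mis m q)"
    have m: "m < d" using less.prems(4) BN by simp
    have EQ: "E \<le> Qn" using less.prems(6,12) me_bound[of q] by simp
    have E': "E \<le> E'" "E' \<le> me q" using less.prems(12) me_ge[OF m] by (auto simp: E'_def)
    have ih: "runs (While 26 search_step) (v', W, R) (37 * bheight t' + 8 * (me q - E') + 1)
      (\<lambda>(v', W', R'). W' = W \<and> R' = R \<and> (\<forall>u<26. v' u = v u) \<and> v' 30 = me q * rec \<and>
      (\<exists>j<d. v' 29 = row j \<and> (\<forall>s. q \<le> s \<longrightarrow> s < me q \<longrightarrow> pw s = dw j s)))"
      if "\<forall>u<26. v' u = v u" "orep SC (v' 27) (bobj row t')" "v' 26 = of_bool (t' \<noteq> BE)" "v' 30 = E' * rec"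
         "j < d" "v' 29 = row j" "\<forall>s. q \<le> s \<longrightarrow> s < E' \<longrightarrow> pw s = dw j s" for v' j
    proof -
      have A: "\<forall>k<d. k \<notin> bset t' \<longrightarrow> mis k q \<le> E'"
      proof (intro allI impI)
        fix k assume k: "k < d" "k \<notin> bset t'"
        show "mis k q \<le> E'"
        proof (cases "k \<in> bset t")
          case False
          then show ?thesis using less.prems(14) k E' by fastforce
        next
          case True
          have ne: "dw m (mis m q) \<noteq> pw (mis m q)" using mis_props(3)[OF m less.prems(6)] by simp
          consider "k = m" | "k \<in> bset l" "dw m (mis m q) < pw (mis m q)" | "k \<in> bset r" "pw (mis m q) < dw m (mis m q)"
            using True k(2) ne BN unfolding t'_def by (auto split: if_splits)
          then have "mis k q \<le> mis m q"
          proof cases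
            case 2
            then show ?thesis using less.prems(4) BN by (intro mis_mono[OF k(1) m less.prems(6)]) auto
          next
            case 3
            then show ?thesis using less.prems(4) BN by (intro mis_mono[OF k(1) m less.prems(6)]) auto
          qed simp
          then show ?thesis by (simp add: E'_def)
        qed
      qed
      have "env v'" by (rule env_frame[OF less.prems(1)]) (use that(1) in simp)
      then have "runs (While 26 search_step) (v', W, R) (37 * bheight t' + 8 * (me q - E') + 1)
        (\<lambda>(v'', W', R'). W' = W \<and> R' = R \<and> (\<forall>u<26. v'' u = v' u) \<and> v'' 30 = me q * rec \<and>
        (\<exists>j<d. v'' 29 = row j \<and> (\<forall>s. q \<le> s \<longrightarrow> s < me q \<longrightarrow> pw s = dw j s)))"
        using less.prems that E' A BN by (intro less.hyps[of t' v' j E']) (auto simp: t'_def)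
      then show ?thesis by (rule runs_mono) (use that(1) in auto)
    qed
    have ss: "runs search_step (v, W, R) (36 + 8 * (E' - E)) (\<lambda>(v', W', R'). W' = W \<and> R' = R \<and> (\<forall>u<26. v' u = v u) \<and>
      orep SC (v' 27) (bobj row t') \<and> v' 26 = of_bool (t' \<noteq> BE) \<and> v' 30 = E' * rec \<and>
      (\<exists>j<d. v' 29 = row j \<and> (\<forall>s. q \<le> s \<longrightarrow> s < E' \<longrightarrow> pw s = dw j s)))"
      unfolding t'_def E'_def
      by (rule search_step[OF less.prems(1,2) less.prems(3,4)[unfolded BN] less.prems(6-11) EQ]) (use less.prems(13) in auto)
    have bh: "Suc (bheight t') \<le> bheight t" unfolding BN t'_def by simp
    show ?thesis
    proof (rule runs_WhileT[OF _ _ runs_mono[OF ss order.refl]])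
      fix s' assume "case s' of (v', W', R') \<Rightarrow> W' = W \<and> R' = R \<and> (\<forall>u<26. v' u = v u) \<and>
        orep SC (v' 27) (bobj row t') \<and> v' 26 = of_bool (t' \<noteq> BE) \<and> v' 30 = E' * rec \<and>
        (\<exists>j<d. v' 29 = row j \<and> (\<forall>s. q \<le> s \<longrightarrow> s < E' \<longrightarrow> pw s = dw j s))"
      then obtain v' j where "s' = (v', W, R)" "\<forall>u<26. v' u = v u" "orep SC (v' 27) (bobj row t')" "v' 26 = of_bool (t' \<noteq> BE)"
        "v' 30 = E' * rec" "j < d" "v' 29 = row j" "\<forall>s. q \<le> s \<longrightarrow> s < E' \<longrightarrow> pw s = dw j s" by (cases s') auto
      then show "runs (While 26 search_step) s' (37 * bheight t' + 8 * (me q - E') + 1)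
         (\<lambda>(v', W', R'). W' = W \<and> R' = R \<and> (\<forall>u<26. v' u = v u) \<and> v' 30 = me q * rec \<and>
        (\<exists>j<d. v' 29 = row j \<and> (\<forall>s. q \<le> s \<longrightarrow> s < me q \<longrightarrow> pw s = dw j s)))" using ih by blast
    next
      show "Suc (36 + 8 * (E' - E) + (37 * bheight t' + 8 * (me q - E') + 1)) \<le> 37 * bheight t + 8 * (me q - E) + 1"
        using E' bh by (simp add: algebra_simps)
    qed (use less.prems(5) BN in auto)
  qed
qed

section \<open>Recording the phrases and the parsing loop\<close>

definition filled :: "nat \<Rightarrow> nat \<Rightarrow> nat \<Rightarrow> nat list \<Rightarrow> nat list \<Rightarrow> bool" where
  "filled r E j W W' \<longleftrightarrow> length W' = length W \<and>
    (\<forall>q. r \<le> q \<longrightarrow> q \<le> E \<longrightarrow> W' ! (q * rec + 1) = row j \<and> W' ! (q * rec + 2) = E * rec) \<and>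
    (\<forall>q\<le>Qn. \<forall>c<rec. (q < r \<or> E < q \<or> c = 0) \<longrightarrow> W' ! (q * rec + c) = W ! (q * rec + c))"

lemma fill:
  fixes bs :: "nat \<Rightarrow> bst"
  assumes "env v" "length W = Wn" "orep SC (v 22) (aobj row (map bs [r..<Suc Qn]))" "v 21 = r * rec" "v 29 = row j" "v 30 = E * rec"
    "v 26 = of_bool (r \<le> E)" "r \<le> Suc E" "E \<le> Qn"
  shows "runs fill (v, W, R) (10 * (Suc E - r) + 1) (\<lambda>(v', W', R'). R' = R \<and> (\<forall>u<20. v' u = v u) \<and>
    (\<forall>u\<in>{23, 24, 25}. v' u = v u) \<and> v' 21 = Suc E * rec \<and> orep SC (v' 22) (aobj row (map bs [Suc E..<Suc Qn])) \<and> filled r E j W W')"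
  using assms
proof (induction "Suc E - r" arbitrary: r v W)
  case 0
  then have "r = Suc E" by simp
  then show ?case using 0 unfolding fill_def by (intro runs_WhileF) (auto simp: filled_def)
next
  case (Suc n)
  have r: "r \<le> E" "r \<le> Qn" using Suc by auto
  note e = envD[OF Suc.prems(1)]
  define p where "p = v 22"
  have "[r..<Suc Qn] = r # [Suc r..<Suc Qn]" using r(2) by (simp add: upt_conv_Cons)
  then have "orep SC p (Rec [] [bobj row (bs r), aobj row (map bs [Suc r..<Suc Qn])])" using Suc.prems(3) by (simp only: p_def list.map aobj.simps)
  then have o: "p + 2 \<le> length SC" "orep SC (SC ! Suc p) (aobj row (map bs [Suc r..<Suc Qn]))"
    by (auto simp: lessThan_Suc)
  have pB: "Suc p < BIG" "Suc p < length SC" using o(1) SC_small by auto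
  have ix: "Suc (r * rec) < Wn" "Suc (Suc (r * rec)) < Wn" using index_less[OF r(2), of 1] index_less[OF r(2), of 2] rec by auto
  have b: "Suc (r * rec) < BIG" "Suc (Suc (r * rec)) < BIG" "rec + r * rec < BIG" using ix W_small scaled_BIG[of "Suc r"] r(2) by auto
  define W' where "W' = W[Suc (r * rec) := row j, Suc (Suc (r * rec)) := E * rec]"
  define v' where "v' = v(34 := Suc (Suc (r * rec)), 21 := Suc r * rec, 22 := SC ! Suc p, 33 := of_bool (E < Suc r), 26 := of_bool (Suc r \<le> E))"
  have cmp: "E * rec < rec + r * rec \<longleftrightarrow> E < Suc r" using mult_less_cancel2[of E rec "Suc r"] rec by simp
  have st: "vsteps [VAdd 34 21 xONE, VStoreW 34 29, VAdd 34 34 xONE, VStoreW 34 30, VAdd 21 21 xREC,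
     VAdd 22 22 xONE, VLoad 22 22, VLess 33 30 21, VSelect 26 33 xZERO xONE] (v, W, R) = Some (v', W', R)"
  proof (cases "E < Suc r")
    case True
    then show ?thesis using Suc.prems(2,4-6) e ix b pB by (simp add: cmp v'_def W'_def p_def[symmetric] fun_upd_twist add.commute)
  next
    case False
    then have "Suc r \<le> E" by simp
    then show ?thesis using False Suc.prems(2,4-6) e ix b pB by (simp add: cmp v'_def W'_def p_def[symmetric] fun_upd_twist add.commute)
  qed
  have env': "env v'" by (rule env_frame[OF Suc.prems(1)]) (simp add: v'_def)
  have "runs fill (v', W', R) (10 * (Suc E - Suc r) + 1) (\<lambda>(v'', W'', R'). R' = R \<and> (\<forall>u<20. v'' u = v' u) \<and>
    (\<forall>u\<in>{23, 24, 25}. v'' u = v' u) \<and> v'' 21 = Suc E * rec \<and> orep SC (v'' 22) (aobj row (map bs [Suc E..<Suc Qn])) \<and> filled (Suc r) E j W' W'')"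
    by (rule Suc.hyps(1)) (use Suc.hyps(2) Suc.prems env' o r in \<open>auto simp: v'_def W'_def\<close>)
  then have n: "runs fill (v', W', R) (10 * (Suc E - Suc r) + 1) (\<lambda>(v'', W'', R'). R' = R \<and> (\<forall>u<20. v'' u = v u) \<and>
    (\<forall>u\<in>{23, 24, 25}. v'' u = v u) \<and> v'' 21 = Suc E * rec \<and> orep SC (v'' 22) (aobj row (map bs [Suc E..<Suc Qn])) \<and> filled r E j W W'')"
  proof (rule runs_mono[OF _ order.refl])
    fix s' assume s': "case s' of (v'', W'', R') \<Rightarrow> R' = R \<and> (\<forall>u<20. v'' u = v' u) \<and>
    (\<forall>u\<in>{23, 24, 25}. v'' u = v' u) \<and> v'' 21 = Suc E * rec \<and> orep SC (v'' 22) (aobj row (map bs [Suc E..<Suc Qn])) \<and> filled (Suc r) E j W' W''"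
    obtain v'' W'' where s: "s' = (v'', W'', R)" and f: "filled (Suc r) E j W' W''" using s' by (cases s') auto
    have lW: "length W = Wn" by (rule Suc.prems(2))
    have old: "W' ! (q * rec + c) = (if q = r \<and> c = 1 then row j else if q = r \<and> c = 2 then E * rec else W ! (q * rec + c))"
      if "q \<le> Qn" "c < rec" for q c
    proof -
      have "Suc (r * rec) = q * rec + c \<longleftrightarrow> q = r \<and> c = 1" "Suc (Suc (r * rec)) = q * rec + c \<longleftrightarrow> q = r \<and> c = 2"
        by (rule rec_eq_Suc[OF that(2)])+
      then show ?thesis using ix lW unfolding W'_def by (simp add: nth_list_update)
    qed
    have k: "W'' ! (r * rec + c) = W' ! (r * rec + c)" if "c < rec" for c using f r(2) that unfolding filled_def by auto
    have new: "W'' ! (r * rec + 1) = row j \<and> W'' ! (r * rec + 2) = E * rec"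
      using k[of 1] k[of 2] old[OF r(2), of 1] old[OF r(2), of 2] rec by simp
    have "filled r E j W W''"
      unfolding filled_def
    proof (intro conjI allI impI)
      show "length W'' = length W" using f by (simp add: filled_def W'_def)
      fix q assume q: "r \<le> q" "q \<le> E"
      show "W'' ! (q * rec + 1) = row j" "W'' ! (q * rec + 2) = E * rec"
        using f new q unfolding filled_def by (cases "q = r"; auto)+
    next
      fix q c assume "q \<le> Qn" "c < rec" "q < r \<or> E < q \<or> c = 0"
      moreover from this have "W'' ! (q * rec + c) = W' ! (q * rec + c)" using f unfolding filled_def by auto
      ultimately show "W'' ! (q * rec + c) = W ! (q * rec + c)" using old[of q c] r(1) by auto
    qed
    then show "case s' of (v'', W'', R') \<Rightarrow> R' = R \<and> (\<forall>u<20. v'' u = v u) \<and>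
    (\<forall>u\<in>{23, 24, 25}. v'' u = v u) \<and> v'' 21 = Suc E * rec \<and> orep SC (v'' 22) (aobj row (map bs [Suc E..<Suc Qn])) \<and> filled r E j W W''"
      using s' unfolding s by (auto simp: v'_def)
  qed
  show ?case unfolding fill_def
    by (rule runs_eq_While[OF _ _ runs_eq_Ops[OF st] n[unfolded fill_def]]) (use Suc.prems(7) r in auto)
qed


text \<open>Every finished phrase contains a mismatching word for each string, and phrases are
  disjoint; this is what the cardinality records. The claim about the following phrase is guarded by
  \<open>Suc (Et r) < q\<close>, as that phrase may not have been parsed yet;
  \<open>parsed_extend\<close> supplies it later.\<close>

definition parsed :: "nat \<Rightarrow> nat \<Rightarrow> nat list \<Rightarrow> (nat \<Rightarrow> nat) \<Rightarrow> (nat \<Rightarrow> nat) \<Rightarrow> bool" where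
  "parsed q cnt W Jt Et \<longleftrightarrow> W_pw W (Suc Qn) \<and>
    (\<forall>r<q. W ! (r * rec + 1) = row (Jt r) \<and> W ! (r * rec + 2) = Et r * rec \<and> Jt r < d \<and> r \<le> Et r \<and> Et r < q \<and>
      (\<forall>s. r \<le> s \<longrightarrow> s < Et r \<longrightarrow> pw s = dw (Jt r) s) \<and>
      (Suc (Et r) < q \<longrightarrow> (\<forall>j<d. \<exists>s. Et r < s \<and> s \<le> Et (Suc (Et r)) \<and> pw s \<noteq> dw j s))) \<and>
    (\<forall>j<d. cnt \<le> card {s. s < q \<and> pw s \<noteq> dw j s})"

lemma parsed_extend:
  assumes "parsed q cnt W Jt Et" "q \<le> Qn" "filled q (me q) j W W'" "j < d"
    "\<forall>s. q \<le> s \<longrightarrow> s < me q \<longrightarrow> pw s = dw j s"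
  defines "Jt' \<equiv> (\<lambda>r. if r < q then Jt r else j)" and "Et' \<equiv> (\<lambda>r. if r < q then Et r else me q)"
  shows "parsed (Suc (me q)) (Suc cnt) W' Jt' Et'"
proof -
  note E = me_bound[OF assms(2)]
  have keep: "W' ! (r * rec + c) = W ! (r * rec + c)" if "r \<le> Qn" "c < rec" "r < q \<or> me q < r \<or> c = 0" for r c
    using assms(3) that unfolding filled_def by blast
  have "W' ! (r * rec) = W ! (r * rec)" if "r \<le> Qn" for r using keep[OF that, of 0] rec by simp
  then have 1: "W_pw W' (Suc Qn)" using assms(1,3) by (auto simp: parsed_def W_pw_def filled_def)
  have every: "\<exists>s. q \<le> s \<and> s \<le> me q \<and> pw s \<noteq> dw k s" if "k < d" for k
    using mis_props[OF that assms(2)] me_ge[OF that, of q] by (intro exI[of _ "mis k q"]) auto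
  have 2: "Suc cnt \<le> card {s. s < Suc (me q) \<and> pw s \<noteq> dw k s}" if k: "k < d" for k
  proof -
    obtain s where s: "q \<le> s" "s \<le> me q" "pw s \<noteq> dw k s" using every[OF k] by blast
    have "Suc cnt \<le> card (insert s {s. s < q \<and> pw s \<noteq> dw k s})" using assms(1) k s by (simp add: parsed_def)
    also have "\<dots> \<le> card {s. s < Suc (me q) \<and> pw s \<noteq> dw k s}" using s E by (intro card_mono) auto
    finally show ?thesis .
  qed
  have 3: "W' ! (r * rec + 1) = row (Jt' r) \<and> W' ! (r * rec + 2) = Et' r * rec \<and> Jt' r < d \<and> r \<le> Et' r \<and> Et' r < Suc (me q) \<and>
      (\<forall>s. r \<le> s \<longrightarrow> s < Et' r \<longrightarrow> pw s = dw (Jt' r) s) \<and>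
      (Suc (Et' r) < Suc (me q) \<longrightarrow> (\<forall>j<d. \<exists>s. Et' r < s \<and> s \<le> Et' (Suc (Et' r)) \<and> pw s \<noteq> dw j s))"
    if r: "r < Suc (me q)" for r
  proof (cases "r < q")
    case True
    have o: "W ! (r * rec + 1) = row (Jt r)" "W ! (r * rec + 2) = Et r * rec" "Jt r < d" "r \<le> Et r" "Et r < q"
      "\<forall>s. r \<le> s \<longrightarrow> s < Et r \<longrightarrow> pw s = dw (Jt r) s"
      "Suc (Et r) < q \<Longrightarrow> \<forall>j<d. \<exists>s. Et r < s \<and> s \<le> Et (Suc (Et r)) \<and> pw s \<noteq> dw j s"
      using assms(1) True unfolding parsed_def by blast+
    have k: "W' ! (r * rec + 1) = W ! (r * rec + 1)" "W' ! (r * rec + 2) = W ! (r * rec + 2)"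
      using keep[of r 1] keep[of r 2] True assms(2) rec by auto
    have "\<forall>j<d. \<exists>s. Et r < s \<and> s \<le> Et' (Suc (Et r)) \<and> pw s \<noteq> dw j s"
    proof (cases "Suc (Et r) < q")
      case False
      then have "Suc (Et r) = q" using o(5) by simp
      then show ?thesis using every by (auto simp: Et'_def Suc_le_eq)
    qed (use o(7) in \<open>simp add: Et'_def\<close>)
    then show ?thesis using o k True E by (simp add: Jt'_def Et'_def)
  next
    case False
    then show ?thesis using assms(3-5) r unfolding filled_def by (simp add: Jt'_def Et'_def)
  qed
  show ?thesis unfolding parsed_def using 1 2 3 by blast
qed

lemma phrase:
  fixes bs :: "nat \<Rightarrow> bst"
  assumes "env v" "parsed q cnt W Jt Et" "q \<le> Qn" "cnt \<le> kmax" "kmax < BIG - 1" "v 21 = q * rec" "v 23 = cnt" "v 25 = 1"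
    "orep SC (v 22) (aobj row (map bs [q..<Suc Qn]))" "bst_ok q (bs q)" "bset (bs q) = {..<d}"
  shows "runs phrase (v, W, R) (37 * bheight (bs q) + 18 * (Suc (me q) - q) + 13) (\<lambda>(v', W', R'). R' = R \<and> (\<forall>u<20. v' u = v u) \<and>
    (\<exists>Jt Et. parsed (Suc (me q)) (Suc cnt) W' Jt Et) \<and> v' 21 = Suc (me q) * rec \<and> v' 23 = (if me q < Qn then Suc cnt else cnt) \<and>
    v' 24 = of_bool (me q < Qn \<and> cnt < kmax) \<and> v' 25 = of_bool (\<not> (me q < Qn \<and> kmax \<le> cnt)) \<and>
    orep SC (v' 22) (aobj row (map bs [Suc (me q)..<Suc Qn])))"
proof -
  let ?Q = "\<lambda>(v', W', R'). R' = R \<and> (\<forall>u<20. v' u = v u) \<and>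
    (\<exists>Jt Et. parsed (Suc (me q)) (Suc cnt) W' Jt Et) \<and> v' 21 = Suc (me q) * rec \<and> v' 23 = (if me q < Qn then Suc cnt else cnt) \<and>
    v' 24 = of_bool (me q < Qn \<and> cnt < kmax) \<and> v' 25 = of_bool (\<not> (me q < Qn \<and> kmax \<le> cnt)) \<and>
    orep SC (v' 22) (aobj row (map bs [Suc (me q)..<Suc Qn]))"
  note e = envD[OF assms(1)]
  note E = me_bound[OF assms(3)]
  define p where "p = v 22"
  have "[q..<Suc Qn] = q # [Suc q..<Suc Qn]" using assms(3) by (simp add: upt_conv_Cons)
  then have o: "orep SC p (Rec [] [bobj row (bs q), aobj row (map bs [Suc q..<Suc Qn])])" using assms(9) by (simp only: p_def list.map aobj.simps)
  then have o1: "p + 2 \<le> length SC" "orep SC (SC ! p) (bobj row (bs q))" by (auto simp: lessThan_Suc)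
  obtain i l r where t: "bs q = BN i l r" using assms(11) d_pos by (cases "bs q") auto
  have i: "i < d" using assms(10) t by simp
  have o2: "SC ! p < length SC" "SC ! (SC ! p) = row i" using o1(2) unfolding t by auto
  define v1 where "v1 = v(27 := SC ! p, 29 := row i, 30 := q * rec, 26 := 1)"
  have 1: "vsteps [VLoad 27 22, VLoad 29 27, VCopy 30 21, VOne 26] (v, W, R) = Some (v1, W, R)"
    using o1(1) o2 assms(6) by (simp add: v1_def p_def fun_upd_twist)
  have env1: "env v1" by (rule env_frame[OF assms(1)]) (simp add: v1_def)
  have Wp: "W_pw W (Suc Qn)" using assms(2) by (simp add: parsed_def)
  have se: "runs (While 26 search_step) (v1, W, R) (37 * bheight (bs q) + 8 * (me q - q) + 1)
    (\<lambda>(v', W', R'). W' = W \<and> R' = R \<and> (\<forall>u<26. v' u = v1 u) \<and> v' 30 = me q * rec \<and>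
    (\<exists>j<d. v' 29 = row j \<and> (\<forall>s. q \<le> s \<longrightarrow> s < me q \<longrightarrow> pw s = dw j s)))"
    by (rule search[OF env1 Wp _ assms(10) _ assms(3), of i]) (use t o1 i E assms(6,11) in \<open>auto simp: v1_def\<close>)
  show ?thesis unfolding phrase_def
  proof (rule runs_Ops_Seq[OF 1], rule runs_Seq[OF runs_mono[OF se order.refl]])
    fix s1 assume "case s1 of (v', W', R') \<Rightarrow> W' = W \<and> R' = R \<and> (\<forall>u<26. v' u = v1 u) \<and> v' 30 = me q * rec \<and>
      (\<exists>j<d. v' 29 = row j \<and> (\<forall>s. q \<le> s \<longrightarrow> s < me q \<longrightarrow> pw s = dw j s))"
    then obtain v2 j where s1: "s1 = (v2, W, R)" and v2: "\<forall>u<26. v2 u = v1 u" "v2 30 = me q * rec"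
      "j < d" "v2 29 = row j" "\<forall>s. q \<le> s \<longrightarrow> s < me q \<longrightarrow> pw s = dw j s" by (cases s1) auto
    let ?v3 = "v2(26 := 1)"
    have 3: "vsteps [VOne 26] s1 = Some (?v3, W, R)" by (simp add: s1)
    have env3: "env ?v3" by (rule env_frame[OF env1]) (use v2(1) in simp)
    have fl: "runs fill (?v3, W, R) (10 * (Suc (me q) - q) + 1) (\<lambda>(v', W', R'). R' = R \<and> (\<forall>u<20. v' u = ?v3 u) \<and>
      (\<forall>u\<in>{23, 24, 25}. v' u = ?v3 u) \<and> v' 21 = Suc (me q) * rec \<and> orep SC (v' 22) (aobj row (map bs [Suc (me q)..<Suc Qn])) \<and>
      filled q (me q) j W W')"
      by (rule fill[OF env3]) (use Wp v2 E assms(6,9) in \<open>auto simp: v1_def W_pw_def\<close>)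
    show "runs (Ops [VOne 26] ;; fill ;; Ops [VLess 33 xQHAT 21, VSelect 24 33 xZERO xONE, VAdd 23 23 24, VLess 33 xKMAX 23,
       VSelect 24 33 xZERO 24, VSelect 25 33 xZERO 25]) s1 (10 * (Suc (me q) - q) + 8) ?Q"
    proof (rule runs_Ops_Seq[OF 3], rule runs_Seq[OF runs_mono[OF fl order.refl]])
      fix s2 assume "case s2 of (v', W', R') \<Rightarrow> R' = R \<and> (\<forall>u<20. v' u = ?v3 u) \<and>
      (\<forall>u\<in>{23, 24, 25}. v' u = ?v3 u) \<and> v' 21 = Suc (me q) * rec \<and> orep SC (v' 22) (aobj row (map bs [Suc (me q)..<Suc Qn])) \<and>
      filled q (me q) j W W'"
      then obtain v4 W' where s2: "s2 = (v4, W', R)" and v4: "\<forall>u<20. v4 u = v u" "v4 23 = cnt" "v4 25 = 1" "v4 21 = Suc (me q) * rec"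
        "orep SC (v4 22) (aobj row (map bs [Suc (me q)..<Suc Qn]))" "filled q (me q) j W W'"
        using v2(1) assms(7,8) by (cases s2) (auto simp: v1_def)
      have P: "\<exists>Jt Et. parsed (Suc (me q)) (Suc cnt) W' Jt Et"
        using parsed_extend[OF assms(2,3) v4(6) v2(3,5)] by blast
      have cmp: "Qn * rec < rec + me q * rec \<longleftrightarrow> \<not> me q < Qn" using mult_less_cancel2[of Qn rec "Suc (me q)"] rec by auto
      have ev: "v4 4 = Qn * rec" "v4 0 = 1" "v4 13 = 0" "v4 2 = kmax" using v4(1) e by auto
      have kB: "cnt < BIG" "Suc cnt < BIG" using assms(4,5) by linarith+
      define b where "b = (me q < Qn)"
      define v5 where "v5 = v4(33 := of_bool (kmax < cnt + of_bool b), 24 := of_bool (b \<and> cnt < kmax),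
        23 := cnt + of_bool b, 25 := of_bool (\<not> (b \<and> kmax \<le> cnt)))"
      have 5: "vsteps [VLess 33 xQHAT 21, VSelect 24 33 xZERO xONE, VAdd 23 23 24, VLess 33 xKMAX 23,
        VSelect 24 33 xZERO 24, VSelect 25 33 xZERO 25] s2 = Some (v5, W', R)"
      proof (cases "me q < Qn")
        case True
        then show ?thesis using ev v4(2-4) kB cmp assms(4)
          by (cases "cnt < kmax") (simp_all add: s2 v5_def b_def fun_upd_twist)
      next
        case False
        then show ?thesis using ev v4(2-4) kB cmp assms(4)
          by (simp add: s2 v5_def b_def fun_upd_twist)
      qed
      show "runs (Ops [VLess 33 xQHAT 21, VSelect 24 33 xZERO xONE, VAdd 23 23 24, VLess 33 xKMAX 23,
        VSelect 24 33 xZERO 24, VSelect 25 33 xZERO 25]) s2 6 ?Q"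
        by (rule runs_Ops[OF 5]) (use P v4 in \<open>auto simp: v5_def b_def\<close>)
    qed auto
  next
    show "length [VLoad 27 22, VLoad 29 27, VCopy 30 21, VOne 26] + (37 * bheight (bs q) + 18 * (Suc (me q) - q) + 9)
      \<le> 37 * bheight (bs q) + 18 * (Suc (me q) - q) + 13" by simp
    show "37 * bheight (bs q) + 8 * (me q - q) + 1 + (10 * (Suc (me q) - q) + 8) \<le> 37 * bheight (bs q) + 18 * (Suc (me q) - q) + 9"
      using E by simp
  qed
qed

lemma parse_loop:
  fixes bs :: "nat \<Rightarrow> bst"
  assumes "env v" "parsed q cnt W Jt Et" "q \<le> Qn" "cnt \<le> kmax" "kmax < BIG - 1" "v 21 = q * rec" "v 23 = cnt" "v 24 = 1" "v 25 = 1"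
    "orep SC (v 22) (aobj row (map bs [q..<Suc Qn]))" "\<And>q. q \<le> Qn \<Longrightarrow> bst_ok q (bs q) \<and> bset (bs q) = {..<d} \<and> bheight (bs q) \<le> hb"
  shows "runs (While 24 phrase) (v, W, R) ((37 * hb + 14) * (Suc kmax - cnt) + 18 * (Suc Qn - q) + 1) (\<lambda>(v', W', R'). R' = R \<and> (\<forall>u<20. v' u = v u) \<and>
    (v' 25 = 1 \<and> (\<exists>Jt Et. W_ok W' Jt Et \<and> maximal Et) \<or> v' 25 = 0 \<and> (\<forall>j<d. kmax < card {s. s < Qn \<and> pw s \<noteq> dw j s})))"
  using assms(1-10)
proof (induction "Suc Qn - q" arbitrary: q cnt v W Jt Et rule: less_induct)
  case less
  note b = assms(11)[OF less.prems(3)]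
  note E = me_bound[OF less.prems(3)]
  let ?t = "37 * bheight (bs q) + 18 * (Suc (me q) - q) + 13"
  note ph = phrase[OF less.prems(1-7,9,10), of R] 
  have A: "runs phrase (v, W, R) ?t (\<lambda>s'. runs (While 24 phrase) s' ((37 * hb + 14) * (Suc kmax - Suc cnt) + 18 * (Suc Qn - Suc (me q)) + 1)
     (\<lambda>(v', W', R'). R' = R \<and> (\<forall>u<20. v' u = v u) \<and>
    (v' 25 = 1 \<and> (\<exists>Jt Et. W_ok W' Jt Et \<and> maximal Et) \<or> v' 25 = 0 \<and> (\<forall>j<d. kmax < card {s. s < Qn \<and> pw s \<noteq> dw j s}))))"
  proof (rule runs_mono[OF ph order.refl])
    fix s' assume "case s' of (v', W', R') \<Rightarrow> R' = R \<and> (\<forall>u<20. v' u = v u) \<and>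
      (\<exists>Jt Et. parsed (Suc (me q)) (Suc cnt) W' Jt Et) \<and> v' 21 = Suc (me q) * rec \<and> v' 23 = (if me q < Qn then Suc cnt else cnt) \<and>
      v' 24 = of_bool (me q < Qn \<and> cnt < kmax) \<and> v' 25 = of_bool (\<not> (me q < Qn \<and> kmax \<le> cnt)) \<and>
      orep SC (v' 22) (aobj row (map bs [Suc (me q)..<Suc Qn]))"
    then obtain v' W' Jt' Et' where s': "s' = (v', W', R)" and v': "\<forall>u<20. v' u = v u" "parsed (Suc (me q)) (Suc cnt) W' Jt' Et'"
      "v' 21 = Suc (me q) * rec" "v' 23 = (if me q < Qn then Suc cnt else cnt)"
      "v' 24 = of_bool (me q < Qn \<and> cnt < kmax)" "v' 25 = of_bool (\<not> (me q < Qn \<and> kmax \<le> cnt))"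
      "orep SC (v' 22) (aobj row (map bs [Suc (me q)..<Suc Qn]))" by (cases s') auto
    have env': "env v'" by (rule env_frame[OF less.prems(1)]) (use v'(1) in simp)
    consider "me q < Qn" "cnt < kmax" | "me q < Qn" "kmax = cnt" | "me q = Qn" using E less.prems(4) by linarith
    then show "runs (While 24 phrase) s' ((37 * hb + 14) * (Suc kmax - Suc cnt) + 18 * (Suc Qn - Suc (me q)) + 1)
     (\<lambda>(v', W', R'). R' = R \<and> (\<forall>u<20. v' u = v u) \<and>
      (v' 25 = 1 \<and> (\<exists>Jt Et. W_ok W' Jt Et \<and> maximal Et) \<or> v' 25 = 0 \<and> (\<forall>j<d. kmax < card {s. s < Qn \<and> pw s \<noteq> dw j s})))"
    proof cases
      case 1
      have "runs (While 24 phrase) (v', W', R) ((37 * hb + 14) * (Suc kmax - Suc cnt) + 18 * (Suc Qn - Suc (me q)) + 1)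
        (\<lambda>(v'', W', R'). R' = R \<and> (\<forall>u<20. v'' u = v' u) \<and>
        (v'' 25 = 1 \<and> (\<exists>Jt Et. W_ok W' Jt Et \<and> maximal Et) \<or> v'' 25 = 0 \<and> (\<forall>j<d. kmax < card {s. s < Qn \<and> pw s \<noteq> dw j s})))"
        by (rule less.hyps[OF _ env' v'(2)]) (use 1 E less.prems(5) v' in auto)
      then show ?thesis unfolding s' by (rule runs_mono) (use v'(1) in auto)
    next
      case 2
      \<comment> \<open>This is phrase number \<open>kmax + 1\<close>. It ends before the sentinel,
        so the mismatches counted so far all lie in words of the actual query.\<close>
      have "kmax < card {s. s < Qn \<and> pw s \<noteq> dw j s}" if "j < d" for j
      proof -
        have "Suc kmax \<le> card {s. s < Suc (me q) \<and> pw s \<noteq> dw j s}" using v'(2) that 2 by (simp add: parsed_def)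
        also have "\<dots> \<le> card {s. s < Qn \<and> pw s \<noteq> dw j s}" using 2 by (intro card_mono) auto
        finally show ?thesis by simp
      qed
      then show ?thesis unfolding s' by (intro runs_WhileF) (use 2 v' in auto)
    next
      case 3
      have W: "W_pw W' (Suc Qn)" using v'(2) by (simp add: parsed_def)
      have "W_ok W' Jt' Et'"
        using v'(2) W unfolding parsed_def W_ok_def W_pw_def 3 by (simp add: less_Suc_eq_le)
      moreover have "maximal Et'" using v'(2) unfolding parsed_def maximal_def 3 by (simp add: less_Suc_eq_le)
      ultimately show ?thesis unfolding s' by (intro runs_WhileF) (use 3 v' in auto)
    qed
  qed (use b in auto)
  have T: "Suc (?t + ((37 * hb + 14) * (Suc kmax - Suc cnt) + 18 * (Suc Qn - Suc (me q)) + 1)) \<le>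
    (37 * hb + 14) * (Suc kmax - cnt) + 18 * (Suc Qn - q) + 1"
  proof -
    have "Suc kmax - cnt = Suc (Suc kmax - Suc cnt)" using less.prems(4) by simp
    then have "(37 * hb + 14) * (Suc kmax - cnt) = 37 * hb + 14 + (37 * hb + 14) * (Suc kmax - Suc cnt)" by simp
    moreover have "18 * (Suc Qn - q) = 18 * (Suc (me q) - q) + 18 * (Suc Qn - Suc (me q))"
      using conjunct1[OF E] conjunct2[OF E] by linarith
    moreover have "bheight (bs q) \<le> hb" using b by simp
    ultimately show ?thesis by linarith
  qed
  show ?case by (rule runs_WhileT[OF _ _ A T]) (use less.prems(8) in auto)
qed

lemma parse:
  fixes bs :: "nat \<Rightarrow> bst"
  assumes "env v" "W_pw W (Suc Qn)" "kmax < BIG - 1"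
    "orep SC (v xANCH) (aobj row (map bs [0..<Suc Qn]))" "\<And>q. q \<le> Qn \<Longrightarrow> bst_ok q (bs q) \<and> bset (bs q) = {..<d} \<and> bheight (bs q) \<le> hb"
  shows "runs parse (v, W, R) ((37 * hb + 14) * Suc kmax + 18 * Suc Qn + 6) (\<lambda>(v', W', R'). R' = R \<and> (\<forall>u<20. v' u = v u) \<and>
    (v' 25 = 1 \<and> (\<exists>Jt Et. W_ok W' Jt Et \<and> maximal Et) \<or> v' 25 = 0 \<and> (\<forall>j<d. kmax < card {s. s < Qn \<and> pw s \<noteq> dw j s})))"
proof -
  let ?v = "v(22 := v xANCH, 21 := 0, 23 := 0, 24 := 1, 25 := 1)"
  have 1: "vsteps [VCopy 22 xANCH, VZero 21, VZero 23, VOne 24, VOne 25] (v, W, R) = Some (?v, W, R)"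
    by (simp add: fun_upd_twist)
  have env': "env ?v" by (rule env_frame[OF assms(1)]) simp
  have "parsed 0 0 W (\<lambda>_. 0) (\<lambda>_. 0)" using assms(2) by (simp add: parsed_def)
  from parse_loop[OF env' this _ _ assms(3) _ _ _ _ _ assms(5), of R] assms(4)
  have "runs (While 24 phrase) (?v, W, R) ((37 * hb + 14) * Suc kmax + 18 * Suc Qn + 1) (\<lambda>(v', W', R'). R' = R \<and> (\<forall>u<20. v' u = ?v u) \<and>
    (v' 25 = 1 \<and> (\<exists>Jt Et. W_ok W' Jt Et \<and> maximal Et) \<or> v' 25 = 0 \<and> (\<forall>j<d. kmax < card {s. s < Qn \<and> pw s \<noteq> dw j s})))"
    by simp
  then have "runs (While 24 phrase) (?v, W, R) ((37 * hb + 14) * Suc kmax + 18 * Suc Qn + 1) (\<lambda>(v', W', R'). R' = R \<and> (\<forall>u<20. v' u = v u) \<and>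
    (v' 25 = 1 \<and> (\<exists>Jt Et. W_ok W' Jt Et \<and> maximal Et) \<or> v' 25 = 0 \<and> (\<forall>j<d. kmax < card {s. s < Qn \<and> pw s \<noteq> dw j s})))"
    by (rule runs_mono) auto
  then show ?thesis unfolding parse_def by (rule runs_Ops_Seq[OF 1]) simp
qed

end

subsection \<open>Traversal of the tree\<close>

text \<open>Rows have positive addresses, so a first cell 0 marks a number to be reported.
  \<open>Leaf\<close> and \<open>Node\<close> share a layout and are treated by the same code; the
  sixth cell tells whether the search stays at the object after a mismatch or moves to the first
  child. The start \<open>x0\<close> is kept in two parts, as a lookup needs word and bit offset
  separately, whereas \<open>v\<close> is only compared.\<close>

fun tobj :: "(nat \<Rightarrow> nat) \<Rightarrow> nat \<Rightarrow> nat \<Rightarrow> nat \<Rightarrow> tree \<Rightarrow> obj" where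
  "tobj row rec n lb Empty = Null"
| "tobj row rec n lb (Rep i T) = Rec [0, i] [tobj row rec n lb T]"
| "tobj row rec n lb (Leaf i x0 v B) =
    Rec [row i, x0 div n * rec, x0 mod n * lb, v div n * rec + v mod n * lb, 1, 1] [tobj row rec n lb B, Null, Null]"
| "tobj row rec n lb (Node e i x0 v B U N) =
    Rec [row i, x0 div n * rec, x0 mod n * lb, v div n * rec + v mod n * lb, e, 0]
      [tobj row rec n lb B, tobj row rec n lb U, tobj row rec n lb N]"

text \<open>An entry consists of the previous stack pointer, the object, the position in two parts
  and the number of errors spent. The pointer is stored and errors are counted upwards because wide
  variables have no subtraction.\<close>

definition push :: "nat \<Rightarrow> nat \<Rightarrow> nat \<Rightarrow> nat \<Rightarrow> vop list" where
  "push p xq xo us =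
    [VAdd 26 20 xFIVE, VStoreW 26 20, VCopy 20 26, VAdd 26 26 xONE, VStoreW 26 p, VAdd 26 26 xONE, VStoreW 26 xq,
     VAdd 26 26 xONE, VStoreW 26 xo, VAdd 26 26 xONE, VStoreW 26 us]"

definition pop :: "vop list" where
  "pop =
    [VLoadW 25 20, VAdd 26 20 xONE, VLoadW 21 26, VAdd 26 26 xONE, VLoadW 22 26, VAdd 26 26 xONE, VLoadW 23 26,
     VAdd 26 26 xONE, VLoadW 24 26, VCopy 20 25, VLess 25 xZERO 21]"

definition report_node :: cmd where
  "report_node =
    Ops [VAdd 26 21 xONE, VLoad 27 26, VReport 27, VAdd 26 26 xONE, VLoad 21 26] ;; Ops (push 21 22 23 24)"

text \<open>Two entries are pushed in every case, with a null object if there is no child or the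
  errors are exhausted. This avoids branching, and \<open>pops\<close> counts the null
  entries.\<close>

definition test_node :: cmd where
  "test_node =
    Ops [VAdd 26 21 xONE, VLoad 33 26, VAdd 26 26 xONE, VLoad 34 26, VAdd 26 26 xONE, VLoad 35 26, VAdd 26 26 xONE, VLoad 36 26,
      VAdd 26 26 xONE, VLoad 37 26, VAdd 26 26 xONE, VLoad 38 26, VAdd 26 26 xONE, VLoad 39 26, VAdd 26 26 xONE, VLoad 28 26] ;;
    Ops [VAdd 26 22 23, VAdd 27 33 34, VLess 25 26 27, VSelect 31 25 33 22, VSelect 32 25 34 23] ;;
    firstmis ;;
    Ops [VAdd 26 50 40, VLess 25 26 35, VAdd 27 40 xLB, VSelect 43 37 21 38, VSelect 44 25 39 38, VSelect 45 25 43 28,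
      VSelect 46 25 50 22, VSelect 47 25 27 23, VSelect 48 25 xONE 36, VAdd 48 48 24, VLess 49 xKMAX 48, VSelect 45 49 xZERO 45] ;;
    Ops (push 45 46 47 48) ;; Ops (push 44 22 23 24)"

definition visit :: cmd where
  "visit = Ops pop ;; If 25 (Ops [VLoad 30 21, VLess 25 xZERO 30] ;; If 25 test_node report_node) (Ops []) ;; Ops [VLess 29 xSBASE 20]"

definition traverse :: cmd where
  "traverse = Ops [VCopy 20 xSBASE] ;; Ops (push xROOT xZERO xZERO xZERO) ;; Ops [VLess 29 xSBASE 20] ;; While 29 visit"

text \<open>The parameters of the instance come from the first ten cells. The size 5 of a stack
  entry is computed as twice two plus one.\<close>

definition prologue :: "vop list" where
  "prologue =
    [VOne 0, VZero 13, VZero 26, VLoad 2 26, VAdd 26 26 0, VLoad 3 26, VAdd 26 26 0, VLoad 4 26, VAdd 26 26 0, VLoad 5 26,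
     VAdd 26 26 0, VLoad 6 26, VAdd 26 26 0, VLoad 7 26, VAdd 26 26 0, VLoad 8 26, VAdd 26 26 0, VLoad 9 26,
     VAdd 26 26 0, VLoad 10 26, VAdd 26 26 0, VLoad 11 26, VAdd 12 0 0, VAdd 12 12 12, VAdd 12 12 0]"

definition program :: cmd where
  "program = Ops prologue ;; copy_query ;; parse ;; If 25 traverse (Ops [])"

context layout
begin

abbreviation "sb \<equiv> Suc Qn * rec"
abbreviation "M \<equiv> Qn * n"

section \<open>Encoded positions and the stack\<close>

definition code :: "nat \<Rightarrow> nat" where
  "code x = x div n * rec + x mod n * lb"

text \<open>Bit offsets are below \<open>rec\<close>, so the word number dominates and positions can
  be compared by one comparison of wide numbers.\<close>

lemma code_mono:
  assumes "x < y"
  shows "code x < code y"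
proof (cases "x div n < y div n")
  case True
  have "x mod n * lb \<le> n * lb" using n_pos by (intro mult_le_mono1) (simp add: less_imp_le)
  then have "x mod n * lb < rec" using rec(1) by (rule le_less_trans)
  then have "code x < Suc (x div n) * rec" by (simp add: code_def)
  also have "\<dots> \<le> y div n * rec" using True by (intro mult_le_mono1) simp
  also have "\<dots> \<le> code y" by (simp add: code_def)
  finally show ?thesis .
next
  case False
  then have q: "x div n = y div n" using assms by (meson div_le_mono le_less_trans less_imp_le linorder_neqE_nat not_le)
  then have "x mod n < y mod n" using assms by (metis div_mult_mod_eq nat_add_left_cancel_less)
  then show ?thesis using lb_pos by (simp add: code_def q)
qed

lemma code_less_iff: "code x < code y \<longleftrightarrow> x < y"
  by (metis code_mono less_asym linorder_neqE_nat)

lemma code_at: "c < n \<Longrightarrow> code (q * n + c) = q * rec + c * lb"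
  by (simp add: code_def)

text \<open>The offset \<open>c = n\<close> denotes the first position of the next word but yields a
  smaller number than its \<open>code\<close>. No code of a position lies strictly between these two
  numbers, so the comparison still selects the maximum; equality is impossible to misjudge, as the
  codes of word \<open>q\<close> end at offset \<open>n - 1\<close>.\<close>

lemma code_max:
  assumes "c \<le> n"
  shows "q * rec + c * lb < code y \<Longrightarrow> max (q * n + c) y = y"
    and "\<not> q * rec + c * lb < code y \<Longrightarrow> max (q * n + c) y = q * n + c"
proof -
  let ?s = "q * rec + c * lb" and ?x = "q * n + c"
  show "max ?x y = y" if "?s < code y"
  proof (cases "c = n")
    case False
    then have "code ?x < code y" using that assms by (simp add: code_at)
    then show ?thesis using code_less_iff by simp
  next
    case True
    have "\<not> y < ?x"
    proof
      assume "y < ?x"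
      then have "y \<le> q * n + (n - 1)" using True n_pos by linarith
      then have "code y \<le> code (q * n + (n - 1))" using code_less_iff by (metis not_less)
      also have "\<dots> = q * rec + (n - 1) * lb" using n_pos by (intro code_at) simp
      also have "\<dots> \<le> ?s" using True by simp
      finally show False using that by simp
    qed
    then show ?thesis by simp
  qed
  show "max ?x y = ?x" if "\<not> ?s < code y"
  proof (cases "c = n")
    case False
    then have "\<not> code ?x < code y" using that assms by (simp add: code_at)
    then show ?thesis using code_less_iff by simp
  next
    case True
    have "code y \<le> ?s" using that by simp
    also have "\<dots> < Suc q * rec" using True rec(1) by simp
    also have "\<dots> = code (Suc q * n + 0)" using code_at[of 0 "Suc q"] n_pos by simp
    finally have "y < Suc q * n + 0" by (simp only: code_less_iff)
    then show ?thesis using True by simp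
  qed
qed

definition posrep :: "nat \<Rightarrow> nat \<Rightarrow> nat \<Rightarrow> bool" where
  "posrep xq xo x \<longleftrightarrow> (\<exists>q c. q \<le> Qn \<and> c \<le> n \<and> (q = Qn \<longrightarrow> c = 0) \<and> xq = q * rec \<and> xo = c * lb \<and> x = q * n + c)"

lemma posrep_sum: "posrep xq xo x \<Longrightarrow> xq + xo < sb"
proof -
  assume "posrep xq xo x"
  then obtain q c where q: "q \<le> Qn" "c \<le> n" "xq = q * rec" "xo = c * lb" unfolding posrep_def by blast
  have "c * lb \<le> n * lb" using q by simp
  then have "c * lb < rec" using rec(1) by (rule le_less_trans)
  then have "xq + xo < Suc q * rec" using q by simp
  also have "\<dots> \<le> sb" using q by (intro mult_le_mono1) simp
  finally show ?thesis .
qed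

lemma posrep_norm: "x \<le> M \<Longrightarrow> posrep (x div n * rec) (x mod n * lb) x"
proof -
  assume x: "x \<le> M"
  have "x div n \<le> Qn" using x n_pos by (metis div_le_mono div_mult_self_is_m mult.commute)
  moreover have "x mod n = 0" if "x div n = Qn" using x that by (metis add.right_neutral add_le_cancel_left div_mult_mod_eq le_zero_eq)
  moreover have "x mod n \<le> n" using n_pos by (simp add: less_imp_le)
  ultimately show ?thesis unfolding posrep_def by (intro exI[of _ "x div n"] exI[of _ "x mod n"]) simp
qed

text \<open>The step behind a mismatch adds one field width and never carries into the next word.
  This is why \<open>posrep\<close> admits the offset \<open>n\<close>.\<close>

lemma posrep_Suc: "x < M \<Longrightarrow> posrep (x div n * rec) (x mod n * lb + lb) (Suc x)"
proof -
  assume x: "x < M"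
  have "x div n < Qn" using x by (rule less_mult_imp_div_less)
  moreover have "Suc (x mod n) \<le> n" using n_pos by (simp add: Suc_le_eq)
  ultimately show ?thesis unfolding posrep_def by (intro exI[of _ "x div n"] exI[of _ "Suc (x mod n)"]) simp
qed

lemma posrep_le: "posrep xq xo x \<Longrightarrow> x \<le> M"
proof -
  assume "posrep xq xo x"
  then obtain q c where q: "q \<le> Qn" "c \<le> n" "q = Qn \<longrightarrow> c = 0" "x = q * n + c" unfolding posrep_def by blast
  show ?thesis
  proof (cases "q = Qn")
    case False
    then have "Suc q \<le> Qn" using q by simp
    then have "Suc q * n \<le> M" by (rule mult_le_mono1)
    moreover have "x \<le> Suc q * n" using q by simp
    ultimately show ?thesis by simp
  qed (use q in simp)
qed

fun stk :: "nat list \<Rightarrow> (nat \<times> nat \<times> nat \<times> nat) list \<Rightarrow> nat \<Rightarrow> bool" where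
  "stk W [] sp \<longleftrightarrow> sp = sb"
| "stk W ((p, xq, xo, us) # es) sp \<longleftrightarrow> sb + 5 \<le> sp \<and> W ! sp = sp - 5 \<and> W ! Suc sp = p \<and> W ! Suc (Suc sp) = xq \<and>
    W ! Suc (Suc (Suc sp)) = xo \<and> W ! Suc (Suc (Suc (Suc sp))) = us \<and> stk W es (sp - 5)"

lemma stk_sp: "stk W es sp \<Longrightarrow> sp = sb + 5 * length es"
  by (induction W es sp rule: stk.induct) auto

lemma stk_update: "sp + 5 \<le> i \<Longrightarrow> stk (W[i := x]) es sp \<longleftrightarrow> stk W es sp"
  by (induction W es sp rule: stk.induct) auto

lemma W_ok_update:
  assumes "W_ok W Jt Et" "sb \<le> i"
  shows "W_ok (W[i := x]) Jt Et"
proof -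
  have ne: "i \<noteq> q * rec" "i \<noteq> Suc (q * rec)" "i \<noteq> Suc (Suc (q * rec))" if "q \<le> Qn" for q
  proof -
    have "Suc q * rec \<le> sb" using that by (intro mult_le_mono1) simp
    then have "Suc q * rec \<le> i" using assms(2) by (rule le_trans)
    then have "rec + q * rec \<le> i" by (simp only: mult_Suc)
    then show "i \<noteq> q * rec" "i \<noteq> Suc (q * rec)" "i \<noteq> Suc (Suc (q * rec))" using rec(2) by linarith+
  qed
  show ?thesis using assms(1) ne unfolding W_ok_def by simp
qed

lemma push:
  assumes "env v" "W_ok W Jt Et" "stk W es (v 20)" "sb + 5 * length es + 10 \<le> Wn"
    "p \<notin> {20, 26}" "xq \<notin> {20, 26}" "xo \<notin> {20, 26}" "us \<notin> {20, 26}"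
  shows "\<exists>v' W'. vsteps (push p xq xo us) (v, W, R) = Some (v', W', R) \<and> (\<forall>u. u \<noteq> 20 \<longrightarrow> u \<noteq> 26 \<longrightarrow> v' u = v u) \<and>
    W_ok W' Jt Et \<and> stk W' ((v p, v xq, v xo, v us) # es) (v' 20)"
proof -
  note e = envD[OF assms(1)]
  define sp where "sp = v 20"
  have sp: "sp = sb + 5 * length es" using stk_sp[OF assms(3)] by (simp add: sp_def)
  have lw: "length W = Wn" using assms(2) by (simp add: W_ok_def)
  have a: "sp + 9 < Wn" "sb \<le> sp" using assms(4) sp by auto
  have b: "sp + 9 < BIG" using a W_small by simp
  define W' where "W' = W[sp + 5 := sp, sp + 6 := v p, sp + 7 := v xq, sp + 8 := v xo, sp + 9 := v us]"
  have "vsteps (push p xq xo us) (v, W, R) = Some (v(26 := sp + 9, 20 := sp + 5), W', R)"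
    unfolding push_def using a b lw e assms(5-8) by (simp add: sp_def[symmetric] W'_def fun_upd_twist add.commute)
  moreover have "W_ok W' Jt Et" unfolding W'_def using a by (intro W_ok_update assms(2)) auto
  moreover have "stk W' ((v p, v xq, v xo, v us) # es) (sp + 5)"
    using a lw assms(3)[folded sp_def] by (simp add: W'_def nth_list_update stk_update)
  ultimately show ?thesis by (intro exI[of _ "v(26 := sp + 9, 20 := sp + 5)"] exI[of _ W']) simp
qed

lemma env_frame2: "env v \<Longrightarrow> (\<forall>u. u \<noteq> 20 \<longrightarrow> u \<noteq> 26 \<longrightarrow> v' u = v u) \<Longrightarrow> env v'"
  by (erule env_frame) simp

lemma pop:
  assumes "env v" "W_ok W Jt Et" "stk W ((p, xq, xo, us) # es) (v 20)" "sb + 5 * length es + 10 \<le> Wn"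
  shows "\<exists>v'. vsteps pop (v, W, R) = Some (v', W, R) \<and> (\<forall>u<20. v' u = v u) \<and> v' 21 = p \<and> v' 22 = xq \<and> v' 23 = xo \<and> v' 24 = us \<and>
    v' 25 = of_bool (0 < p) \<and> stk W es (v' 20)"
proof -
  note e = envD[OF assms(1)]
  define sp where "sp = v 20"
  have sp: "sp = sb + 5 * length es + 5" using stk_sp[OF assms(3)] by (simp add: sp_def)
  have lw: "length W = Wn" using assms(2) by (simp add: W_ok_def)
  have a: "sp + 4 < Wn" "sp < Wn" using assms(4) sp by auto
  have b: "sp + 4 < BIG" using a W_small by simp
  show ?thesis
    unfolding pop_def using a b lw e assms(3) by (simp add: sp_def[symmetric])
qed

lemma test_node:
  assumes "env v" "W_ok W Jt Et" "maximal Et" "stk W es (v 20)" "sb + 5 * length es + 15 \<le> Wn" "kmax < BIG - 1"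
    "v 21 = p" "v 22 = xq" "v 23 = xo" "v 24 = us" "v 30 = row i" "i < d" "posrep xq xo x" "x0 \<le> M" "vv \<le> M" "us \<le> kmax"
    "p + 9 \<le> length SC" "SC ! (p + 1) = x0 div n * rec" "SC ! (p + 2) = x0 mod n * lb" "SC ! (p + 3) = code vv"
    "SC ! (p + 4) = e" "e \<le> 1" "SC ! (p + 5) = of_bool lf" "SC ! (p + 6) = bl" "SC ! (p + 7) = out" "SC ! (p + 8) = om"
  defines "l \<equiv> fm i (max x x0)"
  shows "runs test_node (v, W, R) 145 (\<lambda>(v', W', R'). R' = R \<and> (\<forall>u<20. v' u = v u) \<and> W_ok W' Jt Et \<and>
    (if vv \<le> l then stk W' ((bl, xq, xo, us) # (if us + e \<le> kmax then om else 0, xq, xo, us + e) # es) (v' 20)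
     else stk W' ((out, xq, xo, us) # (if us < kmax then if lf then p else bl else 0, l div n * rec, l mod n * lb + lb, us + 1) # es) (v' 20)))"
    (is "runs _ _ _ ?Q")
proof -
  note ev = envD[OF assms(1)]
  have pl: "p + 8 < BIG" "p + 8 < length SC" using assms(17) SC_small by auto
  define v1 where "v1 = v(26 := Suc (Suc (Suc (Suc (Suc (Suc (Suc (Suc p))))))), 33 := x0 div n * rec, 34 := x0 mod n * lb, 35 := code vv, 36 := e, 37 := of_bool lf, 38 := bl, 39 := out, 28 := om)"
  have cells: "SC ! Suc p = x0 div n * rec" "SC ! Suc (Suc p) = x0 mod n * lb" "SC ! Suc (Suc (Suc p)) = code vv"
    "SC ! Suc (Suc (Suc (Suc p))) = e" "SC ! Suc (Suc (Suc (Suc (Suc p)))) = of_bool lf" "SC ! Suc (Suc (Suc (Suc (Suc (Suc p))))) = bl"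
    "SC ! Suc (Suc (Suc (Suc (Suc (Suc (Suc p)))))) = out" "SC ! Suc (Suc (Suc (Suc (Suc (Suc (Suc (Suc p))))))) = om"
    using assms(18-26) by (simp_all add: eval_nat_numeral)
  have 1: "vsteps [VAdd 26 21 xONE, VLoad 33 26, VAdd 26 26 xONE, VLoad 34 26, VAdd 26 26 xONE, VLoad 35 26, VAdd 26 26 xONE, VLoad 36 26,
      VAdd 26 26 xONE, VLoad 37 26, VAdd 26 26 xONE, VLoad 38 26, VAdd 26 26 xONE, VLoad 39 26, VAdd 26 26 xONE, VLoad 28 26] (v, W, R) = Some (v1, W, R)"
    using pl cells assms(7) ev(1) by (simp add: v1_def fun_upd_twist)
  have p0: "posrep (x0 div n * rec) (x0 mod n * lb) x0" by (rule posrep_norm[OF assms(14)])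
  have s0: "x0 div n * rec + x0 mod n * lb < BIG" "xq + xo < BIG"
    using posrep_sum[OF p0] posrep_sum[OF assms(13)] Wn W_small by linarith+
  obtain q c where q: "q \<le> Qn" "c \<le> n" "q = Qn \<longrightarrow> c = 0" "xq = q * rec" "xo = c * lb" "x = q * n + c"
    using assms(13) unfolding posrep_def by blast
  define b where "b = (xq + xo < code x0)"
  define q' where "q' = (if b then x0 div n else q)"
  define c' where "c' = (if b then x0 mod n else c)"
  have q': "q' \<le> Qn" "c' \<le> n" "q' = Qn \<longrightarrow> c' = 0" "q' * n + c' = max x x0"
  proof -
    have "x0 div n \<le> Qn" using assms(14) n_pos by (metis div_le_mono div_mult_self_is_m mult.commute)
    moreover have "x0 mod n = 0" if "x0 div n = Qn"
      using assms(14) that by (metis add.right_neutral add_le_cancel_left div_mult_mod_eq le_zero_eq)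
    ultimately show "q' \<le> Qn" "c' \<le> n" "q' = Qn \<longrightarrow> c' = 0" using q n_pos by (auto simp: q'_def c'_def less_imp_le)
    show "q' * n + c' = max x x0" using code_max[OF q(2), of q x0] q(4-6) by (auto simp: q'_def c'_def b_def)
  qed
  define v2 where "v2 = v1(26 := xq + xo, 27 := code x0, 25 := of_bool b, 31 := q' * rec, 32 := c' * lb)"
  have vv1: "v1 22 = xq" "v1 23 = xo" "v1 33 = x0 div n * rec" "v1 34 = x0 mod n * lb" using assms(8,9) by (simp_all add: v1_def)
  have 2: "vsteps [VAdd 26 22 23, VAdd 27 33 34, VLess 25 26 27, VSelect 31 25 33 22, VSelect 32 25 34 23] (v1, W, R) = Some (v2, W, R)"
  proof (cases b)
    case True
    then show ?thesis using s0 b_def[unfolded code_def] by (simp add: vv1 v2_def q'_def c'_def code_def fun_upd_twist)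
  next
    case False
    then show ?thesis using s0 b_def[unfolded code_def] q(4,5) by (simp add: vv1 v2_def q'_def c'_def code_def fun_upd_twist)
  qed
  have fr2: "v2 u = v u" if "u \<notin> {25, 26, 27, 28, 31, 32, 33, 34, 35, 36, 37, 38, 39}" for u using that by (simp add: v2_def v1_def)
  have env2: "env v2" by (rule env_frame[OF assms(1)]) (simp add: fr2)
  have fmr: "runs firstmis (v2, W, R) 90 (\<lambda>(v', W', R'). W' = W \<and> R' = R \<and> (\<forall>u<40. v' u = v2 u) \<and>
    v' 50 = l div n * rec \<and> v' 40 = l mod n * lb)"
    using firstmis[OF env2 assms(2,3,12) q'(1-3), of R] fr2 assms(11) unfolding l_def q'(4)[symmetric] by (simp add: v2_def)
  have lM: "l \<le> M" unfolding l_def using fm_props(2)[OF assms(12)] posrep_le[OF assms(13)] assms(14) by simp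
  have lp: "posrep (l div n * rec) (l mod n * lb) l" by (rule posrep_norm[OF lM])
  have sl: "l div n * rec + l mod n * lb < BIG" using posrep_sum[OF lp] Wn W_small by linarith
  have lbB: "l mod n * lb + lb < BIG"
  proof -
    have "Suc (l mod n) * lb \<le> n * lb" using n_pos by (intro mult_le_mono1) (simp add: Suc_le_eq)
    then show ?thesis using rec(1) Wn W_small by (simp add: add.commute)
  qed
  have kB: "us + e < BIG" "us + 1 < BIG" using assms(6,16,22) by linarith+
  show ?thesis unfolding test_node_def
  proof (rule runs_Ops_Seq[OF 1], rule runs_Ops_Seq[OF 2], rule runs_Seq[OF runs_mono[OF fmr order.refl]])
    fix s' assume "case s' of (v', W', R') \<Rightarrow> W' = W \<and> R' = R \<and> (\<forall>u<40. v' u = v2 u) \<and> v' 50 = l div n * rec \<and> v' 40 = l mod n * lb"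
    then obtain v3 where s': "s' = (v3, W, R)" and v3: "\<forall>u<40. v3 u = v2 u" "v3 50 = l div n * rec" "v3 40 = l mod n * lb" by (cases s') auto
    define b2 where "b2 = (l < vv)"
    define P2 where "P2 = (if b2 then if lf then p else bl else om)"
    define us2 where "us2 = us + (if b2 then 1 else e)"
    define v4 where "v4 = v3(26 := l div n * rec + l mod n * lb, 25 := of_bool b2, 27 := l mod n * lb + lb, 43 := if lf then p else bl,
       44 := if b2 then out else bl, 46 := if b2 then l div n * rec else xq, 47 := if b2 then l mod n * lb + lb else xo,
       48 := us2, 49 := of_bool (kmax < us2), 45 := if kmax < us2 then 0 else P2)"
    have cm: "l div n * rec + l mod n * lb < code vv \<longleftrightarrow> b2" using code_less_iff[of l vv] by (simp add: b2_def code_def)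
    have w3: "v3 8 = lb" "v3 0 = 1" "v3 13 = 0" "v3 2 = kmax" "v3 21 = p" "v3 22 = xq" "v3 23 = xo" "v3 24 = us" "v3 28 = om" "v3 35 = code vv" "v3 36 = e"
      "v3 37 = of_bool lf" "v3 38 = bl" "v3 39 = out"
      using v3(1) ev assms(7-10) by (simp_all add: v2_def v1_def)
    have 4: "vsteps [VAdd 26 50 40, VLess 25 26 35, VAdd 27 40 xLB, VSelect 43 37 21 38, VSelect 44 25 39 38, VSelect 45 25 43 28,
      VSelect 46 25 50 22, VSelect 47 25 27 23, VSelect 48 25 xONE 36, VAdd 48 48 24, VLess 49 xKMAX 48, VSelect 45 49 xZERO 45] s' = Some (v4, W, R)"
    proof (cases b2)
      case True
      then show ?thesis using w3 v3(2,3) sl lbB kB cm assms(22)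
        by (cases lf; cases "kmax < us + 1") (simp_all add: s' v4_def P2_def us2_def fun_upd_twist add.commute)
    next
      case False
      then show ?thesis using w3 v3(2,3) sl lbB kB cm assms(22)
        by (cases lf; cases "kmax < us + e") (simp_all add: s' v4_def P2_def us2_def fun_upd_twist add.commute)
    qed
    have fr4: "v4 u = v u" if "u < 25" for u using that v3(1) fr2 by (simp add: v4_def)
    have env4: "env v4" by (rule env_frame[OF assms(1)]) (simp add: fr4)
    obtain v5 W5 where 5: "vsteps (push 45 46 47 48) (v4, W, R) = Some (v5, W5, R)" "\<forall>u. u \<noteq> 20 \<longrightarrow> u \<noteq> 26 \<longrightarrow> v5 u = v4 u"
      "W_ok W5 Jt Et" "stk W5 ((v4 45, v4 46, v4 47, v4 48) # es) (v5 20)"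
      using push[OF env4 assms(2), of es 45 46 47 48 R] assms(4,5) fr4 by auto
    have env5: "env v5" by (rule env_frame2[OF env4 5(2)])
    obtain v6 W6 where 6: "vsteps (push 44 22 23 24) (v5, W5, R) = Some (v6, W6, R)" "\<forall>u. u \<noteq> 20 \<longrightarrow> u \<noteq> 26 \<longrightarrow> v6 u = v5 u"
      "W_ok W6 Jt Et" "stk W6 ((v5 44, v5 22, v5 23, v5 24) # (v4 45, v4 46, v4 47, v4 48) # es) (v6 20)"
      using push[OF env5 5(3,4), of 44 22 23 24 R] assms(5) by auto
    have v5: "v5 44 = (if b2 then out else bl)" "v5 22 = xq" "v5 23 = xo" "v5 24 = us"
    proof -
      show "v5 44 = (if b2 then out else bl)" using 5(2) by (simp add: v4_def)
      show "v5 22 = xq" "v5 23 = xo" "v5 24 = us" using 5(2) fr4 assms(8-10) by simp_all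
    qed
    have v4v: "v4 45 = (if kmax < us2 then 0 else P2)" "v4 46 = (if b2 then l div n * rec else xq)" "v4 47 = (if b2 then l mod n * lb + lb else xo)"
      "v4 48 = us2" by (simp_all add: v4_def)
    have st: "if vv \<le> l then stk W6 ((bl, xq, xo, us) # (if us + e \<le> kmax then om else 0, xq, xo, us + e) # es) (v6 20)
     else stk W6 ((out, xq, xo, us) # (if us < kmax then if lf then p else bl else 0, l div n * rec, l mod n * lb + lb, us + 1) # es) (v6 20)"
    proof (cases "vv \<le> l")
      case True
      then have "\<not> b2" by (simp add: b2_def)
      then show ?thesis using 6(4) True unfolding v5 v4v by (simp add: us2_def P2_def not_less del: stk.simps split: if_splits)
    next
      case False
      then have "b2" by (simp add: b2_def)
      then show ?thesis using 6(4) False unfolding v5 v4v by (simp add: us2_def P2_def not_less del: stk.simps split: if_splits)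
    qed
    have fr6: "\<forall>u<20. v6 u = v u" using 6(2) 5(2) fr4 by simp
    show "runs (Ops [VAdd 26 50 40, VLess 25 26 35, VAdd 27 40 xLB, VSelect 43 37 21 38, VSelect 44 25 39 38, VSelect 45 25 43 28,
      VSelect 46 25 50 22, VSelect 47 25 27 23, VSelect 48 25 xONE 36, VAdd 48 48 24, VLess 49 xKMAX 48, VSelect 45 49 xZERO 45] ;;
      Ops (push 45 46 47 48) ;; Ops (push 44 22 23 24)) s' 34 ?Q"
      by (rule runs_Ops_Seq[OF 4], rule runs_Ops_Seq[OF 5(1)], rule runs_Ops[OF 6(1)])
        (use fr6 6(3) st in \<open>auto simp: push_def simp del: stk.simps\<close>)
  qed auto
qed


lemma pops_pos: "1 \<le> pops f T x k"
  by (cases T) (auto simp: pops.simps(3))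

lemma pops_ge3: "3 \<le> pops f (Leaf i x0 v C) x k" "3 \<le> pops f (Node e i x0 v C U N) x k"
proof -
  have "1 \<le> pops f C x k" "1 \<le> pops f (Leaf i x0 v C) y j" for y j by (rule pops_pos)+
  then show "3 \<le> pops f (Leaf i x0 v C) x k" by (cases k) auto
  have "1 \<le> pops f C y j" "1 \<le> pops f U y j" "1 \<le> pops f N y j" for y j by (rule pops_pos)+
  from this(1)[of x k] this(1)[of "Suc (f i (max x x0))" "k - 1"] this(2)[of x k] this(3)[of x "k - e"]
  show "3 \<le> pops f (Node e i x0 v C U N) x k" by auto
qed

section \<open>Amortized analysis of the traversal\<close>

definition total_pops :: "(tree \<times> nat \<times> nat) list \<Rightarrow> nat" where
  "total_pops ts = sum_list (map (\<lambda>(T, x, k). pops fm T x k) ts)"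

definition answers :: "(tree \<times> nat \<times> nat) list \<Rightarrow> nat list" where
  "answers ts = concat (map (\<lambda>(T, x, k). qry fm T x k) ts)"

lemma total_pops_simps [simp]: "total_pops [] = 0" "total_pops ((T, x, k) # ts) = pops fm T x k + total_pops ts"
  by (simp_all add: total_pops_def)

lemma answers_simps [simp]: "answers [] = []" "answers ((T, x, k) # ts) = qry fm T x k @ answers ts"
  by (simp_all add: answers_def)

lemma length_le_pops: "length ts \<le> total_pops ts"
proof (induction ts)
  case (Cons t ts)
  obtain T x k where "t = (T, x, k)" by (cases t)
  then show ?case using Cons pops_pos[of fm T x k] by simp
qed simp

fun erep :: "nat \<times> nat \<times> nat \<times> nat \<Rightarrow> tree \<times> nat \<times> nat \<Rightarrow> bool" where
  "erep (p, xq, xo, us) (T, x, k) \<longleftrightarrow> orep SC p (tobj row rec n lb T) \<and> tree_ok d M T \<and>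
    (T \<noteq> Empty \<longrightarrow> posrep xq xo x \<and> us + k = kmax)"

text \<open>A visit replaces the top entry by its successors. The answers still to come stay the
  same after the reports made, and the potential drops by exactly one. As every entry has potential
  at least one, \<open>total_pops\<close> bounds the time and the height of the stack.\<close>

definition stepped :: "(nat \<Rightarrow> nat) \<Rightarrow> nat list \<Rightarrow> (nat \<Rightarrow> nat) \<Rightarrow> (nat \<Rightarrow> nat) \<Rightarrow> (tree \<times> nat \<times> nat) list \<Rightarrow> vstate \<Rightarrow> bool" where
  "stepped v R Jt Et ts s \<longleftrightarrow> (case s of (v', W', R') \<Rightarrow> \<exists>es2 ts2 rp. (\<forall>u<20. v' u = v u) \<and> W_ok W' Jt Et \<and> list_all2 erep es2 ts2 \<and>
    stk W' es2 (v' 20) \<and> R' = R @ rp \<and> rp @ answers ts2 = answers ts \<and> Suc (total_pops ts2) = total_pops ts)"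

lemma report_node:
  assumes "env v" "W_ok W Jt Et" "stk W es (v 20)" "sb + 5 * length es + 10 \<le> Wn" "list_all2 erep es ts"
    "v 21 = p" "erep (p, v 22, v 23, v 24) (Rep i T, x, k)"
  shows "runs report_node (v, W, R) 16 (stepped v R Jt Et ((Rep i T, x, k) # ts))"
proof -
  note e = envD[OF assms(1)]
  have o: "p + 3 \<le> length SC" "SC ! Suc p = i" "orep SC (SC ! Suc (Suc p)) (tobj row rec n lb T)"
    using assms(7) by (auto simp: less_Suc_eq)
  have pl: "Suc p < BIG" "Suc (Suc p) < BIG" "Suc p < length SC" "Suc (Suc p) < length SC" using o(1) SC_small by auto
  let ?v = "v(27 := i, 26 := Suc (Suc p), 21 := SC ! Suc (Suc p))"
  have 1: "vsteps [VAdd 26 21 xONE, VLoad 27 26, VReport 27, VAdd 26 26 xONE, VLoad 21 26] (v, W, R) = Some (?v, W, R @ [i])"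
    using pl o(2) e assms(6) by (simp add: fun_upd_twist)
  have env1: "env ?v" by (rule env_frame[OF assms(1)]) simp
  obtain v' W' where 2: "vsteps (push 21 22 23 24) (?v, W, R @ [i]) = Some (v', W', R @ [i])" "\<forall>u. u \<noteq> 20 \<longrightarrow> u \<noteq> 26 \<longrightarrow> v' u = ?v u"
    "W_ok W' Jt Et" "stk W' ((?v 21, ?v 22, ?v 23, ?v 24) # es) (v' 20)"
    using push[OF env1 assms(2), of es 21 22 23 24 "R @ [i]"] assms(3,4) by auto
  have er: "erep (SC ! Suc (Suc p), v 22, v 23, v 24) (T, x, k)" using assms(7) o(3) by simp
  have "stepped v R Jt Et ((Rep i T, x, k) # ts) (v', W', R @ [i])"
    unfolding stepped_def prod.case
    by (rule exI[of _ "(SC ! Suc (Suc p), v 22, v 23, v 24) # es"], rule exI[of _ "(T, x, k) # ts"], rule exI[of _ "[i]"])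
      (use 2 er assms(5) in \<open>auto simp del: stk.simps erep.simps\<close>)
  then show ?thesis unfolding report_node_def by (intro runs_Ops_Seq[OF 1] runs_Ops[OF 2(1)]) (auto simp: push_def)
qed

lemma test_stepped:
  assumes "env v" "W_ok W Jt Et" "maximal Et" "stk W es (v 20)" "sb + 5 * length es + 15 \<le> Wn" "kmax < BIG - 1" "list_all2 erep es ts"
    "v 21 = p" "v 30 = row i" "erep (p, v 22, v 23, v 24) (T, x, k)"
    "(\<exists>x0 vv B. T = Leaf i x0 vv B) \<or> (\<exists>e x0 vv B U N. T = Node e i x0 vv B U N)"
  shows "runs test_node (v, W, R) 145 (stepped v R Jt Et ((T, x, k) # ts))"
  using assms(11)
proof
  assume "\<exists>x0 vv B. T = Leaf i x0 vv B"
  then obtain x0 vv C where T: "T = Leaf i x0 vv C" by blast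
  have o: "p + 9 \<le> length SC" "SC ! (p + 1) = x0 div n * rec" "SC ! (p + 2) = x0 mod n * lb" "SC ! (p + 3) = code vv"
    "SC ! (p + 4) = 1" "SC ! (p + 5) = of_bool True" "orep SC (SC ! (p + 6)) (tobj row rec n lb C)" "SC ! (p + 7) = 0" "SC ! (p + 8) = 0"
    using assms(10) unfolding T by (auto simp: code_def All_less_Suc eval_nat_numeral lessThan_Suc)
  have ok: "i < d" "x0 \<le> M" "vv \<le> M" "tree_ok d M C" and pr: "posrep (v 22) (v 23) x" and us: "v 24 + k = kmax"
    using assms(10) unfolding T by auto
  have er0: "erep (0, a, b, c) (Empty, 0, 0)" for a b c by simp
  define l where "l = fm i (max x x0)"
  have tn: "runs test_node (v, W, R) 145 (\<lambda>(v', W', R'). R' = R \<and> (\<forall>u<20. v' u = v u) \<and> W_ok W' Jt Et \<and>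
    (if vv \<le> l then stk W' ((SC ! (p + 6), v 22, v 23, v 24) # (if v 24 + 1 \<le> kmax then 0 else 0, v 22, v 23, v 24 + 1) # es) (v' 20)
     else stk W' ((0, v 22, v 23, v 24) # (if v 24 < kmax then if True then p else SC ! (p + 6) else 0, l div n * rec, l mod n * lb + lb, v 24 + 1) # es) (v' 20)))"
    unfolding l_def
    by (rule test_node[OF assms(1-6,8) refl refl refl assms(9) ok(1) pr ok(2,3) _ o(1-5) _ o(6) refl o(8,9)]) (use us in auto)
  show ?thesis
  proof (rule runs_mono[OF tn order.refl])
    fix s' assume s: "case s' of (v', W', R') \<Rightarrow> R' = R \<and> (\<forall>u<20. v' u = v u) \<and> W_ok W' Jt Et \<and>
    (if vv \<le> l then stk W' ((SC ! (p + 6), v 22, v 23, v 24) # (if v 24 + 1 \<le> kmax then 0 else 0, v 22, v 23, v 24 + 1) # es) (v' 20)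
     else stk W' ((0, v 22, v 23, v 24) # (if v 24 < kmax then if True then p else SC ! (p + 6) else 0, l div n * rec, l mod n * lb + lb, v 24 + 1) # es) (v' 20))"
    obtain v' W' where s': "s' = (v', W', R)" and f: "\<forall>u<20. v' u = v u" "W_ok W' Jt Et" using s by (cases s') auto
    show "stepped v R Jt Et ((T, x, k) # ts) s'"
    proof (cases "vv \<le> l")
      case True
      have er: "erep (SC ! (p + 6), v 22, v 23, v 24) (C, x, k)" using o(7) ok pr us by simp
      show ?thesis unfolding stepped_def s' prod.case
        by (rule exI[of _ "(SC ! (p + 6), v 22, v 23, v 24) # (0, v 22, v 23, v 24 + 1) # es"],
            rule exI[of _ "(C, x, k) # (Empty, 0, 0) # ts"], rule exI[of _ "[]"])
          (use s f True er er0 assms(7) in \<open>auto simp: s' T l_def[symmetric] qry.simps(3) pops.simps(3) simp del: stk.simps erep.simps\<close>)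
    next
      case False
      then have lM: "l < M" using ok by simp
      show ?thesis
      proof (cases k)
        case 0
        then have "v 24 = kmax" using us by simp
        then show ?thesis unfolding stepped_def s' prod.case
          by (intro exI[of _ "(0, v 22, v 23, v 24) # (0, l div n * rec, l mod n * lb + lb, v 24 + 1) # es"]
              exI[of _ "(Empty, 0, 0) # (Empty, 0, 0) # ts"] exI[of _ "[]"])
            (use s f False er0 assms(7) 0 in \<open>auto simp: s' T l_def[symmetric] simp del: stk.simps erep.simps\<close>)
      next
        case (Suc k')
        then have lt: "v 24 < kmax" using us by simp
        have er: "erep (p, l div n * rec, l mod n * lb + lb, v 24 + 1) (T, Suc l, k')"
          using assms(10) posrep_Suc[OF lM] us Suc by simp
        show ?thesis unfolding stepped_def s' prod.case
          by (rule exI[of _ "(0, v 22, v 23, v 24) # (p, l div n * rec, l mod n * lb + lb, v 24 + 1) # es"],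
              rule exI[of _ "(Empty, 0, 0) # (T, Suc l, k') # ts"], rule exI[of _ "[]"])
            (use s f False er er0 assms(7) Suc lt in \<open>auto simp: s' T l_def[symmetric] simp del: stk.simps erep.simps\<close>)
      qed
    qed
  qed
next
  assume "\<exists>e x0 vv B U N. T = Node e i x0 vv B U N"
  then obtain e x0 vv C U N where T: "T = Node e i x0 vv C U N" by blast
  have o: "p + 9 \<le> length SC" "SC ! (p + 1) = x0 div n * rec" "SC ! (p + 2) = x0 mod n * lb" "SC ! (p + 3) = code vv"
    "SC ! (p + 4) = e" "SC ! (p + 5) = of_bool False" "orep SC (SC ! (p + 6)) (tobj row rec n lb C)"
    "orep SC (SC ! (p + 7)) (tobj row rec n lb U)" "orep SC (SC ! (p + 8)) (tobj row rec n lb N)"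
    using assms(10) unfolding T by (auto simp: code_def All_less_Suc eval_nat_numeral lessThan_Suc)
  have ok: "i < d" "x0 \<le> M" "vv \<le> M" "tree_ok d M C" "tree_ok d M U" "tree_ok d M N" "e \<le> 1"
    and pr: "posrep (v 22) (v 23) x" and us: "v 24 + k = kmax"
    using assms(10) unfolding T by auto
  have er0: "erep (0, a, b, c) (Empty, 0, 0)" for a b c by simp
  define l where "l = fm i (max x x0)"
  have tn: "runs test_node (v, W, R) 145 (\<lambda>(v', W', R'). R' = R \<and> (\<forall>u<20. v' u = v u) \<and> W_ok W' Jt Et \<and>
    (if vv \<le> l then stk W' ((SC ! (p + 6), v 22, v 23, v 24) # (if v 24 + e \<le> kmax then SC ! (p + 8) else 0, v 22, v 23, v 24 + e) # es) (v' 20)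
     else stk W' ((SC ! (p + 7), v 22, v 23, v 24) # (if v 24 < kmax then if False then p else SC ! (p + 6) else 0, l div n * rec, l mod n * lb + lb, v 24 + 1) # es) (v' 20)))"
    unfolding l_def
    by (rule test_node[OF assms(1-6,8) refl refl refl assms(9) ok(1) pr ok(2,3) _ o(1-5) ok(7) o(6) refl refl refl]) (use us in auto)
  show ?thesis
  proof (rule runs_mono[OF tn order.refl])
    fix s' assume s: "case s' of (v', W', R') \<Rightarrow> R' = R \<and> (\<forall>u<20. v' u = v u) \<and> W_ok W' Jt Et \<and>
    (if vv \<le> l then stk W' ((SC ! (p + 6), v 22, v 23, v 24) # (if v 24 + e \<le> kmax then SC ! (p + 8) else 0, v 22, v 23, v 24 + e) # es) (v' 20)
     else stk W' ((SC ! (p + 7), v 22, v 23, v 24) # (if v 24 < kmax then if False then p else SC ! (p + 6) else 0, l div n * rec, l mod n * lb + lb, v 24 + 1) # es) (v' 20))"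
    obtain v' W' where s': "s' = (v', W', R)" and f: "\<forall>u<20. v' u = v u" "W_ok W' Jt Et" using s by (cases s') auto
    show "stepped v R Jt Et ((T, x, k) # ts) s'"
    proof (cases "vv \<le> l")
      case True
      have er: "erep (SC ! (p + 6), v 22, v 23, v 24) (C, x, k)" using o(7) ok pr us by simp
      show ?thesis
      proof (cases "e \<le> k")
        case False
        then have gt: "\<not> v 24 + e \<le> kmax" using us by simp
        show ?thesis unfolding stepped_def s' prod.case
          by (rule exI[of _ "(SC ! (p + 6), v 22, v 23, v 24) # (0, v 22, v 23, v 24 + e) # es"],
            rule exI[of _ "(C, x, k) # (Empty, 0, 0) # ts"], rule exI[of _ "[]"])
          (use s f True False gt er er0 assms(7) in \<open>auto simp: s' T l_def[symmetric] simp del: stk.simps erep.simps\<close>)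
      next
        case ek: True
        then have le: "v 24 + e \<le> kmax" using us by simp
        have er2: "erep (SC ! (p + 8), v 22, v 23, v 24 + e) (N, x, k - e)" using o(9) ok pr us ek by simp
        show ?thesis unfolding stepped_def s' prod.case
          by (rule exI[of _ "(SC ! (p + 6), v 22, v 23, v 24) # (SC ! (p + 8), v 22, v 23, v 24 + e) # es"],
            rule exI[of _ "(C, x, k) # (N, x, k - e) # ts"], rule exI[of _ "[]"])
          (use s f True ek le er er2 assms(7) in \<open>auto simp: s' T l_def[symmetric] simp del: stk.simps erep.simps\<close>)
      qed
    next
      case False
      then have lM: "l < M" using ok by simp
      have er: "erep (SC ! (p + 7), v 22, v 23, v 24) (U, x, k)" using o(8) ok pr us by simp
      show ?thesis
      proof (cases k)
        case 0
        then have "v 24 = kmax" using us by simp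
        then show ?thesis unfolding stepped_def s' prod.case
          by (intro exI[of _ "(SC ! (p + 7), v 22, v 23, v 24) # (0, l div n * rec, l mod n * lb + lb, v 24 + 1) # es"]
              exI[of _ "(U, x, k) # (Empty, 0, 0) # ts"] exI[of _ "[]"])
            (use s f False er er0 assms(7) 0 in \<open>auto simp: s' T l_def[symmetric] simp del: stk.simps erep.simps\<close>)
      next
        case (Suc k')
        then have lt: "v 24 < kmax" using us by simp
        have er2: "erep (SC ! (p + 6), l div n * rec, l mod n * lb + lb, v 24 + 1) (C, Suc l, k')"
          using o(7) ok posrep_Suc[OF lM] us Suc by simp
        show ?thesis unfolding stepped_def s' prod.case
          by (rule exI[of _ "(SC ! (p + 7), v 22, v 23, v 24) # (SC ! (p + 6), l div n * rec, l mod n * lb + lb, v 24 + 1) # es"],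
              rule exI[of _ "(U, x, k) # (C, Suc l, k') # ts"], rule exI[of _ "[]"])
            (use s f False er er2 assms(7) Suc lt in \<open>auto simp: s' T l_def[symmetric] simp del: stk.simps erep.simps\<close>)
      qed
    qed
  qed
qed


lemma visit:
  assumes "env v" "W_ok W Jt Et" "maximal Et" "stk W (e # es) (v 20)" "list_all2 erep (e # es) (t # ts)" "kmax < BIG - 1"
    "sb + 5 * total_pops (t # ts) + 10 \<le> Wn"
  shows "runs visit (v, W, R) 161 (\<lambda>s. stepped v R Jt Et (t # ts) s \<and> (case s of (v', W', R') \<Rightarrow> v' 29 = of_bool (sb < v' 20)))"
proof -
  note ev = envD[OF assms(1)]
  obtain p xq xo us where e: "e = (p, xq, xo, us)" by (cases e)
  obtain T x k where t: "t = (T, x, k)" by (cases t)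
  have er: "erep (p, xq, xo, us) (T, x, k)" "list_all2 erep es ts" using assms(5) by (simp_all add: e t del: erep.simps)
  have len: "length es \<le> total_pops ts" using length_le_pops[of ts] er(2) by (simp add: list_all2_lengthD)
  have pp: "1 \<le> pops fm T x k" by (rule pops_pos)
  have cap: "sb + 5 * length es + 10 \<le> Wn"
    by (rule le_trans[OF _ assms(7)[unfolded t total_pops_simps]]) (use len pp in simp)
  obtain v1 where 1: "vsteps pop (v, W, R) = Some (v1, W, R)" "\<forall>u<20. v1 u = v u" "v1 21 = p" "v1 22 = xq" "v1 23 = xo" "v1 24 = us"
     "v1 25 = of_bool (0 < p)" "stk W es (v1 20)"
    using pop[OF assms(1,2) assms(4)[unfolded e] cap, of R] by blast
  have env1: "env v1" by (rule env_frame[OF assms(1)]) (use 1(2) in simp)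
  have mid: "runs (If 25 (Ops [VLoad 30 21, VLess 25 xZERO 30] ;; If 25 test_node report_node) (Ops [])) (v1, W, R) 149 (stepped v R Jt Et (t # ts))"
  proof (cases "T = Empty")
    case True
    then have "p = 0" using er(1) by simp
    have "stepped v R Jt Et (t # ts) (v1, W, R)" unfolding stepped_def prod.case
      by (rule exI[of _ es], rule exI[of _ ts], rule exI[of _ "[]"]) (use 1 er(2) assms(2) True in \<open>auto simp: t\<close>)
    then show ?thesis using 1(7) \<open>p = 0\<close> by (intro runs_IfF[OF _ runs_Ops[of "[]"]]) auto
  next
    case False
    then obtain ds os where ob: "tobj row rec n lb T = Rec ds os" "ds \<noteq> []" by (cases T) auto
    have p: "0 < p" "p < length SC" "SC ! p = ds ! 0" using er(1) ob by (auto simp: neq_Nil_conv)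
    define r where "r = ds ! 0"
    let ?v = "v1(30 := r, 25 := of_bool (0 < r))"
    have env2: "env ?v" by (rule env_frame[OF env1]) simp
    have 2: "vsteps [VLoad 30 21, VLess 25 xZERO 30] (v1, W, R) = Some (?v, W, R)"
      using p 1(3) envD(2)[OF env1] by (simp add: r_def)
    have st2: "stk W es (?v 20)" using 1(8) by simp
    have tr: "stepped v R Jt Et (t # ts) s'" if "stepped ?v R Jt Et (t # ts) s'" for s'
      using that 1(2) unfolding stepped_def by (auto simp del: stk.simps)
    have inner: "runs (If 25 test_node report_node) (?v, W, R) 146 (stepped v R Jt Et (t # ts))"
    proof (cases "\<exists>i T'. T = Rep i T'")
      case True
      then obtain i T' where T: "T = Rep i T'" by blast
      then have "r = 0" using ob by (auto simp: r_def)
      moreover have "runs report_node (?v, W, R) 16 (stepped ?v R Jt Et (t # ts))"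
        unfolding t T by (rule report_node[OF env2 assms(2) st2 cap er(2)]) (use 1 er(1) T in auto)
      ultimately show ?thesis by (intro runs_IfF[OF _ runs_mono[OF _ _ tr]]) auto
    next
      case nr: False
      obtain i where i: "i < d" "r = row i" "(\<exists>x0 vv B. T = Leaf i x0 vv B) \<or> (\<exists>e x0 vv B U N. T = Node e i x0 vv B U N)"
        using False nr er(1) ob by (cases T) (auto simp: r_def)
      \<comment> \<open>A test removes one entry and pushes two, so the stack needs room for one
        entry more than before. At least three removals are due to such an object, which guarantees
        this room.\<close>
      have "3 \<le> pops fm T x k" using i(3) pops_ge3 by blast
      then have cap2: "sb + 5 * length es + 15 \<le> Wn"
        by (intro le_trans[OF _ assms(7)[unfolded t total_pops_simps]]) (use len in simp)
      have "runs test_node (?v, W, R) 145 (stepped ?v R Jt Et (t # ts))"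
        unfolding t by (rule test_stepped[OF env2 assms(2,3) st2 cap2 assms(6) er(2), of p i]) (use 1 er(1) i in \<open>auto simp del: erep.simps\<close>)
      moreover have "0 < r" using row_pos i by simp
      ultimately show ?thesis by (intro runs_IfT[OF _ _ runs_mono[OF _ _ tr]]) auto
    qed
    show ?thesis using p(1) 1(7) by (intro runs_IfT[OF _ _ runs_Ops_Seq[OF 2 inner order.refl]]) auto
  qed
  show ?thesis unfolding visit_def
  proof (rule runs_Ops_Seq[OF 1(1)], rule runs_Seq[OF runs_mono[OF mid order.refl]])
    fix s' assume s: "stepped v R Jt Et (t # ts) s'"
    obtain v' W' R' where s': "s' = (v', W', R')" by (cases s')
    have fr: "\<forall>u<20. v' u = v u" using s unfolding s' stepped_def by auto
    have 3: "vsteps [VLess 29 xSBASE 20] s' = Some (v'(29 := of_bool (sb < v' 20)), W', R')" using fr ev(10) by (simp add: s')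
    have "stepped v R Jt Et (t # ts) (v'(29 := of_bool (sb < v' 20)), W', R')"
      using s unfolding s' stepped_def by auto
    then show "runs (Ops [VLess 29 xSBASE 20]) s' 1 (\<lambda>s. stepped v R Jt Et (t # ts) s \<and> (case s of (v', W', R') \<Rightarrow> v' 29 = of_bool (sb < v' 20)))"
      by (intro runs_Ops[OF 3]) auto
  qed (auto simp: pop_def)
qed

lemma visit_loop:
  assumes "env v" "W_ok W Jt Et" "maximal Et" "stk W es (v 20)" "list_all2 erep es ts" "kmax < BIG - 1"
    "sb + 5 * total_pops ts + 10 \<le> Wn" "v 29 = of_bool (sb < v 20)"
  shows "runs (While 29 visit) (v, W, R) (162 * total_pops ts + 1) (\<lambda>(v', W', R'). R' = R @ answers ts)"
  using assms
proof (induction "total_pops ts" arbitrary: ts es v W R rule: less_induct)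
  case less
  show ?case
  proof (cases ts)
    case Nil
    then have "es = []" using less.prems(5) by simp
    then have "v 29 = 0" using less.prems(4,8) by simp
    then show ?thesis using Nil by (intro runs_WhileF) auto
  next
    case (Cons t ts')
    then obtain e es' where es: "es = e # es'" using less.prems(5) by (auto simp: list_all2_Cons2)
    have "v 20 = sb + 5 * length es" by (rule stk_sp[OF less.prems(4)])
    then have v29: "v 29 = 1" using less.prems(8) es by simp
    have p0: "0 < total_pops ts" using length_le_pops[of ts] Cons by simp
    note vi = visit[OF less.prems(1-3) less.prems(4)[unfolded es] less.prems(5)[unfolded es Cons] less.prems(6) less.prems(7)[unfolded Cons], of R]
    show ?thesis
    proof (rule runs_WhileT[OF _ _ runs_mono[OF vi order.refl]])
      fix s assume s: "stepped v R Jt Et (t # ts') s \<and> (case s of (v', W', R') \<Rightarrow> v' 29 = of_bool (sb < v' 20))"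
      obtain v' W' R' where ss: "s = (v', W', R')" by (cases s)
      from s obtain es2 ts2 rp where 2: "\<forall>u<20. v' u = v u" "W_ok W' Jt Et" "list_all2 erep es2 ts2"
        "stk W' es2 (v' 20)" "R' = R @ rp" "rp @ answers ts2 = answers ts" "Suc (total_pops ts2) = total_pops ts" "v' 29 = of_bool (sb < v' 20)"
        unfolding ss stepped_def Cons by auto
      have env': "env v'" by (rule env_frame[OF less.prems(1)]) (use 2(1) in simp)
      have "runs (While 29 visit) (v', W', R') (162 * total_pops ts2 + 1) (\<lambda>(v'', W'', R''). R'' = R' @ answers ts2)"
        by (rule less.hyps) (use 2 less.prems(3,6,7) env' in \<open>auto simp del: stk.simps\<close>)
      moreover have "total_pops ts2 = total_pops ts - 1" using 2(7) by simp
      ultimately show "runs (While 29 visit) s (162 * (total_pops ts - 1) + 1) (\<lambda>(v', W', R'). R' = R @ answers ts)"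
        unfolding ss using 2(5,6) by (auto elim!: runs_mono)
    next
      show "Suc (161 + (162 * (total_pops ts - 1) + 1)) \<le> 162 * total_pops ts + 1" using p0 by simp
    qed (use v29 in auto)
  qed
qed

lemma traverse:
  assumes "env v" "W_ok W Jt Et" "maximal Et" "kmax < BIG - 1" "orep SC (v xROOT) (tobj row rec n lb T)" "tree_ok d M T"
    "sb + 5 * pops fm T 0 kmax + 10 \<le> Wn"
  shows "runs traverse (v, W, R) (162 * pops fm T 0 kmax + 14) (\<lambda>(v', W', R'). R' = R @ qry fm T 0 kmax)"
proof -
  note ev = envD[OF assms(1)]
  let ?v = "v(20 := sb)"
  have 1: "vsteps [VCopy 20 xSBASE] (v, W, R) = Some (?v, W, R)" using ev(10) by simp
  have env1: "env ?v" using assms(1) unfolding env_def by simp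
  have st: "stk W [] (?v 20)" by simp
  have p0: "1 \<le> pops fm T 0 kmax" by (rule pops_pos)
  have "\<exists>v' W'. vsteps (push xROOT xZERO xZERO xZERO) (?v, W, R) = Some (v', W', R) \<and> (\<forall>u. u \<noteq> 20 \<longrightarrow> u \<noteq> 26 \<longrightarrow> v' u = ?v u) \<and>
    W_ok W' Jt Et \<and> stk W' [(?v xROOT, ?v xZERO, ?v xZERO, ?v xZERO)] (v' 20)"
    by (rule push[OF env1 assms(2) st]) (use assms(7) p0 in auto)
  then obtain v' W' where 2: "vsteps (push xROOT xZERO xZERO xZERO) (?v, W, R) = Some (v', W', R)" "\<forall>u. u \<noteq> 20 \<longrightarrow> u \<noteq> 26 \<longrightarrow> v' u = ?v u"
    "W_ok W' Jt Et" "stk W' [(?v xROOT, ?v xZERO, ?v xZERO, ?v xZERO)] (v' 20)"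
    by blast
  have st2: "stk W' [(v xROOT, 0, 0, 0)] (v' 20)" using 2(4) ev(2) by simp
  have env2: "env v'" by (rule env_frame2[OF env1 2(2)])
  let ?v2 = "v'(29 := of_bool (sb < v' 20))"
  have 3: "vsteps [VLess 29 xSBASE 20] (v', W', R) = Some (?v2, W', R)" using envD(10)[OF env2] by simp
  have env3: "env ?v2" by (rule env_frame[OF env2]) simp
  have "posrep 0 0 0" unfolding posrep_def by (intro exI[of _ 0]) simp
  then have er: "list_all2 erep [(v xROOT, 0, 0, 0)] [(T, 0, kmax)]" using assms(5,6) by simp
  have "runs (While 29 visit) (?v2, W', R) (162 * total_pops [(T, 0, kmax)] + 1) (\<lambda>(v', W', R'). R' = R @ answers [(T, 0, kmax)])"
    by (rule visit_loop[OF env3 2(3) assms(3) _ er assms(4)]) (use st2 assms(7) in \<open>auto simp del: stk.simps\<close>)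
  then have 4: "runs (While 29 visit) (?v2, W', R) (162 * pops fm T 0 kmax + 1) (\<lambda>(v', W', R'). R' = R @ qry fm T 0 kmax)" by simp
  show ?thesis unfolding traverse_def
    by (rule runs_Ops_Seq[OF 1], rule runs_Ops_Seq[OF 2(1)], rule runs_Ops_Seq[OF 3 4]) (auto simp: push_def)
qed

theorem program:
  fixes bs :: "nat \<Rightarrow> bst"
  assumes "10 \<le> length SC" "SC ! 0 = kmax" "SC ! 1 = rec" "SC ! 2 = Qn * rec" "SC ! 3 = msb" "SC ! 4 = pm" "SC ! 5 = lowt" "SC ! 6 = lb"
    "SC ! 7 = sb" "orep SC (SC ! 8) (tobj row rec n lb T)" "orep SC (SC ! 9) (aobj row (map bs [0..<Suc Qn]))"
    "kmax < BIG - 1" "tree_ok d M T" "\<And>q. q \<le> Qn \<Longrightarrow> bst_ok q (bs q) \<and> bset (bs q) = {..<d} \<and> bheight (bs q) \<le> hb"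
    "sb + 5 * pops fm T 0 kmax + 10 \<le> Wn" "length W = Wn" "R = []"
  shows "runs program (v, W, R) ((37 * hb + 14) * Suc kmax + 24 * Suc Qn + 162 * pops fm T 0 kmax + 60)
    (\<lambda>(v', W', R'). R' = qry fm T 0 kmax \<or> R' = [] \<and> (\<forall>j<d. kmax < card {s. s < Qn \<and> pw s \<noteq> dw j s}))"
proof -
  define v1 where "v1 = v(0 := 1, 13 := 0, 26 := 9, 2 := kmax, 3 := rec, 4 := Qn * rec, 5 := msb, 6 := pm, 7 := lowt, 8 := lb, 9 := sb,
    10 := SC ! 8, 11 := SC ! 9, 12 := 5)"
  have ne: "SC \<noteq> []" using assms(1) by auto
  have B: "9 < BIG" using assms(1) SC_small by simp
  have cells: "SC ! 0 = kmax" "SC ! Suc 0 = rec" "SC ! Suc (Suc 0) = Qn * rec" "SC ! Suc (Suc (Suc 0)) = msb" "SC ! Suc (Suc (Suc (Suc 0))) = pm"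
    "SC ! Suc (Suc (Suc (Suc (Suc 0)))) = lowt" "SC ! Suc (Suc (Suc (Suc (Suc (Suc 0))))) = lb" "SC ! Suc (Suc (Suc (Suc (Suc (Suc (Suc 0)))))) = sb"
    using assms(2-9) by (simp_all add: eval_nat_numeral)
  have 1: "vsteps prologue (v, W, R) = Some (v1, W, R)"
    unfolding prologue_def using assms(1-9) cells B ne by (simp add: v1_def fun_upd_twist numeral_2_eq_2[symmetric])
  have env1: "env v1" by (simp add: env_def v1_def)
  note cq = copy_query[OF env1 assms(16), of R]
  show ?thesis unfolding program_def
  proof (rule runs_Ops_Seq[OF 1], rule runs_Seq[OF runs_mono[OF cq order.refl]])
    fix s2 assume "case s2 of (v', W', R') \<Rightarrow> R' = R \<and> (\<forall>u<20. v' u = v1 u) \<and> W_pw W' (Suc Qn)"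
    then obtain v2 W2 where s2: "s2 = (v2, W2, R)" "\<forall>u<20. v2 u = v1 u" "W_pw W2 (Suc Qn)" by (cases s2) auto
    have env2: "env v2" by (rule env_frame[OF env1]) (use s2 in simp)
    have an: "orep SC (v2 xANCH) (aobj row (map bs [0..<Suc Qn]))" using assms(11) s2(2) by (simp add: v1_def)
    have ro: "v2 xROOT = SC ! 8" using s2(2) by (simp add: v1_def)
    note pa = parse[OF env2 s2(3) assms(12) an assms(14), of R]
    show "runs (parse ;; If 25 traverse (Ops [])) s2 ((37 * hb + 14) * Suc kmax + 18 * Suc Qn + 6 + (162 * pops fm T 0 kmax + 15))
      (\<lambda>(v', W', R'). R' = qry fm T 0 kmax \<or> R' = [] \<and> (\<forall>j<d. kmax < card {s. s < Qn \<and> pw s \<noteq> dw j s}))"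
      unfolding s2(1)
    proof (rule runs_Seq[OF runs_mono[OF pa order.refl]])
      fix s3 assume s: "case s3 of (v', W', R') \<Rightarrow> R' = R \<and> (\<forall>u<20. v' u = v2 u) \<and>
       (v' 25 = 1 \<and> (\<exists>Jt Et. W_ok W' Jt Et \<and> maximal Et) \<or> v' 25 = 0 \<and> (\<forall>j<d. kmax < card {s. s < Qn \<and> pw s \<noteq> dw j s}))"
      obtain v3 W3 where s3: "s3 = (v3, W3, R)" "\<forall>u<20. v3 u = v2 u" using s by (cases s3) auto
      have env3: "env v3" by (rule env_frame[OF env2]) (use s3 in simp)
      from s consider Jt Et where "v3 25 = 1" "W_ok W3 Jt Et" "maximal Et" | "v3 25 = 0" "\<forall>j<d. kmax < card {s. s < Qn \<and> pw s \<noteq> dw j s}"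
        unfolding s3(1) by auto
      then show "runs (If 25 traverse (Ops [])) s3 (162 * pops fm T 0 kmax + 15)
        (\<lambda>(v', W', R'). R' = qry fm T 0 kmax \<or> R' = [] \<and> (\<forall>j<d. kmax < card {s. s < Qn \<and> pw s \<noteq> dw j s}))"
      proof cases
        case 1
        have r3: "orep SC (v3 xROOT) (tobj row rec n lb T)" using assms(10) ro s3(2) by simp
        have "runs traverse (v3, W3, R) (162 * pops fm T 0 kmax + 14) (\<lambda>(v', W', R'). R' = R @ qry fm T 0 kmax)"
          by (rule traverse[OF env3 1(2,3) assms(12) r3 assms(13,15)])
        then show ?thesis unfolding s3(1) using 1(1) assms(17)
          by (intro runs_IfT[where t = "162 * pops fm T 0 kmax + 14"]) (auto elim!: runs_mono)
      next
        case 2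
        then show ?thesis unfolding s3(1) using assms(17) by (intro runs_IfF[OF _ runs_Ops[of "[]"]]) auto
      qed
    qed (assumption, rule order.refl)
  qed (auto simp: prologue_def)
qed

end

subsection \<open>Static memory\<close>

definition placed :: "nat list \<Rightarrow> nat \<Rightarrow> nat list \<Rightarrow> bool" where
  "placed S b xs \<longleftrightarrow> b + length xs \<le> length S \<and> (\<forall>i<length xs. S ! (b + i) = xs ! i)"

lemma placed_append: "placed S b (xs @ ys) \<longleftrightarrow> placed S b xs \<and> placed S (b + length xs) ys"
proof
  assume a: "placed S b (xs @ ys)"
  have "S ! (b + length xs + i) = ys ! i" if "i < length ys" for i
    using a that unfolding placed_def by (metis add.assoc length_append nat_add_left_cancel_less nth_append_length_plus)
  moreover have "S ! (b + i) = xs ! i" if "i < length xs" for i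
    using a that unfolding placed_def by (metis length_append nth_append trans_less_add1)
  ultimately show "placed S b xs \<and> placed S (b + length xs) ys" using a by (auto simp: placed_def)
next
  assume a: "placed S b xs \<and> placed S (b + length xs) ys"
  have "S ! (b + i) = (xs @ ys) ! i" if "i < length (xs @ ys)" for i
  proof (cases "i < length xs")
    case False
    then have "i - length xs < length ys" "b + i = b + length xs + (i - length xs)" using that by auto
    then show ?thesis using a False unfolding placed_def nth_append by metis
  qed (use a in \<open>auto simp: placed_def nth_append\<close>)
  then show "placed S b (xs @ ys)" using a by (auto simp: placed_def)
qed

fun osize :: "obj \<Rightarrow> nat" where
  "osize Null = 0"
| "osize (Rec ds os) = length ds + length os + sum_list (map osize os)"

fun odata :: "obj \<Rightarrow> nat set" where
  "odata Null = {}"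
| "odata (Rec ds os) = set ds \<union> (\<Union>x\<in>set os. odata x)"

text \<open>A layout for base address \<open>b\<close>, valid in every memory that contains it
  there. Cells and the pointer are bounded, because each of them has to fit into \<open>K\<close>
  words in the end.\<close>

definition stored :: "nat \<Rightarrow> obj \<Rightarrow> nat list \<Rightarrow> nat \<Rightarrow> bool" where
  "stored b x cells p \<longleftrightarrow> length cells = osize x \<and> (\<forall>c\<in>set cells. c \<in> odata x \<or> c \<le> b + osize x) \<and> p \<le> b + osize x \<and> (\<forall>S. placed S b cells \<longrightarrow> orep S p x)"

lemma stored_list:
  assumes "0 < b" "\<And>x b. x \<in> set os \<Longrightarrow> 0 < b \<Longrightarrow> \<exists>cells p. stored b x cells p"
  shows "\<exists>cells ps. length cells = sum_list (map osize os) \<and> length ps = length os \<and>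
    (\<forall>c\<in>set cells. (\<exists>x\<in>set os. c \<in> odata x) \<or> c \<le> b + length cells) \<and> (\<forall>p\<in>set ps. p \<le> b + length cells) \<and>
    (\<forall>S. placed S b cells \<longrightarrow> (\<forall>i<length os. orep S (ps ! i) (os ! i)))"
  using assms
proof (induction os arbitrary: b)
  case Nil
  then show ?case by (intro exI[of _ "[]"]) auto
next
  case (Cons x os)
  obtain c1 p1 where 1: "stored b x c1 p1" using Cons.prems by (meson list.set_intros(1))
  have "0 < b + length c1" using Cons.prems by simp
  from Cons.IH[OF this] Cons.prems(2) obtain c2 ps where 2: "length c2 = sum_list (map osize os)" "length ps = length os"
    "\<forall>c\<in>set c2. (\<exists>x\<in>set os. c \<in> odata x) \<or> c \<le> b + length c1 + length c2" "\<forall>p\<in>set ps. p \<le> b + length c1 + length c2"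
    "\<forall>S. placed S (b + length c1) c2 \<longrightarrow> (\<forall>i<length os. orep S (ps ! i) (os ! i))" by auto
  have "length (c1 @ c2) = sum_list (map osize (x # os))" using 1 2(1) by (simp add: stored_def)
  moreover have "length (p1 # ps) = length (x # os)" using 2(2) by simp
  moreover have "\<forall>c\<in>set (c1 @ c2). (\<exists>x\<in>set (x # os). c \<in> odata x) \<or> c \<le> b + length (c1 @ c2)"
    using 1 2(3) by (fastforce simp: stored_def)
  moreover have "\<forall>p\<in>set (p1 # ps). p \<le> b + length (c1 @ c2)" using 1 2(4) Cons.prems(1) by (auto simp: stored_def)
  moreover have "\<forall>S. placed S b (c1 @ c2) \<longrightarrow> (\<forall>i<length (x # os). orep S ((p1 # ps) ! i) ((x # os) ! i))"
    using 1 2(5) by (auto simp: placed_append stored_def less_Suc_eq_0_disj)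
  ultimately show ?case by blast
qed

text \<open>Children are laid out before their parent, so their addresses are known when the
  pointers of the parent are written.\<close>

lemma stored_exists: "0 < b \<Longrightarrow> \<exists>cells p. stored b x cells p"
proof (induction x arbitrary: b)
  case Null
  show ?case by (intro exI[of _ "[]"] exI[of _ 0]) (simp add: stored_def)
next
  case (Rec ds os)
  obtain c2 ps where 2: "length c2 = sum_list (map osize os)" "length ps = length os"
    "\<forall>c\<in>set c2. (\<exists>x\<in>set os. c \<in> odata x) \<or> c \<le> b + length c2" "\<forall>p\<in>set ps. p \<le> b + length c2"
    "\<forall>S. placed S b c2 \<longrightarrow> (\<forall>i<length os. orep S (ps ! i) (os ! i))"
    using stored_list[OF Rec.prems Rec.IH] by blast
  let ?p = "b + length c2"
  have "orep S ?p (Rec ds os)" if "placed S b (c2 @ ds @ ps)" for S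
  proof -
    have "placed S b c2" "placed S ?p ds" "placed S (?p + length ds) ps"
      using that by (simp_all add: placed_append)
    then show ?thesis using 2(2,5) Rec.prems by (auto simp: placed_def)
  qed
  then have "stored b (Rec ds os) (c2 @ ds @ ps) ?p"
    unfolding stored_def using 2(1-4) by (auto simp: trans_le_add1)
  then show ?case by blast
qed

text \<open>Disjoint sparse table: ranks whose highest different bit is bit \<open>h - 1\<close> are separated by a multiple of \<open>2 ^ (h - 1)\<close>.\<close>

definition ord :: "nat \<Rightarrow> (nat \<Rightarrow> nat \<Rightarrow> nat) \<Rightarrow> nat \<Rightarrow> nat \<Rightarrow> nat list" where
  "ord Q dw d q = sort_key (\<lambda>j. map (dw j) [q..<Suc Q]) [0..<d]"

definition rank :: "nat \<Rightarrow> (nat \<Rightarrow> nat \<Rightarrow> nat) \<Rightarrow> nat \<Rightarrow> nat \<Rightarrow> nat \<Rightarrow> nat" where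
  "rank Q dw d j q = (SOME r. r < d \<and> ord Q dw d q ! r = j)"

definition lcw :: "nat \<Rightarrow> (nat \<Rightarrow> nat \<Rightarrow> nat) \<Rightarrow> nat \<Rightarrow> nat \<Rightarrow> nat \<Rightarrow> nat" where
  "lcw Q dw i j q = (LEAST f. q \<le> f \<and> (f = Suc Q \<or> dw i f \<noteq> dw j f))"

definition pivot :: "nat \<Rightarrow> nat \<Rightarrow> nat" where
  "pivot h r = r div 2 ^ h * 2 ^ h + 2 ^ (h - 1)"

text \<open>Equal ranks have xor 0 and meet at level 0, where a suffix is compared with itself; its
  common prefix extends over all words, hence \<open>Suc Q\<close>. At a positive level the entry is
  the common prefix with the suffix at the pivot of the block.\<close>

definition level :: "nat \<Rightarrow> (nat \<Rightarrow> nat \<Rightarrow> nat) \<Rightarrow> nat \<Rightarrow> nat \<Rightarrow> nat \<Rightarrow> nat \<Rightarrow> nat" where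
  "level Q dw d j q h =
    (let p = pivot h (rank Q dw d j q)
     in if h = 0 then Suc Q else if p < d then lcw Q dw j (ord Q dw d q ! p) q else 0)"

definition topbit :: "nat \<Rightarrow> nat" where
  "topbit z = (LEAST h. z < 2 ^ h)"

section \<open>Suffix order and common prefixes\<close>

lemma lexle_map: "map f [q..<Suc Q] \<le> map g [q..<Suc Q] \<Longrightarrow> lexle Q q f g"
proof (induction "Suc Q - q" arbitrary: q)
  case 0
  then show ?case by (auto simp: lexle_def)
next
  case (Suc n)
  then have "q \<le> Q" by simp
  then have "[q..<Suc Q] = q # [Suc q..<Suc Q]" by (simp add: upt_conv_Cons)
  then have "f q < g q \<or> f q = g q \<and> map f [Suc q..<Suc Q] \<le> map g [Suc q..<Suc Q]" using Suc.prems by (simp only: list.map Cons_le_Cons)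
  then show ?case
  proof
    assume a: "f q < g q"
    show ?thesis unfolding lexle_def
    proof (intro allI impI)
      fix r assume "q \<le> r" "\<forall>s. q \<le> s \<longrightarrow> s < r \<longrightarrow> f s = g s"
      then show "f r \<le> g r" using a by (cases "q = r") auto
    qed
  next
    assume a: "f q = g q \<and> map f [Suc q..<Suc Q] \<le> map g [Suc q..<Suc Q]"
    then have "lexle Q (Suc q) f g" using Suc.hyps by simp
    then show ?thesis using a unfolding lexle_def by (metis Suc_leD Suc_leI le_neq_implies_less order.refl)
  qed
qed

lemma lcw_props:
  assumes "q \<le> Q"
  shows "q \<le> lcw Q dw i j q" "lcw Q dw i j q \<le> Suc Q" "\<And>r. q \<le> r \<Longrightarrow> r < lcw Q dw i j q \<Longrightarrow> dw i r = dw j r"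
    "lcw Q dw i j q \<le> Q \<Longrightarrow> dw i (lcw Q dw i j q) \<noteq> dw j (lcw Q dw i j q)"
proof -
  let ?P = "\<lambda>f. q \<le> f \<and> (f = Suc Q \<or> dw i f \<noteq> dw j f)"
  have ex: "?P (Suc Q)" using assms by simp
  from LeastI[of ?P, OF ex] have 1: "?P (lcw Q dw i j q)" unfolding lcw_def .
  then show "q \<le> lcw Q dw i j q" by simp
  show "lcw Q dw i j q \<le> Suc Q" unfolding lcw_def by (rule Least_le[of ?P, OF ex])
  show "dw i r = dw j r" if "q \<le> r" "r < lcw Q dw i j q" for r
    using not_less_Least[of r ?P] that unfolding lcw_def by blast
  show "dw i (lcw Q dw i j q) \<noteq> dw j (lcw Q dw i j q)" if "lcw Q dw i j q \<le> Q" using 1 that by simp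
qed

lemma lcw_ge:
  assumes "q \<le> Q" "e \<le> Suc Q"
  shows "e \<le> lcw Q dw i j q \<longleftrightarrow> (\<forall>r. q \<le> r \<longrightarrow> r < e \<longrightarrow> dw i r = dw j r)"
proof
  note l = lcw_props[OF assms(1), where dw = dw and i = i and j = j]
  show "e \<le> lcw Q dw i j q \<Longrightarrow> \<forall>r. q \<le> r \<longrightarrow> r < e \<longrightarrow> dw i r = dw j r" using l(3) by simp
  assume a: "\<forall>r. q \<le> r \<longrightarrow> r < e \<longrightarrow> dw i r = dw j r"
  show "e \<le> lcw Q dw i j q"
  proof (rule ccontr)
    assume "\<not> e \<le> lcw Q dw i j q"
    then show False using a l(1,4) assms(2) by simp
  qed
qed

lemma lcw_sym: "lcw Q dw i j q = lcw Q dw j i q"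
  unfolding lcw_def by (metis (no_types, lifting))

text \<open>A suffix between two others in lexicographic order is squeezed: it shares their common
  prefix. Conversely, what both share with the one in between they share with each other.\<close>

lemma lcw_min:
  assumes "q \<le> Q" "lexle Q q (dw i) (dw m)" "lexle Q q (dw m) (dw j)"
  shows "min (lcw Q dw i m q) (lcw Q dw j m q) = lcw Q dw i j q"
proof (rule antisym)
  let ?e = "min (lcw Q dw i m q) (lcw Q dw j m q)"
  have e: "?e \<le> Suc Q" using lcw_props(2)[OF assms(1)] by (simp add: min_le_iff_disj)
  show "?e \<le> lcw Q dw i j q"
    unfolding lcw_ge[OF assms(1) e]
    using lcw_props(3)[OF assms(1), where dw = dw and i = i and j = m] lcw_props(3)[OF assms(1), where dw = dw and i = j and j = m] by simp
  let ?f = "lcw Q dw i j q"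
  have f: "?f \<le> Suc Q" by (rule lcw_props(2)[OF assms(1)])
  have ij: "dw i r = dw j r" if "q \<le> r" "r < ?f" for r using lcw_props(3)[OF assms(1)] that .
  have im: "dw i r = dw m r" if "q \<le> r" "r < ?f" for r
    using that
  proof (induction r rule: less_induct)
    case (less r)
    then have b: "\<forall>s. q \<le> s \<longrightarrow> s < r \<longrightarrow> dw i s = dw m s" by simp
    have b2: "\<forall>s. q \<le> s \<longrightarrow> s < r \<longrightarrow> dw m s = dw j s" using b ij less.prems by fastforce
    have rQ: "r \<le> Q" using less.prems f by simp
    have "dw i r \<le> dw m r" using assms(2) less.prems rQ b unfolding lexle_def by blast
    moreover have "dw m r \<le> dw j r" using assms(3) less.prems rQ b2 unfolding lexle_def by blast
    ultimately show ?case using ij less.prems by fastforce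
  qed
  then have "?f \<le> lcw Q dw i m q" "?f \<le> lcw Q dw j m q" unfolding lcw_ge[OF assms(1) f] using ij by fastforce+
  then show "?f \<le> ?e" by simp
qed

lemma ord_perm: "set (ord Q dw d q) = {0..<d}" "length (ord Q dw d q) = d" "distinct (ord Q dw d q)"
  by (auto simp: ord_def)

lemma ord_sorted: "r \<le> s \<Longrightarrow> s < d \<Longrightarrow> lexle Q q (dw (ord Q dw d q ! r)) (dw (ord Q dw d q ! s))"
proof -
  assume a: "r \<le> s" "s < d"
  have "sorted (map (\<lambda>j. map (dw j) [q..<Suc Q]) (ord Q dw d q))" unfolding ord_def by (rule sorted_sort_key)
  from sorted_nth_mono[OF this a(1)] a ord_perm(2)[of Q dw d q] show ?thesis by (intro lexle_map) simp
qed

lemma rank_props: "j < d \<Longrightarrow> rank Q dw d j q < d" "j < d \<Longrightarrow> ord Q dw d q ! rank Q dw d j q = j"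
proof -
  have "rank Q dw d j q < d \<and> ord Q dw d q ! rank Q dw d j q = j" if "j < d"
  proof -
    have "j \<in> set (ord Q dw d q)" using that ord_perm(1) by simp
    then have "\<exists>r. r < d \<and> ord Q dw d q ! r = j" using ord_perm(2)[of Q dw d q] by (metis in_set_conv_nth)
    then show ?thesis unfolding rank_def by (rule someI_ex)
  qed
  then show "j < d \<Longrightarrow> rank Q dw d j q < d" "j < d \<Longrightarrow> ord Q dw d q ! rank Q dw d j q = j" by auto
qed

lemma topbit_props:
  shows "z < 2 ^ topbit z" "z \<noteq> 0 \<Longrightarrow> 0 < topbit z \<and> 2 ^ (topbit z - 1) \<le> z" "z < 2 ^ H \<Longrightarrow> topbit z \<le> H" "topbit 0 = 0"
proof -
  have ex: "z < 2 ^ z" by (rule less_exp)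
  show 1: "z < 2 ^ topbit z" unfolding topbit_def by (rule LeastI[of "\<lambda>h. z < 2 ^ h", OF ex])
  show "z < 2 ^ H \<Longrightarrow> topbit z \<le> H" unfolding topbit_def by (rule Least_le)
  show "topbit 0 = 0" unfolding topbit_def by (rule Least_equality) auto
  assume z: "z \<noteq> 0"
  then have p: "0 < topbit z" using 1 by (cases "topbit z") auto
  have "\<not> z < 2 ^ (topbit z - 1)" using not_less_Least[of "topbit z - 1" "\<lambda>h. z < 2 ^ h"] p unfolding topbit_def by simp
  then show "0 < topbit z \<and> 2 ^ (topbit z - 1) \<le> z" using p by simp
qed

text \<open>Bit \<open>h - 1\<close> is the highest in which the ranks differ, so it is 0 in
  \<open>r\<close> and 1 in \<open>s\<close>, and the bits above agree. The pivot has these upper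
  bits, then a one, then zeros; it is the least number of the upper half of the block, to which
  \<open>s\<close> belongs and \<open>r\<close> does not.\<close>

lemma pivot_between:
  fixes r s :: nat
  assumes "r < s" "h = topbit (Bit_Operations.xor r s)"
  shows "0 < h" "pivot h r = pivot h s" "r < pivot h r" "pivot h r \<le> s"
proof -
  let ?z = "Bit_Operations.xor r s"
  have "?z \<noteq> 0"
  proof
    assume "?z = 0"
    then have "r = s" by (metis bit.xor_self xor.assoc xor.left_neutral xor_self_eq)
    then show False using assms(1) by simp
  qed
  then have t: "0 < h" "2 ^ (h - 1) \<le> ?z" "?z < 2 ^ h" using topbit_props(1,2)[of ?z] assms(2) by auto
  show "0 < h" by (rule t(1))
  have "drop_bit h ?z = 0" using t(3) by (simp add: drop_bit_eq_div)
  then have "Bit_Operations.xor (drop_bit h r) (drop_bit h s) = 0" by (simp add: drop_bit_xor)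
  then have dh: "r div 2 ^ h = s div 2 ^ h" by (metis drop_bit_eq_div xor.assoc xor.left_neutral xor_self_eq)
  then show p: "pivot h r = pivot h s" by (simp add: pivot_def)
  have h2: "(2::nat) ^ h = 2 * 2 ^ (h - 1)" using t(1) by (metis Suc_pred' power_Suc)
  let ?g = "2 ^ (h - 1) :: nat"
  have dd: "x div ?g div 2 = x div 2 ^ h" for x unfolding h2 mult.commute[of 2] by (rule div_mult2_eq[symmetric])
  have "drop_bit (h - 1) ?z \<noteq> 0" using t(2) by (simp add: drop_bit_eq_div div_eq_0_iff not_less del: drop_bit_xor)
  then have ne: "r div ?g \<noteq> s div ?g" by (metis drop_bit_eq_div drop_bit_xor xor_self_eq)
  have "r div ?g \<le> s div ?g" using assms(1) by (intro div_le_mono) simp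
  then have lt: "r div ?g < s div ?g" using ne by simp
  have half: "a = 2 * (a div 2) \<and> b = 2 * (a div 2) + 1" if "a div 2 = b div 2" "a < b" for a b :: nat
    using that by presburger
  have "r div ?g div 2 = s div ?g div 2" using dh dd by simp
  then have e: "r div ?g = 2 * (r div 2 ^ h)" "s div ?g = 2 * (r div 2 ^ h) + 1"
    using half[OF \<open>r div ?g div 2 = s div ?g div 2\<close> lt] unfolding dd[symmetric] by auto
  have pv: "pivot h r = (2 * (r div 2 ^ h) + 1) * ?g" unfolding pivot_def h2 by (simp add: algebra_simps)
  have "r < ?g + r div ?g * ?g" by (rule dividend_less_div_times) simp
  then have "r < (r div ?g + 1) * ?g" by (simp only: add_mult_distrib mult_1 add.commute)
  then show "r < pivot h r" unfolding pv e(1) .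
  have "s div ?g * ?g \<le> s" by simp
  then show "pivot h r \<le> s" unfolding pv e(2) .
qed

text \<open>The suffix at the common pivot lies between the two in sorted order, so
  \<open>lcw_min\<close> applies to it. The pivot is below \<open>d\<close>, being at most the
  larger rank.\<close>

lemma level_min:
  fixes dw :: "nat \<Rightarrow> nat \<Rightarrow> nat" and Q :: nat
  assumes "i < d" "j < d" "q \<le> Q"
  defines "h \<equiv> topbit (Bit_Operations.xor (rank Q dw d i q) (rank Q dw d j q))"
  shows "min (level Q dw d i q h) (level Q dw d j q h) = lcw Q dw i j q"
proof -
  let ?r = "\<lambda>j. rank Q dw d j q" and ?o = "ord Q dw d q"
  have main: "min (level Q dw d i q (topbit (Bit_Operations.xor (?r i) (?r j)))) (level Q dw d j q (topbit (Bit_Operations.xor (?r i) (?r j)))) = lcw Q dw i j q"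
    if ij: "i < d" "j < d" "?r i < ?r j" for i j
  proof -
    define h where "h = topbit (Bit_Operations.xor (?r i) (?r j))"
    note p = pivot_between[OF ij(3) h_def]
    have pd: "pivot h (?r i) < d" using p(4) rank_props(1)[OF ij(2), of Q dw q] by simp
    let ?m = "?o ! pivot h (?r i)"
    have "level Q dw d i q h = lcw Q dw i ?m q" "level Q dw d j q h = lcw Q dw j ?m q"
      using p pd by (simp_all add: level_def Let_def)
    moreover have "lexle Q q (dw i) (dw ?m)"
      using ord_sorted[of "?r i" "pivot h (?r i)" d Q q dw] rank_props(2)[OF ij(1), of Q dw q] p(3) pd by simp
    moreover have "lexle Q q (dw ?m) (dw j)"
      using ord_sorted[of "pivot h (?r i)" "?r j" d Q q dw] rank_props[OF ij(2), of Q dw q] p(4) by simp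
    ultimately show ?thesis using lcw_min[OF assms(3), of dw i ?m j] unfolding h_def by simp
  qed
  consider "?r i < ?r j" | "?r j < ?r i" | "?r i = ?r j" by linarith
  then show ?thesis
  proof cases
    case 1
    then show ?thesis using main[OF assms(1,2)] unfolding h_def by simp
  next
    case 2
    then show ?thesis using main[OF assms(2,1)] unfolding h_def by (simp add: lcw_sym[of _ _ i] xor.commute min.commute)
  next
    case 3
    have "i = ?o ! ?r i" by (rule rank_props(2)[OF assms(1), symmetric])
    also have "\<dots> = j" unfolding 3 by (rule rank_props(2)[OF assms(2)])
    finally have "i = j" .
    have "lcw Q dw j j q = Suc Q" using lcw_props(2,4)[OF assms(3), of dw j j] by (metis le_SucE)
    then show ?thesis unfolding h_def 3 \<open>i = j\<close> by (simp add: topbit_props(4) level_def)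
  qed
qed

lemma level_le: "q \<le> Q \<Longrightarrow> level Q dw d j q h \<le> Suc Q"
  by (simp add: level_def Let_def lcw_props(2))

section \<open>Balanced search trees and sizes of objects\<close>

function bst_of :: "nat list \<Rightarrow> bst" where
  "bst_of xs = (if xs = [] then BE else
    BN (xs ! (length xs div 2)) (bst_of (take (length xs div 2) xs)) (bst_of (drop (Suc (length xs div 2)) xs)))"
  by pat_completeness auto
termination
proof (relation "measure length")
  show "(take (length xs div 2) xs, xs) \<in> measure length" if "xs \<noteq> []" for xs :: "nat list"
    using that by (cases xs) auto
qed auto

declare bst_of.simps [simp del]

lemma bst_of_props:
  "bset (bst_of xs) = set xs \<and> (length xs < 2 ^ h \<longrightarrow> bheight (bst_of xs) \<le> h) \<and> osize (bobj row (bst_of xs)) = 3 * length xs \<and>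
    odata (bobj row (bst_of xs)) = row ` set xs"
proof (induction xs arbitrary: h rule: bst_of.induct)
  case (1 xs)
  show ?case
  proof (cases "xs = []")
    case False
    let ?m = "length xs div 2"
    let ?l = "take ?m xs" and ?r = "drop (Suc ?m) xs"
    have m: "?m < length xs" using False by (simp add: Suc_leI)
    have xs: "xs = ?l @ xs ! ?m # ?r" using m by (rule id_take_nth_drop)
    have e: "bst_of xs = BN (xs ! ?m) (bst_of ?l) (bst_of ?r)" using False by (subst bst_of.simps) simp
    note L = 1(1)[OF False] and R = 1(2)[OF False]
    have s: "set xs = insert (xs ! ?m) (set ?l \<union> set ?r)" by (subst xs) auto
    have h: "bheight (bst_of xs) \<le> h" if lt: "length xs < 2 ^ h"
    proof (cases h)
      case 0
      then show ?thesis using lt False by simp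
    next
      case (Suc g)
      then have "length ?l < 2 ^ g" "length ?r < 2 ^ g" using lt m by auto
      then show ?thesis using L[of g] R[of g] e Suc by simp
    qed
    have "osize (bobj row (bst_of xs)) = 3 * length xs" using e L R m by simp
    moreover have "odata (bobj row (bst_of xs)) = row ` set xs" unfolding s using e L R by auto
    moreover have "bset (bst_of xs) = set xs" unfolding s using e L R by simp
    ultimately show ?thesis using h by simp
  qed (simp add: bst_of.simps)
qed

lemma (in layout) bst_ok_bst_of:
  assumes "\<And>r s. r \<le> s \<Longrightarrow> s < length xs \<Longrightarrow> lexle Qn q (dw (xs ! r)) (dw (xs ! s))" "set xs \<subseteq> {..<d}"
  shows "bst_ok q (bst_of xs)"
  using assms
proof (induction xs rule: bst_of.induct)
  case (1 xs)
  show ?case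
  proof (cases "xs = []")
    case False
    let ?m = "length xs div 2"
    let ?l = "take ?m xs" and ?r = "drop (Suc ?m) xs"
    have m: "?m < length xs" using False by (simp add: Suc_leI)
    have e: "bst_of xs = BN (xs ! ?m) (bst_of ?l) (bst_of ?r)" using False by (subst bst_of.simps) simp
    have sub: "set ?l \<subseteq> {..<d}" "set ?r \<subseteq> {..<d}" using 1(4) set_take_subset[of ?m xs] set_drop_subset[of "Suc ?m" xs] by blast+
    have L: "bst_ok q (bst_of ?l)" by (rule 1(1)[OF False]) (use 1(3) sub in auto)
    have R: "bst_ok q (bst_of ?r)" by (rule 1(2)[OF False]) (use 1(3) sub in auto)
    have "\<forall>i\<in>set ?l. i < d \<and> lexle Qn q (dw i) (dw (xs ! ?m))"
    proof
      fix i assume i: "i \<in> set ?l"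
      then obtain r where "r < ?m" "i = xs ! r" by (auto simp: in_set_conv_nth)
      then show "i < d \<and> lexle Qn q (dw i) (dw (xs ! ?m))" using 1(3)[of r ?m] m sub i by auto
    qed
    moreover have "\<forall>i\<in>set ?r. i < d \<and> lexle Qn q (dw (xs ! ?m)) (dw i)"
    proof
      fix i assume i: "i \<in> set ?r"
      then obtain r where "r < length ?r" "i = xs ! (Suc ?m + r)" by (auto simp: in_set_conv_nth)
      then show "i < d \<and> lexle Qn q (dw (xs ! ?m)) (dw i)" using 1(3)[of ?m "Suc ?m + r"] sub i by auto
    qed
    moreover have "xs ! ?m < d" using 1(4) m by (meson lessThan_iff nth_mem subsetD)
    ultimately show ?thesis unfolding e using L R by (simp add: bst_of_props)
  qed (simp add: bst_of.simps)
qed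

lemma aobj_props:
  "osize (aobj row bs) = sum_list (map (\<lambda>t. osize (bobj row t) + 2) bs)" "odata (aobj row bs) = (\<Union>t\<in>set bs. odata (bobj row t))"
  by (induction bs) auto

lemma tobj_props:
  "osize (tobj row rec n lb T) \<le> 9 * nodes T"
  "tree_ok d (Q * n) T \<Longrightarrow> (\<And>j. j < d \<Longrightarrow> row j < N) \<Longrightarrow> d \<le> N \<Longrightarrow> Suc Q * rec \<le> N \<Longrightarrow> n * lb < rec \<Longrightarrow> 0 < n \<Longrightarrow> 1 < N \<Longrightarrow>
    odata (tobj row rec n lb T) \<subseteq> {..<N}"
proof -
  show "osize (tobj row rec n lb T) \<le> 9 * nodes T" by (induction T) auto
  have pos: "x div n * rec + x mod n * lb < N" if "x \<le> Q * n" "Suc Q * rec \<le> N" "n * lb < rec" "0 < n" for x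
  proof -
    have "x div n \<le> Q" using that by (metis div_le_mono div_mult_self_is_m mult.commute)
    then have "x div n * rec \<le> Q * rec" by (rule mult_le_mono1)
    moreover have "x mod n * lb \<le> n * lb" using that(4) by (intro mult_le_mono1) (simp add: less_imp_le)
    moreover have "Suc Q * rec = Q * rec + rec" by simp
    ultimately have "x div n * rec + x mod n * lb < Suc Q * rec" using that(3) by linarith
    then show ?thesis using that(2) by (rule less_le_trans)
  qed
  show "tree_ok d (Q * n) T \<Longrightarrow> (\<And>j. j < d \<Longrightarrow> row j < N) \<Longrightarrow> d \<le> N \<Longrightarrow> Suc Q * rec \<le> N \<Longrightarrow> n * lb < rec \<Longrightarrow> 0 < n \<Longrightarrow> 1 < N \<Longrightarrow>
    odata (tobj row rec n lb T) \<subseteq> {..<N}"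
  proof (induction T)
    case (Leaf i x0 v B)
    then show ?case using pos[of x0] pos[of v] by auto
  next
    case (Node e i x0 v B U N')
    then show ?case using pos[of x0] pos[of v] by auto
  qed auto
qed

subsection \<open>Size of the error tree\<close>

text \<open>As \<open>log d\<close> is at least 3/2, this lets powers of \<open>log d\<close> absorb
  factors linear in the number of errors. It is used for the tree and for the number of
  phrases.\<close>

lemma Suc_le_three_halves_power: "real j + 1 \<le> 2 * (3 / 2) ^ j"
proof (induction j)
  case (Suc j)
  show ?case
  proof (cases "j = 0")
    case False
    then have "real (Suc j) + 1 \<le> 3 / 2 * (real j + 1)" by simp
    also have "\<dots> \<le> 3 / 2 * (2 * (3 / 2) ^ j)" using Suc.IH by (intro mult_left_mono) auto
    finally show ?thesis by simp
  qed simp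
qed simp

text \<open>Split \<open>k\<close> by \<open>k \<le> (i + 1) (k - i + 1)\<close>. The first factor
  is at most \<open>2 ^ i\<close>, the second at most \<open>2 * l ^ (k - i)\<close>, while
  \<open>h choose i\<close> is at most \<open>(c l) ^ i / i!\<close>. The powers of \<open>l\<close>
  combine to \<open>l ^ k\<close>, and what is left is a partial sum of the exponential series at
  \<open>2 c\<close>. The factor \<open>k\<close> on the left is the one that occurs in
  \<open>etree_pops\<close>.\<close>

lemma below_sum_bound:
  fixes c l :: real
  assumes "real h \<le> c * l" "3 / 2 \<le> l"
  shows "real k * real (below_sum h k) \<le> 2 * exp (2 * c) * l ^ k"
proof -
  have c: "0 \<le> c"
  proof (rule ccontr)
    assume "\<not> 0 \<le> c"
    then have "c * l < 0" using assms(2) by (intro mult_neg_pos) auto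
    then show False using assms(1) by linarith
  qed
  have tm: "real k * real (h choose i) \<le> 2 * l ^ k * ((2 * c) ^ i / fact i)" if "i \<le> k" for i
  proof -
    let ?j = "k - i"
    have "k \<le> (i + 1) * (?j + 1)" using that by simp
    then have "real k \<le> real ((i + 1) * (?j + 1))" by (rule of_nat_mono)
    also have "\<dots> = (real i + 1) * (real ?j + 1)" by (simp only: of_nat_mult of_nat_add of_nat_1)
    also have "\<dots> \<le> 2 ^ i * (2 * l ^ ?j)"
    proof (rule mult_mono)
      have "Suc i \<le> 2 ^ i" by (rule Suc_leI[OF less_exp])
      then have "real (Suc i) \<le> real (2 ^ i)" by (rule of_nat_mono)
      then show "real i + 1 \<le> 2 ^ i" by simp
      have "(3 / 2) ^ ?j \<le> l ^ ?j" using assms(2) by (intro power_mono) auto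
      then show "real ?j + 1 \<le> 2 * l ^ ?j" using Suc_le_three_halves_power[of ?j] by linarith
    qed auto
    finally have 1: "real k \<le> 2 ^ i * (2 * l ^ ?j)" .
    have "real ((h choose i) * fact i) \<le> real (h ^ i)" by (rule of_nat_mono[OF binomial_fact_pow])
    also have "\<dots> = real h ^ i" by simp
    also have "\<dots> \<le> (c * l) ^ i" using assms(1) by (intro power_mono) auto
    finally have 2: "real (h choose i) \<le> (c * l) ^ i / fact i" by (simp add: field_simps)
    have "real k * real (h choose i) \<le> (2 ^ i * (2 * l ^ ?j)) * ((c * l) ^ i / fact i)"
      using assms(2) by (intro mult_mono 1 2) auto
    also have "\<dots> = 2 * (l ^ i * l ^ ?j) * ((2 * c) ^ i / fact i)" by (simp add: power_mult_distrib)
    also have "l ^ i * l ^ ?j = l ^ k" using that by (simp add: power_add[symmetric])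
    finally show ?thesis .
  qed
  have "real k * real (below_sum h k) = (\<Sum>i\<le>k. real k * real (h choose i))" by (simp add: below_sum_def sum_distrib_left)
  also have "\<dots> \<le> (\<Sum>i\<le>k. 2 * l ^ k * ((2 * c) ^ i / fact i))" by (intro sum_mono tm) simp
  also have "\<dots> = 2 * l ^ k * (\<Sum>i\<le>k. (2 * c) ^ i / fact i)" by (simp add: sum_distrib_left)
  also have "(\<Sum>i\<le>k. (2 * c) ^ i / fact i) \<le> exp (2 * c)"
  proof -
    have s: "(\<lambda>i. (2 * c) ^ i /\<^sub>R fact i) sums exp (2 * c)" by (rule exp_converges)
    have "(\<Sum>i\<le>k. (2 * c) ^ i /\<^sub>R fact i) \<le> suminf (\<lambda>i. (2 * c) ^ i /\<^sub>R fact i)"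
      using c by (intro sum_le_suminf sums_summable[OF s]) auto
    then show ?thesis using sums_unique[OF s] by (simp add: divide_inverse mult.commute)
  qed
  finally show ?thesis using assms(2) by (simp add: mult_left_mono mult.commute mult.left_commute)
qed

text \<open>By \<open>1 - x \<le> exp (- x)\<close> the power is at most
  \<open>exp (- h / (2 t))\<close>, which is below \<open>1 / d\<close> as soon as \<open>h\<close>
  exceeds \<open>2 t ln d\<close>.\<close>

lemma height_exists:
  assumes "2 < d" "0 < t"
  shows "\<exists>h. real d * ((2 * real t - 1) / (2 * real t)) ^ h < 1 \<and> real h \<le> (2 * real t + 1) * log 2 (real d)"
proof -
  define h where "h = nat \<lfloor>2 * real t * ln (real d)\<rfloor> + 1"
  have ld: "0 \<le> ln (real d)" using assms by simp
  have h1: "2 * real t * ln (real d) < real h" unfolding h_def by linarith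
  have "real h \<le> 2 * real t * ln (real d) + 1" unfolding h_def using ld by (simp add: of_nat_nat)
  also have "\<dots> \<le> 2 * real t * log 2 (real d) + log 2 (real d)"
  proof (rule add_mono)
    have "ln (2 :: real) \<le> 1" using ln_2_less_1 by linarith
    then have "log 2 (real d) * ln 2 \<le> log 2 (real d) * 1" using assms by (intro mult_left_mono) auto
    moreover have "log 2 (real d) * ln 2 = ln (real d)" by (simp add: log_def)
    ultimately show "2 * real t * ln (real d) \<le> 2 * real t * log 2 (real d)" by (intro mult_left_mono) auto
    show "1 \<le> log 2 (real d)" using assms by (simp add: le_log_iff)
  qed
  finally have h2: "real h \<le> (2 * real t + 1) * log 2 (real d)" by (simp add: algebra_simps)
  have "(2 * real t - 1) / (2 * real t) = 1 + (- 1 / (2 * real t))" using assms(2) by (simp add: field_simps)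
  also have "\<dots> \<le> exp (- 1 / (2 * real t))" by (rule exp_ge_add_one_self)
  finally have "((2 * real t - 1) / (2 * real t)) ^ h \<le> exp (- 1 / (2 * real t)) ^ h"
    using assms(2) by (intro power_mono) (auto simp: field_simps)
  also have "\<dots> = exp (real h * (- 1 / (2 * real t)))" by (rule exp_of_nat_mult[symmetric])
  also have "\<dots> < exp (- ln (real d))" using h1 assms(2) by (simp add: field_simps)
  also have "\<dots> = 1 / real d" using assms(1) by (simp add: exp_minus inverse_eq_divide)
  finally have "real d * ((2 * real t - 1) / (2 * real t)) ^ h < real d * (1 / real d)"
    using assms(1) by (intro mult_strict_left_mono) auto
  then have "real d * ((2 * real t - 1) / (2 * real t)) ^ h < 1" using assms(1) by simp
  then show ?thesis using h2 by blast
qed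

text \<open>The square of \<open>2 powr (3 / 2)\<close> is 8, which is less than 9.\<close>

lemma log2_ge_three_halves: "2 < d \<Longrightarrow> 3 / 2 \<le> log 2 (real d)"
proof -
  assume d: "2 < d"
  have "(3 / 2) = log 2 (2 powr (3 / 2))" by simp
  also have "2 powr (3 / 2) \<le> real d"
  proof -
    have "(2 powr (3 / 2))\<^sup>2 = (8 :: real)" by (simp add: powr_power)
    also have "\<dots> \<le> (real d)\<^sup>2" using power_mono[of 3 "real d" 2] d by simp
    finally show ?thesis by (rule power2_le_imp_le) simp
  qed
  then have "log 2 (2 powr (3 / 2)) \<le> log 2 (real d)" using d by (subst log_le_cancel_iff) auto
  finally show ?thesis .
qed

text \<open>If \<open>(log d)\<^sup>k\<close> exceeds \<open>d (m + 1)\<close>, then testing all strings meets the bounds; otherwise the tree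
  has size polynomial in \<open>d m\<close>, so that a constant number of words can address it.\<close>

lemma tree_choice:
  fixes f :: "nat \<Rightarrow> nat \<Rightarrow> nat" and d t k m M :: nat
  assumes "2 < d" "0 < t" "0 < k" "k \<le> m" "\<forall>i<d. \<forall>p<M. f i p < t"
  defines "c \<equiv> 2 * exp (2 * (2 * real t + 1))" and "l \<equiv> log 2 (real d)"
  shows "\<exists>T b. tree_ok d M T \<and> real (nodes T) \<le> 3 * c * real d * l ^ k \<and> real (nodes T) \<le> 3 * c * (real d)\<^sup>2 * (real m + 1) \<and>
    real b \<le> (5 * c + 1) * real d * l ^ k \<and> real b \<le> (5 * c + 1) * (real d)\<^sup>2 * (real m + 1) \<and>
    (\<forall>P fm. mism M P f d fm \<longrightarrow> distinct (qry fm T 0 k) \<and> set (qry fm T 0 k) = {i. i < d \<and> card {y. y < M \<and> f i y \<noteq> P y} \<le> k} \<and>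
      pops fm T 0 k \<le> b \<and> real (pops fm T 0 k) \<le> 5 * c * l ^ (k + 1) + real (length (qry fm T 0 k)))"
proof -
  have l: "3 / 2 \<le> l" unfolding l_def by (rule log2_ge_three_halves[OF assms(1)])
  have ld: "l \<le> real d"
  proof -
    have "d \<le> 2 ^ d" by (simp add: less_imp_le)
    then have "real d \<le> real (2 ^ d)" by (rule of_nat_mono)
    then show ?thesis unfolding l_def using assms(1) by (subst log_le_iff) (auto simp: powr_realpow)
  qed
  have "1 \<le> exp (2 * (2 * real t + 1))" by simp
  then have c: "1 \<le> c" unfolding c_def by linarith
  have lk: "1 \<le> l ^ k" using l by (intro one_le_power) simp
  have dlk: "real d \<le> real d * l ^ k" using lk by (simp add: mult_le_cancel_left1)
  have dm: "real d \<le> (real d)\<^sup>2 * (real m + 1)"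
  proof -
    have "real d * 1 \<le> real d * (real d * (real m + 1))" using assms(1) by (intro mult_left_mono mult_ge1_I) auto
    then show ?thesis by (simp add: power2_eq_square mult.assoc)
  qed
  have cnt: "mism.cnt M P (f i) 0 = card {y. y < M \<and> f i y \<noteq> P y}" if "mism M P f d fm" for P fm i
    using mism.cnt_def[OF that] by simp
  have len: "length (qry fm T 0 k) \<le> d" if "distinct (qry fm T 0 k)" "set (qry fm T 0 k) = {i. i < d \<and> Q i}" for fm T Q
  proof -
    have "length (qry fm T 0 k) = card {i. i < d \<and> Q i}" using distinct_card[OF that(1)] that(2) by simp
    also have "\<dots> \<le> card {..<d}" by (intro card_mono) auto
    finally show ?thesis by simp
  qed
  show ?thesis
  proof (cases "l ^ k \<le> real d * (real m + 1)")
    case True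
    obtain h where h: "real d * ((2 * real t - 1) / (2 * real t)) ^ h < 1" "real h \<le> (2 * real t + 1) * l"
      using height_exists[OF assms(1,2)] unfolding l_def by blast
    let ?X = "map (\<lambda>i. (i, f i, 0 :: nat)) [0..<d]"
    obtain T where T: "etree M k h ?X T"
      using etree_exists[of t ?X M h k] assms(2,5) h(1) by auto
    have ok: "tree_ok d M T" by (rule etree_ok[OF T]) auto
    have bs: "real k * real (below_sum h k) \<le> c * l ^ k" for k unfolding c_def by (rule below_sum_bound[OF h(2) l])
    have "real (below_sum h k) \<le> real k * real (below_sum h k)" using assms(3) by (simp add: mult_le_cancel_right1)
    with bs have bk: "real (below_sum h k) \<le> c * l ^ k" by (rule order.trans[rotated])
    have "nodes T \<le> 3 * d * below_sum h k" using etree_nodes[OF T] assms(1) by simp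
    then have "real (nodes T) \<le> real (3 * d * below_sum h k)" by (rule of_nat_mono)
    also have "\<dots> \<le> 3 * real d * (c * l ^ k)" using bk by (simp add: mult_left_mono)
    finally have n1: "real (nodes T) \<le> 3 * c * real d * l ^ k" by (simp add: algebra_simps)
    also have "\<dots> \<le> 3 * c * real d * (real d * (real m + 1))" using True c by (intro mult_left_mono) auto
    finally have n2: "real (nodes T) \<le> 3 * c * (real d)\<^sup>2 * (real m + 1)" by (simp add: power2_eq_square mult.assoc)
    \<comment> \<open>No search reports more than \<open>d\<close> strings. This makes the bound
      independent of the query, so that it can fix the size of the stack.\<close>
    let ?b = "3 * (k + 1) * below_sum h (k + 1) + d"
    have p: "real (3 * (k + 1) * below_sum h (k + 1)) \<le> 3 * (c * l ^ (k + 1))"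
      using bs[of "k + 1"] by (simp add: algebra_simps)
    have "c * l ^ (k + 1) \<le> c * (real d * l ^ k)" using ld c lk by (intro mult_left_mono) (auto intro: mult_right_mono)
    have "0 \<le> c * (real d * l ^ k)" using c lk by simp
    then have "real ?b \<le> 5 * (c * (real d * l ^ k)) + real d * l ^ k"
      using p dlk \<open>c * l ^ (k + 1) \<le> c * (real d * l ^ k)\<close> unfolding of_nat_add by linarith
    then have b1: "real ?b \<le> (5 * c + 1) * real d * l ^ k" by (simp add: algebra_simps)
    have "c * (real d * l ^ k) \<le> c * (real d * (real d * (real m + 1)))" using True c by (intro mult_left_mono) auto
    then have "real ?b \<le> 3 * (c * (real d * (real d * (real m + 1)))) + (real d)\<^sup>2 * (real m + 1)"
      using p dm \<open>c * l ^ (k + 1) \<le> c * (real d * l ^ k)\<close> by simp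
    also have "\<dots> \<le> 5 * (c * (real d * (real d * (real m + 1)))) + (real d)\<^sup>2 * (real m + 1)" using c by simp
    finally have b2: "real ?b \<le> (5 * c + 1) * (real d)\<^sup>2 * (real m + 1)" by (simp add: algebra_simps power2_eq_square)
    have "distinct (qry fm T 0 k) \<and> set (qry fm T 0 k) = {i. i < d \<and> card {y. y < M \<and> f i y \<noteq> P y} \<le> k} \<and>
      pops fm T 0 k \<le> ?b \<and> real (pops fm T 0 k) \<le> 5 * c * l ^ (k + 1) + real (length (qry fm T 0 k))" if mi: "mism M P f d fm" for P fm
    proof -
      have "etree M k h (mism.items f [0..<d]) T" using T by (simp add: mism.items_def[OF mi])
      from mism.qry_etree[OF mi this] have q: "distinct (qry fm T 0 k)" "set (qry fm T 0 k) = {i. i < d \<and> card {y. y < M \<and> f i y \<noteq> P y} \<le> k}"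
        unfolding cnt[OF mi] by auto
      have pp: "pops fm T 0 k \<le> 3 * (k + 1) * below_sum h (k + 1) + length (qry fm T 0 k)" by (rule etree_pops[OF T])
      then have "real (pops fm T 0 k) \<le> real (3 * (k + 1) * below_sum h (k + 1) + length (qry fm T 0 k))" by (rule of_nat_mono)
      also have "\<dots> \<le> 3 * (c * l ^ (k + 1)) + real (length (qry fm T 0 k))" using p by simp
      also have "\<dots> \<le> 5 * c * l ^ (k + 1) + real (length (qry fm T 0 k))" using c l by simp
      finally show ?thesis using q pp len[OF q] by simp
    qed
    then show ?thesis using ok n1 n2 b1 b2 by blast
  next
    case False
    let ?T = "scan M [0..<d]"
    have ok: "tree_ok d M ?T" and nd: "nodes ?T = 3 * d" using scan_ok[of "[0..<d]" d M] by (auto simp: atLeast0LessThan)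
    have n1: "real (nodes ?T) \<le> 3 * c * real d * l ^ k"
    proof -
      have "real d * 1 \<le> real d * l ^ k * c" using c lk dlk by (metis mult.right_neutral mult_mono' of_nat_0_le_iff order.trans zero_le_one)
      then show ?thesis unfolding nd by (simp add: algebra_simps)
    qed
    have n2: "real (nodes ?T) \<le> 3 * c * (real d)\<^sup>2 * (real m + 1)"
    proof -
      have "real d * 1 \<le> (real d)\<^sup>2 * (real m + 1) * c" using c dm by (metis mult.right_neutral mult_mono' of_nat_0_le_iff order.trans zero_le_one)
      then show ?thesis unfolding nd by (simp add: algebra_simps)
    qed
    let ?b = "d * (3 * k + 4) + d + 1"
    have "real (d * (3 * k + 4) + 1) \<le> real (d * (3 * m + 4) + 1)" using assms(4) by (intro of_nat_mono) simp
    also have "\<dots> \<le> 4 * (real d * (real m + 1)) + 1" by (simp add: algebra_simps)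
    also have "\<dots> \<le> 5 * (real d * (real m + 1))"
    proof -
      have "1 * 1 \<le> real d * (real m + 1)" using assms(1) by (intro mult_mono) auto
      then show ?thesis by simp
    qed
    finally have q: "real (d * (3 * k + 4) + 1) \<le> 5 * (real d * (real m + 1))" .
    have q2: "real (d * (3 * k + 4) + 1) \<le> 5 * c * l ^ k"
    proof -
      have "real (d * (3 * k + 4) + 1) \<le> 5 * l ^ k * 1" using q False by simp
      also have "5 * l ^ k * 1 \<le> 5 * l ^ k * c" using c lk by (intro mult_left_mono) auto
      finally show ?thesis by (simp add: mult_ac)
    qed
    have b1: "real ?b \<le> (5 * c + 1) * real d * l ^ k"
    proof -
      have "5 * c * l ^ k * 1 \<le> 5 * c * l ^ k * real d" using c lk assms(1) by (intro mult_left_mono) auto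
      then show ?thesis using q2 dlk by (simp add: algebra_simps)
    qed
    have b2: "real ?b \<le> (5 * c + 1) * (real d)\<^sup>2 * (real m + 1)"
    proof -
      have "1 * (real d * (real m + 1)) \<le> (c * real d) * (real d * (real m + 1))" using c assms(1) by (intro mult_right_mono mult_ge1_I) auto
      then have "real ?b \<le> 5 * ((c * real d) * (real d * (real m + 1))) + (real d)\<^sup>2 * (real m + 1)" using q dm by simp
      then show ?thesis by (simp add: algebra_simps power2_eq_square)
    qed
    have "distinct (qry fm ?T 0 k) \<and> set (qry fm ?T 0 k) = {i. i < d \<and> card {y. y < M \<and> f i y \<noteq> P y} \<le> k} \<and>
      pops fm ?T 0 k \<le> ?b \<and> real (pops fm ?T 0 k) \<le> 5 * c * l ^ (k + 1) + real (length (qry fm ?T 0 k))" if mi: "mism M P f d fm" for P fm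
    proof -
      have sub: "set [0..<d] \<subseteq> {..<d}" by auto
      have qf: "qry fm ?T 0 k = filter (\<lambda>i. card {y. y < M \<and> f i y \<noteq> P y} \<le> k) [0..<d]"
        using mism.qry_scan[OF mi sub, of k] unfolding cnt[OF mi] .
      then have q: "distinct (qry fm ?T 0 k)" "set (qry fm ?T 0 k) = {i. i < d \<and> card {y. y < M \<and> f i y \<noteq> P y} \<le> k}" by auto
      have pp: "pops fm ?T 0 k \<le> d * (3 * k + 4) + length (qry fm ?T 0 k) + 1" using mism.pops_scan[OF mi sub, of k] by simp
      then have "real (pops fm ?T 0 k) \<le> real (d * (3 * k + 4) + length (qry fm ?T 0 k) + 1)" by (rule of_nat_mono)
      also have "\<dots> \<le> 5 * c * l ^ k + real (length (qry fm ?T 0 k))" using q2 by simp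
      also have "5 * c * l ^ k \<le> 5 * c * l ^ (k + 1)" using c l lk by (intro mult_left_mono power_increasing) auto
      finally show ?thesis using q pp len[OF q] by simp
    qed
    then show ?thesis using ok n1 n2 b1 b2 by blast
  qed
qed

subsection \<open>A small modulus separating the powers of two\<close>

text \<open>Lifting the exponent at the prime 3. Modulo 9 the power \<open>4 ^ v\<close> is
  \<open>1 + 3 v\<close>, so 3 divides \<open>v\<close>, say \<open>v = 3 u\<close>. With
  \<open>4 ^ u = 1 + 3 x\<close> the cube satisfies
  \<open>(1 + 3 x) ^ 3 - 1 = 9 x (1 + 3 (x + x * x))\<close>, whose last factor is coprime to 3. So
  passing from \<open>v\<close> to \<open>u\<close> costs exactly one factor 3.\<close>

lemma three_power_dvd:
  "(3 :: int) ^ Suc s dvd 4 ^ v - 1 \<Longrightarrow> 3 ^ s dvd int v"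
proof (induction s arbitrary: v)
  case (Suc s)
  have four: "\<exists>z. (4 :: int) ^ x = 1 + 3 * int x + 9 * z" for x
  proof (induction x)
    case (Suc x)
    then obtain z where "(4 :: int) ^ x = 1 + 3 * int x + 9 * z" by blast
    then have "(4 :: int) ^ Suc x = 1 + 3 * int (Suc x) + 9 * (int x + 4 * z)" by simp
    then show ?case by blast
  qed (rule exI[of _ 0], simp)
  obtain z where z: "(4 :: int) ^ v = 1 + 3 * int v + 9 * z" using four by blast
  have "(9 :: int) dvd 3 ^ Suc (Suc s)" by simp
  then have "9 dvd (4 :: int) ^ v - 1" using Suc.prems dvd_trans by blast
  then have "9 dvd 3 * int v + 9 * z" unfolding z by simp
  then have "9 dvd 3 * int v" using dvd_add_times_triv_right_iff[of 9 "3 * int v" z] by (simp add: mult.commute)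
  then have "3 dvd int v" by presburger
  then obtain u where u: "v = 3 * u" by (metis dvdE int_dvd_int_iff of_nat_numeral)
  obtain y where "(4 :: int) ^ u = 1 + 3 * int u + 9 * y" using four by blast
  then have "(4 :: int) ^ u = 1 + 3 * (int u + 3 * y)" by simp
  then obtain x where x: "(4 :: int) ^ u = 1 + 3 * x" by blast
  have "(4 :: int) ^ v - 1 = (1 + 3 * x) ^ 3 - 1" unfolding u x[symmetric] by (simp only: power_mult[symmetric] mult.commute)
  also have "\<dots> = 3 * (3 * x * (1 + 3 * (x + x * x)))" by (simp add: power3_eq_cube algebra_simps)
  finally have "3 * 3 ^ Suc s dvd 3 * (3 * x * (1 + 3 * (x + x * x)))" using Suc.prems by simp
  then have "3 ^ Suc s dvd 3 * x * (1 + 3 * (x + x * x))" by (subst (asm) dvd_mult_cancel_left) simp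
  moreover have "coprime ((3 :: int) ^ Suc s) (1 + 3 * (x + x * x))"
  proof -
    have "coprime (3 :: int) (1 + 3 * (x + x * x))"
    proof (rule coprimeI)
      fix c :: int assume "c dvd 3" "c dvd 1 + 3 * (x + x * x)"
      moreover have "c dvd 3 * (x + x * x)" using \<open>c dvd 3\<close> by (rule dvd_mult2)
      ultimately show "is_unit c" by (simp only: dvd_add_left_iff)
    qed
    then show ?thesis by (simp only: coprime_power_left_iff) simp
  qed
  ultimately have "3 ^ Suc s dvd 3 * x" by (simp only: coprime_dvd_mult_left_iff)
  then have "3 ^ Suc s dvd (4 :: int) ^ u - 1" unfolding x by simp
  from Suc.IH[OF this] show ?case unfolding u by simp
qed simp

text \<open>2 is a primitive root modulo \<open>3 ^ Suc s\<close>, of order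
  \<open>2 * 3 ^ s\<close>. The least \<open>s\<close> for which this order reaches \<open>w\<close>
  separates the first \<open>w\<close> powers and keeps the modulus linear in \<open>w\<close>. For
  \<open>w \<le> 4\<close> a power of three may not fit into a word, and \<open>2 ^ w - 1\<close> is
  taken.\<close>

lemma modulus_exists:
  fixes w :: nat
  assumes "0 < w"
  shows "\<exists>p. 0 < p \<and> p < 2 ^ w \<and> p \<le> 5 * w + 3 \<and> inj_on (\<lambda>i. (2 * 2 ^ i - 1) mod p) {..<w}"
proof (cases "w \<le> 4")
  case True
  then have "w \<in> {1, 2, 3, 4}" using assms by auto
  moreover have "{..<1} = {0::nat}" "{..<2} = {0::nat, 1}" "{..<3} = {0::nat, 1, 2}" "{..<4} = {0::nat, 1, 2, 3}" by auto
  ultimately show ?thesis by (intro exI[of _ "2 ^ w - 1"]) (elim insertE emptyE; simp)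
next
  case False
  define s where "s = (LEAST s. w \<le> 2 * 3 ^ s)"
  have "w < 2 ^ w" "(2::nat) ^ w \<le> 3 ^ w" by (rule less_exp, rule power_mono) auto
  then have "w \<le> 2 * 3 ^ w" by linarith
  then have s: "w \<le> 2 * 3 ^ s" unfolding s_def by (rule LeastI)
  have s0: "s \<noteq> 0" using s False by (intro notI) simp
  then have "\<not> w \<le> 2 * 3 ^ (s - 1)" using not_less_Least[of "s - 1" "\<lambda>s. w \<le> 2 * 3 ^ s"] unfolding s_def by simp
  moreover have "(3::nat) ^ Suc s = 9 * 3 ^ (s - 1)" using s0 by (cases s) auto
  ultimately have p: "2 * 3 ^ Suc s < 9 * w" by simp
  have "2 * 3 ^ Suc s < 2 * (2 :: nat) ^ w"
  proof -
    have "9 * w \<le> 2 * 2 ^ w" if "5 \<le> w" for w :: nat using that by (induction w rule: dec_induct) auto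
    from this[of w] show ?thesis using p False by linarith
  qed
  then have p2: "(3 :: nat) ^ Suc s < 2 ^ w" by simp
  have no: False if "i < j" "j < w" "(2 * 2 ^ i - 1) mod 3 ^ Suc s = (2 * 2 ^ j - 1 :: nat) mod 3 ^ Suc s" for i j
  proof -
    let ?p = "(3 :: int) ^ Suc s"
    have "int ((2 * 2 ^ x - 1) mod 3 ^ Suc s) = (2 * 2 ^ x - 1) mod ?p" for x by (simp add: of_nat_mod of_nat_diff)
    then have "(2 * 2 ^ j - 1) mod ?p = (2 * 2 ^ i - 1) mod ?p" using that(3) by metis
    then have "?p dvd (2 * 2 ^ j - 1) - (2 * 2 ^ i - 1)" by (rule mod_eq_dvd_iff[THEN iffD1])
    also have "(2 * 2 ^ j - 1) - (2 * 2 ^ i - 1) = (2 :: int) ^ Suc i * (2 ^ (j - i) - 1)"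
      using that(1) by (simp add: algebra_simps power_add[symmetric])
    finally have "?p dvd 2 ^ Suc i * (2 ^ (j - i) - 1)" .
    moreover have "coprime ?p (2 ^ Suc i)" by (simp only: coprime_power_left_iff coprime_power_right_iff) simp
    ultimately have u: "?p dvd 2 ^ (j - i) - 1" by (simp only: coprime_dvd_mult_right_iff)
    \<comment> \<open>Odd powers of 2 are 2 modulo 3. Hence the difference of the exponents is even
      and powers of 4 remain.\<close>
    have ev: "even (j - i)"
    proof (rule ccontr)
      assume "odd (j - i)"
      then obtain x where x: "j - i = 2 * x + 1" by (rule oddE)
      have "(2 :: int) ^ (j - i) = 2 * 4 ^ x" unfolding x by (simp add: power_mult)
      moreover have "(4 :: int) ^ x mod 3 = 1" using power_mod[of "4 :: int" 3 x] by simp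
      ultimately have "((2 :: int) ^ (j - i) - 1) mod 3 = 1" by presburger
      moreover have "3 dvd (2 :: int) ^ (j - i) - 1" using u dvd_trans[of 3 ?p] by simp
      ultimately show False by presburger
    qed
    then obtain x where x: "j - i = 2 * x" by (rule evenE)
    have "?p dvd 4 ^ x - 1" using u unfolding x by (simp add: power_mult)
    then have "3 ^ s dvd int x" by (rule three_power_dvd)
    then have "int (3 ^ s) dvd int x" by simp
    then have "3 ^ s dvd x" by (simp only: int_dvd_int_iff)
    moreover have "0 < x" using x that(1) by simp
    ultimately have "3 ^ s \<le> x" by (rule dvd_imp_le)
    then show False using s x that(1,2) by linarith
  qed
  have "inj_on (\<lambda>i. (2 * 2 ^ i - 1 :: nat) mod 3 ^ Suc s) {..<w}"
    by (rule inj_onI) (metis lessThan_iff linorder_neqE_nat no)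
  then show ?thesis using p p2 by (intro exI[of _ "3 ^ Suc s"]) auto
qed

subsection \<open>Packed strings\<close>

lemma pack_word_field:
  assumes "\<forall>x\<in>set cs. x - 1 < 2 ^ letter_bits \<sigma>"
  shows "pack_word \<sigma> cs < 2 ^ (length cs * letter_bits \<sigma>)"
    "fld (letter_bits \<sigma>) (pack_word \<sigma> cs) c = (if c < length cs then cs ! c - 1 else 0)"
proof -
  let ?b = "letter_bits \<sigma>"
  have "pack_word \<sigma> cs < 2 ^ (length cs * ?b) \<and>
    (\<forall>c. fld ?b (pack_word \<sigma> cs) c = (if c < length cs then cs ! c - 1 else 0))"
    using assms
  proof (induction cs)
    case Nil
    then show ?case by (simp add: pack_word_def fld_def)
  next
    case (Cons x cs)
    let ?y = "pack_word \<sigma> cs"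
    have e: "pack_word \<sigma> (x # cs) = (x - 1) + 2 ^ ?b * ?y" by (simp add: pack_word_def)
    have x: "x - 1 < 2 ^ ?b" using Cons.prems by simp
    have y: "?y < 2 ^ (length cs * ?b)" and f: "\<And>c. fld ?b ?y c = (if c < length cs then cs ! c - 1 else 0)"
      using Cons by auto
    have "(x - 1) + 2 ^ ?b * ?y < 2 ^ ?b * Suc ?y" using x by simp
    also have "\<dots> \<le> 2 ^ ?b * 2 ^ (length cs * ?b)" using y by (intro mult_left_mono) auto
    finally have l: "pack_word \<sigma> (x # cs) < 2 ^ (length (x # cs) * ?b)" unfolding e by (simp add: power_add)
    have "fld ?b (pack_word \<sigma> (x # cs)) c = (if c < length (x # cs) then (x # cs) ! c - 1 else 0)" for c
    proof (cases c)
      case 0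
      then show ?thesis using x unfolding e by (simp add: fld_def take_bit_eq_mod)
    next
      case (Suc c')
      have "((x - 1) + 2 ^ ?b * ?y) div 2 ^ ?b = ?y" using x by simp
      then have "drop_bit (?b * c) ((x - 1) + 2 ^ ?b * ?y) = drop_bit (?b * c') ?y"
        unfolding Suc by (simp add: drop_bit_eq_div power_add div_mult2_eq)
      then show ?thesis using f[of c'] unfolding e Suc by (simp add: fld_def)
    qed
    then show ?case using l by blast
  qed
  then show "pack_word \<sigma> cs < 2 ^ (length cs * ?b)" "fld ?b (pack_word \<sigma> cs) c = (if c < length cs then cs ! c - 1 else 0)"
    by auto
qed

lemma letter_bits_bound: "x \<in> {1..\<sigma>} \<Longrightarrow> x - 1 < 2 ^ letter_bits \<sigma>"
proof -
  assume x: "x \<in> {1..\<sigma>}"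
  then have s: "0 < \<sigma>" by auto
  have "log 2 (real \<sigma>) \<le> real (letter_bits \<sigma>)" unfolding letter_bits_def by (simp add: real_nat_ceiling_ge)
  then have "real \<sigma> \<le> 2 powr real (letter_bits \<sigma>)" using s by (subst (asm) log_le_iff) auto
  then have "real \<sigma> \<le> real (2 ^ letter_bits \<sigma>)" by (simp add: powr_realpow)
  then have "\<sigma> \<le> 2 ^ letter_bits \<sigma>" by (simp only: of_nat_le_iff)
  then show ?thesis using x by auto
qed

lemma packed_props:
  fixes \<sigma> w :: nat and P :: "nat list"
  defines "n \<equiv> letters_per_word \<sigma> w" and "b \<equiv> letter_bits \<sigma>"
  defines "Q \<equiv> nat \<lceil>real (length P) / real n\<rceil>"
  assumes "set P \<subseteq> {1..\<sigma>}" "0 < n"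
  shows "length (packed \<sigma> w P) = Q" "\<And>q. q < Q \<Longrightarrow> packed \<sigma> w P ! q < 2 ^ (n * b)"
    "\<And>y. y < Q * n \<Longrightarrow> ltr b n (\<lambda>q. packed \<sigma> w P ! q) y = (if y < length P then P ! y - 1 else 0)"
    "\<And>q. q < Q \<Longrightarrow> packed \<sigma> w P ! q = pack_word \<sigma> (take n (drop (q * n) P))"
    "length P \<le> Q * n"
proof -
  show l: "length (packed \<sigma> w P) = Q" by (simp add: packed_def Let_def Q_def n_def)
  show nth: "packed \<sigma> w P ! q = pack_word \<sigma> (take n (drop (q * n) P))" if "q < Q" for q
    using that by (simp add: packed_def Let_def Q_def n_def)
  have "set (take n (drop (q * n) P)) \<subseteq> {1..\<sigma>}" for q
    using assms(4) set_take_subset[of n "drop (q * n) P"] set_drop_subset[of "q * n" P] by blast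
  then have sm: "\<forall>x\<in>set (take n (drop (q * n) P)). x - 1 < 2 ^ letter_bits \<sigma>" for q
    using letter_bits_bound by blast
  show "packed \<sigma> w P ! q < 2 ^ (n * b)" if "q < Q" for q
  proof -
    have "pack_word \<sigma> (take n (drop (q * n) P)) < 2 ^ (length (take n (drop (q * n) P)) * b)"
      unfolding b_def by (rule pack_word_field(1)[OF sm])
    also have "\<dots> \<le> 2 ^ (n * b)" by (intro power_increasing mult_le_mono1) auto
    finally show ?thesis using nth[OF that] by simp
  qed
  show "ltr b n (\<lambda>q. packed \<sigma> w P ! q) y = (if y < length P then P ! y - 1 else 0)" if "y < Q * n" for y
  proof -
    have q: "y div n < Q" using that by (simp add: less_mult_imp_div_less)
    have c: "y mod n < n" using assms(5) by simp
    have y: "y div n * n + y mod n = y" by simp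
    have "ltr b n (\<lambda>q. packed \<sigma> w P ! q) y = fld b (pack_word \<sigma> (take n (drop (y div n * n) P))) (y mod n)"
      by (simp add: ltr_def nth[OF q])
    also have "\<dots> = (if y mod n < length (take n (drop (y div n * n) P)) then take n (drop (y div n * n) P) ! (y mod n) - 1 else 0)"
      unfolding b_def by (rule pack_word_field(2)[OF sm])
    also have "\<dots> = (if y < length P then P ! y - 1 else 0)"
    proof (cases "y < length P")
      case True
      then have "y mod n < length P - y div n * n" using y by linarith
      then show ?thesis using True c y by (simp add: min_def)
    next
      case False
      then have "\<not> y mod n < length P - y div n * n" using y by linarith
      then show ?thesis using False by simp
    qed
    finally show ?thesis .
  qed
  have "real (length P) / real n \<le> real Q" unfolding Q_def by (simp add: real_nat_ceiling_ge)
  then have "real (length P) \<le> real (Q * n)" using assms(5) by (simp add: field_simps)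
  then show "length P \<le> Q * n" by (simp only: of_nat_le_iff)
qed

text \<open>The two strings have the same length, so their padding is zero in the same fields and
  adds no mismatch. Letters are at least 1, so subtracting 1 is injective on them. For the second
  claim, a differing word \<open>q\<close> contains a differing position \<open>y\<close> with
  \<open>y div n = q\<close>.\<close>

lemma packed_mismatches:
  fixes \<sigma> w :: nat and P S :: "nat list"
  defines "n \<equiv> letters_per_word \<sigma> w" and "b \<equiv> letter_bits \<sigma>"
  defines "Q \<equiv> nat \<lceil>real (length P) / real n\<rceil>"
  assumes P: "set P \<subseteq> {1..\<sigma>}" and S: "set S \<subseteq> {1..\<sigma>}" and len: "length S = length P" and n: "0 < n"
    and pw: "\<And>q. q < Q \<Longrightarrow> pw q = packed \<sigma> w P ! q" and dw: "\<And>q. q < Q \<Longrightarrow> dw q = packed \<sigma> w S ! q"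
  shows "card {y. y < Q * n \<and> ltr b n dw y \<noteq> ltr b n pw y} = hamming S P"
    "card {q. q < Q \<and> pw q \<noteq> dw q} \<le> hamming S P"
proof -
  note pp = packed_props[of P \<sigma> w, folded n_def b_def, OF P n, folded Q_def]
  note ps = packed_props[of S \<sigma> w, folded n_def b_def, OF S n, unfolded len, folded Q_def]
  have lp: "ltr b n pw y = (if y < length P then P ! y - 1 else 0)" if "y < Q * n" for y
    using pp(3)[OF that] pw[of "y div n"] that by (simp add: ltr_def less_mult_imp_div_less)
  have ls: "ltr b n dw y = (if y < length P then S ! y - 1 else 0)" if "y < Q * n" for y
    using ps(3)[OF that] dw[of "y div n"] that by (simp add: ltr_def less_mult_imp_div_less)
  have inj: "S ! y - 1 = P ! y - 1 \<longleftrightarrow> S ! y = P ! y" if "y < length P" for y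
  proof -
    have "S ! y \<in> {1..\<sigma>}" "P ! y \<in> {1..\<sigma>}" using P S that len nth_mem by (metis subsetD)+
    then show ?thesis by auto
  qed
  let ?A = "{y. y < length S \<and> S ! y \<noteq> P ! y}"
  have "{y. y < Q * n \<and> ltr b n dw y \<noteq> ltr b n pw y} = ?A"
  proof (rule set_eqI)
    fix y
    show "y \<in> {y. y < Q * n \<and> ltr b n dw y \<noteq> ltr b n pw y} \<longleftrightarrow> y \<in> ?A"
    proof (cases "y < length P")
      case True
      then have "y < Q * n" using pp(5) by simp
      then show ?thesis using lp[of y] ls[of y] True inj[OF True] len by simp
    next
      case False
      then show ?thesis using lp[of y] ls[of y] len by auto
    qed
  qed
  then show "card {y. y < Q * n \<and> ltr b n dw y \<noteq> ltr b n pw y} = hamming S P" by (simp add: hamming_def)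
  have "{q. q < Q \<and> pw q \<noteq> dw q} \<subseteq> (\<lambda>y. y div n) ` ?A"
  proof
    fix q assume "q \<in> {q. q < Q \<and> pw q \<noteq> dw q}"
    then have q: "q < Q" "pw q \<noteq> dw q" by auto
    then have "take n (drop (q * n) P) \<noteq> take n (drop (q * n) S)" using pw dw pp(4) ps(4) by metis
    then obtain c where c: "c < length (take n (drop (q * n) P))" "take n (drop (q * n) P) ! c \<noteq> take n (drop (q * n) S) ! c"
      using len by (metis (no_types, lifting) length_drop length_take nth_equalityI)
    then have "c < n" "q * n + c < length P" by (simp_all add: less_diff_conv add.commute)
    have "P ! (q * n + c) \<noteq> S ! (q * n + c)" using c \<open>c < n\<close> \<open>q * n + c < length P\<close> len by simp
    then have "q * n + c \<in> ?A" using len \<open>q * n + c < length P\<close> by simp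
    then have "(q * n + c) div n \<in> (\<lambda>y. y div n) ` ?A" by (rule imageI)
    then show "q \<in> (\<lambda>y. y div n) ` ?A" using \<open>c < n\<close> by simp
  qed
  then have "card {q. q < Q \<and> pw q \<noteq> dw q} \<le> card ((\<lambda>y. y div n) ` ?A)" by (intro card_mono) auto
  also have "\<dots> \<le> card ?A" by (rule card_image_le) simp
  finally show "card {q. q < Q \<and> pw q \<noteq> dw q} \<le> hamming S P" by (simp add: hamming_def)
qed

subsection \<open>The data structure\<close>

lemma placed_nth: "placed S b xs \<Longrightarrow> i < length xs \<Longrightarrow> b + i < length S \<and> S ! (b + i) = xs ! i"
  by (simp add: placed_def)

lemma xor_less_exp: "a < 2 ^ H \<Longrightarrow> b < 2 ^ H \<Longrightarrow> Bit_Operations.xor a b < 2 ^ H" for a b :: nat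
  by (metis take_bit_nat_eq_self_iff take_bit_xor)

text \<open>The inverse of the residue map, followed by rounding a bit position down to the start of
  its field.\<close>

definition low_field :: "nat \<Rightarrow> nat \<Rightarrow> nat \<Rightarrow> nat \<Rightarrow> nat" where
  "low_field w lb p r =
    (let f = \<lambda>i. (2 * 2 ^ i - 1) mod p in if r \<in> f ` {..<w} then the_inv_into {..<w} f r div lb * lb else 0)"

lemma low_field_props:
  assumes "inj_on (\<lambda>i. (2 * 2 ^ i - 1) mod p) {..<w}"
  shows "i < w \<Longrightarrow> low_field w lb p ((2 * 2 ^ i - 1) mod p) = i div lb * lb" "low_field w lb p r \<le> w"
proof -
  let ?f = "\<lambda>i. (2 * 2 ^ i - 1) mod p :: nat"
  show "low_field w lb p (?f i) = i div lb * lb" if "i < w"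
    using that the_inv_into_f_f[OF assms, of i] by (auto simp: low_field_def Let_def)
  show "low_field w lb p r \<le> w"
  proof (cases "r \<in> ?f ` {..<w}")
    case True
    then obtain i where i: "i < w" "r = ?f i" by auto
    then have "low_field w lb p r = i div lb * lb" using the_inv_into_f_f[OF assms, of i] by (auto simp: low_field_def Let_def)
    also have "\<dots> \<le> i" by simp
    finally show ?thesis using i(1) by simp
  qed (simp add: low_field_def Let_def)
qed

definition row_cell :: "nat \<Rightarrow> nat \<Rightarrow> nat \<Rightarrow> (nat \<Rightarrow> nat \<Rightarrow> nat) \<Rightarrow> nat \<Rightarrow> nat" where
  "row_cell Q rec d dw x =
    (let j = x div (Suc Q * rec); q = x mod (Suc Q * rec) div rec; c = x mod (Suc Q * rec) mod rec
     in if c = 0 then dw j q else if c = 1 then rank Q dw d j q else level Q dw d j q (c - 2) * rec)"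

lemma row_cell:
  assumes "q \<le> Q" "c < rec"
  shows "row_cell Q rec d dw (j * (Suc Q * rec) + (q * rec + c)) =
      (if c = 0 then dw j q else if c = 1 then rank Q dw d j q else level Q dw d j q (c - 2) * rec)"
    "q * rec + c < Suc Q * rec"
proof -
  have "q * rec + c < Suc q * rec" using assms(2) by simp
  also have "\<dots> \<le> Suc Q * rec" using assms(1) by (intro mult_le_mono1) simp
  finally show lt: "q * rec + c < Suc Q * rec" .
  have 1: "(j * (Suc Q * rec) + (q * rec + c)) div (Suc Q * rec) = j"
    using lt assms(2) by (subst div_mult_self3) (auto simp del: mult_Suc)
  have 2: "(j * (Suc Q * rec) + (q * rec + c)) mod (Suc Q * rec) = q * rec + c"
    using lt by (simp del: mult_Suc)
  have 3: "(q * rec + c) div rec = q" "(q * rec + c) mod rec = c" using assms(2) by auto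
  show "row_cell Q rec d dw (j * (Suc Q * rec) + (q * rec + c)) =
      (if c = 0 then dw j q else if c = 1 then rank Q dw d j q else level Q dw d j q (c - 2) * rec)"
    unfolding row_cell_def 1 2 3 Let_def by (rule refl)
qed

text \<open>The record length has to leave room for the word, the rank and the levels 0 to
  \<open>H\<close>, which are \<open>H + 3\<close> cells, and has to exceed \<open>w\<close> so that
  a bit offset stays below it. The summand \<open>w\<close> is affordable as a string has only
  \<open>O(m / w + 1)\<close> records. Memory consists of the header, the table of highest bits, the
  table of residues, the rows, the error tree and the search trees.\<close>

lemma memory_exists:
  fixes d Q n lb w p k :: nat and dw :: "nat \<Rightarrow> nat \<Rightarrow> nat" and T :: tree
  defines "H \<equiv> topbit d"
  defines "rec \<equiv> w + H + 4"
  defines "sb \<equiv> Suc Q * rec"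
  defines "row \<equiv> \<lambda>j. 10 + 2 ^ H + p + j * sb"
  assumes d: "0 < d" and lb: "0 < lb" and n: "0 < n" and nlb: "n * lb \<le> w" and dwless: "\<forall>j<d. \<forall>q\<le>Q. dw j q < 2 ^ w"
    and p: "0 < p" and inj: "inj_on (\<lambda>i. (2 * 2 ^ i - 1) mod p) {..<w}" and T: "tree_ok d (Q * n) T"
  shows "\<exists>S. length S \<le> 10 + 2 ^ H + p + d * sb + 9 * nodes T + Suc Q * (3 * d + 2) \<and>
    (\<forall>x\<in>set S. x < 2 ^ w \<or> x \<le> length S \<or> x = k) \<and> 10 \<le> length S \<and>
    (S ! 0 = k \<and> S ! 1 = rec \<and> S ! 2 = Q * rec \<and> S ! 3 = 10 \<and> S ! 4 = p \<and> S ! 5 = 10 + 2 ^ H \<and> S ! 6 = lb \<and> S ! 7 = sb) \<and>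
    orep S (S ! 8) (tobj row rec n lb T) \<and> orep S (S ! 9) (aobj row (map (\<lambda>q. bst_of (ord Q dw d q)) [0..<Suc Q])) \<and>
    (\<forall>j q. j < d \<longrightarrow> q \<le> Q \<longrightarrow> row j + q * rec + 1 < length S \<and> S ! (row j + q * rec) = dw j q \<and>
      S ! (row j + q * rec + 1) = rank Q dw d j q) \<and>
    (\<forall>i j q. i < d \<longrightarrow> j < d \<longrightarrow> q \<le> Q \<longrightarrow> (\<exists>h. Bit_Operations.xor (rank Q dw d i q) (rank Q dw d j q) + 10 < length S \<and>
      S ! (Bit_Operations.xor (rank Q dw d i q) (rank Q dw d j q) + 10) = h \<and>
      row i + q * rec + 2 + h < length S \<and> row j + q * rec + 2 + h < length S \<and>
      min (S ! (row i + q * rec + 2 + h)) (S ! (row j + q * rec + 2 + h)) = lcw Q dw i j q * rec)) \<and>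
    (\<forall>i<w. (2 * 2 ^ i - 1) mod p + (10 + 2 ^ H) < length S \<and> S ! ((2 * 2 ^ i - 1) mod p + (10 + 2 ^ H)) = i div lb * lb)"
proof -
  have dH: "d < 2 ^ H" unfolding H_def by (rule topbit_props(1))
  define tx where "tx = tobj row rec n lb T"
  define ax where "ax = aobj row (map (\<lambda>q. bst_of (ord Q dw d q)) [0..<Suc Q])"
  define b1 where "b1 = 10 + 2 ^ H + p + d * sb"
  have "0 < b1" by (simp add: b1_def)
  then obtain c1 p1 where c1: "stored b1 tx c1 p1" using stored_exists by blast
  define b2 where "b2 = b1 + length c1"
  have "0 < b2" by (simp add: b2_def b1_def)
  then obtain c2 p2 where c2: "stored b2 ax c2 p2" using stored_exists by blast
  define hdr where "hdr = [k, rec, Q * rec, 10, p, 10 + 2 ^ H, lb, sb, p1, p2]"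
  define t1 where "t1 = map topbit [0..<2 ^ H]"
  define t2 where "t2 = map (low_field w lb p) [0..<p]"
  define rows where "rows = map (row_cell Q rec d dw) [0..<d * sb]"
  define S where "S = hdr @ t1 @ t2 @ rows @ c1 @ c2"
  have len: "length hdr = 10" "length t1 = 2 ^ H" "length t2 = p" "length rows = d * sb"
    by (simp_all add: hdr_def t1_def t2_def rows_def)
  have lenS: "length S = b2 + length c2" by (simp add: S_def len b2_def b1_def)
  have "placed S 0 (hdr @ t1 @ t2 @ rows @ c1 @ c2)" by (simp add: placed_def S_def)
  then have pl: "placed S 0 hdr" "placed S 10 t1" "placed S (10 + 2 ^ H) t2" "placed S (10 + 2 ^ H + p) rows" "placed S b1 c1" "placed S b2 c2"
    unfolding placed_append len b1_def b2_def by (simp_all add: add.assoc)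
  have sbrec: "rec \<le> sb" unfolding sb_def by simp
  have Qrec: "Q * rec \<le> sb" unfolding sb_def by simp
  have dsb: "sb \<le> d * sb" using d by simp
  have nlbrec: "n * lb < rec" using nlb unfolding rec_def by simp
  have rowj: "j * sb + (q * rec + c) < d * sb" if "j < d" "q \<le> Q" "c < rec" for j q c
  proof -
    have "j * sb + (q * rec + c) < Suc j * sb" using row_cell(2)[OF that(2,3)] unfolding sb_def by simp
    also have "\<dots> \<le> d * sb" using that(1) by (intro mult_le_mono1) simp
    finally show ?thesis .
  qed
  have cell: "row j + q * rec + c < length S \<and> S ! (row j + q * rec + c) =
      (if c = 0 then dw j q else if c = 1 then rank Q dw d j q else level Q dw d j q (c - 2) * rec)"
    if "j < d" "q \<le> Q" "c < rec" for j q c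
  proof -
    have lt: "j * sb + (q * rec + c) < length rows" using rowj[OF that] len(4) by simp
    have e: "10 + 2 ^ H + p + (j * sb + (q * rec + c)) = row j + q * rec + c" by (simp add: row_def)
    have "rows ! (j * sb + (q * rec + c)) = row_cell Q rec d dw (j * sb + (q * rec + c))" using lt unfolding rows_def by simp
    also have "\<dots> = (if c = 0 then dw j q else if c = 1 then rank Q dw d j q else level Q dw d j q (c - 2) * rec)"
      unfolding sb_def by (rule row_cell(1)[OF that(2,3)])
    finally show ?thesis using placed_nth[OF pl(4) lt] unfolding e by (simp only:)
  qed
  have rowlt: "row j < b1" if "j < d" for j
    using rowj[OF that, of 0 0] unfolding row_def b1_def rec_def by simp
  have bounds: "length c1 \<le> 9 * nodes T" "length c2 = Suc Q * (3 * d + 2)"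
  proof -
    show "length c1 \<le> 9 * nodes T" using c1 tobj_props(1)[of row rec n lb T] by (simp add: stored_def tx_def)
    have "osize ax = sum_list (map (\<lambda>q. osize (bobj row (bst_of (ord Q dw d q))) + 2) [0..<Suc Q])"
      unfolding ax_def aobj_props(1) by (simp add: comp_def)
    also have "\<dots> = sum_list (map (\<lambda>q. 3 * d + 2) [0..<Suc Q])" by (simp only: bst_of_props ord_perm(2))
    also have "\<dots> = Suc Q * (3 * d + 2)" by (simp only: sum_list_triv map_replicate_const length_map sum_list_replicate length_upt) simp
    finally show "length c2 = Suc Q * (3 * d + 2)" using c2 by (simp add: stored_def)
  qed
  have od1: "c < b1" if "c \<in> odata tx" for c
  proof -
    have "odata tx \<subseteq> {..<b1}" unfolding tx_def
    proof (rule tobj_props(2)[OF T])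
      show "Suc Q * rec \<le> b1" using dsb unfolding b1_def sb_def by linarith
    qed (use rowlt dH nlbrec n in \<open>simp_all add: b1_def\<close>)
    then show ?thesis using that by auto
  qed
  have od2: "c < b1" if "c \<in> odata ax" for c
  proof -
    have "odata ax \<subseteq> row ` {0..<d}" unfolding ax_def aobj_props(2) using bst_of_props ord_perm(1)
      by (auto simp: bst_of_props ord_perm(1))
    then show ?thesis using that rowlt by auto
  qed
  have small: "x < 2 ^ w \<or> x \<le> length S \<or> x = k" if "x \<in> set S" for x
  proof -
    have b1S: "b1 \<le> length S" by (simp add: lenS b2_def)
    have h: "x = k \<or> x \<le> length S" if "x \<in> set hdr"
    proof -
      have l1: "lb \<le> n * lb" using n by simp
      have "rec \<le> length S" "Q * rec \<le> length S" "10 \<le> length S" "p \<le> length S" "10 + 2 ^ H \<le> length S" "lb \<le> length S" "sb \<le> length S"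
        using sbrec Qrec dsb nlbrec b1S l1 unfolding b1_def by linarith+
      moreover have "p1 \<le> length S" "p2 \<le> length S" using c1 c2 by (auto simp: stored_def lenS b2_def)
      ultimately show ?thesis using that unfolding hdr_def by auto
    qed
    have 1: "x \<le> length S" if "x \<in> set t1"
    proof -
      have "x \<le> H" using that topbit_props(3) unfolding t1_def by auto
      then show ?thesis using sbrec dsb b1S unfolding b1_def rec_def by linarith
    qed
    have 2: "x \<le> length S" if "x \<in> set t2"
    proof -
      have "x \<le> w" using that low_field_props(2)[OF inj] unfolding t2_def by auto
      then show ?thesis using sbrec dsb b1S unfolding b1_def rec_def by linarith
    qed
    have 3: "x < 2 ^ w \<or> x \<le> length S" if "x \<in> set rows"
    proof -
      have "x \<in> row_cell Q rec d dw ` {..<d * sb}" using that by (simp add: rows_def atLeast0LessThan)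
      then obtain y where y: "y < d * sb" "x = row_cell Q rec d dw y" by blast
      let ?j = "y div sb" and ?q = "y mod sb div rec"
      have s0: "0 < sb" using sbrec unfolding rec_def by simp
      have j: "?j < d" using y(1) by (simp add: less_mult_imp_div_less)
      have "y mod sb < Suc Q * rec" using s0 unfolding sb_def by (rule mod_less_divisor)
      then have q: "?q \<le> Q" by (metis less_mult_imp_div_less less_Suc_eq_le)
      have "rank Q dw d ?j ?q \<le> length S" using rank_props(1)[OF j, of Q dw ?q] dH b1S unfolding b1_def by linarith
      moreover have "level Q dw d ?j ?q h * rec \<le> length S" for h
      proof -
        have "level Q dw d ?j ?q h * rec \<le> Suc Q * rec" by (rule mult_le_mono1[OF level_le[OF q]])
        then show ?thesis using dsb b1S unfolding b1_def sb_def by linarith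
      qed
      ultimately show ?thesis using dwless j q unfolding y(2) row_cell_def Let_def sb_def[symmetric] by simp
    qed
    have 4: "x \<le> length S" if "x \<in> set c1" using c1 that od1[of x] b1S lenS unfolding stored_def b2_def by fastforce
    have 5: "x \<le> length S" if "x \<in> set c2" using c2 that od2[of x] b1S lenS unfolding stored_def by fastforce
    show ?thesis using that h 1 2 3 4 5 unfolding S_def by auto
  qed
  have hdr: "S ! i = hdr ! i" if "i < 10" for i using placed_nth[OF pl(1)] that len(1) by simp
  have lc: "\<exists>h. Bit_Operations.xor (rank Q dw d i q) (rank Q dw d j q) + 10 < length S \<and>
      S ! (Bit_Operations.xor (rank Q dw d i q) (rank Q dw d j q) + 10) = h \<and>
      row i + q * rec + 2 + h < length S \<and> row j + q * rec + 2 + h < length S \<and>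
      min (S ! (row i + q * rec + 2 + h)) (S ! (row j + q * rec + 2 + h)) = lcw Q dw i j q * rec"
    if ij: "i < d" "j < d" "q \<le> Q" for i j q
  proof -
    let ?x = "Bit_Operations.xor (rank Q dw d i q) (rank Q dw d j q)"
    have x: "?x < 2 ^ H" using rank_props(1)[OF ij(1), of Q dw q] rank_props(1)[OF ij(2), of Q dw q] dH by (intro xor_less_exp) simp_all
    then have 1: "10 + ?x < length S \<and> S ! (10 + ?x) = topbit ?x" using placed_nth[OF pl(2), of ?x] len(2) by (simp add: t1_def)
    have h: "topbit ?x + 2 < rec" using topbit_props(3)[OF x] unfolding rec_def by simp
    have c: "row i' + q * rec + 2 + topbit ?x < length S \<and> S ! (row i' + q * rec + 2 + topbit ?x) = level Q dw d i' q (topbit ?x) * rec"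
      if "i' < d" for i' using cell[OF that ij(3) h] by (simp add: add_ac)
    show ?thesis
    proof (intro exI[of _ "topbit ?x"] conjI)
      show "min (S ! (row i + q * rec + 2 + topbit ?x)) (S ! (row j + q * rec + 2 + topbit ?x)) = lcw Q dw i j q * rec"
        using c[OF ij(1)] c[OF ij(2)] level_min[OF ij, of dw] by (simp add: nat_mult_min_left[symmetric])
    qed (use 1 c[OF ij(1)] c[OF ij(2)] in \<open>simp_all add: add.commute[of _ 10]\<close>)
  qed
  have low: "(2 * 2 ^ i - 1) mod p + (10 + 2 ^ H) < length S \<and> S ! ((2 * 2 ^ i - 1) mod p + (10 + 2 ^ H)) = i div lb * lb" if i: "i < w" for i
  proof -
    define r where "r = (2 * 2 ^ i - 1) mod p"
    have "r < length t2" using p len(3) by (simp add: r_def)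
    from placed_nth[OF pl(3) this] this have "10 + 2 ^ H + r < length S \<and> S ! (10 + 2 ^ H + r) = low_field w lb p r" by (simp add: t2_def)
    then show ?thesis using low_field_props(1)[OF inj i, of lb] unfolding r_def[symmetric] by (simp add: add.commute)
  qed
  have o1: "orep S (S ! 8) tx" using hdr[of 8] c1 pl(5) by (simp add: hdr_def stored_def)
  have o2: "orep S (S ! 9) ax" using hdr[of 9] c2 pl(6) by (simp add: hdr_def stored_def)
  have hs: "S ! 0 = k \<and> S ! 1 = rec \<and> S ! 2 = Q * rec \<and> S ! 3 = 10 \<and> S ! 4 = p \<and> S ! 5 = 10 + 2 ^ H \<and> S ! 6 = lb \<and> S ! 7 = sb"
    using hdr[of 0] hdr[of 1] hdr[of 2] hdr[of 3] hdr[of 4] hdr[of 5] hdr[of 6] hdr[of 7] by (simp add: hdr_def)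
  have L: "length S \<le> 10 + 2 ^ H + p + d * sb + 9 * nodes T + Suc Q * (3 * d + 2)"
    unfolding lenS b2_def b1_def bounds(2) using bounds(1) by linarith
  have L10: "10 \<le> length S" by (simp add: lenS b2_def b1_def)
  have dwr: "row j + q * rec + 1 < length S \<and> S ! (row j + q * rec) = dw j q \<and> S ! (row j + q * rec + 1) = rank Q dw d j q"
    if "j < d" "q \<le> Q" for j q
  proof -
    have "0 < rec" "1 < rec" by (simp_all add: rec_def)
    from cell[OF that this(1)] cell[OF that this(2)] show ?thesis by simp
  qed
  show ?thesis
    using L L10 small hs o1 o2 dwr lc low unfolding tx_def ax_def by (intro exI[of _ S]) blast
qed

lemma query_correct:
  fixes \<sigma> w m d k K Wn b p :: nat and D :: "nat list list" and S P :: "nat list" and T :: tree and e :: real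
  defines "lb \<equiv> letter_bits \<sigma>" and "n \<equiv> letters_per_word \<sigma> w"
  defines "Q \<equiv> nat \<lceil>real m / real n\<rceil>" and "H \<equiv> topbit d"
  defines "rec \<equiv> w + H + 4"
  defines "sb \<equiv> Suc Q * rec"
  defines "row \<equiv> \<lambda>j. 10 + 2 ^ H + p + j * sb" and "dw \<equiv> \<lambda>j q. if q < Q then packed \<sigma> w (D ! j) ! q else 0"
  assumes D: "set D \<subseteq> strings \<sigma> m" "length D = d" "0 < d" and lb: "0 < lb" "0 < n" and p: "0 < p" "p < 2 ^ w"
    and K: "0 < K" "\<forall>x\<in>set S. x < 2 ^ (w * K)" "K * length S < 2 ^ (w * K)" "K * Wn < 2 ^ (w * K)" "k < 2 ^ (w * K) - 1"
    and S: "10 \<le> length S"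
      "S ! 0 = k \<and> S ! 1 = rec \<and> S ! 2 = Q * rec \<and> S ! 3 = 10 \<and> S ! 4 = p \<and> S ! 5 = 10 + 2 ^ H \<and> S ! 6 = lb \<and> S ! 7 = sb"
      "orep S (S ! 8) (tobj row rec n lb T)" "orep S (S ! 9) (aobj row (map (\<lambda>q. bst_of (ord Q dw d q)) [0..<Suc Q]))"
      "\<forall>j q. j < d \<longrightarrow> q \<le> Q \<longrightarrow> row j + q * rec + 1 < length S \<and> S ! (row j + q * rec) = dw j q \<and>
        S ! (row j + q * rec + 1) = rank Q dw d j q"
      "\<forall>i j q. i < d \<longrightarrow> j < d \<longrightarrow> q \<le> Q \<longrightarrow> (\<exists>h. Bit_Operations.xor (rank Q dw d i q) (rank Q dw d j q) + 10 < length S \<and>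
        S ! (Bit_Operations.xor (rank Q dw d i q) (rank Q dw d j q) + 10) = h \<and>
        row i + q * rec + 2 + h < length S \<and> row j + q * rec + 2 + h < length S \<and>
        min (S ! (row i + q * rec + 2 + h)) (S ! (row j + q * rec + 2 + h)) = lcw Q dw i j q * rec)"
      "\<forall>i<w. (2 * 2 ^ i - 1) mod p + (10 + 2 ^ H) < length S \<and> S ! ((2 * 2 ^ i - 1) mod p + (10 + 2 ^ H)) = i div lb * lb"
    and T: "tree_ok d (Q * n) T" "\<forall>P fm. mism (Q * n) P (\<lambda>j. ltr lb n (dw j)) d fm \<longrightarrow> distinct (qry fm T 0 k) \<and>
      set (qry fm T 0 k) = {i. i < d \<and> card {y. y < Q * n \<and> ltr lb n (dw i) y \<noteq> P y} \<le> k} \<and>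
      pops fm T 0 k \<le> b \<and> real (pops fm T 0 k) \<le> e + real (length (qry fm T 0 k))"
    and work_size: "sb + 5 * b + 10 \<le> Wn" and P: "P \<in> strings \<sigma> m"
  shows "\<exists>t xs q. reports_within w (vm.comp K program 0 @ [Halt])
      (map (\<lambda>i. digit w (S ! (i div K)) (i mod K)) [0..<K * length S]) (K * Wn) (packed \<sigma> w P) t xs \<and>
    distinct xs \<and> set xs = occurrences k D P \<and> t \<le> vm.opmax K * ((37 * H + 14) * Suc k + 24 * Suc Q + 162 * q + 60) \<and>
    real q \<le> e + real (length xs)"
proof -
  have nlb: "n * lb \<le> w" unfolding n_def lb_def letters_per_word_def by simp
  have w: "0 < w" using nlb lb by (metis gr0I le_zero_eq mult_is_0 not_gr0)
  have Pp: "set P \<subseteq> {1..\<sigma>}" "length P = m" using P by (auto simp: strings_def)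
  have Dp: "set (D ! j) \<subseteq> {1..\<sigma>}" "length (D ! j) = m" if "j < d" for j
  proof -
    have "D ! j \<in> strings \<sigma> m" using that D nth_mem by blast
    then show "set (D ! j) \<subseteq> {1..\<sigma>}" "length (D ! j) = m" by (auto simp: strings_def)
  qed
  note pp = packed_props[of P \<sigma> w, folded n_def lb_def, OF Pp(1) lb(2), unfolded Pp(2), folded Q_def]
  have dp: "packed \<sigma> w (D ! j) ! q < 2 ^ (n * lb)" if "j < d" "q < Q" for j q
    using packed_props(2)[of "D ! j" \<sigma> w, folded n_def lb_def, OF Dp(1)[OF that(1)] lb(2), unfolded Dp(2)[OF that(1)], folded Q_def] that(2) .
  define pw where "pw q = (if q < Q then packed \<sigma> w P ! q else 1)" for q
  have one: "(1 :: nat) < 2 ^ (n * lb)" using lb by (intro one_less_power) auto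
  have len: "length S < 2 ^ (w * K)" "Wn < 2 ^ (w * K)"
  proof -
    have "length S \<le> K * length S" "Wn \<le> K * Wn" using K(1) by auto
    then show "length S < 2 ^ (w * K)" "Wn < 2 ^ (w * K)" using K(3,4) by linarith+
  qed
  interpret layout w K S "packed \<sigma> w P" d Q n lb rec 10 p "10 + 2 ^ H" k Wn row dw pw "rank Q dw d" "lcw Q dw"
  proof
    show "Suc Q * rec \<le> Wn" using work_size unfolding sb_def by linarith
    show "n * lb < rec" "2 < rec" using nlb w unfolding rec_def by simp_all
    show "pw q < 2 ^ (n * lb)" if "q \<le> Q" for q using pp(2) one by (simp add: pw_def)
    show "dw j q < 2 ^ (n * lb)" if "j < d" "q \<le> Q" for j q using dp[OF that(1)] by (simp add: dw_def)
    show "q \<le> lcw Q dw i j q \<and> (\<forall>r. q \<le> r \<longrightarrow> r < lcw Q dw i j q \<longrightarrow> dw i r = dw j r) \<and>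
        (lcw Q dw i j q \<le> Q \<longrightarrow> dw i (lcw Q dw i j q) \<noteq> dw j (lcw Q dw i j q))" if "q \<le> Q" for i j q
      using lcw_props[OF that, where dw = dw and i = i and j = j] by blast
    show "0 < row j" if "j < d" for j by (simp add: row_def)
  qed (use w K(1) D lb nlb p len pp(1) S(5-7) in \<open>simp_all add: pw_def dw_def\<close>)
  have mi: "mism (Q * n) pl (\<lambda>j. dl j) d fm" by unfold_locales (use fm_props in blast)
  from T(2) mi have q: "distinct (qry fm T 0 k)" "set (qry fm T 0 k) = {i. i < d \<and> card {y. y < Q * n \<and> dl i y \<noteq> pl y} \<le> k}"
    "pops fm T 0 k \<le> b" "real (pops fm T 0 k) \<le> e + real (length (qry fm T 0 k))" by blast+
  have mm: "card {y. y < Q * n \<and> dl i y \<noteq> pl y} = hamming (D ! i) P" "card {s. s < Q \<and> pw s \<noteq> dw i s} \<le> hamming (D ! i) P"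
    if "i < d" for i
    using packed_mismatches[where P = P and \<sigma> = \<sigma> and S = "D ! i" and w = w and pw = pw and dw = "dw i", folded n_def lb_def, unfolded Pp(2), folded Q_def, OF Pp(1) Dp(1)[OF that] Dp(2)[OF that] lb(2)]
    by (simp_all add: pw_def dw_def)
  have occ: "set (qry fm T 0 k) = occurrences k D P" unfolding q(2) occurrences_def D(2) using mm(1) by auto
  have "runs program (\<lambda>_. 0, replicate Wn 0, []) ((37 * H + 14) * Suc k + 24 * Suc Q + 162 * pops fm T 0 k + 60)
    (\<lambda>(v', W', R'). R' = qry fm T 0 k \<or> R' = [] \<and> (\<forall>j<d. k < card {s. s < Q \<and> pw s \<noteq> dw j s}))"
  proof (rule program)
    show "bst_ok q (bst_of (ord Q dw d q)) \<and> bset (bst_of (ord Q dw d q)) = {..<d} \<and> bheight (bst_of (ord Q dw d q)) \<le> H" for q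
    proof -
      have "bst_ok q (bst_of (ord Q dw d q))"
        by (rule bst_ok_bst_of) (auto simp: ord_perm intro: ord_sorted)
      moreover have "length (ord Q dw d q) < 2 ^ H" unfolding H_def ord_perm(2) by (rule topbit_props(1))
      ultimately show ?thesis using bst_of_props[of "ord Q dw d q" H row] by (auto simp: ord_perm)
    qed
    show "Suc Q * rec + 5 * pops fm T 0 k + 10 \<le> Wn" using work_size q(3) unfolding sb_def by linarith
  qed (use S(1-4) K(5) T(1) in \<open>simp_all add: sb_def\<close>)
  then obtain t' v W R where r: "t' \<le> (37 * H + 14) * Suc k + 24 * Suc Q + 162 * pops fm T 0 k + 60"
    "run program (\<lambda>_. 0, replicate Wn 0, []) t' (v, W, R)"
    "R = qry fm T 0 k \<or> R = [] \<and> (\<forall>j<d. k < card {s. s < Q \<and> pw s \<noteq> dw j s})"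
    unfolding runs_def by auto
  \<comment> \<open>If the parser gave up, each string differs from the query in more than
    \<open>k\<close> words, hence in more than \<open>k\<close> letters. Then the correct answer is
    empty, like the report.\<close>
  have R: "R = qry fm T 0 k"
  proof (rule ccontr)
    assume "R \<noteq> qry fm T 0 k"
    then have "R = []" "\<forall>j<d. k < card {s. s < Q \<and> pw s \<noteq> dw j s}" using r(3) by auto
    then have "\<forall>j<d. k < hamming (D ! j) P" using mm(2) less_le_trans by blast
    then have "occurrences k D P = {}" unfolding occurrences_def D(2) by (auto simp: not_le)
    then show False using occ \<open>R = []\<close> \<open>R \<noteq> qry fm T 0 k\<close> by simp
  qed
  have QW: "\<forall>q\<in>set (packed \<sigma> w P). q < 2 ^ w"
  proof
    fix x assume "x \<in> set (packed \<sigma> w P)"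
    then have "x < 2 ^ (n * lb)" using pp(1,2) by (auto simp: in_set_conv_nth)
    also have "\<dots> \<le> 2 ^ w" using nlb by (intro power_increasing) auto
    finally show "x < 2 ^ w" .
  qed
  from run_reports[OF r(2) K(2,3,4) QW] obtain t where t: "t \<le> opmax * t'"
    "reports_within w (comp program 0 @ [Halt]) (map (\<lambda>i. digit w (S ! (i div K)) (i mod K)) [0..<K * length S]) (K * Wn) (packed \<sigma> w P) t R"
    by blast
  have "t \<le> opmax * ((37 * H + 14) * Suc k + 24 * Suc Q + 162 * pops fm T 0 k + 60)"
    using t(1) mult_le_mono2[OF r(1)] by (rule le_trans)
  then show ?thesis using t(2) q(1,4) occ unfolding R by blast
qed

text \<open>\<open>K\<close> words hold numbers up to \<open>N powr (a K)\<close>. The choice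
  \<open>K > 2 / a\<close> yields a factor \<open>N ^ 2\<close>, and the rest, at least
  \<open>3 powr (a K - 2)\<close>, grows exponentially in \<open>K\<close> and so exceeds the factor
  \<open>K c\<close> eventually. \<open>K\<close> does not depend on \<open>N\<close> or
  \<open>w\<close>.\<close>

lemma digits_exist:
  fixes a c :: real
  assumes "0 < a" "0 < c"
  shows "\<exists>K>0. \<forall>N w. 3 \<le> N \<and> a * log 2 N \<le> real w \<longrightarrow> real K * (c * N\<^sup>2) < 2 ^ (w * K)"
proof -
  have r: "1 < 3 powr a" using assms(1) by simp
  have "(\<lambda>n. real n * inverse (3 powr a) ^ n) \<longlonglongrightarrow> 0"
    by (rule powser_times_n_limit_0) (use r in \<open>simp add: inverse_less_1_iff\<close>)
  then have "eventually (\<lambda>n. real n * inverse (3 powr a) ^ n < 1 / (9 * c)) sequentially"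
    by (rule order_tendstoD) (use assms(2) in simp)
  moreover have "eventually (\<lambda>n. nat \<lceil>2 / a\<rceil> + 1 \<le> n) sequentially" by (rule eventually_ge_at_top)
  ultimately have "eventually (\<lambda>n. real n * inverse (3 powr a) ^ n < 1 / (9 * c) \<and> nat \<lceil>2 / a\<rceil> + 1 \<le> n) sequentially"
    by (rule eventually_conj)
  then obtain K where K: "real K * inverse (3 powr a) ^ K < 1 / (9 * c)" "nat \<lceil>2 / a\<rceil> + 1 \<le> K"
    using eventually_sequentially by (metis (no_types, lifting) order.refl)
  have "2 / a \<le> real K" using K(2) by linarith
  then have aK: "2 \<le> a * real K" using assms(1) by (simp add: field_simps)
  have "(3 powr a) ^ K = 3 powr (a * real K)" by (simp add: powr_power mult.commute)
  also have "\<dots> = 9 * 3 powr (a * real K - 2)" by (simp add: powr_diff)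
  finally have p: "(3 powr a) ^ K = 9 * 3 powr (a * real K - 2)" .
  have "real K * c * 9 < (3 powr a) ^ K"
    using K(1) assms(2) r by (simp add: power_inverse field_simps)
  then have Kc: "real K * c < 3 powr (a * real K - 2)" unfolding p by simp
  have "real K * (c * N\<^sup>2) < 2 ^ (w * K)" if N: "3 \<le> N" "a * log 2 N \<le> real w" for N w
  proof -
    have "N powr (a * real K) = 2 powr (log 2 N * (a * real K))" using N(1) by (simp add: powr_powr[symmetric])
    also have "\<dots> = 2 powr (a * log 2 N * real K)" by (simp add: mult_ac)
    also have "\<dots> \<le> 2 powr (real w * real K)" using N(2) by (intro powr_mono mult_right_mono) auto
    also have "\<dots> = 2 ^ (w * K)" by (simp add: powr_realpow[symmetric])
    finally have 1: "N powr (a * real K) \<le> 2 ^ (w * K)" .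
    have "N powr (a * real K) = N powr (a * real K - 2) * N powr 2" by (subst powr_add[symmetric]) simp
    also have "N powr 2 = N\<^sup>2" using N(1) by simp
    finally have 2: "N powr (a * real K) = N powr (a * real K - 2) * N\<^sup>2" .
    have "3 powr (a * real K - 2) \<le> N powr (a * real K - 2)" using N(1) aK by (intro powr_mono2) auto
    with Kc have "real K * c < N powr (a * real K - 2)" by simp
    then have "real K * c * N\<^sup>2 < N powr (a * real K - 2) * N\<^sup>2" using N(1) by (intro mult_strict_right_mono) auto
    then show ?thesis using 1 2 by (simp add: mult.assoc)
  qed
  then show ?thesis using K(2) by (intro exI[of _ K]) auto
qed

text \<open>There are at most \<open>\<sigma> ^ m\<close> different strings, so \<open>log d\<close>
  is at most \<open>m lb\<close> and the word size is \<open>O(m)\<close>. Thus the additive terms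
  in \<open>w\<close>, from the residue table and from rounding up the number of words, disappear in
  the term \<open>m d\<close> of the space bound. Since \<open>lb \<le> w\<close>, at least half of
  each word is filled with letters, whence the factor \<open>2 * real lb\<close>.\<close>

lemma dictionary_bounds:
  fixes \<sigma> m d w k :: nat and a b :: real
  defines "lb \<equiv> letter_bits \<sigma>" and "n \<equiv> letters_per_word \<sigma> w" and "l \<equiv> log 2 (real d)" and "H \<equiv> topbit d"
  defines "Q \<equiv> nat \<lceil>real m / real n\<rceil>"
  assumes "0 < a" "a \<le> b" "dictionary \<sigma> m D" "length D = d" "2 < d"
    "a * log 2 (real m * real d) \<le> real w" "real w \<le> b * log 2 (real m * real d)" "letter_bits \<sigma> \<le> w"
  shows "0 < m" "0 < lb" "0 < n" "real w \<le> b * (1 + real lb) * real m" "real H \<le> l + 1" "2 ^ H \<le> 2 * d"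
    "real (Suc Q) \<le> 2 * real lb * (real m / real w) + 2" "real (w + H + 4) \<le> (6 + 1 / a) * real w"
proof -
  have dist: "distinct D" "set D \<subseteq> strings \<sigma> m" using assms(8) by (auto simp: dictionary_def)
  have "card (set D) = d" using dist(1) assms(9) distinct_card by metis
  moreover have "strings \<sigma> m = {xs. set xs \<subseteq> {1..\<sigma>} \<and> length xs = m}" by (auto simp: strings_def)
  then have fin: "finite (strings \<sigma> m)" "card (strings \<sigma> m) = \<sigma> ^ m"
    using finite_lists_length_eq[of "{1..\<sigma>}" m] card_lists_length_eq[of "{1..\<sigma>}" m] by simp_all
  ultimately have ds: "d \<le> \<sigma> ^ m" using card_mono[OF fin(1) dist(2)] by simp
  show m: "0 < m" using ds assms(10) by (cases m) auto
  have s: "2 \<le> \<sigma>"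
  proof (rule ccontr)
    assume "\<not> 2 \<le> \<sigma>"
    then have "\<sigma> ^ m \<le> 1 ^ m" by (intro power_mono) auto
    then show False using ds assms(10) by simp
  qed
  then have "1 \<le> log 2 (real \<sigma>)" by (simp add: le_log_iff)
  then have lgs: "1 \<le> log 2 (real \<sigma>)" "log 2 (real \<sigma>) \<le> real lb" unfolding lb_def letter_bits_def by (simp_all add: real_nat_ceiling_ge)
  then show lb: "0 < lb" by (metis gr0I le_numeral_extra(2) of_nat_0 order.trans)
  show n: "0 < n" using assms(13) lb unfolding n_def letters_per_word_def lb_def by (simp add: div_greater_zero_iff)
  have w: "0 < w" using assms(13) lb unfolding lb_def by simp
  have l: "1 \<le> l" using assms(10) by (simp add: l_def le_log_iff)
  have lmd: "log 2 (real m * real d) = log 2 (real m) + l" using m assms(10) by (simp add: l_def log_mult)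
  have lm: "0 \<le> log 2 (real m)" using m by simp
  have lw: "l \<le> real w / a"
  proof -
    have "a * l \<le> a * log 2 (real m * real d)" unfolding lmd using lm assms(6) by simp
    then have "a * l \<le> real w" using assms(11) by simp
    then show ?thesis using assms(6) by (simp add: field_simps)
  qed
  have "l \<le> log 2 (real (\<sigma> ^ m))" unfolding l_def using ds assms(10) s by (subst log_le_cancel_iff) (auto simp flip: of_nat_power)
  also have "\<dots> = real m * log 2 (real \<sigma>)" using s by (simp add: log_nat_power)
  also have "\<dots> \<le> real m * real lb" using lgs by (intro mult_left_mono) auto
  finally have l2: "l \<le> real m * real lb" .
  have "real m \<le> real (2 ^ m)" using less_exp[of m] by (intro of_nat_mono) simp
  then have "log 2 (real m) \<le> real m" using m by (subst log_le_iff) (auto simp: powr_realpow)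
  with l2 have "log 2 (real m * real d) \<le> (1 + real lb) * real m" unfolding lmd by (simp add: algebra_simps)
  then have "b * log 2 (real m * real d) \<le> b * ((1 + real lb) * real m)" using assms(6,7) by (intro mult_left_mono) auto
  then show "real w \<le> b * (1 + real lb) * real m" using assms(12) by (simp add: mult.assoc)
  have H0: "0 < H" "2 ^ (H - 1) \<le> d" using topbit_props(2)[of d] assms(10) by (auto simp: H_def)
  then have "(2 :: nat) ^ H = 2 * 2 ^ (H - 1)" by (cases H) auto
  then show "2 ^ H \<le> 2 * d" using H0 by simp
  have "real (H - 1) \<le> l"
  proof -
    have "real (2 ^ (H - 1)) \<le> real d" using H0(2) by (rule of_nat_mono)
    then show ?thesis unfolding l_def using assms(10) by (subst le_log_iff) (auto simp: powr_realpow)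
  qed
  then show H: "real H \<le> l + 1" by simp
  have "w = n * lb + w mod lb" unfolding n_def letters_per_word_def lb_def by simp
  moreover have "w mod lb < n * lb" using less_le_trans[OF mod_less_divisor[OF lb, of w]] n by simp
  ultimately have "w \<le> 2 * lb * n" by (simp add: mult.commute mult.left_commute)
  then have "real w \<le> 2 * real lb * real n" by (metis of_nat_le_iff of_nat_mult of_nat_numeral)
  then have "1 / real n \<le> 2 * real lb / real w" using n w by (simp add: field_simps)
  then have "real m * (1 / real n) \<le> real m * (2 * real lb / real w)" by (intro mult_left_mono) auto
  moreover have "real Q \<le> real m / real n + 1"
    unfolding Q_def using of_int_ceiling_le_add_one[of "real m / real n"] by (simp add: of_nat_nat ceiling_mono)
  ultimately show "real (Suc Q) \<le> 2 * real lb * (real m / real w) + 2" by (simp add: mult_ac)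
  have "real (w + H + 4) \<le> real w + (real w / a + 5)" using H lw by simp
  also have "\<dots> \<le> (6 + 1 / a) * real w" using w by (simp add: algebra_simps)
  finally show "real (w + H + 4) \<le> (6 + 1 / a) * real w" .
qed

theorem theorem11:
  fixes \<sigma> :: nat and a b :: real
  assumes "0 < a" and "a \<le> b"
  shows "\<exists>(prog :: instr list) (C :: real). \<forall>(w :: nat) (m :: nat) (d :: nat) (k :: nat) (D :: nat list list).
    dictionary \<sigma> m D \<and> length D = d \<and> d > 2 \<and> k > 0 \<and>
    a * log 2 (real m * real d) \<le> real w \<and> real w \<le> b * log 2 (real m * real d) \<and>
    letter_bits \<sigma> \<le> w
    \<longrightarrow> (\<exists>(S :: nat list) (s :: nat).
          (\<forall>x\<in>set S. x < 2 ^ w) \<and>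
          real w * (real (length S) + real s)
            \<le> C * (real w * real m * real d + real w * real d * (log 2 (real d)) ^ k) \<and>
          (\<forall>P\<in>strings \<sigma> m. \<exists>(t :: nat) (xs :: nat list).
             reports_within w prog S s (packed \<sigma> w P) t xs \<and>
             distinct xs \<and> set xs = occurrences k D P \<and>
             real t \<le> C * (real m / real w + (log 2 (real d)) ^ (k + 1) + real (length xs))))"
proof -
  define lb where "lb = letter_bits \<sigma>"
  \<comment> \<open>The tree is built over fields of \<open>lb\<close> bits, which take
    \<open>2 ^ lb\<close> values.\<close>
  define t where "t = (2 :: nat) ^ lb"
  define c where "c = 2 * exp (2 * (2 * real t + 1))"
  define c0 where "c0 = b * (1 + real lb)"
  define c3 where "c3 = 6 + 1 / a"
  define c4 where "c4 = c3 * (2 * real lb + 2 * c0)"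
  \<comment> \<open>From 25 for tables, header and stack base, and \<open>27 c + 25 c + 5\<close>
    for nine cells per tree node and five per stack entry. The latter is doubled,
    \<open>104 c + 10\<close>, for the bound by \<open>N\<^sup>2\<close>, where \<open>m + 1\<close>
    is replaced by \<open>2 m\<close>.\<close>
  define c6 where "c6 = 35 + 5 * c0 + 7 * c4 + 104 * c"
  have nonneg: "0 \<le> c" "0 \<le> c0" "0 \<le> c3" "0 \<le> c4" "0 \<le> c6"
    using assms by (simp_all add: c_def c0_def c3_def c4_def c6_def)
  \<comment> \<open>The additional 2 makes room for the number of errors plus one; \<open>c6\<close>
    alone accounts for the memory.\<close>
  obtain K where K: "0 < K" "\<And>N w. 3 \<le> N \<Longrightarrow> a * log 2 N \<le> real w \<Longrightarrow> real K * ((c6 + 2) * N\<^sup>2) < 2 ^ (w * K)"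
    using digits_exist[of a "c6 + 2"] assms(1) nonneg(5) by auto
  define om where "om = vm.opmax K"
  \<comment> \<open>Here 250 is 142 for finding the phrases, 48 for the two extra words and 60 for
    the constant; 810 is 162 times 5, the cost of a visit times the bound on their number.\<close>
  define C1 where "C1 = 250 + 810 * c + 48 * real lb + 162"
  define C where "C = real K * c6 + real om * C1"
  have C1: "0 \<le> C1" using nonneg by (simp add: C1_def)
  show ?thesis
  proof (intro exI[of _ "vm.comp K program 0 @ [Halt]"] exI[of _ C] allI impI, elim conjE)
    fix w m d k :: nat and D :: "nat list list"
    assume D: "dictionary \<sigma> m D" "length D = d" "2 < d" and k: "0 < k"
      and aw: "a * log 2 (real m * real d) \<le> real w" and bw: "real w \<le> b * log 2 (real m * real d)"
      and lw: "letter_bits \<sigma> \<le> w"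
    define n where "n = letters_per_word \<sigma> w"
    define l where "l = log 2 (real d)"
    define H where "H = topbit d"
    define Q where "Q = nat \<lceil>real m / real n\<rceil>"
    \<comment> \<open>No Hamming distance exceeds \<open>m\<close>, so capping the errors does not
      change the answers. The capped number fits into a wide variable and meets the condition of
      \<open>tree_choice\<close>.\<close>
    define \<kappa> where "\<kappa> = min k m"
    define N where "N = real m * real d"
    note db = dictionary_bounds[OF assms D aw bw lw, folded lb_def n_def l_def, folded H_def Q_def c0_def c3_def]
    have \<kappa>: "0 < \<kappa>" "\<kappa> \<le> m" "\<kappa> \<le> k" using k db(1) by (auto simp: \<kappa>_def)
    have w: "0 < w" using lw db(2) by (simp add: lb_def)
    obtain p where p: "0 < p" "p < 2 ^ w" "p \<le> 5 * w + 3" "inj_on (\<lambda>i. (2 * 2 ^ i - 1) mod p) {..<w}"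
      using modulus_exists[OF w] by blast
    define dw where "dw j q = (if q < Q then packed \<sigma> w (D ! j) ! q else 0)" for j q
    have t: "0 < t" "\<forall>i<d. \<forall>y<Q * n. ltr lb n (dw i) y < t" by (simp_all add: t_def ltr_less)
    obtain T bb where T: "tree_ok d (Q * n) T" "real (nodes T) \<le> 3 * c * real d * l ^ \<kappa>" "real (nodes T) \<le> 3 * c * (real d)\<^sup>2 * (real m + 1)"
      "real bb \<le> (5 * c + 1) * real d * l ^ \<kappa>" "real bb \<le> (5 * c + 1) * (real d)\<^sup>2 * (real m + 1)"
      "\<forall>P fm. mism (Q * n) P (\<lambda>j. ltr lb n (dw j)) d fm \<longrightarrow> distinct (qry fm T 0 \<kappa>) \<and>
        set (qry fm T 0 \<kappa>) = {i. i < d \<and> card {y. y < Q * n \<and> ltr lb n (dw i) y \<noteq> P y} \<le> \<kappa>} \<and>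
        pops fm T 0 \<kappa> \<le> bb \<and> real (pops fm T 0 \<kappa>) \<le> 5 * c * l ^ (\<kappa> + 1) + real (length (qry fm T 0 \<kappa>))"
      using tree_choice[OF D(3) t(1) \<kappa>(1,2) t(2), folded c_def l_def] by blast
    define rec where "rec = w + H + 4"
    define sb where "sb = Suc Q * rec"
    have nlb: "n * lb \<le> w" unfolding n_def lb_def letters_per_word_def by simp
    have dset: "set (D ! j) \<subseteq> {1..\<sigma>} \<and> length (D ! j) = m" if "j < d" for j
    proof -
      have "D ! j \<in> strings \<sigma> m" using that D(1,2) nth_mem unfolding dictionary_def by blast
      then show ?thesis by (auto simp: strings_def)
    qed
    have "dw j q < 2 ^ w" if "j < d" for j q
    proof (cases "q < Q")
      case True
      have "dw j q < 2 ^ (n * lb)"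
        using packed_props(2)[of "D ! j" \<sigma> w q] dset[OF that] True db(3) by (simp add: dw_def Q_def n_def lb_def)
      also have "\<dots> \<le> 2 ^ w" using nlb by (intro power_increasing) auto
      finally show ?thesis .
    qed (simp add: dw_def)
    then have dwless: "\<forall>j<d. \<forall>q\<le>Q. dw j q < 2 ^ w" by blast
    from D(3) have d0: "0 < d" by simp
    from memory_exists[OF d0 db(2,3) nlb dwless p(1,4) T(1), where k = \<kappa>, folded H_def, folded rec_def, folded sb_def]
    obtain S where S: "length S \<le> 10 + 2 ^ H + p + d * sb + 9 * nodes T + Suc Q * (3 * d + 2)"
      "\<forall>x\<in>set S. x < 2 ^ w \<or> x \<le> length S \<or> x = \<kappa>" and S10: "10 \<le> length S"
      and S': "S ! 0 = \<kappa> \<and> S ! 1 = rec \<and> S ! 2 = Q * rec \<and> S ! 3 = 10 \<and> S ! 4 = p \<and> S ! 5 = 10 + 2 ^ H \<and> S ! 6 = lb \<and> S ! 7 = sb"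
        "orep S (S ! 8) (tobj (\<lambda>j. 10 + 2 ^ H + p + j * sb) rec n lb T)"
        "orep S (S ! 9) (aobj (\<lambda>j. 10 + 2 ^ H + p + j * sb) (map (\<lambda>q. bst_of (ord Q dw d q)) [0..<Suc Q]))"
        "\<forall>j q. j < d \<longrightarrow> q \<le> Q \<longrightarrow> 10 + 2 ^ H + p + j * sb + q * rec + 1 < length S \<and> S ! (10 + 2 ^ H + p + j * sb + q * rec) = dw j q \<and>
          S ! (10 + 2 ^ H + p + j * sb + q * rec + 1) = rank Q dw d j q"
        "\<forall>i j q. i < d \<longrightarrow> j < d \<longrightarrow> q \<le> Q \<longrightarrow> (\<exists>h. Bit_Operations.xor (rank Q dw d i q) (rank Q dw d j q) + 10 < length S \<and>
          S ! (Bit_Operations.xor (rank Q dw d i q) (rank Q dw d j q) + 10) = h \<and>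
          10 + 2 ^ H + p + i * sb + q * rec + 2 + h < length S \<and> 10 + 2 ^ H + p + j * sb + q * rec + 2 + h < length S \<and>
          min (S ! (10 + 2 ^ H + p + i * sb + q * rec + 2 + h)) (S ! (10 + 2 ^ H + p + j * sb + q * rec + 2 + h)) = lcw Q dw i j q * rec)"
        "\<forall>i<w. (2 * 2 ^ i - 1) mod p + (10 + 2 ^ H) < length S \<and> S ! ((2 * 2 ^ i - 1) mod p + (10 + 2 ^ H)) = i div lb * lb"
      by blast
    define Wn where "Wn = sb + 5 * bb + 10"
    have l: "3 / 2 \<le> l" unfolding l_def by (rule log2_ge_three_halves[OF D(3)])
    define L where "L = real d * l ^ k"
    have lk: "l ^ \<kappa> \<le> l ^ k" "l ^ (\<kappa> + 1) \<le> l ^ (k + 1)" using l \<kappa>(3) by (auto intro!: power_increasing)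
    have lk1: "1 \<le> l ^ (k + 1)" using l by (intro one_le_power) simp
    have L: "0 \<le> L" using l by (simp add: L_def)
    have N: "3 \<le> N" "real m \<le> N" "real d \<le> N" "(real d)\<^sup>2 * (real m + 1) \<le> 2 * N\<^sup>2" "N \<le> N\<^sup>2"
    proof -
      have m1: "1 \<le> real m" "3 \<le> real d" using db(1) D(3) by auto
      show N3: "3 \<le> N" unfolding N_def using mult_mono[of 1 "real m" 3 "real d"] m1 by simp
      show "real m \<le> N" "real d \<le> N" unfolding N_def
        using mult_left_mono[of 1 "real d" "real m"] mult_right_mono[of 1 "real m" "real d"] m1 by auto
      have "real m \<le> (real m)\<^sup>2" using m1(1) by (simp add: power2_eq_square)
      then have "real m + 1 \<le> 2 * (real m)\<^sup>2" using m1(1) by linarith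
      then have "(real d)\<^sup>2 * (real m + 1) \<le> (real d)\<^sup>2 * (2 * (real m)\<^sup>2)" by (intro mult_left_mono) auto
      then show "(real d)\<^sup>2 * (real m + 1) \<le> 2 * N\<^sup>2" by (simp add: N_def power_mult_distrib mult_ac)
      show "N \<le> N\<^sup>2" using N3 by (simp add: power2_eq_square)
    qed
    \<comment> \<open>The records of all words together: \<open>O(m / w)\<close> of them have total
      length \<open>O(m)\<close>, and the two extra ones contribute \<open>O(w)\<close>, which is
      \<open>O(m)\<close> as well.\<close>
    have sbm: "real sb \<le> c4 * real m"
    proof -
      have "real sb = real (Suc Q) * real rec" unfolding sb_def by (rule of_nat_mult)
      also have "\<dots> \<le> (2 * real lb * (real m / real w) + 2) * (c3 * real w)"
        using db(7) db(8)[folded rec_def] by (intro mult_mono) auto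
      also have "\<dots> = c3 * (2 * real lb * real m + 2 * real w)" using w by (simp add: field_simps)
      also have "\<dots> \<le> c3 * (2 * real lb * real m + 2 * (c0 * real m))" using db(4) nonneg(3) by (intro mult_left_mono) auto
      also have "\<dots> = c4 * real m" by (simp add: c4_def algebra_simps)
      finally show ?thesis .
    qed
    have SQ: "real (Suc Q) \<le> c4 * real m"
    proof -
      have "Suc Q * 1 \<le> sb" unfolding sb_def rec_def by (intro mult_le_mono2) simp
      then have "real (Suc Q) \<le> real sb" by (simp only: mult_1_right of_nat_le_iff)
      then show ?thesis using sbm by simp
    qed
    have size: "real (length S) + real Wn \<le> (25 + 5 * c0 + 7 * c4) * N + (9 * real (nodes T) + 5 * real bb)"
    proof -
      have "real (length S) \<le> real (10 + 2 ^ H + p + d * sb + 9 * nodes T + Suc Q * (3 * d + 2))" by (rule of_nat_mono[OF S(1)])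
      also have "\<dots> = 10 + real (2 ^ H) + real p + real d * real sb + 9 * real (nodes T) + real (Suc Q) * (3 * real d + 2)"
        by (simp only: of_nat_add of_nat_mult of_nat_numeral)
      finally have 1: "real (length S) \<le> 10 + real (2 ^ H) + real p + real d * real sb + 9 * real (nodes T) + real (Suc Q) * (3 * real d + 2)" .
      have 2: "real (2 ^ H) \<le> 2 * N" using of_nat_mono[OF db(6), where 'a = real] N(3) by simp
      have "real p \<le> real (5 * w + 3)" by (rule of_nat_mono[OF p(3)])
      also have "\<dots> \<le> 5 * (c0 * real m) + 3" using db(4) by simp
      also have "\<dots> \<le> 5 * (c0 * N) + 3" using N(2) nonneg(2) by (simp add: mult_left_mono)
      finally have 3: "real p \<le> 5 * (c0 * N) + 3" .
      have "real d * real sb \<le> real d * (c4 * real m)" by (intro mult_left_mono sbm) auto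
      then have 4: "real d * real sb \<le> c4 * N" by (simp add: N_def mult_ac)
      have "real (Suc Q) * (3 * real d + 2) \<le> c4 * real m * (5 * real d)" using SQ D(3) nonneg(4) by (intro mult_mono) auto
      then have 5: "real (Suc Q) * (3 * real d + 2) \<le> 5 * (c4 * N)" by (simp add: N_def mult_ac)
      have "real sb \<le> c4 * N" using sbm mult_left_mono[OF N(2) nonneg(4)] by simp
      then have 6: "real Wn \<le> c4 * N + 5 * real bb + 10" by (simp add: Wn_def)
      show ?thesis using 1 2 3 4 5 6 N(1) by (simp add: algebra_simps)
    qed
    have size1: "real (length S) + real Wn \<le> c6 * (N + L)"
    proof -
      have mono: "x * real d * l ^ \<kappa> \<le> x * real d * l ^ k" if "0 \<le> x" for x
        using that by (intro mult_left_mono lk(1)) auto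
      have "9 * real (nodes T) \<le> 9 * (3 * c * real d * l ^ k)"
        using T(2) mono[of "3 * c"] nonneg(1) by linarith
      moreover have "5 * real bb \<le> 5 * ((5 * c + 1) * real d * l ^ k)"
        using T(4) mono[of "5 * c + 1"] nonneg(1) by linarith
      ultimately have "9 * real (nodes T) + 5 * real bb \<le> (52 * c + 5) * L" by (simp add: L_def algebra_simps)
      moreover have "(52 * c + 5) * L \<le> c6 * L" using nonneg L by (intro mult_right_mono) (auto simp: c6_def)
      moreover have "(25 + 5 * c0 + 7 * c4) * N \<le> c6 * N" using nonneg N(1) by (intro mult_right_mono) (auto simp: c6_def)
      ultimately show ?thesis using size by (simp add: distrib_left)
    qed
    have size2: "real (length S) + real Wn \<le> c6 * N\<^sup>2"
    proof -
      have mono: "x * (real d)\<^sup>2 * (real m + 1) \<le> x * (2 * N\<^sup>2)" if "0 \<le> x" for x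
        using mult_left_mono[OF N(4) that] by (simp only: mult.assoc)
      have "9 * real (nodes T) \<le> 9 * (3 * c * (2 * N\<^sup>2))"
        using T(3) mono[of "3 * c"] nonneg(1) by linarith
      moreover have "5 * real bb \<le> 5 * ((5 * c + 1) * (2 * N\<^sup>2))"
        using T(5) mono[of "5 * c + 1"] nonneg(1) by linarith
      moreover have "(25 + 5 * c0 + 7 * c4) * N \<le> (25 + 5 * c0 + 7 * c4) * N\<^sup>2" using nonneg N(5) by (intro mult_left_mono) auto
      ultimately show ?thesis using size by (simp add: c6_def algebra_simps)
    qed
    have big: "real K * ((c6 + 2) * N\<^sup>2) < real (2 ^ (w * K))" using K(2)[OF N(1)] aw by (simp add: N_def)
    have Nsq: "0 \<le> N\<^sup>2" "0 \<le> c6 * N\<^sup>2" using nonneg(5) by simp_all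
    have addr: "x < 2 ^ (w * K)" if "real x \<le> real K * ((c6 + 2) * N\<^sup>2)" for x
      using le_less_trans[OF that big] by (simp only: of_nat_less_iff)
    have KS: "K * length S < 2 ^ (w * K)"
    proof (rule addr)
      have "real (length S) \<le> (c6 + 2) * N\<^sup>2" using size2 Nsq unfolding distrib_right by linarith
      then show "real (K * length S) \<le> real K * ((c6 + 2) * N\<^sup>2)" by (simp add: mult_left_mono)
    qed
    have KW: "K * Wn < 2 ^ (w * K)"
    proof (rule addr)
      have "real Wn \<le> (c6 + 2) * N\<^sup>2" using size2 Nsq unfolding distrib_right by linarith
      then show "real (K * Wn) \<le> real K * ((c6 + 2) * N\<^sup>2)" by (simp add: mult_left_mono)
    qed
    have \<kappa>b: "\<kappa> + 1 < 2 ^ (w * K)"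
    proof (rule addr)
      have "real (\<kappa> + 1) \<le> 2 * N\<^sup>2" using \<kappa>(2) N(1,2,5) by linarith
      also have "\<dots> \<le> 1 * ((c6 + 2) * N\<^sup>2)" using Nsq unfolding distrib_right mult_1 by linarith
      also have "\<dots> \<le> real K * ((c6 + 2) * N\<^sup>2)" using K(1) nonneg(5) by (intro mult_right_mono) auto
      finally show "real (\<kappa> + 1) \<le> real K * ((c6 + 2) * N\<^sup>2)" .
    qed
    have Sx: "\<forall>x\<in>set S. x < 2 ^ (w * K)"
    proof
      fix x assume "x \<in> set S"
      then have "x < 2 ^ w \<or> x \<le> length S \<or> x = \<kappa>" using S(2) by blast
      moreover have "(2 :: nat) ^ w \<le> 2 ^ (w * K)" using K(1) by (intro power_increasing) auto
      moreover have "length S \<le> K * length S" using K(1) by simp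
      ultimately show "x < 2 ^ (w * K)" using KS \<kappa>b by linarith
    qed
    have \<kappa>b': "\<kappa> < 2 ^ (w * K) - 1" using \<kappa>b by simp
    have Ds: "set D \<subseteq> strings \<sigma> m" using D(1) by (simp add: dictionary_def)
    let ?S = "map (\<lambda>i. digit w (S ! (i div K)) (i mod K)) [0..<K * length S]"
    have space: "real w * (real (length ?S) + real (K * Wn)) \<le> C * (real w * real m * real d + real w * real d * l ^ k)"
    proof -
      have "real w * (real (length ?S) + real (K * Wn)) = real w * (real K * (real (length S) + real Wn))" by (simp add: distrib_left)
      also have "\<dots> \<le> real w * (real K * (c6 * (N + L)))" using size1 by (intro mult_left_mono) auto
      also have "\<dots> = real K * c6 * (real w * (N + L))" by simp
      also have "\<dots> \<le> C * (real w * (N + L))" using C1 N(1) L by (intro mult_right_mono) (auto simp: C_def)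
      also have "\<dots> = C * (real w * real m * real d + real w * real d * l ^ k)" by (simp add: N_def L_def algebra_simps)
      finally show ?thesis .
    qed
    have query: "\<exists>t xs. reports_within w (vm.comp K program 0 @ [Halt]) ?S (K * Wn) (packed \<sigma> w P) t xs \<and>
        distinct xs \<and> set xs = occurrences k D P \<and> real t \<le> C * (real m / real w + l ^ (k + 1) + real (length xs))"
      if P: "P \<in> strings \<sigma> m" for P
    proof -
      have occ: "occurrences \<kappa> D P = occurrences k D P"
      proof -
        have "hamming s P \<le> m" if "length s = m" for s
        proof -
          have "hamming s P \<le> card {..<m}" unfolding hamming_def using that by (intro card_mono) auto
          then show ?thesis by simp
        qed
        then have "hamming (D ! i) P \<le> \<kappa> \<longleftrightarrow> hamming (D ! i) P \<le> k" if "i < d" for i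
          using dset[OF that] by (auto simp: \<kappa>_def)
        then show ?thesis unfolding occurrences_def D(2) by auto
      qed
      from query_correct[OF Ds D(2) d0 db(2)[unfolded lb_def] db(3)[unfolded n_def] p(1,2) K(1) Sx KS KW \<kappa>b' S10,
          folded lb_def n_def, folded Q_def H_def, folded rec_def, folded sb_def, folded dw_def, OF S' T(1,6) _ P]
      obtain t xs q where r: "reports_within w (vm.comp K program 0 @ [Halt]) ?S (K * Wn) (packed \<sigma> w P) t xs"
        "distinct xs" "set xs = occurrences k D P" "t \<le> om * ((37 * H + 14) * Suc \<kappa> + 24 * Suc Q + 162 * q + 60)"
        "real q \<le> 5 * c * l ^ (\<kappa> + 1) + real (length xs)"
        unfolding occ om_def[symmetric] Wn_def by blast
      have "real t \<le> real (om * ((37 * H + 14) * Suc \<kappa> + 24 * Suc Q + 162 * q + 60))" by (rule of_nat_mono[OF r(4)])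
      also have "\<dots> = real om * ((37 * real H + 14) * real (Suc \<kappa>) + 24 * real (Suc Q) + 162 * real q + 60)"
        by (simp only: of_nat_add of_nat_mult of_nat_numeral)
      also have "\<dots> \<le> real om * (C1 * (real m / real w + l ^ (k + 1) + real (length xs)))"
      proof (rule mult_left_mono)
        have "(37 * real H + 14) * real (Suc \<kappa>) \<le> (71 * l) * (2 * l ^ \<kappa>)"
        proof (rule mult_mono)
          \<comment> \<open>With \<open>H \<le> l + 1\<close> the left side is at most
            \<open>37 l + 51\<close>, and 51 is 34 times 3/2.\<close>
          show "37 * real H + 14 \<le> 71 * l" using db(5) l by simp
          have "(3 / 2) ^ \<kappa> \<le> l ^ \<kappa>" using l by (intro power_mono) auto
          then show "real (Suc \<kappa>) \<le> 2 * l ^ \<kappa>" using Suc_le_three_halves_power[of \<kappa>] by simp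
        qed (use l in auto)
        then have 1: "(37 * real H + 14) * real (Suc \<kappa>) \<le> 142 * l ^ (k + 1)" using lk(2) by simp
        have 2: "24 * real (Suc Q) \<le> 48 * real lb * (real m / real w) + 48 * l ^ (k + 1)" using db(7) lk1 by simp
        have "162 * real q \<le> 810 * (c * l ^ (\<kappa> + 1)) + 162 * real (length xs)" using r(5) by simp
        also have "\<dots> \<le> 810 * (c * l ^ (k + 1)) + 162 * real (length xs)" using mult_left_mono[OF lk(2) nonneg(1)] by simp
        finally have 3: "162 * real q \<le> 810 * (c * l ^ (k + 1)) + 162 * real (length xs)" .
        have "48 * real lb * (real m / real w) \<le> C1 * (real m / real w)" "(250 + 810 * c) * l ^ (k + 1) \<le> C1 * l ^ (k + 1)"
          "162 * real (length xs) \<le> C1 * real (length xs)"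
          using nonneg(1) l by (intro mult_right_mono; simp add: C1_def)+
        with 1 2 3 lk1 show "(37 * real H + 14) * real (Suc \<kappa>) + 24 * real (Suc Q) + 162 * real q + 60 \<le>
            C1 * (real m / real w + l ^ (k + 1) + real (length xs))"
          unfolding distrib_left distrib_right by linarith
      qed simp
      also have "\<dots> = real om * C1 * (real m / real w + l ^ (k + 1) + real (length xs))" by simp
      also have "\<dots> \<le> C * (real m / real w + l ^ (k + 1) + real (length xs))"
        using nonneg(5) l by (intro mult_right_mono) (auto simp: C_def)
      finally show ?thesis using r(1-3) by blast
    qed
    show "\<exists>(S :: nat list) (s :: nat). (\<forall>x\<in>set S. x < 2 ^ w) \<and>
        real w * (real (length S) + real s) \<le> C * (real w * real m * real d + real w * real d * (log 2 (real d)) ^ k) \<and>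
        (\<forall>P\<in>strings \<sigma> m. \<exists>(t :: nat) (xs :: nat list).
           reports_within w (vm.comp K program 0 @ [Halt]) S s (packed \<sigma> w P) t xs \<and> distinct xs \<and> set xs = occurrences k D P \<and>
           real t \<le> C * (real m / real w + (log 2 (real d)) ^ (k + 1) + real (length xs)))"
      unfolding l_def[symmetric] using space query by (intro exI[of _ ?S] exI[of _ "K * Wn"]) auto
  qed
qed

end
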